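(* The assignment $H\mapsto H_{par}$ (with the Hopf algebroid structure described in the context) on Hopf algebras with invertible antipode, sending a Hopf algebra morphism $\varphi:H\to L$ to the algebra morphism $\varphi_{par}:H_{par}\to L_{par}$ determined by $\varphi_{par}([h])=[\varphi(h)]$, defines a functor from the category of Hopf algebras (with invertible antipode) to the category of Hopf algebroids.
   Context: $k$ is a commutative ring; all algebras are associative unital $k$-algebras. $H$ is a Hopf algebra over $k$ with Sweedler notation $\Delta(h)=h_{(1)}\otimes h_{(2)}$ and antipode $S$. **The algebra $H_{par}$.** $H_{par}$ is the quotient of the tensor algebra $T(H)$ by the ideal generated by the elements, for all $h,l\in H$: $1_H-1_{T(H)}$; $h\otimes l_{(1)}\otimes S(l_{(2)})-hl_{(1)}\otimes S(l_{(2)})$; $h_{(1)}\otimes S(h_{(2)})\otimes l-h_{(1)}\otimes S(h_{(2)})l$; $h\otimes S(l_{(1)})\otimes l_{(2)}-hS(l_{(1)})\otimes l_{(2)}$; $S(h_{(1)})\otimes h_{(2)}\otimes l-S(h_{(1)})\otimes h_{(2)}l$. The class of $h$ is $[h]$. Put $\varepsilon_h=[h_{(1)}][S(h_{(2)})]$, $\tilde\varepsilon_h=[S(h_{(1)})][h_{(2)}]$; $A$ (resp. $\tilde A$) is the subalgebra of $H_{par}$ generated by all $\varepsilon_h$ (resp. all $\tilde\varepsilon_h$). **Hopf algebroid structure of $H_{par}$.** The anti-algebra maps $\mathcal S,\mathcal S':H_{par}\to H_{par}$ are $\mathcal S([h^1]\cdots[h^n])=[S(h^n)]\cdots[S(h^1)]$,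 $\mathcal S'([h^1]\cdots[h^n])=[S^{-1}(h^n)]\cdots[S^{-1}(h^1)]$. For $a\in A$: $s(a)=a$, $t(a)=\mathcal S'(a)$; for $a'\in\tilde A$: $\tilde s(a')=a'$, $\tilde t(a')=\mathcal S'(a')$. The $A$-bimodule structure is $a\triangleright x\triangleleft b=s(a)t(b)x$; the $\tilde A$-bimodule structure is $a\triangleright x\triangleleft b=x\tilde s(b)\tilde t(a)$. $\underline\Delta_l$ and $\underline\Delta_r$ send $[h^1]\cdots[h^n]$ to $[h^1_{(1)}]\cdots[h^n_{(1)}]\otimes[h^1_{(2)}]\cdots[h^n_{(2)}]$, with tensor product over $A$ and $\tilde A$ respectively; $\underline\epsilon_l([h^1]\cdots[h^n])=\varepsilon_{h^1_{(1)}}\varepsilon_{h^1_{(2)}h^2_{(1)}}\cdots\varepsilon_{h^1_{(n)}\cdots h^n}$; $\underline\epsilon_r([h^1]\cdots[h^n])=\tilde\varepsilon_{h^1h^2_{(1)}\cdots h^n_{(1)}}\tilde\varepsilon_{h^2_{(2)}\cdots h^n_{(2)}}\cdots\tilde\varepsilon_{h^n_{(n)}}$. The antipode is $\mathcal S$. **Bialgebroids.** A left (resp. right) bialgebroid over a $k$-algebra $A$ is given by data $(\mathcal H,A,s,t,\underline\Delta_l,\underline\epsilon_l)$ (resp. $(\mathcal H,A,\tilde s,\tilde t,\underline\Delta_r,\underline\epsilon_r)$) such that: (1) $\mathcal H$ is a $k$-algebra. (2) $s$ (resp. $\tilde s$) is an algebra morphism $A\to\mathcal H$, $t$ (resp.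 $\tilde t$) is an algebra anti-morphism $A\to\mathcal H$, and their images commute elementwise; $\mathcal H$ is an $A$-bimodule by $a\triangleright h\triangleleft b=s(a)t(b)h$ (resp. $a\triangleright h\triangleleft b=h\tilde s(b)\tilde t(a)$). (3) $(\mathcal H,\underline\Delta_l,\underline\epsilon_l)$ (resp. $(\mathcal H,\underline\Delta_r,\underline\epsilon_r)$) is an $A$-coring for this bimodule structure. (4) The image of $\underline\Delta_l$ (resp. $\underline\Delta_r$) lies in $\mathcal H\times_A\mathcal H=\{\sum_i h_i\otimes k_i\in\mathcal H\otimes_A\mathcal H:\sum_i h_it(a)\otimes k_i=\sum_i h_i\otimes k_is(a)\ \forall a\in A\}$ (resp. $\mathcal H\,{}_A\!\times\mathcal H=\{\sum_i h_i\otimes k_i\in\mathcal H\otimes_A\mathcal H:\sum_i\tilde s(a)h_i\otimes k_i=\sum_i h_i\otimes\tilde t(a)k_i\ \forall a\in A\}$), and it is an algebra morphism into it. (5) $\underline\epsilon_l(hl)=\underline\epsilon_l(hs(\underline\epsilon_l(l)))=\underline\epsilon_l(ht(\underline\epsilon_l(l)))$ (resp. $\underline\epsilon_r(hl)=\underline\epsilon_r(\tilde s(\underline\epsilon_r(h))l)=\underline\epsilon_r(\tilde t(\underline\epsilon_r(h))l)$) for $h,l\in\mathcal H$. **Hopf algebroids.** Given $A\cong\tilde A^{op}$, a left $A$-bialgebroid and a right $\tilde A$-bialgebroid on the same algebra $\mathcal H$, a Hopf algebroid structure is given by an anti-algebra morphism $\mathcal S:\mathcal H\to\mathcal H$ such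 that: (i) $s\underline\epsilon_l\tilde t=\tilde t$, $t\underline\epsilon_l\tilde s=\tilde s$, $\tilde s\underline\epsilon_rt=t$, $\tilde t\underline\epsilon_rs=s$; (ii) $(\underline\Delta_l\otimes_{\tilde A}I)\underline\Delta_r=(I\otimes_A\underline\Delta_r)\underline\Delta_l$ and $(I\otimes_{\tilde A}\underline\Delta_l)\underline\Delta_r=(\underline\Delta_r\otimes_AI)\underline\Delta_l$; (iii) $\mathcal S(t(a)h\tilde t(b'))=\tilde s(b')\mathcal S(h)s(a)$; (iv) $\mu(\mathcal S\otimes I)\underline\Delta_l=\tilde s\underline\epsilon_r$ and $\mu(I\otimes\mathcal S)\underline\Delta_r=s\underline\epsilon_l$. **Morphisms.** A morphism of Hopf algebroids $(\mathcal H,A,\tilde A,\dots)\to(\mathcal L,A',\tilde A',\dots)$ is an algebra morphism $F:\mathcal H\to\mathcal L$ together with algebra morphisms $f:A\to A'$, $\tilde f:\tilde A\to\tilde A'$ compatible with all structure maps: $F$ intertwines the sources and targets (via $f$ and $\tilde f$), the two comultiplications (via the maps induced by $F\otimes F$ on the tensor products over the bases), the two counits ($f\underline\epsilon_l=\underline\epsilon_lF$, $\tilde f\underline\epsilon_r=\underline\epsilon_rF$) and the antipodes. For $\varphi_{par}$, the maps $f,\tilde f$ are its restrictions to the base algebras. *)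

theory Defs
  imports "HOL-Algebra.Algebra"
begin

section \<open>Algebras over a commutative ring\<close>

locale k_algebra = module + ring M +
  assumes smult_mult_left:
      "\<lbrakk>a \<in> carrier R; x \<in> carrier M; y \<in> carrier M\<rbrakk> \<Longrightarrow>
        (a \<odot>\<^bsub>M\<^esub> x) \<otimes>\<^bsub>M\<^esub> y = a \<odot>\<^bsub>M\<^esub> (x \<otimes>\<^bsub>M\<^esub> y)"
    and smult_mult_right:
      "\<lbrakk>a \<in> carrier R; x \<in> carrier M; y \<in> carrier M\<rbrakk> \<Longrightarrow>
        x \<otimes>\<^bsub>M\<^esub> (a \<odot>\<^bsub>M\<^esub> y) = a \<odot>\<^bsub>M\<^esub> (x \<otimes>\<^bsub>M\<^esub> y)"

definition linear_maps ::
  "('k, 'r) ring_scheme \<Rightarrow> ('k, 'm, 'x) module_scheme \<Rightarrow> ('k, 'n, 'y) module_scheme \<Rightarrow> ('m \<Rightarrow> 'n) set"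
  where "linear_maps R M N =
    {f \<in> carrier M \<rightarrow> carrier N.
      (\<forall>x\<in>carrier M. \<forall>y\<in>carrier M. f (x \<oplus>\<^bsub>M\<^esub> y) = f x \<oplus>\<^bsub>N\<^esub> f y) \<and>
      (\<forall>r\<in>carrier R. \<forall>x\<in>carrier M. f (r \<odot>\<^bsub>M\<^esub> x) = r \<odot>\<^bsub>N\<^esub> f x)}"

definition alg_hom ::
  "('k, 'r) ring_scheme \<Rightarrow> ('k, 'm, 'x) module_scheme \<Rightarrow> ('k, 'n, 'y) module_scheme \<Rightarrow> ('m \<Rightarrow> 'n) set"
  where "alg_hom R M N = ring_hom M N \<inter> linear_maps R M N"

text \<open>Anti-algebra maps from \<open>M\<close> to \<open>N\<close> are algebra maps from \<open>M\<close> to \<open>op_alg N\<close>.\<close>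

definition op_alg :: "('k, 'm, 'x) module_scheme \<Rightarrow> ('k, 'm, 'x) module_scheme"
  where "op_alg M = M\<lparr>monoid.mult := (\<lambda>x y. y \<otimes>\<^bsub>M\<^esub> x)\<rparr>"

definition subalg :: "('k, 'r) ring_scheme \<Rightarrow> ('k, 'm, 'x) module_scheme \<Rightarrow> 'm set \<Rightarrow> bool"
  where "subalg R M B \<longleftrightarrow> subring B M \<and> (\<forall>r\<in>carrier R. \<forall>x\<in>B. r \<odot>\<^bsub>M\<^esub> x \<in> B)"

definition subalg_generated ::
  "('k, 'r) ring_scheme \<Rightarrow> ('k, 'm, 'x) module_scheme \<Rightarrow> 'm set \<Rightarrow> 'm set"
  where "subalg_generated R M V = \<Inter>{B. subalg R M B \<and> V \<subseteq> B}"

definition list_prod :: "('a, 'z) monoid_scheme \<Rightarrow> 'a list \<Rightarrow> 'a"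
  where "list_prod M xs = foldr (\<lambda>x y. x \<otimes>\<^bsub>M\<^esub> y) xs \<one>\<^bsub>M\<^esub>"

definition quot_alg :: "('k, 'm, 'x) module_scheme \<Rightarrow> 'm set \<Rightarrow> ('k, 'm set) module"
  where "quot_alg M I =
    \<lparr>carrier = carrier (M Quot I), monoid.mult = monoid.mult (M Quot I),
     monoid.one = monoid.one (M Quot I),
     ring.zero = ring.zero (M Quot I), ring.add = ring.add (M Quot I),
     smult = (\<lambda>r V. \<Union>x\<in>V. I +>\<^bsub>M\<^esub> (r \<odot>\<^bsub>M\<^esub> x))\<rparr>"


section \<open>Tensor products over a possibly noncommutative ring\<close>

text \<open>
  \<open>tensor M N A ra la\<close> is \<open>M \<otimes>\<^sub>A N\<close>, where \<open>ra\<close> is the right action of the base (with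
  carrier \<open>A\<close>) on \<open>M\<close> and \<open>la\<close> its left action on \<open>N\<close>: the free abelian group on pairs modulo
  the subgroup spanned by the relations below.  Its \<open>zero\<close> is that subgroup.  The scalars act
  through \<open>M\<close>.  The field \<open>mult\<close> is the componentwise product of representatives; over a
  noncommutative base it is well defined only on suitable subsets (Takeuchi products), and it
  is used only there.
\<close>

definition tensor_rels ::
  "('m, 'x) ring_scheme \<Rightarrow> ('n, 'y) ring_scheme \<Rightarrow> 'a set \<Rightarrow> ('m \<Rightarrow> 'a \<Rightarrow> 'm) \<Rightarrow> ('a \<Rightarrow> 'n \<Rightarrow> 'n)
    \<Rightarrow> ('m \<times> 'n \<Rightarrow>\<^sub>0 int) set"
  where "tensor_rels M N A ra la =
    {frag_of (x \<oplus>\<^bsub>M\<^esub> x', y) - frag_of (x, y) - frag_of (x', y) | x x' y.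
       x \<in> carrier M \<and> x' \<in> carrier M \<and> y \<in> carrier N} \<union>
    {frag_of (x, y \<oplus>\<^bsub>N\<^esub> y') - frag_of (x, y) - frag_of (x, y') | x y y'.
       x \<in> carrier M \<and> y \<in> carrier N \<and> y' \<in> carrier N} \<union>
    {frag_of (ra x a, y) - frag_of (x, la a y) | x a y.
       x \<in> carrier M \<and> a \<in> A \<and> y \<in> carrier N}"

definition tensor ::
  "('k, 'm, 'x) module_scheme \<Rightarrow> ('n, 'y) ring_scheme \<Rightarrow> 'a set \<Rightarrow> ('m \<Rightarrow> 'a \<Rightarrow> 'm) \<Rightarrow> ('a \<Rightarrow> 'n \<Rightarrow> 'n)
    \<Rightarrow> ('k, ('m \<times> 'n \<Rightarrow>\<^sub>0 int) set) module"
  where "tensor M N A ra la =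
    (let G = free_Abelian_group (carrier M \<times> carrier N);
         K = generate G (tensor_rels M N A ra la)
     in \<lparr>carrier = rcosets\<^bsub>G\<^esub> K,
         monoid.mult = (\<lambda>V Y. the_elem
           {K #>\<^bsub>G\<^esub> frag_extend (\<lambda>(x, y). frag_extend (\<lambda>(x', y').
               frag_of (x \<otimes>\<^bsub>M\<^esub> x', y \<otimes>\<^bsub>N\<^esub> y')) d) c | c d. c \<in> V \<and> d \<in> Y}),
         monoid.one = K #>\<^bsub>G\<^esub> frag_of (\<one>\<^bsub>M\<^esub>, \<one>\<^bsub>N\<^esub>),
         ring.zero = K,
         ring.add = monoid.mult (G Mod K),
         smult = (\<lambda>r V. the_elem
           {K #>\<^bsub>G\<^esub> frag_extend (\<lambda>(x, y). frag_of (r \<odot>\<^bsub>M\<^esub> x, y)) c | c. c \<in> V})\<rparr>)"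

text \<open>The pure tensor \<open>x \<boxtimes> y\<close> in a tensor product \<open>T\<close>: the coset of the generator \<open>(x, y)\<close>.\<close>

definition pure_tensor ::
  "(('m \<times> 'n \<Rightarrow>\<^sub>0 int) set, 'z) ring_scheme \<Rightarrow> 'm \<Rightarrow> 'n \<Rightarrow> ('m \<times> 'n \<Rightarrow>\<^sub>0 int) set"
    (\<open>(_ \<boxtimes>\<index> _)\<close> [71, 71] 70)
  where "x \<boxtimes>\<^bsub>T\<^esub> y = (\<lambda>c. c + frag_of (x, y)) ` \<zero>\<^bsub>T\<^esub>"

text \<open>
  The additive map \<open>\<Sum>\<^sub>i x\<^sub>i \<otimes> y\<^sub>i \<mapsto> \<Sum>\<^sub>i \<beta> x\<^sub>i y\<^sub>i\<close> into \<open>G\<close> induced by a balanced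
  biadditive map \<open>\<beta>\<close>.  All maps out of tensor products below are obtained in this way.
\<close>

definition tlift :: "('g, 'z) ring_scheme \<Rightarrow> ('m \<Rightarrow> 'n \<Rightarrow> 'g) \<Rightarrow> ('m \<times> 'n \<Rightarrow>\<^sub>0 int) set \<Rightarrow> 'g"
  where "tlift G \<beta> V = the_elem
    ((\<lambda>c. \<Oplus>\<^bsub>G\<^esub>p\<in>Poly_Mapping.keys c. add_pow G (Poly_Mapping.lookup c p) (\<beta> (fst p) (snd p))) ` V)"

text \<open>\<open>tmap T f g\<close> is \<open>f \<otimes> g\<close> with target the tensor product \<open>T\<close>.\<close>

definition tmap ::
  "(('p \<times> 'q \<Rightarrow>\<^sub>0 int) set, 'z) ring_scheme \<Rightarrow> ('m \<Rightarrow> 'p) \<Rightarrow> ('n \<Rightarrow> 'q)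
    \<Rightarrow> ('m \<times> 'n \<Rightarrow>\<^sub>0 int) set \<Rightarrow> ('p \<times> 'q \<Rightarrow>\<^sub>0 int) set"
  where "tmap T f g = tlift T (\<lambda>x y. f x \<boxtimes>\<^bsub>T\<^esub> g y)"

text \<open>
  \<open>tassoc T W\<close> is the associativity map \<open>(V \<otimes> Y) \<otimes> Z \<rightarrow> V \<otimes> (Y \<otimes> Z)\<close>, where
  \<open>W = Y \<otimes> Z\<close> and \<open>T = V \<otimes> W\<close>; the two tensor products may be over different bases.
\<close>

definition tassoc ::
  "(('m \<times> ('n \<times> 'p \<Rightarrow>\<^sub>0 int) set \<Rightarrow>\<^sub>0 int) set, 'x) ring_scheme
    \<Rightarrow> (('n \<times> 'p \<Rightarrow>\<^sub>0 int) set, 'y) ring_scheme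
    \<Rightarrow> (('m \<times> 'n \<Rightarrow>\<^sub>0 int) set \<times> 'p \<Rightarrow>\<^sub>0 int) set
    \<Rightarrow> ('m \<times> ('n \<times> 'p \<Rightarrow>\<^sub>0 int) set \<Rightarrow>\<^sub>0 int) set"
  where "tassoc T W = tlift T (\<lambda>U z. tlift T (\<lambda>x y. x \<boxtimes>\<^bsub>T\<^esub> (y \<boxtimes>\<^bsub>W\<^esub> z)) U)"


section \<open>Corings\<close>

locale bimodule = base: ring A + module: abelian_group C
  for A :: "('a, 'r) ring_scheme" and C :: "('c, 's) ring_scheme"
    and la :: "'a \<Rightarrow> 'c \<Rightarrow> 'c" and ra :: "'c \<Rightarrow> 'a \<Rightarrow> 'c" +
  assumes la_closed: "\<lbrakk>a \<in> carrier A; x \<in> carrier C\<rbrakk> \<Longrightarrow> la a x \<in> carrier C"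
    and ra_closed: "\<lbrakk>a \<in> carrier A; x \<in> carrier C\<rbrakk> \<Longrightarrow> ra x a \<in> carrier C"
    and la_add: "\<lbrakk>a \<in> carrier A; x \<in> carrier C; y \<in> carrier C\<rbrakk> \<Longrightarrow>
      la a (x \<oplus>\<^bsub>C\<^esub> y) = la a x \<oplus>\<^bsub>C\<^esub> la a y"
    and ra_add: "\<lbrakk>a \<in> carrier A; x \<in> carrier C; y \<in> carrier C\<rbrakk> \<Longrightarrow>
      ra (x \<oplus>\<^bsub>C\<^esub> y) a = ra x a \<oplus>\<^bsub>C\<^esub> ra y a"
    and add_la: "\<lbrakk>a \<in> carrier A; b \<in> carrier A; x \<in> carrier C\<rbrakk> \<Longrightarrow>
      la (a \<oplus>\<^bsub>A\<^esub> b) x = la a x \<oplus>\<^bsub>C\<^esub> la b x"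
    and add_ra: "\<lbrakk>a \<in> carrier A; b \<in> carrier A; x \<in> carrier C\<rbrakk> \<Longrightarrow>
      ra x (a \<oplus>\<^bsub>A\<^esub> b) = ra x a \<oplus>\<^bsub>C\<^esub> ra x b"
    and la_mult: "\<lbrakk>a \<in> carrier A; b \<in> carrier A; x \<in> carrier C\<rbrakk> \<Longrightarrow>
      la (a \<otimes>\<^bsub>A\<^esub> b) x = la a (la b x)"
    and ra_mult: "\<lbrakk>a \<in> carrier A; b \<in> carrier A; x \<in> carrier C\<rbrakk> \<Longrightarrow>
      ra x (a \<otimes>\<^bsub>A\<^esub> b) = ra (ra x a) b"
    and la_one: "x \<in> carrier C \<Longrightarrow> la \<one>\<^bsub>A\<^esub> x = x"
    and ra_one: "x \<in> carrier C \<Longrightarrow> ra x \<one>\<^bsub>A\<^esub> = x"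
    and la_ra: "\<lbrakk>a \<in> carrier A; b \<in> carrier A; x \<in> carrier C\<rbrakk> \<Longrightarrow>
      ra (la a x) b = la a (ra x b)"

text \<open>For an \<open>A\<close>-bimodule \<open>C\<close>: \<open>C \<otimes>\<^sub>A C\<close>, \<open>(C \<otimes>\<^sub>A C) \<otimes>\<^sub>A C\<close> and \<open>C \<otimes>\<^sub>A (C \<otimes>\<^sub>A C)\<close>.\<close>

definition tensor_square where
  "tensor_square A C la ra = tensor C C (carrier A) ra la"

definition tensor_cube_left where
  "tensor_cube_left A C la ra = tensor (tensor_square A C la ra) C (carrier A)
     (\<lambda>V a. tmap (tensor_square A C la ra) (\<lambda>x. x) (\<lambda>y. ra y a) V) la"

definition tensor_cube_right where
  "tensor_cube_right A C la ra = tensor C (tensor_square A C la ra) (carrier A) ra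
     (\<lambda>a V. tmap (tensor_square A C la ra) (la a) (\<lambda>y. y) V)"

text \<open>
  An \<open>A\<close>-coring \<open>C\<close>: \<open>\<Delta>\<close> and \<open>\<epsilon>\<close> are bimodule maps, \<open>\<Delta>\<close> is coassociative and \<open>\<epsilon>\<close> is a counit;
  the canonical isomorphisms \<open>A \<otimes>\<^sub>A C \<cong> C \<cong> C \<otimes>\<^sub>A A\<close> are applied in the counit axioms.
\<close>

locale coring = bimodule A C la ra
  for A :: "('a, 'r) ring_scheme" and C :: "('k, 'c, 's) module_scheme"
    and la :: "'a \<Rightarrow> 'c \<Rightarrow> 'c" and ra :: "'c \<Rightarrow> 'a \<Rightarrow> 'c"
    and \<Delta> :: "'c \<Rightarrow> ('c \<times> 'c \<Rightarrow>\<^sub>0 int) set" and \<epsilon> :: "'c \<Rightarrow> 'a" +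
  assumes comult_closed: "c \<in> carrier C \<Longrightarrow> \<Delta> c \<in> carrier (tensor_square A C la ra)"
    and comult_add: "\<lbrakk>c \<in> carrier C; d \<in> carrier C\<rbrakk> \<Longrightarrow>
      \<Delta> (c \<oplus>\<^bsub>C\<^esub> d) = \<Delta> c \<oplus>\<^bsub>tensor_square A C la ra\<^esub> \<Delta> d"
    and comult_la: "\<lbrakk>a \<in> carrier A; c \<in> carrier C\<rbrakk> \<Longrightarrow>
      \<Delta> (la a c) = tmap (tensor_square A C la ra) (la a) (\<lambda>y. y) (\<Delta> c)"
    and comult_ra: "\<lbrakk>a \<in> carrier A; c \<in> carrier C\<rbrakk> \<Longrightarrow>
      \<Delta> (ra c a) = tmap (tensor_square A C la ra) (\<lambda>x. x) (\<lambda>y. ra y a) (\<Delta> c)"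
    and counit_closed: "c \<in> carrier C \<Longrightarrow> \<epsilon> c \<in> carrier A"
    and counit_add: "\<lbrakk>c \<in> carrier C; d \<in> carrier C\<rbrakk> \<Longrightarrow> \<epsilon> (c \<oplus>\<^bsub>C\<^esub> d) = \<epsilon> c \<oplus>\<^bsub>A\<^esub> \<epsilon> d"
    and counit_la: "\<lbrakk>a \<in> carrier A; c \<in> carrier C\<rbrakk> \<Longrightarrow> \<epsilon> (la a c) = a \<otimes>\<^bsub>A\<^esub> \<epsilon> c"
    and counit_ra: "\<lbrakk>a \<in> carrier A; c \<in> carrier C\<rbrakk> \<Longrightarrow> \<epsilon> (ra c a) = \<epsilon> c \<otimes>\<^bsub>A\<^esub> a"
    and coassoc: "c \<in> carrier C \<Longrightarrow>
      tassoc (tensor_cube_right A C la ra) (tensor_square A C la ra)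
        (tmap (tensor_cube_left A C la ra) \<Delta> (\<lambda>y. y) (\<Delta> c))
      = tmap (tensor_cube_right A C la ra) (\<lambda>x. x) \<Delta> (\<Delta> c)"
    and counit_left: "c \<in> carrier C \<Longrightarrow> tlift C (\<lambda>x y. la (\<epsilon> x) y) (\<Delta> c) = c"
    and counit_right: "c \<in> carrier C \<Longrightarrow> tlift C (\<lambda>x y. ra x (\<epsilon> y)) (\<Delta> c) = c"


section \<open>Hopf algebras\<close>

record ('k, 'h) hopf_algebra = "('k, 'h) module" +
  comult :: "'h \<Rightarrow> ('h \<times> 'h \<Rightarrow>\<^sub>0 int) set"
  counit :: "'h \<Rightarrow> 'k"
  antipode :: "'h \<Rightarrow> 'h"

definition k_tensor_square ::
  "('k, 'r) ring_scheme \<Rightarrow> ('k, 'h, 'z) module_scheme \<Rightarrow> ('k, ('h \<times> 'h \<Rightarrow>\<^sub>0 int) set) module"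
  where "k_tensor_square R H = tensor_square R H (\<lambda>r x. r \<odot>\<^bsub>H\<^esub> x) (\<lambda>x r. r \<odot>\<^bsub>H\<^esub> x)"

text \<open>The coalgebra axioms are those of a coring over \<open>R\<close> with equal left and right actions.\<close>

locale hopf_algebra =
  algebra: k_algebra R H +
  coalgebra: coring R H "\<lambda>r x. r \<odot>\<^bsub>H\<^esub> x" "\<lambda>x r. r \<odot>\<^bsub>H\<^esub> x" "comult H" "counit H"
  for R :: "'k ring" and H :: "('k, 'h) hopf_algebra" +
  assumes comult_alg_hom: "comult H \<in> alg_hom R H (k_tensor_square R H)"
    and counit_ring_hom: "counit H \<in> ring_hom H R"
    and antipode_linear: "antipode H \<in> linear_maps R H H"
    and antipode_left: "h \<in> carrier H \<Longrightarrow>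
      tlift H (\<lambda>x y. antipode H x \<otimes>\<^bsub>H\<^esub> y) (comult H h) = counit H h \<odot>\<^bsub>H\<^esub> \<one>\<^bsub>H\<^esub>"
    and antipode_right: "h \<in> carrier H \<Longrightarrow>
      tlift H (\<lambda>x y. x \<otimes>\<^bsub>H\<^esub> antipode H y) (comult H h) = counit H h \<odot>\<^bsub>H\<^esub> \<one>\<^bsub>H\<^esub>"

definition hopf_hom ::
  "'k ring \<Rightarrow> ('k, 'h) hopf_algebra \<Rightarrow> ('k, 'l) hopf_algebra \<Rightarrow> ('h \<Rightarrow> 'l) set"
  where "hopf_hom R H L =
    {\<phi> \<in> alg_hom R H L. \<forall>h\<in>carrier H.
      comult L (\<phi> h) = tmap (k_tensor_square R L) \<phi> \<phi> (comult H h) \<and>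
      counit L (\<phi> h) = counit H h \<and>
      antipode L (\<phi> h) = \<phi> (antipode H h)}"


section \<open>Bialgebroids and Hopf algebroids\<close>

definition left_tensor ::
  "('k, 'h, 'x) module_scheme \<Rightarrow> ('a, 'y) ring_scheme \<Rightarrow> ('a \<Rightarrow> 'h) \<Rightarrow> ('a \<Rightarrow> 'h)
    \<Rightarrow> ('k, ('h \<times> 'h \<Rightarrow>\<^sub>0 int) set) module"
  where "left_tensor H A s t =
    tensor_square A H (\<lambda>a h. s a \<otimes>\<^bsub>H\<^esub> h) (\<lambda>h a. t a \<otimes>\<^bsub>H\<^esub> h)"

definition right_tensor ::
  "('k, 'h, 'x) module_scheme \<Rightarrow> ('a, 'y) ring_scheme \<Rightarrow> ('a \<Rightarrow> 'h) \<Rightarrow> ('a \<Rightarrow> 'h)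
    \<Rightarrow> ('k, ('h \<times> 'h \<Rightarrow>\<^sub>0 int) set) module"
  where "right_tensor H A s t =
    tensor_square A H (\<lambda>a h. h \<otimes>\<^bsub>H\<^esub> t a) (\<lambda>h a. h \<otimes>\<^bsub>H\<^esub> s a)"

definition left_takeuchi ::
  "('k, 'h, 'x) module_scheme \<Rightarrow> ('a, 'y) ring_scheme \<Rightarrow> ('a \<Rightarrow> 'h) \<Rightarrow> ('a \<Rightarrow> 'h)
    \<Rightarrow> ('k, ('h \<times> 'h \<Rightarrow>\<^sub>0 int) set) module"
  where "left_takeuchi H A s t = (let T = left_tensor H A s t in
    T\<lparr>carrier := {V \<in> carrier T. \<forall>a\<in>carrier A.
      tmap T (\<lambda>h. h \<otimes>\<^bsub>H\<^esub> t a) (\<lambda>h. h) V = tmap T (\<lambda>h. h) (\<lambda>h. h \<otimes>\<^bsub>H\<^esub> s a) V}\<rparr>)"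

definition right_takeuchi ::
  "('k, 'h, 'x) module_scheme \<Rightarrow> ('a, 'y) ring_scheme \<Rightarrow> ('a \<Rightarrow> 'h) \<Rightarrow> ('a \<Rightarrow> 'h)
    \<Rightarrow> ('k, ('h \<times> 'h \<Rightarrow>\<^sub>0 int) set) module"
  where "right_takeuchi H A s t = (let T = right_tensor H A s t in
    T\<lparr>carrier := {V \<in> carrier T. \<forall>a\<in>carrier A.
      tmap T (\<lambda>h. s a \<otimes>\<^bsub>H\<^esub> h) (\<lambda>h. h) V = tmap T (\<lambda>h. h) (\<lambda>h. t a \<otimes>\<^bsub>H\<^esub> h) V}\<rparr>)"

locale left_bialgebroid =
  total: k_algebra R H + base: k_algebra R A +
  coring: coring A H "\<lambda>a h. s a \<otimes>\<^bsub>H\<^esub> h" "\<lambda>h a. t a \<otimes>\<^bsub>H\<^esub> h" \<Delta> \<epsilon>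
  for R :: "'k ring" and H :: "('k, 'h) module" and A :: "('k, 'a) module"
    and s :: "'a \<Rightarrow> 'h" and t :: "'a \<Rightarrow> 'h"
    and \<Delta> :: "'h \<Rightarrow> ('h \<times> 'h \<Rightarrow>\<^sub>0 int) set" and \<epsilon> :: "'h \<Rightarrow> 'a" +
  assumes source_hom: "s \<in> alg_hom R A H"
    and target_antihom: "t \<in> alg_hom R A (op_alg H)"
    and source_target_commute: "\<lbrakk>a \<in> carrier A; b \<in> carrier A\<rbrakk> \<Longrightarrow> s a \<otimes>\<^bsub>H\<^esub> t b = t b \<otimes>\<^bsub>H\<^esub> s a"
    and comult_takeuchi: "\<Delta> \<in> alg_hom R H (left_takeuchi H A s t)"
    and counit_source: "\<lbrakk>h \<in> carrier H; l \<in> carrier H\<rbrakk> \<Longrightarrow> \<epsilon> (h \<otimes>\<^bsub>H\<^esub> l) = \<epsilon> (h \<otimes>\<^bsub>H\<^esub> s (\<epsilon> l))"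
    and counit_target: "\<lbrakk>h \<in> carrier H; l \<in> carrier H\<rbrakk> \<Longrightarrow> \<epsilon> (h \<otimes>\<^bsub>H\<^esub> l) = \<epsilon> (h \<otimes>\<^bsub>H\<^esub> t (\<epsilon> l))"

locale right_bialgebroid =
  total: k_algebra R H + base: k_algebra R A +
  coring: coring A H "\<lambda>a h. h \<otimes>\<^bsub>H\<^esub> t a" "\<lambda>h a. h \<otimes>\<^bsub>H\<^esub> s a" \<Delta> \<epsilon>
  for R :: "'k ring" and H :: "('k, 'h) module" and A :: "('k, 'a) module"
    and s :: "'a \<Rightarrow> 'h" and t :: "'a \<Rightarrow> 'h"
    and \<Delta> :: "'h \<Rightarrow> ('h \<times> 'h \<Rightarrow>\<^sub>0 int) set" and \<epsilon> :: "'h \<Rightarrow> 'a" +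
  assumes source_hom: "s \<in> alg_hom R A H"
    and target_antihom: "t \<in> alg_hom R A (op_alg H)"
    and source_target_commute: "\<lbrakk>a \<in> carrier A; b \<in> carrier A\<rbrakk> \<Longrightarrow> s a \<otimes>\<^bsub>H\<^esub> t b = t b \<otimes>\<^bsub>H\<^esub> s a"
    and comult_takeuchi: "\<Delta> \<in> alg_hom R H (right_takeuchi H A s t)"
    and counit_source: "\<lbrakk>h \<in> carrier H; l \<in> carrier H\<rbrakk> \<Longrightarrow> \<epsilon> (h \<otimes>\<^bsub>H\<^esub> l) = \<epsilon> (s (\<epsilon> h) \<otimes>\<^bsub>H\<^esub> l)"
    and counit_target: "\<lbrakk>h \<in> carrier H; l \<in> carrier H\<rbrakk> \<Longrightarrow> \<epsilon> (h \<otimes>\<^bsub>H\<^esub> l) = \<epsilon> (t (\<epsilon> h) \<otimes>\<^bsub>H\<^esub> l)"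

record ('k, 'h, 'a, 'b) hopf_algebroid =
  total :: "('k, 'h) module"
  lbase :: "('k, 'a) module"
  rbase :: "('k, 'b) module"
  lsource :: "'a \<Rightarrow> 'h"
  ltarget :: "'a \<Rightarrow> 'h"
  lcomult :: "'h \<Rightarrow> ('h \<times> 'h \<Rightarrow>\<^sub>0 int) set"
  lcounit :: "'h \<Rightarrow> 'a"
  rsource :: "'b \<Rightarrow> 'h"
  rtarget :: "'b \<Rightarrow> 'h"
  rcomult :: "'h \<Rightarrow> ('h \<times> 'h \<Rightarrow>\<^sub>0 int) set"
  rcounit :: "'h \<Rightarrow> 'b"
  antip :: "'h \<Rightarrow> 'h"

abbreviation ltensor :: "('k, 'h, 'a, 'b) hopf_algebroid \<Rightarrow> ('k, ('h \<times> 'h \<Rightarrow>\<^sub>0 int) set) module"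
  where "ltensor D \<equiv> left_tensor (total D) (lbase D) (lsource D) (ltarget D)"

abbreviation rtensor :: "('k, 'h, 'a, 'b) hopf_algebroid \<Rightarrow> ('k, ('h \<times> 'h \<Rightarrow>\<^sub>0 int) set) module"
  where "rtensor D \<equiv> right_tensor (total D) (rbase D) (rsource D) (rtarget D)"

text \<open>
  The four iterated tensor products occurring in the mixed coassociativity axioms.  With
  \<open>A\<close>, \<open>B\<close> the left and right bases and \<open>H\<close> the total algebra they are, in order,
  \<open>(H \<otimes>\<^sub>A H) \<otimes>\<^sub>B H\<close>, \<open>H \<otimes>\<^sub>A (H \<otimes>\<^sub>B H)\<close>, \<open>(H \<otimes>\<^sub>B H) \<otimes>\<^sub>A H\<close>, \<open>H \<otimes>\<^sub>B (H \<otimes>\<^sub>A H)\<close>;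
  the actions on the inner tensor products are those on the adjacent factor.
\<close>

definition tensor_lr_left where
  "tensor_lr_left D = tensor (ltensor D) (total D) (carrier (rbase D))
     (\<lambda>V b. tmap (ltensor D) (\<lambda>x. x) (\<lambda>y. y \<otimes>\<^bsub>total D\<^esub> rsource D b) V)
     (\<lambda>b z. z \<otimes>\<^bsub>total D\<^esub> rtarget D b)"

definition tensor_lr_right where
  "tensor_lr_right D = tensor (total D) (rtensor D) (carrier (lbase D))
     (\<lambda>x a. ltarget D a \<otimes>\<^bsub>total D\<^esub> x)
     (\<lambda>a Y. tmap (rtensor D) (\<lambda>y. lsource D a \<otimes>\<^bsub>total D\<^esub> y) (\<lambda>z. z) Y)"

definition tensor_rl_left where
  "tensor_rl_left D = tensor (rtensor D) (total D) (carrier (lbase D))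
     (\<lambda>V a. tmap (rtensor D) (\<lambda>x. x) (\<lambda>y. ltarget D a \<otimes>\<^bsub>total D\<^esub> y) V)
     (\<lambda>a z. lsource D a \<otimes>\<^bsub>total D\<^esub> z)"

definition tensor_rl_right where
  "tensor_rl_right D = tensor (total D) (ltensor D) (carrier (rbase D))
     (\<lambda>x b. x \<otimes>\<^bsub>total D\<^esub> rsource D b)
     (\<lambda>b Y. tmap (ltensor D) (\<lambda>y. y \<otimes>\<^bsub>total D\<^esub> rtarget D b) (\<lambda>z. z) Y)"

locale hopf_algebroid =
  left: left_bialgebroid R "total D" "lbase D" "lsource D" "ltarget D" "lcomult D" "lcounit D" +
  right: right_bialgebroid R "total D" "rbase D" "rsource D" "rtarget D" "rcomult D" "rcounit D"
  for R :: "'k ring" and D :: "('k, 'h, 'a, 'b) hopf_algebroid" +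
  assumes bases_anti_iso:
      "\<exists>\<theta> \<in> alg_hom R (lbase D) (op_alg (rbase D)). bij_betw \<theta> (carrier (lbase D)) (carrier (rbase D))"
    and antip_antihom: "antip D \<in> alg_hom R (total D) (op_alg (total D))"
    and lsource_lcounit_rtarget: "b \<in> carrier (rbase D) \<Longrightarrow>
      lsource D (lcounit D (rtarget D b)) = rtarget D b"
    and ltarget_lcounit_rsource: "b \<in> carrier (rbase D) \<Longrightarrow>
      ltarget D (lcounit D (rsource D b)) = rsource D b"
    and rsource_rcounit_ltarget: "a \<in> carrier (lbase D) \<Longrightarrow>
      rsource D (rcounit D (ltarget D a)) = ltarget D a"
    and rtarget_rcounit_lsource: "a \<in> carrier (lbase D) \<Longrightarrow>
      rtarget D (rcounit D (lsource D a)) = lsource D a"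
    and coassoc_lr: "h \<in> carrier (total D) \<Longrightarrow>
      tassoc (tensor_lr_right D) (rtensor D)
        (tmap (tensor_lr_left D) (lcomult D) (\<lambda>z. z) (rcomult D h))
      = tmap (tensor_lr_right D) (\<lambda>x. x) (rcomult D) (lcomult D h)"
    and coassoc_rl: "h \<in> carrier (total D) \<Longrightarrow>
      tmap (tensor_rl_right D) (\<lambda>x. x) (lcomult D) (rcomult D h)
      = tassoc (tensor_rl_right D) (ltensor D)
          (tmap (tensor_rl_left D) (rcomult D) (\<lambda>z. z) (lcomult D h))"
    and antip_target: "\<lbrakk>a \<in> carrier (lbase D); h \<in> carrier (total D); b \<in> carrier (rbase D)\<rbrakk> \<Longrightarrow>
      antip D (ltarget D a \<otimes>\<^bsub>total D\<^esub> h \<otimes>\<^bsub>total D\<^esub> rtarget D b)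
      = rsource D b \<otimes>\<^bsub>total D\<^esub> antip D h \<otimes>\<^bsub>total D\<^esub> lsource D a"
    and antip_left: "h \<in> carrier (total D) \<Longrightarrow>
      tlift (total D) (\<lambda>x y. antip D x \<otimes>\<^bsub>total D\<^esub> y) (lcomult D h) = rsource D (rcounit D h)"
    and antip_right: "h \<in> carrier (total D) \<Longrightarrow>
      tlift (total D) (\<lambda>x y. x \<otimes>\<^bsub>total D\<^esub> antip D y) (rcomult D h) = lsource D (lcounit D h)"

definition hopf_algebroid_hom ::
  "'k ring \<Rightarrow> ('k, 'h, 'a, 'b) hopf_algebroid \<Rightarrow> ('k, 'l, 'c, 'd) hopf_algebroid
    \<Rightarrow> (('h \<Rightarrow> 'l) \<times> ('a \<Rightarrow> 'c) \<times> ('b \<Rightarrow> 'd)) set"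
  where "hopf_algebroid_hom R D E =
    {(F, f, g).
      F \<in> alg_hom R (total D) (total E) \<and>
      f \<in> alg_hom R (lbase D) (lbase E) \<and>
      g \<in> alg_hom R (rbase D) (rbase E) \<and>
      (\<forall>a\<in>carrier (lbase D). F (lsource D a) = lsource E (f a) \<and> F (ltarget D a) = ltarget E (f a)) \<and>
      (\<forall>b\<in>carrier (rbase D). F (rsource D b) = rsource E (g b) \<and> F (rtarget D b) = rtarget E (g b)) \<and>
      (\<forall>h\<in>carrier (total D).
        lcomult E (F h) = tmap (ltensor E) F F (lcomult D h) \<and>
        rcomult E (F h) = tmap (rtensor E) F F (rcomult D h) \<and>
        f (lcounit D h) = lcounit E (F h) \<and>
        g (rcounit D h) = rcounit E (F h) \<and>
        F (antip D h) = antip E (F h))}"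


section \<open>Categories and functors\<close>

record ('o, 'm) category =
  Obj :: "'o set"
  Hom :: "'o \<Rightarrow> 'o \<Rightarrow> 'm set"
  Ident :: "'o \<Rightarrow> 'm"
  Comp :: "'o \<Rightarrow> 'o \<Rightarrow> 'o \<Rightarrow> 'm \<Rightarrow> 'm \<Rightarrow> 'm"  \<comment> \<open>\<open>Comp C V Y Z g f\<close> is \<open>g \<circ> f : V \<rightarrow> Y \<rightarrow> Z\<close>\<close>

locale category =
  fixes C :: "('o, 'm) category"
  assumes Ident_Hom: "V \<in> Obj C \<Longrightarrow> Ident C V \<in> Hom C V V"
    and Comp_Hom: "\<lbrakk>V \<in> Obj C; Y \<in> Obj C; Z \<in> Obj C; f \<in> Hom C V Y; g \<in> Hom C Y Z\<rbrakk>
      \<Longrightarrow> Comp C V Y Z g f \<in> Hom C V Z"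
    and Comp_Ident_right: "\<lbrakk>V \<in> Obj C; Y \<in> Obj C; f \<in> Hom C V Y\<rbrakk>
      \<Longrightarrow> Comp C V V Y f (Ident C V) = f"
    and Comp_Ident_left: "\<lbrakk>V \<in> Obj C; Y \<in> Obj C; f \<in> Hom C V Y\<rbrakk>
      \<Longrightarrow> Comp C V Y Y (Ident C Y) f = f"
    and Comp_assoc: "\<lbrakk>W \<in> Obj C; V \<in> Obj C; Y \<in> Obj C; Z \<in> Obj C;
        f \<in> Hom C W V; g \<in> Hom C V Y; h \<in> Hom C Y Z\<rbrakk>
      \<Longrightarrow> Comp C W V Z (Comp C V Y Z h g) f = Comp C W Y Z h (Comp C W V Y g f)"

locale is_functor = source: category C + target: category D
  for C :: "('o, 'm) category" and D :: "('p, 'n) category"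
    and FO :: "'o \<Rightarrow> 'p" and FM :: "'o \<Rightarrow> 'o \<Rightarrow> 'm \<Rightarrow> 'n" +
  assumes FO_Obj: "V \<in> Obj C \<Longrightarrow> FO V \<in> Obj D"
    and FM_Hom: "\<lbrakk>V \<in> Obj C; Y \<in> Obj C; f \<in> Hom C V Y\<rbrakk> \<Longrightarrow> FM V Y f \<in> Hom D (FO V) (FO Y)"
    and FM_Ident: "V \<in> Obj C \<Longrightarrow> FM V V (Ident C V) = Ident D (FO V)"
    and FM_Comp: "\<lbrakk>V \<in> Obj C; Y \<in> Obj C; Z \<in> Obj C; f \<in> Hom C V Y; g \<in> Hom C Y Z\<rbrakk>
      \<Longrightarrow> FM V Z (Comp C V Y Z g f) = Comp D (FO V) (FO Y) (FO Z) (FM Y Z g) (FM V Y f)"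

text \<open>
  Morphisms are taken extensional, so that they are determined by their values on carriers.
  The objects have carriers in a fixed but arbitrary type, which plays the role of the universe.
\<close>

definition hopf_algebra_category :: "'k ring \<Rightarrow> (('k, 'h) hopf_algebra, 'h \<Rightarrow> 'h) category"
  where "hopf_algebra_category R =
    \<lparr>Obj = {H. hopf_algebra R H \<and> bij_betw (antipode H) (carrier H) (carrier H)},
     Hom = (\<lambda>H L. hopf_hom R H L \<inter> extensional (carrier H)),
     Ident = (\<lambda>H. restrict (\<lambda>h. h) (carrier H)),
     Comp = (\<lambda>H L M \<psi> \<phi>. compose (carrier H) \<psi> \<phi>)\<rparr>"

definition hopf_algebroid_category ::
  "'k ring \<Rightarrow> (('k, 'h, 'a, 'b) hopf_algebroid, ('h \<Rightarrow> 'h) \<times> ('a \<Rightarrow> 'a) \<times> ('b \<Rightarrow> 'b)) category"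
  where "hopf_algebroid_category R =
    \<lparr>Obj = {D. hopf_algebroid R D},
     Hom = (\<lambda>D E. hopf_algebroid_hom R D E \<inter>
       extensional (carrier (total D)) \<times> extensional (carrier (lbase D)) \<times>
       extensional (carrier (rbase D))),
     Ident = (\<lambda>D. (restrict (\<lambda>h. h) (carrier (total D)), restrict (\<lambda>a. a) (carrier (lbase D)),
       restrict (\<lambda>b. b) (carrier (rbase D)))),
     Comp = (\<lambda>D E E' (G, g, g') (F, f, f').
       (compose (carrier (total D)) G F, compose (carrier (lbase D)) g f,
        compose (carrier (rbase D)) g' f'))\<rparr>"


section \<open>The partial Hopf algebra\<close>

text \<open>The free algebra on a set: finitely supported functions on words with convolution product.\<close>

definition free_algebra :: "('k, 'r) ring_scheme \<Rightarrow> 's set \<Rightarrow> ('k, 's list \<Rightarrow> 'k) module"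
  where "free_algebra R V =
    \<lparr>carrier = {f. f \<in> UNIV \<rightarrow> carrier R \<and> finite {w. f w \<noteq> \<zero>\<^bsub>R\<^esub>} \<and> {w. f w \<noteq> \<zero>\<^bsub>R\<^esub>} \<subseteq> lists V},
     monoid.mult = (\<lambda>f g w. \<Oplus>\<^bsub>R\<^esub>i\<in>{..length w}. f (take i w) \<otimes>\<^bsub>R\<^esub> g (drop i w)),
     monoid.one = (\<lambda>w. if w = [] then \<one>\<^bsub>R\<^esub> else \<zero>\<^bsub>R\<^esub>),
     ring.zero = (\<lambda>w. \<zero>\<^bsub>R\<^esub>),
     ring.add = (\<lambda>f g w. f w \<oplus>\<^bsub>R\<^esub> g w),
     smult = (\<lambda>r f w. r \<otimes>\<^bsub>R\<^esub> f w)\<rparr>"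

definition free_gen :: "('k, 'r) ring_scheme \<Rightarrow> 's \<Rightarrow> 's list \<Rightarrow> 'k"
  where "free_gen R x = (\<lambda>w. if w = [x] then \<one>\<^bsub>R\<^esub> else \<zero>\<^bsub>R\<^esub>)"

text \<open>
  The tensor algebra \<open>T(H)\<close> of the \<open>k\<close>-module \<open>H\<close>, presented as the free algebra on the set \<open>H\<close>
  modulo the relations that make the inclusion \<open>tens_gen\<close> of \<open>H\<close> linear.
\<close>

definition tens_ideal :: "('k, 'r) ring_scheme \<Rightarrow> ('k, 'h, 'z) module_scheme \<Rightarrow> ('h list \<Rightarrow> 'k) set"
  where "tens_ideal R H = (let F = free_algebra R (carrier H) in
    Idl\<^bsub>F\<^esub>
     ({free_gen R (x \<oplus>\<^bsub>H\<^esub> y) \<ominus>\<^bsub>F\<^esub> (free_gen R x \<oplus>\<^bsub>F\<^esub> free_gen R y) | x y.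
        x \<in> carrier H \<and> y \<in> carrier H} \<union>
      {free_gen R (r \<odot>\<^bsub>H\<^esub> x) \<ominus>\<^bsub>F\<^esub> r \<odot>\<^bsub>F\<^esub> free_gen R x | r x. r \<in> carrier R \<and> x \<in> carrier H}))"

definition tens_alg ::
  "('k, 'r) ring_scheme \<Rightarrow> ('k, 'h, 'z) module_scheme \<Rightarrow> ('k, ('h list \<Rightarrow> 'k) set) module"
  where "tens_alg R H = quot_alg (free_algebra R (carrier H)) (tens_ideal R H)"

definition tens_gen ::
  "('k, 'r) ring_scheme \<Rightarrow> ('k, 'h, 'z) module_scheme \<Rightarrow> 'h \<Rightarrow> ('h list \<Rightarrow> 'k) set"
  where "tens_gen R H h = tens_ideal R H +>\<^bsub>free_algebra R (carrier H)\<^esub> free_gen R h"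

text \<open>\<open>sweedler G H \<beta> h\<close> is \<open>\<beta>(h\<^sub>1, h\<^sub>2)\<close>, summed in \<open>G\<close>.\<close>

abbreviation sweedler ::
  "('g, 'z) ring_scheme \<Rightarrow> ('k, 'h) hopf_algebra \<Rightarrow> ('h \<Rightarrow> 'h \<Rightarrow> 'g) \<Rightarrow> 'h \<Rightarrow> 'g"
  where "sweedler G H \<beta> h \<equiv> tlift G \<beta> (comult H h)"

definition par_ideal :: "'k ring \<Rightarrow> ('k, 'h) hopf_algebra \<Rightarrow> ('h list \<Rightarrow> 'k) set set"
  where "par_ideal R H = (let T = tens_alg R H; \<tau> = tens_gen R H; S = antipode H in
    Idl\<^bsub>T\<^esub>
     ({\<tau> \<one>\<^bsub>H\<^esub> \<ominus>\<^bsub>T\<^esub> \<one>\<^bsub>T\<^esub>} \<union>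
      {sweedler T H (\<lambda>x y. \<tau> h \<otimes>\<^bsub>T\<^esub> \<tau> x \<otimes>\<^bsub>T\<^esub> \<tau> (S y)) l \<ominus>\<^bsub>T\<^esub>
       sweedler T H (\<lambda>x y. \<tau> (h \<otimes>\<^bsub>H\<^esub> x) \<otimes>\<^bsub>T\<^esub> \<tau> (S y)) l | h l. h \<in> carrier H \<and> l \<in> carrier H} \<union>
      {sweedler T H (\<lambda>x y. \<tau> x \<otimes>\<^bsub>T\<^esub> \<tau> (S y) \<otimes>\<^bsub>T\<^esub> \<tau> l) h \<ominus>\<^bsub>T\<^esub>
       sweedler T H (\<lambda>x y. \<tau> x \<otimes>\<^bsub>T\<^esub> \<tau> (S y \<otimes>\<^bsub>H\<^esub> l)) h | h l. h \<in> carrier H \<and> l \<in> carrier H} \<union>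
      {sweedler T H (\<lambda>x y. \<tau> h \<otimes>\<^bsub>T\<^esub> \<tau> (S x) \<otimes>\<^bsub>T\<^esub> \<tau> y) l \<ominus>\<^bsub>T\<^esub>
       sweedler T H (\<lambda>x y. \<tau> (h \<otimes>\<^bsub>H\<^esub> S x) \<otimes>\<^bsub>T\<^esub> \<tau> y) l | h l. h \<in> carrier H \<and> l \<in> carrier H} \<union>
      {sweedler T H (\<lambda>x y. \<tau> (S x) \<otimes>\<^bsub>T\<^esub> \<tau> y \<otimes>\<^bsub>T\<^esub> \<tau> l) h \<ominus>\<^bsub>T\<^esub>
       sweedler T H (\<lambda>x y. \<tau> (S x) \<otimes>\<^bsub>T\<^esub> \<tau> (y \<otimes>\<^bsub>H\<^esub> l)) h | h l. h \<in> carrier H \<and> l \<in> carrier H}))"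

type_synonym ('k, 'h) par = "('h list \<Rightarrow> 'k) set set"

definition par_alg :: "'k ring \<Rightarrow> ('k, 'h) hopf_algebra \<Rightarrow> ('k, ('k, 'h) par) module"
  where "par_alg R H = quot_alg (tens_alg R H) (par_ideal R H)"

text \<open>The class \<open>[h]\<close>, and the product \<open>[h\<^sup>1]\<cdots>[h\<^sup>n]\<close>.\<close>

definition par_gen :: "'k ring \<Rightarrow> ('k, 'h) hopf_algebra \<Rightarrow> 'h \<Rightarrow> ('k, 'h) par"
  where "par_gen R H h = par_ideal R H +>\<^bsub>tens_alg R H\<^esub> tens_gen R H h"

definition par_word :: "'k ring \<Rightarrow> ('k, 'h) hopf_algebra \<Rightarrow> 'h list \<Rightarrow> ('k, 'h) par"
  where "par_word R H ws = list_prod (par_alg R H) (map (par_gen R H) ws)"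

definition par_eps :: "'k ring \<Rightarrow> ('k, 'h) hopf_algebra \<Rightarrow> 'h \<Rightarrow> ('k, 'h) par"
  where "par_eps R H h = sweedler (par_alg R H) H
    (\<lambda>x y. par_gen R H x \<otimes>\<^bsub>par_alg R H\<^esub> par_gen R H (antipode H y)) h"

definition par_eps' :: "'k ring \<Rightarrow> ('k, 'h) hopf_algebra \<Rightarrow> 'h \<Rightarrow> ('k, 'h) par"
  where "par_eps' R H h = sweedler (par_alg R H) H
    (\<lambda>x y. par_gen R H (antipode H x) \<otimes>\<^bsub>par_alg R H\<^esub> par_gen R H y) h"

definition par_lbase :: "'k ring \<Rightarrow> ('k, 'h) hopf_algebra \<Rightarrow> ('k, ('k, 'h) par) module"
  where "par_lbase R H = (par_alg R H)
    \<lparr>carrier := subalg_generated R (par_alg R H) (par_eps R H ` carrier H)\<rparr>"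

definition par_rbase :: "'k ring \<Rightarrow> ('k, 'h) hopf_algebra \<Rightarrow> ('k, ('k, 'h) par) module"
  where "par_rbase R H = (par_alg R H)
    \<lparr>carrier := subalg_generated R (par_alg R H) (par_eps' R H ` carrier H)\<rparr>"

text \<open>
  Iterated Sweedler notation: \<open>legs G H m \<beta> h\<close> is \<open>\<beta> [h\<^sub>1, \<dots>, h\<^sub>m\<^sub>+\<^sub>1]\<close>, summed in \<open>G\<close>, and
  \<open>multi_legs G H [(h\<^sup>1, m\<^sub>1), \<dots>, (h\<^sup>n, m\<^sub>n)] \<beta>\<close> applies \<open>\<beta>\<close> to the list whose \<open>i\<close>-th entry is
  the list of the \<open>m\<^sub>i + 1\<close> legs of \<open>h\<^sup>i\<close>.  List positions count from 0.
\<close>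

fun legs :: "('g, 'z) ring_scheme \<Rightarrow> ('k, 'h) hopf_algebra \<Rightarrow> nat \<Rightarrow> ('h list \<Rightarrow> 'g) \<Rightarrow> 'h \<Rightarrow> 'g"
  where
    "legs G H 0 \<beta> h = \<beta> [h]"
  | "legs G H (Suc m) \<beta> h = sweedler G H (\<lambda>x y. legs G H m (\<lambda>L. \<beta> (x # L)) y) h"

fun multi_legs ::
  "('g, 'z) ring_scheme \<Rightarrow> ('k, 'h) hopf_algebra \<Rightarrow> ('h \<times> nat) list \<Rightarrow> ('h list list \<Rightarrow> 'g) \<Rightarrow> 'g"
  where
    "multi_legs G H [] \<beta> = \<beta> []"
  | "multi_legs G H ((h, m) # hs) \<beta> =
      legs G H m (\<lambda>L. multi_legs G H hs (\<lambda>Ls. \<beta> (L # Ls))) h"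

text \<open>\<open>[h\<^sup>1\<^sub>1]\<cdots>[h\<^sup>n\<^sub>1] \<otimes> [h\<^sup>1\<^sub>2]\<cdots>[h\<^sup>n\<^sub>2]\<close> in the tensor product \<open>T\<close>\<close>

definition par_comult_word ::
  "'k ring \<Rightarrow> ('k, 'h) hopf_algebra \<Rightarrow> ('k, (('k, 'h) par \<times> ('k, 'h) par \<Rightarrow>\<^sub>0 int) set) module
    \<Rightarrow> 'h list \<Rightarrow> (('k, 'h) par \<times> ('k, 'h) par \<Rightarrow>\<^sub>0 int) set"
  where "par_comult_word R H T ws = multi_legs T H (map (\<lambda>h. (h, 1)) ws)
    (\<lambda>Ls. par_word R H (map (\<lambda>L. L ! 0) Ls) \<boxtimes>\<^bsub>T\<^esub> par_word R H (map (\<lambda>L. L ! 1) Ls))"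

text \<open>
  The \<open>j\<close>-th factor of the left counit uses the legs \<open>h\<^sup>1\<^sub>j, h\<^sup>2\<^sub>j\<^sub>-\<^sub>1, \<dots>, h\<^sup>j\<^sub>1\<close>, so that \<open>h\<^sup>i\<close>
  has \<open>n - i + 1\<close> legs; that of the right counit uses \<open>h\<^sup>j\<^sub>j, \<dots>, h\<^sup>n\<^sub>j\<close>, so that \<open>h\<^sup>i\<close> has \<open>i\<close> legs.
\<close>

definition par_lcounit_word :: "'k ring \<Rightarrow> ('k, 'h) hopf_algebra \<Rightarrow> 'h list \<Rightarrow> ('k, 'h) par"
  where "par_lcounit_word R H ws = (let n = length ws in
    multi_legs (par_lbase R H) H (map (\<lambda>i. (ws ! i, n - 1 - i)) [0..<n])
     (\<lambda>Ls. list_prod (par_alg R H)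
        (map (\<lambda>j. par_eps R H (list_prod H (map (\<lambda>i. Ls ! i ! (j - i)) [0..<Suc j]))) [0..<n])))"

definition par_rcounit_word :: "'k ring \<Rightarrow> ('k, 'h) hopf_algebra \<Rightarrow> 'h list \<Rightarrow> ('k, 'h) par"
  where "par_rcounit_word R H ws = (let n = length ws in
    multi_legs (par_rbase R H) H (map (\<lambda>i. (ws ! i, i)) [0..<n])
     (\<lambda>Ls. list_prod (par_alg R H)
        (map (\<lambda>j. par_eps' R H (list_prod H (map (\<lambda>i. Ls ! i ! j) [j..<n]))) [0..<n])))"

text \<open>
  \<open>extends_words R H G \<beta> f\<close>: \<open>f\<close> is the \<open>k\<close>-linear map from \<open>par_alg R H\<close> to \<open>G\<close> with
  \<open>[h\<^sup>1]\<cdots>[h\<^sup>n] \<mapsto> \<beta> [h\<^sup>1, \<dots>, h\<^sup>n]\<close>.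
\<close>

definition extends_words ::
  "'k ring \<Rightarrow> ('k, 'h) hopf_algebra \<Rightarrow> ('k, 'g, 'z) module_scheme \<Rightarrow> ('h list \<Rightarrow> 'g)
    \<Rightarrow> (('k, 'h) par \<Rightarrow> 'g) \<Rightarrow> bool"
  where "extends_words R H G \<beta> f \<longleftrightarrow>
    f \<in> extensional (carrier (par_alg R H)) \<and> f \<in> linear_maps R (par_alg R H) G \<and>
    (\<forall>ws\<in>lists (carrier H). f (par_word R H ws) = \<beta> ws)"

definition par_extend ::
  "'k ring \<Rightarrow> ('k, 'h) hopf_algebra \<Rightarrow> ('k, 'g, 'z) module_scheme \<Rightarrow> ('h list \<Rightarrow> 'g)
    \<Rightarrow> ('k, 'h) par \<Rightarrow> 'g"
  where "par_extend R H G \<beta> = (THE f. extends_words R H G \<beta> f)"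

definition par_antip_word :: "'k ring \<Rightarrow> ('k, 'h) hopf_algebra \<Rightarrow> 'h list \<Rightarrow> ('k, 'h) par"
  where "par_antip_word R H ws = par_word R H (rev (map (antipode H) ws))"

definition par_antip'_word :: "'k ring \<Rightarrow> ('k, 'h) hopf_algebra \<Rightarrow> 'h list \<Rightarrow> ('k, 'h) par"
  where "par_antip'_word R H ws =
    par_word R H (rev (map (inv_into (carrier H) (antipode H)) ws))"

definition par_antip' :: "'k ring \<Rightarrow> ('k, 'h) hopf_algebra \<Rightarrow> ('k, 'h) par \<Rightarrow> ('k, 'h) par"
  where "par_antip' R H = par_extend R H (par_alg R H) (par_antip'_word R H)"

definition par_ltensor ::
  "'k ring \<Rightarrow> ('k, 'h) hopf_algebra \<Rightarrow> ('k, (('k, 'h) par \<times> ('k, 'h) par \<Rightarrow>\<^sub>0 int) set) module"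
  where "par_ltensor R H = left_tensor (par_alg R H) (par_lbase R H) (\<lambda>a. a) (par_antip' R H)"

definition par_rtensor ::
  "'k ring \<Rightarrow> ('k, 'h) hopf_algebra \<Rightarrow> ('k, (('k, 'h) par \<times> ('k, 'h) par \<Rightarrow>\<^sub>0 int) set) module"
  where "par_rtensor R H = right_tensor (par_alg R H) (par_rbase R H) (\<lambda>b. b) (par_antip' R H)"

definition par_algebroid ::
  "'k ring \<Rightarrow> ('k, 'h) hopf_algebra
    \<Rightarrow> ('k, ('k, 'h) par, ('k, 'h) par, ('k, 'h) par) hopf_algebroid"
  where "par_algebroid R H =
    \<lparr>total = par_alg R H, lbase = par_lbase R H, rbase = par_rbase R H,
     lsource = (\<lambda>a. a),
     ltarget = par_antip' R H,
     lcomult = par_extend R H (par_ltensor R H) (par_comult_word R H (par_ltensor R H)),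
     lcounit = par_extend R H (par_lbase R H) (par_lcounit_word R H),
     rsource = (\<lambda>b. b),
     rtarget = par_antip' R H,
     rcomult = par_extend R H (par_rtensor R H) (par_comult_word R H (par_rtensor R H)),
     rcounit = par_extend R H (par_rbase R H) (par_rcounit_word R H),
     antip = par_extend R H (par_alg R H) (par_antip_word R H)\<rparr>"

text \<open>
  The structure maps above are introduced by description; this says that the formulas on words
  do determine linear maps, and that the one for \<open>S\<^sup>-\<^sup>1\<close> is an anti-algebra map
  (for \<open>antip\<close> this is part of being a Hopf algebroid).
\<close>

definition par_maps_well_defined :: "'k ring \<Rightarrow> ('k, 'h) hopf_algebra \<Rightarrow> bool"
  where "par_maps_well_defined R H \<longleftrightarrow>
    (\<exists>!f. extends_words R H (par_alg R H) (par_antip_word R H) f) \<and>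
    (\<exists>!f. extends_words R H (par_alg R H) (par_antip'_word R H) f) \<and>
    (\<exists>!f. extends_words R H (par_ltensor R H) (par_comult_word R H (par_ltensor R H)) f) \<and>
    (\<exists>!f. extends_words R H (par_rtensor R H) (par_comult_word R H (par_rtensor R H)) f) \<and>
    (\<exists>!f. extends_words R H (par_lbase R H) (par_lcounit_word R H) f) \<and>
    (\<exists>!f. extends_words R H (par_rbase R H) (par_rcounit_word R H) f) \<and>
    par_antip' R H \<in> alg_hom R (par_alg R H) (op_alg (par_alg R H))"

definition is_par_map ::
  "'k ring \<Rightarrow> ('k, 'h) hopf_algebra \<Rightarrow> ('k, 'l) hopf_algebra \<Rightarrow> ('h \<Rightarrow> 'l)
    \<Rightarrow> (('k, 'h) par \<Rightarrow> ('k, 'l) par) \<Rightarrow> bool"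
  where "is_par_map R H L \<phi> F \<longleftrightarrow>
    F \<in> extensional (carrier (par_alg R H)) \<and> F \<in> alg_hom R (par_alg R H) (par_alg R L) \<and>
    (\<forall>h\<in>carrier H. F (par_gen R H h) = par_gen R L (\<phi> h))"

definition par_map ::
  "'k ring \<Rightarrow> ('k, 'h) hopf_algebra \<Rightarrow> ('k, 'l) hopf_algebra \<Rightarrow> ('h \<Rightarrow> 'l)
    \<Rightarrow> ('k, 'h) par \<Rightarrow> ('k, 'l) par"
  where "par_map R H L \<phi> = (THE F. is_par_map R H L \<phi> F)"

definition par_algebroid_map ::
  "'k ring \<Rightarrow> ('k, 'h) hopf_algebra \<Rightarrow> ('k, 'l) hopf_algebra \<Rightarrow> ('h \<Rightarrow> 'l)
    \<Rightarrow> (('k, 'h) par \<Rightarrow> ('k, 'l) par) \<times> (('k, 'h) par \<Rightarrow> ('k, 'l) par) \<times> (('k, 'h) par \<Rightarrow> ('k, 'l) par)"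
  where "par_algebroid_map R H L \<phi> =
    (par_map R H L \<phi>,
     restrict (par_map R H L \<phi>) (carrier (par_lbase R H)),
     restrict (par_map R H L \<phi>) (carrier (par_rbase R H)))"

end

theory Submission
 imports Defs
begin

text \<open>
 Algebra maps out of \<open>H\<^sub>p\<^sub>a\<^sub>r\<close> are partial representations of \<open>H\<close>. The exchange rule
 \<open>[h] \<epsilon>\<^sub>k = \<Sum> \<epsilon>\<^bsub>h\<^sub>1k\<^esub> [h\<^sub>2]\<close> makes \<open>h \<mapsto> [h\<^sub>1] \<otimes> [h\<^sub>2]\<close> a partial representation in the Takeuchi
 product, which gives the comultiplication; the counit of \<open>x\<close> is \<open>x\<close> acting on \<open>1 \<in> A\<close> by the adjoint
 action \<open>a \<mapsto> \<Sum> [h\<^sub>1] a [S h\<^sub>2]\<close>. As \<open>h \<mapsto> [h]\<close> is also a partial representation of \<open>H\<^sup>o\<^sup>p\<close>, whose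
 antipode is the inverse of \<open>S\<close>, in the opposite algebra, the right bialgebroid is the left one of the
 opposite data. The mixed coassociativity and antipode identities, the closed formulas for the counits and
 the compatibility with \<open>\<phi>\<^sub>p\<^sub>a\<^sub>r\<close> only have to be compared on words \<open>[h\<^sup>1] \<cdots> [h\<^sup>n]\<close>.
\<close>

section \<open>Additive and linear maps\<close>

text \<open>The formulas on words cannot be taken as definitions, since nothing shows directly that
  they respect the relations of H_par. Each structure map is first produced by a universal
  construction and only then compared with its formula. To this end \<open>partial_rep\<close>
  leaves the target algebra free: one universal property serves for the Takeuchi product
  (comultiplications), the opposite algebra (S and its inverse) and L_par (functoriality). The
  counits are not multiplicative and escape this scheme; the adjoint action behind them is formed
  with the comultiplication of the other side, so that the axiom mu(I (x) S) Delta_r = s eps_l holds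
  by construction and later yields naturality of the counits. A second obstacle is the product of
  tensors over a noncommutative base, defined on representatives: V W exists once V lies in the
  Takeuchi product, and it is handled as right multiplication of V by the pure tensors in W
  (\<open>rmul\<close>, \<open>tmul\<close>). Scalars on tensors act through the left factor, so
  moving them to the right factor passes through the base element r 1.\<close>

definition add_maps :: "('a, 'x) ring_scheme => ('b, 'y) ring_scheme => ('a => 'b) set"
 where "add_maps M N = {f \<in> carrier M \<rightarrow> carrier N.
  \<forall>x\<in>carrier M. \<forall>y\<in>carrier M. f (x \<oplus>\<^bsub>M\<^esub> y) = f x \<oplus>\<^bsub>N\<^esub> f y}"

lemma add_mapsI:
 assumes "!!x. x \<in> carrier M ==> f x \<in> carrier N"
  and "!!x y. [|x \<in> carrier M; y \<in> carrier M|] ==> f (x \<oplus>\<^bsub>M\<^esub> y) = f x \<oplus>\<^bsub>N\<^esub> f y"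
 shows "f \<in> add_maps M N"
 using assms by (auto simp: add_maps_def)

lemma add_maps_closed: "f \<in> add_maps M N ==> x \<in> carrier M ==> f x \<in> carrier N"
 and add_maps_add: "f \<in> add_maps M N ==> x \<in> carrier M ==> y \<in> carrier M
  ==> f (x \<oplus>\<^bsub>M\<^esub> y) = f x \<oplus>\<^bsub>N\<^esub> f y"
 by (auto simp: add_maps_def)

lemma add_maps_comp:
 "f \<in> add_maps M N ==> g \<in> add_maps N P ==> (%x. g (f x)) \<in> add_maps M P"
 by (auto simp: add_maps_def Pi_iff)

lemma add_maps_id: "(%x. x) \<in> add_maps M M"
 by (auto simp: add_maps_def)

lemma add_maps_zero:
 assumes "abelian_group M" "abelian_group N" "f \<in> add_maps M N"
 shows "f \<zero>\<^bsub>M\<^esub> = \<zero>\<^bsub>N\<^esub>"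
proof -
 interpret M: abelian_group M by fact
 interpret N: abelian_group N by fact
 have "f \<zero>\<^bsub>M\<^esub> \<oplus>\<^bsub>N\<^esub> f \<zero>\<^bsub>M\<^esub> = f \<zero>\<^bsub>M\<^esub>"
  using add_maps_add[OF assms(3) M.zero_closed M.zero_closed] by simp
 moreover have "f \<zero>\<^bsub>M\<^esub> \<in> carrier N" using assms(3) by (simp add: add_maps_closed)
 ultimately show ?thesis by (metis N.add.r_cancel_one')
qed

lemma linear_mapsI:
 assumes "!!x. x \<in> carrier M ==> f x \<in> carrier N"
  and "!!x y. [|x \<in> carrier M; y \<in> carrier M|] ==> f (x \<oplus>\<^bsub>M\<^esub> y) = f x \<oplus>\<^bsub>N\<^esub> f y"
  and "!!r x. [|r \<in> carrier R; x \<in> carrier M|] ==> f (r \<odot>\<^bsub>M\<^esub> x) = r \<odot>\<^bsub>N\<^esub> f x"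
 shows "f \<in> linear_maps R M N"
 using assms by (auto simp: linear_maps_def)

lemma linear_maps_closed: "f \<in> linear_maps R M N ==> x \<in> carrier M ==> f x \<in> carrier N"
 and linear_maps_add: "f \<in> linear_maps R M N ==> x \<in> carrier M ==> y \<in> carrier M
  ==> f (x \<oplus>\<^bsub>M\<^esub> y) = f x \<oplus>\<^bsub>N\<^esub> f y"
 and linear_maps_smult: "f \<in> linear_maps R M N ==> r \<in> carrier R ==> x \<in> carrier M
  ==> f (r \<odot>\<^bsub>M\<^esub> x) = r \<odot>\<^bsub>N\<^esub> f x"
 by (auto simp: linear_maps_def)

lemma linear_maps_add_maps: "f \<in> linear_maps R M N ==> f \<in> add_maps M N"
 by (auto simp: linear_maps_def add_maps_def)

lemma linear_maps_comp:
 "f \<in> linear_maps R M N ==> g \<in> linear_maps R N P ==> (%x. g (f x)) \<in> linear_maps R M P"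
 by (auto simp: linear_maps_def Pi_iff)

lemma linear_maps_id: "(%x. x) \<in> linear_maps R M M"
 by (auto simp: linear_maps_def)

lemma linear_maps_cong:
 assumes "module R M" "!!x. x \<in> carrier M ==> f x = g x"
 shows "f \<in> linear_maps R M N \<longleftrightarrow> g \<in> linear_maps R M N"
proof -
 interpret module R M by fact
 show ?thesis using assms(2) by (auto simp: linear_maps_def Pi_iff)
qed

lemma alg_homI:
 assumes "f \<in> linear_maps R M N" 
  and "!!x y. [|x \<in> carrier M; y \<in> carrier M|] ==> f (x \<otimes>\<^bsub>M\<^esub> y) = f x \<otimes>\<^bsub>N\<^esub> f y"
  and "f \<one>\<^bsub>M\<^esub> = \<one>\<^bsub>N\<^esub>"
 shows "f \<in> alg_hom R M N"
 using assms by (auto simp: alg_hom_def linear_maps_def ring_hom_def)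

lemma alg_hom_linear: "f \<in> alg_hom R M N ==> f \<in> linear_maps R M N"
 and alg_hom_mult: "f \<in> alg_hom R M N ==> x \<in> carrier M ==> y \<in> carrier M
  ==> f (x \<otimes>\<^bsub>M\<^esub> y) = f x \<otimes>\<^bsub>N\<^esub> f y"
 and alg_hom_one: "f \<in> alg_hom R M N ==> f \<one>\<^bsub>M\<^esub> = \<one>\<^bsub>N\<^esub>"
 by (auto simp: alg_hom_def ring_hom_def)

lemmas alg_hom_closed = linear_maps_closed[OF alg_hom_linear]
lemmas alg_hom_add = linear_maps_add[OF alg_hom_linear]
lemmas alg_hom_smult = linear_maps_smult[OF alg_hom_linear]

lemma alg_hom_comp:
 "f \<in> alg_hom R M N ==> g \<in> alg_hom R N P ==> (%x. g (f x)) \<in> alg_hom R M P"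
 by (intro alg_homI linear_maps_comp[of f R M N g P])
   (simp_all add: alg_hom_linear alg_hom_mult alg_hom_one alg_hom_closed)

lemma op_alg_simps [simp]:
 "carrier (op_alg M) = carrier M" "\<one>\<^bsub>op_alg M\<^esub> = \<one>\<^bsub>M\<^esub>" "\<zero>\<^bsub>op_alg M\<^esub> = \<zero>\<^bsub>M\<^esub>"
 "ring.add (op_alg M) = ring.add M" "smult (op_alg M) = smult M"
 "x \<otimes>\<^bsub>op_alg M\<^esub> y = y \<otimes>\<^bsub>M\<^esub> x" "op_alg (op_alg M) = M"
 by (simp_all add: op_alg_def)

lemma linear_maps_op_alg [simp]:
 "linear_maps R (op_alg M) N = linear_maps R M N" "linear_maps R M (op_alg N) = linear_maps R M N"
 by (simp_all add: linear_maps_def)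

lemma add_maps_op_alg [simp]:
 "add_maps (op_alg M) N = add_maps M N" "add_maps M (op_alg N) = add_maps M N"
 by (simp_all add: add_maps_def)

lemma alg_hom_op_alg: "alg_hom R (op_alg M) (op_alg N) = alg_hom R M N"
 by (auto simp: alg_hom_def linear_maps_def ring_hom_def)

lemma alg_hom_op_alg': "alg_hom R (op_alg M) N = alg_hom R M (op_alg N)"
 by (auto simp: alg_hom_def linear_maps_def ring_hom_def)

lemma finsum_op_alg [simp]: "finsum (op_alg M) = finsum M"
 by (intro ext) (simp add: finsum_def)

lemma add_pow_op_alg [simp]: "add_pow (op_alg M) = add_pow M"
 by (intro ext) (simp add: add_pow_def)

lemma tlift_op_alg [simp]: "tlift (op_alg G) = tlift G"
 by (intro ext) (simp add: tlift_def)

lemma pure_tensor_op_alg [simp]: "pure_tensor (op_alg T) = pure_tensor T"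
 by (intro ext) (simp add: pure_tensor_def)

lemma tmap_op_alg [simp]: "tmap (op_alg T) = tmap T"
 by (intro ext) (simp add: tmap_def)

lemma tassoc_op_alg [simp]: "tassoc (op_alg T) W = tassoc T W" "tassoc T (op_alg W) = tassoc T W"
 by (intro ext; simp add: tassoc_def)+

lemma abelian_group_op_alg [simp]: "abelian_group (op_alg M) = abelian_group M"
 by (simp add: abelian_group_def abelian_monoid_def abelian_group_axioms_def)

lemma ring_op_alg: "ring M ==> ring (op_alg M)"
proof -
 assume "ring M"
 then interpret ring M .
 have "monoid (op_alg M)" by (rule monoidI) (simp_all add: m_assoc)
 then show ?thesis
  using abelian_group_axioms by (intro ringI) (simp_all add: l_distr r_distr)
qed

lemma k_algebra_op_alg: "k_algebra R M ==> k_algebra R (op_alg M)"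
proof -
 assume "k_algebra R M"
 then interpret k_algebra R M .
 have "module R (op_alg M)"
  using module_axioms by (simp add: module_def module_axioms_def)
 then show ?thesis
  using ring_op_alg[OF ring_axioms] by (simp add: k_algebra_def k_algebra_axioms_def smult_mult_left smult_mult_right)
qed

lemma k_algebraI:
 assumes "module R M" "monoid M"
  and "!!x y z. [|x \<in> carrier M; y \<in> carrier M; z \<in> carrier M|]
   ==> (x \<oplus>\<^bsub>M\<^esub> y) \<otimes>\<^bsub>M\<^esub> z = x \<otimes>\<^bsub>M\<^esub> z \<oplus>\<^bsub>M\<^esub> y \<otimes>\<^bsub>M\<^esub> z"
  and "!!x y z. [|x \<in> carrier M; y \<in> carrier M; z \<in> carrier M|]
   ==> z \<otimes>\<^bsub>M\<^esub> (x \<oplus>\<^bsub>M\<^esub> y) = z \<otimes>\<^bsub>M\<^esub> x \<oplus>\<^bsub>M\<^esub> z \<otimes>\<^bsub>M\<^esub> y"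
  and "!!r x y. [|r \<in> carrier R; x \<in> carrier M; y \<in> carrier M|]
   ==> (r \<odot>\<^bsub>M\<^esub> x) \<otimes>\<^bsub>M\<^esub> y = r \<odot>\<^bsub>M\<^esub> (x \<otimes>\<^bsub>M\<^esub> y)"
  and "!!r x y. [|r \<in> carrier R; x \<in> carrier M; y \<in> carrier M|]
   ==> x \<otimes>\<^bsub>M\<^esub> (r \<odot>\<^bsub>M\<^esub> y) = r \<odot>\<^bsub>M\<^esub> (x \<otimes>\<^bsub>M\<^esub> y)"
 shows "k_algebra R M"
proof -
 interpret module R M by fact
 have "ring M" using assms by (intro ringI abelian_group_axioms) auto
 then show ?thesis using assms module_axioms by (simp add: k_algebra_def k_algebra_axioms_def)
qed

section \<open>Tensor products\<close>

lemma foldSetD_cong_on: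
 "(S, y) \<in> foldSetD D f e ==> (!!x. x \<in> S ==> f x = g x) ==> (S, y) \<in> foldSetD D g e"
proof (induction rule: foldSetD.induct)
 case (insertI x S y)
 then have "f x y = g x y" "(S, y) \<in> foldSetD D g e" "g x y \<in> D" by auto
 then show ?case using foldSetD.insertI[of x S g y D e] insertI.hyps(1) by simp
qed (auto intro: foldSetD.emptyI)

text \<open>The sum is a fold whose graph \<open>foldSetD\<close> sees \<open>f\<close> and
  \<open>g\<close> only on \<open>S\<close>, so agreement there suffices even when their values
  leave the carrier of \<open>G\<close>. This allows \<open>tlift\<close> to be rewritten before
  anything is known about the map inside it.\<close>

lemma finsum_cong_on:
 assumes "!!x. x \<in> S ==> f x = g x"
 shows "finsum G f S = finsum G g S"
proof -
 have "(S, y) \<in> foldSetD D (%x. ring.add G (f x)) e \<longleftrightarrow> (S, y) \<in> foldSetD D (%x. ring.add G (g x)) e"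
  for D e y
  using assms by (auto intro: foldSetD_cong_on)
 then show ?thesis by (simp add: finsum_def finprod_def foldD_def comp_def)
qed

definition biadditive ::
 "('m, 'x) ring_scheme => ('n, 'y) ring_scheme => ('g, 'z) ring_scheme => ('m => 'n => 'g) => bool"
 where "biadditive M N G be \<longleftrightarrow>
  (\<forall>x\<in>carrier M. be x \<in> add_maps N G) \<and> (\<forall>y\<in>carrier N. (%x. be x y) \<in> add_maps M G)"

lemma biadditiveI:
 assumes "!!x. x \<in> carrier M ==> be x \<in> add_maps N G"
  and "!!y. y \<in> carrier N ==> (%x. be x y) \<in> add_maps M G"
 shows "biadditive M N G be"
 using assms by (auto simp: biadditive_def)

locale tensor_product = left: abelian_group M + right: abelian_group N
 for M :: "('k, 'm, 'x) module_scheme" and N :: "('n, 'y) ring_scheme" and A :: "'a set"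
  and ra :: "'m => 'a => 'm" and la :: "'a => 'n => 'n" +
 assumes ra_closed: "[|x \<in> carrier M; a \<in> A|] ==> ra x a \<in> carrier M"
  and la_closed: "[|a \<in> A; y \<in> carrier N|] ==> la a y \<in> carrier N"
begin

abbreviation (input) "FA \<equiv> free_Abelian_group (carrier M \<times> carrier N)"
abbreviation (input) "rels \<equiv> tensor_rels M N A ra la"
abbreviation (input) "K \<equiv> generate FA rels"
abbreviation (input) "T \<equiv> tensor M N A ra la"

definition balanced :: "('g, 'z) ring_scheme => ('m => 'n => 'g) => bool"
 where "balanced G be \<longleftrightarrow> abelian_group G \<and> biadditive M N G be \<and>
  (\<forall>x\<in>carrier M. \<forall>a\<in>A. \<forall>y\<in>carrier N. be (ra x a) y = be x (la a y))"

lemma balancedI: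
 assumes "abelian_group G" "biadditive M N G be"
  and "!!x a y. [|x \<in> carrier M; a \<in> A; y \<in> carrier N|] ==> be (ra x a) y = be x (la a y)"
 shows "balanced G be"
 using assms by (auto simp: balanced_def)

lemma rels_subset: "rels \<subseteq> carrier FA"
 unfolding tensor_rels_def
 by (auto simp: ra_closed la_closed dest!: subsetD[OF keys_diff])

lemma FA_comm_group: "comm_group FA"
 by (rule abelian_free_Abelian_group)

lemma K_subgroup: "subgroup K FA"
 using group.generate_is_subgroup[OF group_free_Abelian_group rels_subset] .

lemma quotient_comm_group: "comm_group (FA Mod K)"
 using comm_group.abelian_FactGroup[OF FA_comm_group K_subgroup] .

lemma K_normal: "K \<lhd> FA"
 using comm_group.subgroup_imp_normal[OF FA_comm_group K_subgroup] .

lemma tensor_simps: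
 "carrier T = rcosets\<^bsub>FA\<^esub> K" "\<zero>\<^bsub>T\<^esub> = K" "ring.add T = set_mult FA"
 by (simp_all add: tensor_def Let_def)

lemma tensor_abelian_group: "abelian_group T"
proof -
 interpret Q: comm_group "FA Mod K" by (rule quotient_comm_group)
 show ?thesis
  using Q.m_closed Q.one_closed Q.m_assoc Q.m_comm Q.l_one Q.l_inv_ex
  by (intro abelian_groupI) (simp_all add: tensor_simps FactGroup_def)
qed

lemma coset_in_carrier: "c \<in> carrier FA ==> K #>\<^bsub>FA\<^esub> c \<in> carrier T"
 by (auto simp: tensor_simps RCOSETS_def)

lemma carrier_cosetE:
 assumes "V \<in> carrier T"
 obtains c where "c \<in> carrier FA" "V = K #>\<^bsub>FA\<^esub> c"
 using assms by (auto simp: tensor_simps RCOSETS_def)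

lemma coset_add:
 "c \<in> carrier FA ==> d \<in> carrier FA ==>
  (K #>\<^bsub>FA\<^esub> c) \<oplus>\<^bsub>T\<^esub> (K #>\<^bsub>FA\<^esub> d) = K #>\<^bsub>FA\<^esub> (c + d)"
 using normal.rcos_sum[OF K_normal, of c d] by (simp add: tensor_simps)

lemma pure_tensor_coset: "x \<boxtimes>\<^bsub>T\<^esub> y = K #>\<^bsub>FA\<^esub> frag_of (x, y)"
 by (auto simp: pure_tensor_def tensor_simps r_coset_def)

lemma tensor_one: "monoid.one T = \<one>\<^bsub>M\<^esub> \<boxtimes>\<^bsub>T\<^esub> \<one>\<^bsub>N\<^esub>"
 by (simp only: pure_tensor_coset) (simp add: tensor_def Let_def)

lemma pure_closed: "x \<in> carrier M ==> y \<in> carrier N ==> x \<boxtimes>\<^bsub>T\<^esub> y \<in> carrier T"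
 unfolding pure_tensor_coset by (rule coset_in_carrier) simp

lemma coset_eq_iff:
 assumes "c \<in> carrier FA" "d \<in> carrier FA" "c - d \<in> K"
 shows "K #>\<^bsub>FA\<^esub> c = K #>\<^bsub>FA\<^esub> d"
proof -
 interpret group FA by simp
 have "c \<in> K #>\<^bsub>FA\<^esub> d"
  unfolding r_coset_def using assms by (auto intro!: bexI[of _ "c - d"])
 then show ?thesis using repr_independence[OF _ assms(2) K_subgroup] by simp
qed

lemma coset_eq_of_rel:
 assumes "c \<in> carrier FA" "d \<in> carrier FA" "c - d \<in> rels"
 shows "K #>\<^bsub>FA\<^esub> c = K #>\<^bsub>FA\<^esub> d"
 using assms by (intro coset_eq_iff) (auto intro: generate.incl)

lemma pure_add_left:
 assumes "x \<in> carrier M" "x' \<in> carrier M" "y \<in> carrier N"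
 shows "(x \<oplus>\<^bsub>M\<^esub> x') \<boxtimes>\<^bsub>T\<^esub> y = x \<boxtimes>\<^bsub>T\<^esub> y \<oplus>\<^bsub>T\<^esub> x' \<boxtimes>\<^bsub>T\<^esub> y"
proof -
 have "frag_of (x, y) + frag_of (x', y) \<in> carrier FA"
  using assms by (auto dest!: subsetD[OF keys_add])
 moreover have "frag_of (x \<oplus>\<^bsub>M\<^esub> x', y) - (frag_of (x, y) + frag_of (x', y)) \<in> rels"
  using assms unfolding tensor_rels_def by (auto simp: diff_diff_eq)
 ultimately have "K #>\<^bsub>FA\<^esub> frag_of (x \<oplus>\<^bsub>M\<^esub> x', y) = K #>\<^bsub>FA\<^esub> (frag_of (x, y) + frag_of (x', y))"
  using assms by (intro coset_eq_of_rel) simp_all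
 also have "... = (K #>\<^bsub>FA\<^esub> frag_of (x, y)) \<oplus>\<^bsub>T\<^esub> (K #>\<^bsub>FA\<^esub> frag_of (x', y))"
  using assms by (intro coset_add[symmetric]) simp_all
 finally show ?thesis unfolding pure_tensor_coset .
qed

lemma pure_add_right:
 assumes "x \<in> carrier M" "y \<in> carrier N" "y' \<in> carrier N"
 shows "x \<boxtimes>\<^bsub>T\<^esub> (y \<oplus>\<^bsub>N\<^esub> y') = x \<boxtimes>\<^bsub>T\<^esub> y \<oplus>\<^bsub>T\<^esub> x \<boxtimes>\<^bsub>T\<^esub> y'"
proof -
 have "frag_of (x, y) + frag_of (x, y') \<in> carrier FA"
  using assms by (auto dest!: subsetD[OF keys_add])
 moreover have "frag_of (x, y \<oplus>\<^bsub>N\<^esub> y') - (frag_of (x, y) + frag_of (x, y')) \<in> rels"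
  using assms unfolding tensor_rels_def by (auto simp: diff_diff_eq)
 ultimately have "K #>\<^bsub>FA\<^esub> frag_of (x, y \<oplus>\<^bsub>N\<^esub> y') = K #>\<^bsub>FA\<^esub> (frag_of (x, y) + frag_of (x, y'))"
  using assms by (intro coset_eq_of_rel) simp_all
 also have "... = (K #>\<^bsub>FA\<^esub> frag_of (x, y)) \<oplus>\<^bsub>T\<^esub> (K #>\<^bsub>FA\<^esub> frag_of (x, y'))"
  using assms by (intro coset_add[symmetric]) simp_all
 finally show ?thesis unfolding pure_tensor_coset .
qed

lemma pure_balanced:
 assumes "x \<in> carrier M" "a \<in> A" "y \<in> carrier N"
 shows "ra x a \<boxtimes>\<^bsub>T\<^esub> y = x \<boxtimes>\<^bsub>T\<^esub> la a y"
 using assms unfolding pure_tensor_coset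
 by (intro coset_eq_of_rel) (auto simp: tensor_rels_def ra_closed la_closed)

lemma pure_left_add_maps: "y \<in> carrier N ==> (%x. x \<boxtimes>\<^bsub>T\<^esub> y) \<in> add_maps M T"
 by (intro add_mapsI) (simp_all add: pure_closed pure_add_left)

lemma pure_right_add_maps: "x \<in> carrier M ==> (%y. x \<boxtimes>\<^bsub>T\<^esub> y) \<in> add_maps N T"
 by (intro add_mapsI) (simp_all add: pure_closed pure_add_right)

text \<open>An element is represented by an integer combination of generators, and the negative of a
  generator is again a pure tensor, (-x) (x) y. Hence sums of pure tensors exhaust the tensor
  product.\<close>

lemma tensor_induct [consumes 1, case_names zero pure add]:
 assumes "V \<in> carrier T"
  and zero: "P \<zero>\<^bsub>T\<^esub>"
  and pure: "!!x y. [|x \<in> carrier M; y \<in> carrier N|] ==> P (x \<boxtimes>\<^bsub>T\<^esub> y)"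
  and add: "!!V W. [|V \<in> carrier T; W \<in> carrier T; P V; P W|] ==> P (V \<oplus>\<^bsub>T\<^esub> W)"
 shows "P V"
proof -
 interpret T: abelian_group T by (rule tensor_abelian_group)
 obtain c where c: "c \<in> carrier FA" "V = K #>\<^bsub>FA\<^esub> c" using assms(1) by (rule carrier_cosetE)
 have K0: "K #>\<^bsub>FA\<^esub> 0 = \<zero>\<^bsub>T\<^esub>" by (auto simp: tensor_simps r_coset_def)
 \<comment> \<open>Induction on a free abelian group proceeds by differences, so the claim is
   carried for \<open>c\<close> and \<open>- c\<close> at once.\<close>
 have "P (K #>\<^bsub>FA\<^esub> c) \<and> P (K #>\<^bsub>FA\<^esub> (- c))"
 proof (rule free_Abelian_group_induct[of c "carrier M \<times> carrier N"])
  show "Poly_Mapping.keys c \<subseteq> carrier M \<times> carrier N" using c(1) by simp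
  show "P (K #>\<^bsub>FA\<^esub> 0) \<and> P (K #>\<^bsub>FA\<^esub> (- 0))" using zero K0 by simp
 next
  fix x y :: "'m \<times> 'n \<Rightarrow>\<^sub>0 int"
  assume *: "Poly_Mapping.keys x \<subseteq> carrier M \<times> carrier N" "Poly_Mapping.keys y \<subseteq> carrier M \<times> carrier N"
   "P (K #>\<^bsub>FA\<^esub> x) \<and> P (K #>\<^bsub>FA\<^esub> (- x))" "P (K #>\<^bsub>FA\<^esub> y) \<and> P (K #>\<^bsub>FA\<^esub> (- y))"
  have "K #>\<^bsub>FA\<^esub> (x + - y) = (K #>\<^bsub>FA\<^esub> x) \<oplus>\<^bsub>T\<^esub> (K #>\<^bsub>FA\<^esub> (- y))"
   "K #>\<^bsub>FA\<^esub> (- x + y) = (K #>\<^bsub>FA\<^esub> (- x)) \<oplus>\<^bsub>T\<^esub> (K #>\<^bsub>FA\<^esub> y)"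
   using * by (subst coset_add; simp)+
  moreover have "K #>\<^bsub>FA\<^esub> x \<in> carrier T" "K #>\<^bsub>FA\<^esub> y \<in> carrier T" "K #>\<^bsub>FA\<^esub> (- x) \<in> carrier T"
   "K #>\<^bsub>FA\<^esub> (- y) \<in> carrier T"
   using * by (auto intro!: coset_in_carrier)
  moreover have "x - y = x + - y" "- (x - y) = - x + y" by auto
  ultimately show "P (K #>\<^bsub>FA\<^esub> (x - y)) \<and> P (K #>\<^bsub>FA\<^esub> (- (x - y)))"
   using * add by metis
 next
  fix a assume "a \<in> carrier M \<times> carrier N"
  then obtain x y where a: "a = (x, y)" "x \<in> carrier M" "y \<in> carrier N" by auto
  have "\<zero>\<^bsub>M\<^esub> \<boxtimes>\<^bsub>T\<^esub> y = \<zero>\<^bsub>T\<^esub>"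
   using add_maps_zero[OF left.abelian_group_axioms tensor_abelian_group pure_left_add_maps] a by simp
  then have "(\<ominus>\<^bsub>M\<^esub> x) \<boxtimes>\<^bsub>T\<^esub> y \<oplus>\<^bsub>T\<^esub> x \<boxtimes>\<^bsub>T\<^esub> y = \<zero>\<^bsub>T\<^esub>"
   using a pure_add_left[of "\<ominus>\<^bsub>M\<^esub> x" x y] by (simp add: left.l_neg)
  moreover have "(K #>\<^bsub>FA\<^esub> (- frag_of a)) \<oplus>\<^bsub>T\<^esub> (K #>\<^bsub>FA\<^esub> frag_of a) = \<zero>\<^bsub>T\<^esub>"
   using a by (subst coset_add) (auto simp: K0)
  moreover have "K #>\<^bsub>FA\<^esub> frag_of a = x \<boxtimes>\<^bsub>T\<^esub> y" by (simp only: a pure_tensor_coset)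
  moreover have "K #>\<^bsub>FA\<^esub> (- frag_of a) \<in> carrier T" using a by (intro coset_in_carrier) simp
  ultimately have "K #>\<^bsub>FA\<^esub> (- frag_of a) = (\<ominus>\<^bsub>M\<^esub> x) \<boxtimes>\<^bsub>T\<^esub> y"
   using a by (metis T.add.inv_equality left.a_inv_closed pure_closed)
  then show "P (K #>\<^bsub>FA\<^esub> frag_of a) \<and> P (K #>\<^bsub>FA\<^esub> (- frag_of a))"
   using pure a \<open>K #>\<^bsub>FA\<^esub> frag_of a = x \<boxtimes>\<^bsub>T\<^esub> y\<close> by simp
 qed
 then show ?thesis using c(2) by simp
qed

lemma tensor_map_eqI:
 assumes "V \<in> carrier T" "abelian_group G" "f \<in> add_maps T G" "g \<in> add_maps T G"
  and "!!x y. [|x \<in> carrier M; y \<in> carrier N|] ==> f (x \<boxtimes>\<^bsub>T\<^esub> y) = g (x \<boxtimes>\<^bsub>T\<^esub> y)"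
 shows "f V = g V"
 using assms(1)
proof (induction rule: tensor_induct)
 case zero
 then show ?case
  by (simp add: add_maps_zero[OF tensor_abelian_group assms(2) assms(3)]
    add_maps_zero[OF tensor_abelian_group assms(2) assms(4)])
qed (simp_all add: assms(5) add_maps_add[OF assms(3)] add_maps_add[OF assms(4)])

text \<open>The sum that \<open>tlift\<close> forms on a single representative; it is the
  homomorphism on the free abelian group that has to be shown constant on cosets of
  \<open>K\<close>.\<close>

definition frag_lift :: "('g, 'z) ring_scheme => ('m => 'n => 'g) => ('m \<times> 'n \<Rightarrow>\<^sub>0 int) => 'g"
 where "frag_lift G be c =
  (\<Oplus>\<^bsub>G\<^esub>p\<in>Poly_Mapping.keys c. add_pow G (Poly_Mapping.lookup c p) (be (fst p) (snd p)))"

lemma frag_lift_hom: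
 assumes "abelian_group G" "!!x y. [|x \<in> carrier M; y \<in> carrier N|] ==> be x y \<in> carrier G"
 shows "frag_lift G be \<in> hom FA (add_monoid G)"
proof -
 interpret G: abelian_group G by fact
 have term_closed: "add_pow G (Poly_Mapping.lookup c p) (be (fst p) (snd p)) \<in> carrier G"
  if "p \<in> carrier M \<times> carrier N" for c :: "'m \<times> 'n \<Rightarrow>\<^sub>0 int" and p
  using that assms(2) group.int_pow_closed[OF G.a_group, of "be (fst p) (snd p)"]
  by (auto simp: add_pow_def)
 have extend: "frag_lift G be c =
   (\<Oplus>\<^bsub>G\<^esub>p\<in>S. add_pow G (Poly_Mapping.lookup c p) (be (fst p) (snd p)))"
  if "finite S" "Poly_Mapping.keys c \<subseteq> S" "S \<subseteq> carrier M \<times> carrier N" for S c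
  unfolding frag_lift_def
 proof (rule G.add.finprod_mono_neutral_cong_left[OF that(1,2)])
  fix p assume p: "p \<in> S - Poly_Mapping.keys c"
  then have "Poly_Mapping.lookup c p = 0" by (simp add: in_keys_iff)
  then show "add_pow G (Poly_Mapping.lookup c p) (be (fst p) (snd p)) = \<zero>\<^bsub>G\<^esub>"
   by (simp add: add_pow_def)
 qed (use that(3) term_closed in "auto simp del: G.add.int_pow_closed")
 show ?thesis
 proof (rule homI)
  fix c assume "c \<in> carrier FA"
  then show "frag_lift G be c \<in> carrier (add_monoid G)"
   unfolding frag_lift_def using term_closed by (auto intro!: G.finsum_closed)
 next
  fix c d assume cd: "c \<in> carrier FA" "d \<in> carrier FA"
  let ?S = "Poly_Mapping.keys c \<union> Poly_Mapping.keys d"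
  have S: "finite ?S" "?S \<subseteq> carrier M \<times> carrier N" using cd by auto
  have b: "be (fst p) (snd p) \<in> carrier G" if "p \<in> ?S" for p
   using subsetD[OF S(2) that] assms(2) by (auto simp: mem_Times_iff)
  have "frag_lift G be (c + d) =
    (\<Oplus>\<^bsub>G\<^esub>p\<in>?S. add_pow G (Poly_Mapping.lookup (c + d) p) (be (fst p) (snd p)))"
   using S keys_add[of c d] by (intro extend) auto
  also have "... = (\<Oplus>\<^bsub>G\<^esub>p\<in>?S. add_pow G (Poly_Mapping.lookup c p) (be (fst p) (snd p)) \<oplus>\<^bsub>G\<^esub>
    add_pow G (Poly_Mapping.lookup d p) (be (fst p) (snd p)))"
   using b by (intro G.finsum_cong') (auto simp: lookup_add G.add.int_pow_mult)
  also have "... = frag_lift G be c \<oplus>\<^bsub>G\<^esub> frag_lift G be d"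
   using b S by (subst G.finsum_addf) (auto simp: extend[of ?S])
  finally show "frag_lift G be (c \<otimes>\<^bsub>FA\<^esub> d) = frag_lift G be c \<otimes>\<^bsub>add_monoid G\<^esub> frag_lift G be d"
   by simp
 qed
qed

lemma frag_lift_of:
 assumes "abelian_group G" "be x y \<in> carrier G"
 shows "frag_lift G be (frag_of (x, y)) = be x y"
proof -
 interpret G: abelian_group G by fact
 show ?thesis using assms(2) by (simp add: frag_lift_def)
qed

text \<open>The three families of relations are exactly additivity in either variable and balancing,
  so a balanced map sends each of them to zero; the kernel is a subgroup and therefore contains all
  of \<open>K\<close>.\<close>

lemma frag_lift_K:
 assumes "balanced G be" "c \<in> K"
 shows "frag_lift G be c = \<zero>\<^bsub>G\<^esub>"
proof -
 interpret G: abelian_group G using assms(1) by (simp add: balanced_def)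
 have biadd: "biadditive M N G be" using assms(1) by (simp add: balanced_def)
 have cl: "be x y \<in> carrier G" if "x \<in> carrier M" "y \<in> carrier N" for x y
  using biadd that by (auto simp: biadditive_def add_maps_def)
 interpret h: group_hom FA "add_monoid G" "frag_lift G be"
  by (intro group_hom.intro group_hom_axioms.intro frag_lift_hom cl G.a_group) (auto intro: G.abelian_group_axioms)
 have diff: "frag_lift G be (c - d) = frag_lift G be c \<ominus>\<^bsub>G\<^esub> frag_lift G be d"
  if "c \<in> carrier FA" "d \<in> carrier FA" for c d
  using h.hom_mult[of c "- d"] h.hom_inv[of d] that by (simp add: a_minus_def a_inv_def)
 have "rels \<subseteq> kernel FA (add_monoid G) (frag_lift G be)"
 proof
  fix c assume c: "c \<in> rels"
  note [simp] = diff frag_lift_of[OF G.abelian_group_axioms] cl ra_closed la_closed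
  have cancel: "(u \<oplus>\<^bsub>G\<^esub> v) \<ominus>\<^bsub>G\<^esub> u \<ominus>\<^bsub>G\<^esub> v = \<zero>\<^bsub>G\<^esub>" if "u \<in> carrier G" "v \<in> carrier G" for u v
   using that G.a_comm[of u v] by (simp add: a_minus_def G.a_assoc G.r_neg)
  have kd: "Poly_Mapping.keys (frag_of p - frag_of q) \<subseteq> carrier M \<times> carrier N"
   if "p \<in> carrier M \<times> carrier N" "q \<in> carrier M \<times> carrier N" for p q
   using that by (auto dest!: subsetD[OF keys_diff])
  have "frag_lift G be c = \<zero>\<^bsub>G\<^esub>"
   using c biadd assms(1) unfolding tensor_rels_def
  proof (elim UnE, goal_cases)
   case 1
   then obtain x x' y where p: "c = frag_of (x \<oplus>\<^bsub>M\<^esub> x', y) - frag_of (x, y) - frag_of (x', y)"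
    "x \<in> carrier M" "x' \<in> carrier M" "y \<in> carrier N" by auto
   have "be (x \<oplus>\<^bsub>M\<^esub> x') y = be x y \<oplus>\<^bsub>G\<^esub> be x' y"
    using biadd p by (auto simp: biadditive_def add_maps_def)
   then show ?case using p
    by (simp add: kd cancel)
  next
   case 2
   then obtain x y y' where p: "c = frag_of (x, y \<oplus>\<^bsub>N\<^esub> y') - frag_of (x, y) - frag_of (x, y')"
    "x \<in> carrier M" "y \<in> carrier N" "y' \<in> carrier N" by auto
   have "be x (y \<oplus>\<^bsub>N\<^esub> y') = be x y \<oplus>\<^bsub>G\<^esub> be x y'"
    using biadd p by (auto simp: biadditive_def add_maps_def)
   then show ?case using p
    by (simp add: kd cancel)
  next
   case 3
   then obtain x a y where p: "c = frag_of (ra x a, y) - frag_of (x, la a y)"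
    "x \<in> carrier M" "a \<in> A" "y \<in> carrier N" by auto
   have "be (ra x a) y = be x (la a y)"
    using assms(1) p by (auto simp: balanced_def)
   then show ?case using p by (simp add: a_minus_def G.r_neg)
  qed
  then show "c \<in> kernel FA (add_monoid G) (frag_lift G be)"
   using subsetD[OF rels_subset c] by (simp add: kernel_def)
 qed
 then have "K \<subseteq> kernel FA (add_monoid G) (frag_lift G be)"
  by (rule group.generate_subgroup_incl[OF group_free_Abelian_group _ h.subgroup_kernel])
 then show ?thesis using assms(2) by (auto simp: kernel_def)
qed

lemma balanced_closed:
 "balanced G be ==> x \<in> carrier M ==> y \<in> carrier N ==> be x y \<in> carrier G"
 by (auto simp: balanced_def biadditive_def add_maps_def)

lemma tlift_coset:
 assumes "balanced G be" "c \<in> carrier FA"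
 shows "tlift G be (K #>\<^bsub>FA\<^esub> c) = frag_lift G be c"
proof -
 interpret G: abelian_group G using assms(1) by (simp add: balanced_def)
 have hom: "frag_lift G be \<in> hom FA (add_monoid G)"
  by (rule frag_lift_hom[OF G.abelian_group_axioms balanced_closed[OF assms(1)]])
 have "frag_lift G be (k + c) = frag_lift G be c" if k: "k \<in> K" for k
 proof -
  have "k \<in> carrier FA" using k subgroup.mem_carrier[OF K_subgroup] by simp
  then show ?thesis
   using hom_mult[OF hom, of k c] frag_lift_K[OF assms(1) k] assms(2) hom_in_carrier[OF hom assms(2)]
   by simp
 qed
 moreover have "0 \<in> K" using subgroup.one_closed[OF K_subgroup] by simp
 ultimately have "frag_lift G be ` (K #>\<^bsub>FA\<^esub> c) = {frag_lift G be c}"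
  by (fastforce simp: r_coset_def)
 then show ?thesis by (simp add: tlift_def frag_lift_def[abs_def])
qed

lemma tlift_pure [simp]:
 assumes "balanced G be" "x \<in> carrier M" "y \<in> carrier N"
 shows "tlift G be (x \<boxtimes>\<^bsub>T\<^esub> y) = be x y"
 using assms unfolding pure_tensor_coset
 by (subst tlift_coset) (auto intro!: frag_lift_of balanced_closed simp: balanced_def)

lemma tlift_add_maps:
 assumes "balanced G be"
 shows "tlift G be \<in> add_maps T G"
proof -
 interpret G: abelian_group G using assms(1) by (simp add: balanced_def)
 have hom: "frag_lift G be \<in> hom FA (add_monoid G)"
  by (rule frag_lift_hom[OF G.abelian_group_axioms balanced_closed[OF assms(1)]])
 show ?thesis
 proof (rule add_mapsI)
  fix V assume "V \<in> carrier T"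
  then show "tlift G be V \<in> carrier G"
   using hom_in_carrier[OF hom] by (elim carrier_cosetE) (simp add: tlift_coset[OF assms])
 next
  fix V W assume "V \<in> carrier T" "W \<in> carrier T"
  then obtain c d where *: "c \<in> carrier FA" "V = K #>\<^bsub>FA\<^esub> c" "d \<in> carrier FA" "W = K #>\<^bsub>FA\<^esub> d"
   by (elim carrier_cosetE)
  have "c + d \<in> carrier FA" using * by (auto dest!: subsetD[OF keys_add])
  then show "tlift G be (V \<oplus>\<^bsub>T\<^esub> W) = tlift G be V \<oplus>\<^bsub>G\<^esub> tlift G be W"
   using * hom_mult[OF hom, of c d] by (simp add: coset_add tlift_coset[OF assms] del: carrier_free_Abelian_group_iff)
 qed
qed

lemmas tlift_closed = add_maps_closed[OF tlift_add_maps]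
lemmas tlift_add = add_maps_add[OF tlift_add_maps]

text \<open>Every representative of an element of \<open>T\<close> is supported on pairs from the
  two carriers, so only the values there enter the sum, representative by representative. The
  argument does not pass through balancedness.\<close>

lemma tlift_cong:
 assumes "V \<in> carrier T" "!!x y. [|x \<in> carrier M; y \<in> carrier N|] ==> be x y = ga x y"
 shows "tlift G be V = tlift G ga V"
proof -
 obtain c where c: "c \<in> carrier FA" "V = K #>\<^bsub>FA\<^esub> c" using assms(1) by (rule carrier_cosetE)
 have "frag_lift G be d = frag_lift G ga d" if "d \<in> V" for d
 proof -
  have "d \<in> carrier FA"
   using that c subgroup.mem_carrier[OF K_subgroup] by (auto simp: r_coset_def dest!: subsetD[OF keys_add])
  then have *: "fst p \<in> carrier M" "snd p \<in> carrier N" if "p \<in> Poly_Mapping.keys d" for p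
   using that by auto
  show ?thesis
   unfolding frag_lift_def using * assms(2) by (intro finsum_cong_on) auto
 qed
 then have "frag_lift G be ` V = frag_lift G ga ` V" by auto
 then show ?thesis by (simp add: tlift_def frag_lift_def[abs_def])
qed

lemma tlift_comp:
 assumes "balanced G be" "abelian_group G'" "f \<in> add_maps G G'" "V \<in> carrier T"
 shows "f (tlift G be V) = tlift G' (%x y. f (be x y)) V"
proof -
 have b: "balanced G' (%x y. f (be x y))"
  using assms(1-3) by (auto simp: balanced_def biadditive_def intro: add_maps_comp)
 show ?thesis
  by (rule tensor_map_eqI[where f="%V. f (tlift G be V)" and g="tlift G' (%x y. f (be x y))", OF assms(4,2) add_maps_comp[OF tlift_add_maps[OF assms(1)] assms(3)] tlift_add_maps[OF b]])
   (simp add: assms(1) b)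
qed

text \<open>\<open>be\<close> inherits its balancedness from the additive map \<open>f\<close>,
  which already lives on the tensor product. This identifies a lift with a known map without
  checking balancedness separately.\<close>

lemma tlift_comp':
 assumes "!!x y. [|x \<in> carrier M; y \<in> carrier N|] ==> f (x \<boxtimes>\<^bsub>T\<^esub> y) = be x y"
  and "abelian_group G" "f \<in> add_maps T G" "V \<in> carrier T"
 shows "tlift G be V = f V"
proof -
 have pb: "balanced T (%x y. x \<boxtimes>\<^bsub>T\<^esub> y)"
  by (intro balancedI biadditiveI tensor_abelian_group pure_left_add_maps pure_right_add_maps pure_balanced)
 have "balanced G (%x y. f (x \<boxtimes>\<^bsub>T\<^esub> y))"
  using assms(2,3) pb by (auto simp: balanced_def biadditive_def intro: add_maps_comp)
 then have b: "balanced G be"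
  using assms(1) by (auto simp: balanced_def biadditive_def add_maps_def Pi_iff ra_closed la_closed)
 show ?thesis
  by (rule tensor_map_eqI[OF assms(4,2) tlift_add_maps[OF b] assms(3)]) (simp add: b assms(1))
qed

end

section \<open>Tensor products, corings and bialgebroids of opposite algebras\<close>

lemma frag_extend_swap:
 "frag_extend (%p. frag_extend (%q. f p q) d) c = frag_extend (%q. frag_extend (%p. f p q) c) d"
 by (simp add: frag_extend_def frag_cmul_sum sum.swap[of _ "Poly_Mapping.keys d"] mult.commute)

text \<open>The underlying group and its relations do not involve the products of the factors. Only
  the double sum that multiplies representatives changes, and exchanging the two summations turns it
  into the reversed product. The result is an equality of records, so statements about opposites
  transfer by rewriting.\<close>

lemma tensor_op_alg: "tensor (op_alg M) (op_alg N) A ra la = op_alg (tensor M N A ra la)"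
proof -
 have rels: "tensor_rels (op_alg M) (op_alg N) A ra la = tensor_rels M N A ra la"
  by (simp add: tensor_rels_def)
 have swap: "frag_extend (%(x, y). frag_extend (%(x', y'). frag_of (x' \<otimes>\<^bsub>M\<^esub> x, y' \<otimes>\<^bsub>N\<^esub> y)) d) c
   = frag_extend (%(x, y). frag_extend (%(x', y'). frag_of (x \<otimes>\<^bsub>M\<^esub> x', y \<otimes>\<^bsub>N\<^esub> y')) c) d" for c d
  using frag_extend_swap[of "%p q. frag_of (fst q \<otimes>\<^bsub>M\<^esub> fst p, snd q \<otimes>\<^bsub>N\<^esub> snd p)" d c]
  by (simp add: case_prod_beta')
 have comm: "{f c d | c d. P c \<and> Q d} = {f c d | d c. Q d \<and> P c}" for f :: "'x => 'y => 'z" and P Q by blast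
 show ?thesis
  unfolding tensor_def Let_def rels op_alg_simps swap
  by (simp add: op_alg_def) (intro ext arg_cong[where f = the_elem] comm)
qed

lemma tensor_square_op_alg: "tensor_square A (op_alg C) la ra = op_alg (tensor_square A C la ra)"
 by (simp add: tensor_square_def tensor_op_alg)

lemma tensor_cube_op_alg:
 "tensor_cube_left A (op_alg C) la ra = op_alg (tensor_cube_left A C la ra)"
 "tensor_cube_right A (op_alg C) la ra = op_alg (tensor_cube_right A C la ra)"
 by (simp_all add: tensor_cube_left_def tensor_cube_right_def tensor_square_op_alg tensor_op_alg)

lemma bimodule_op_alg: "bimodule A (op_alg C) la ra = bimodule A C la ra"
 by (simp add: bimodule_def bimodule_axioms_def)

lemma coring_op_alg: "coring A (op_alg C) la ra \<Delta> \<epsilon> = coring A C la ra \<Delta> \<epsilon>"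
 by (simp add: coring_def coring_axioms_def bimodule_op_alg tensor_square_op_alg tensor_cube_op_alg)

lemma left_tensor_op_alg: "left_tensor (op_alg B) A t s = op_alg (right_tensor B A s t)"
 by (simp add: left_tensor_def right_tensor_def tensor_square_op_alg)

lemma left_takeuchi_op_alg: "left_takeuchi (op_alg B) A t s = op_alg (right_takeuchi B A s t)"
 by (simp add: left_takeuchi_def right_takeuchi_def Let_def left_tensor_op_alg) (simp add: op_alg_def)

text \<open>Right multiplication in \<open>B\<close> is left multiplication in the opposite algebra,
  so the right bialgebroid axioms are literally the left ones for \<open>op_alg B\<close> with
  source and target exchanged.\<close>

lemma right_bialgebroid_op:
 assumes "k_algebra R B" "left_bialgebroid R (op_alg B) A t s \<Delta> \<epsilon>"
 shows "right_bialgebroid R B A s t \<Delta> \<epsilon>"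
proof -
 interpret l: left_bialgebroid R "op_alg B" A t s \<Delta> \<epsilon> by fact
 have "coring A (op_alg B) (%a h. h \<otimes>\<^bsub>B\<^esub> t a) (%h a. h \<otimes>\<^bsub>B\<^esub> s a) \<Delta> \<epsilon>"
  using l.coring.coring_axioms by simp
 then have "coring A B (%a h. h \<otimes>\<^bsub>B\<^esub> t a) (%h a. h \<otimes>\<^bsub>B\<^esub> s a) \<Delta> \<epsilon>"
  by (simp add: coring_op_alg)
 moreover have "\<Delta> \<in> alg_hom R B (right_takeuchi B A s t)"
  using l.comult_takeuchi by (simp add: left_takeuchi_op_alg alg_hom_op_alg)
 ultimately show ?thesis
  using assms(1) l.base.k_algebra_axioms l.target_antihom l.source_hom l.source_target_commute
   l.counit_target l.counit_source
  by (simp add: right_bialgebroid_def right_bialgebroid_axioms_def)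
qed

section \<open>Operations on representatives as additive lifts\<close>

context tensor_product begin

text \<open>The product and the scalar action of \<open>tensor\<close> extend a map on generators to
  representatives and then project to cosets. This recognises such an expression as the lift of the
  projected map, which is how both operations become instances of \<open>tlift\<close>.\<close>

lemma coset_frag_extend:
 assumes "!!x y. [|x \<in> carrier M; y \<in> carrier N|] ==> g (x, y) \<in> carrier FA" "c \<in> carrier FA"
 shows "K #>\<^bsub>FA\<^esub> frag_extend g c = frag_lift T (%x y. K #>\<^bsub>FA\<^esub> g (x, y)) c"
  and "frag_extend g c \<in> carrier FA"
proof -
 interpret T: abelian_group T by (rule tensor_abelian_group)
 have hom: "frag_lift T (%x y. K #>\<^bsub>FA\<^esub> g (x, y)) \<in> hom FA (add_monoid T)"
  by (intro frag_lift_hom tensor_abelian_group coset_in_carrier assms(1))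
 have ext: "frag_extend g d \<in> carrier FA" if "d \<in> carrier FA" for d
 proof -
  have "Poly_Mapping.keys (g p) \<subseteq> carrier M \<times> carrier N" if "p \<in> Poly_Mapping.keys d" for p
  proof -
   have "p \<in> carrier M \<times> carrier N" using that \<open>d \<in> carrier FA\<close> by auto
   then show ?thesis using assms(1) by (cases p) simp
  qed
  then show ?thesis using order_trans[OF keys_frag_extend[of g d] UN_least] by simp
 qed
 then show "frag_extend g c \<in> carrier FA" using assms(2) by blast
 have coset_hom: "(%d. K #>\<^bsub>FA\<^esub> frag_extend g d) \<in> hom FA (add_monoid T)"
 proof (rule homI)
  fix d e assume "d \<in> carrier FA" "e \<in> carrier FA"
  then show "K #>\<^bsub>FA\<^esub> frag_extend g (d \<otimes>\<^bsub>FA\<^esub> e)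
    = (K #>\<^bsub>FA\<^esub> frag_extend g d) \<otimes>\<^bsub>add_monoid T\<^esub> (K #>\<^bsub>FA\<^esub> frag_extend g e)"
   using coset_add[OF ext ext, of d e] by (simp add: frag_extend_add)
 qed (simp add: coset_in_carrier[OF ext] del: carrier_free_Abelian_group_iff)
 interpret h: group_hom FA "add_monoid T" "frag_lift T (%x y. K #>\<^bsub>FA\<^esub> g (x, y))"
  by (intro group_hom.intro group_hom_axioms.intro hom T.a_group) simp
 interpret k: group_hom FA "add_monoid T" "%d. K #>\<^bsub>FA\<^esub> frag_extend g d"
  by (intro group_hom.intro group_hom_axioms.intro coset_hom T.a_group) simp
 show "K #>\<^bsub>FA\<^esub> frag_extend g c = frag_lift T (%x y. K #>\<^bsub>FA\<^esub> g (x, y)) c"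
 proof (rule free_Abelian_group_induct[of c "carrier M \<times> carrier N"])
  show "Poly_Mapping.keys c \<subseteq> carrier M \<times> carrier N" using assms(2) by simp
  show "K #>\<^bsub>FA\<^esub> frag_extend g 0 = frag_lift T (%x y. K #>\<^bsub>FA\<^esub> g (x, y)) 0"
   using h.hom_one k.hom_one by simp
 next
  fix a assume "a \<in> carrier M \<times> carrier N"
  then obtain x y where a: "a = (x, y)" "x \<in> carrier M" "y \<in> carrier N" by auto
  then show "K #>\<^bsub>FA\<^esub> frag_extend g (frag_of a) = frag_lift T (%x y. K #>\<^bsub>FA\<^esub> g (x, y)) (frag_of a)"
   using frag_lift_of[OF tensor_abelian_group, of "%x y. K #>\<^bsub>FA\<^esub> g (x, y)" x y]
    coset_in_carrier[OF assms(1)]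
   by simp
 next
  fix d e assume *: "Poly_Mapping.keys d \<subseteq> carrier M \<times> carrier N" "Poly_Mapping.keys e \<subseteq> carrier M \<times> carrier N"
   "K #>\<^bsub>FA\<^esub> frag_extend g d = frag_lift T (%x y. K #>\<^bsub>FA\<^esub> g (x, y)) d"
   "K #>\<^bsub>FA\<^esub> frag_extend g e = frag_lift T (%x y. K #>\<^bsub>FA\<^esub> g (x, y)) e"
  show "K #>\<^bsub>FA\<^esub> frag_extend g (d - e) = frag_lift T (%x y. K #>\<^bsub>FA\<^esub> g (x, y)) (d - e)"
   using h.hom_mult[of d "- e"] h.hom_inv[of e] k.hom_mult[of d "- e"] k.hom_inv[of e] *
   by simp
 qed
qed

lemma in_coset_carrier:
 "V \<in> carrier T ==> c \<in> V ==> c \<in> carrier FA \<and> V = K #>\<^bsub>FA\<^esub> c"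
proof -
 assume V: "V \<in> carrier T" and c: "c \<in> V"
 interpret group FA by simp
 from V obtain d where d: "d \<in> carrier FA" "V = K #>\<^bsub>FA\<^esub> d" by (rule carrier_cosetE)
 then show ?thesis
  using c repr_independence[OF _ d(1) K_subgroup]
   subsetD[OF r_coset_subset_G[OF subgroup.subset[OF K_subgroup] d(1)], of c]
  by simp
qed

lemma carrier_nonempty: "V \<in> carrier T ==> \<exists>c. c \<in> V"
proof (elim carrier_cosetE)
 fix c assume "c \<in> carrier FA" "V = K #>\<^bsub>FA\<^esub> c"
 then have "c \<in> V" using group.rcos_self[OF group_free_Abelian_group _ K_subgroup] by simp
 then show ?thesis ..
qed

lemma biadditive_pure: "biadditive M N T (%x y. x \<boxtimes>\<^bsub>T\<^esub> y)"
 by (intro biadditiveI pure_left_add_maps pure_right_add_maps)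

end

text \<open>The hypotheses under which \<open>f \<otimes> g\<close> is well defined.\<close>

lemma tmap_balanced:
 assumes "tensor_product M N A ra la" "tensor_product M' N' A' ra' la'"
  and "T' = tensor M' N' A' ra' la'"
  and "f \<in> add_maps M M'" "g \<in> add_maps N N'"
  and "!!x a y. [|x \<in> carrier M; a \<in> A; y \<in> carrier N|]
   ==> f (ra x a) \<boxtimes>\<^bsub>T'\<^esub> g y = f x \<boxtimes>\<^bsub>T'\<^esub> g (la a y)"
 shows "tensor_product.balanced M N A ra la T' (%x y. f x \<boxtimes>\<^bsub>T'\<^esub> g y)"
proof -
 interpret t: tensor_product M N A ra la by fact
 interpret t': tensor_product M' N' A' ra' la' by fact
 show ?thesis unfolding assms(3)
 proof (intro t.balancedI t'.tensor_abelian_group biadditiveI)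
  fix x assume "x \<in> carrier M"
  then show "(%y. f x \<boxtimes>\<^bsub>tensor M' N' A' ra' la'\<^esub> g y) \<in> add_maps N (tensor M' N' A' ra' la')"
   using add_maps_comp[OF assms(5) t'.pure_right_add_maps] add_maps_closed[OF assms(4)] by blast
 next
  fix y assume "y \<in> carrier N"
  then show "(%x. f x \<boxtimes>\<^bsub>tensor M' N' A' ra' la'\<^esub> g y) \<in> add_maps M (tensor M' N' A' ra' la')"
   using add_maps_comp[OF assms(4) t'.pure_left_add_maps] add_maps_closed[OF assms(5)] by blast
 qed (use assms(3,6) in auto)
qed

text \<open>The scalars act through \<open>M\<close>; they descend to the tensor product because
  they commute with the right action of the base (\<open>ra_smult\<close>).\<close>

locale tensor_module = tensor_product M N A ra la + module R M
 for R :: "('k, 'r) ring_scheme" and M :: "('k, 'm, 'x) module_scheme" and N :: "('n, 'y) ring_scheme"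
  and A :: "'a set" and ra :: "'m => 'a => 'm" and la :: "'a => 'n => 'n" +
 assumes ra_smult: "[|r \<in> carrier R; x \<in> carrier M; a \<in> A|] ==> ra (r \<odot>\<^bsub>M\<^esub> x) a = r \<odot>\<^bsub>M\<^esub> ra x a"
begin

lemma tensor_smult:
 assumes "r \<in> carrier R" "V \<in> carrier T"
 shows "r \<odot>\<^bsub>T\<^esub> V = tlift T (%x y. (r \<odot>\<^bsub>M\<^esub> x) \<boxtimes>\<^bsub>T\<^esub> y) V"
proof -
 have "K #>\<^bsub>FA\<^esub> frag_extend (%(x, y). frag_of (r \<odot>\<^bsub>M\<^esub> x, y)) c
   = frag_lift T (%x y. (r \<odot>\<^bsub>M\<^esub> x) \<boxtimes>\<^bsub>T\<^esub> y) c" if "c \<in> V" for c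
  using that assms in_coset_carrier[OF assms(2)]
  by (subst coset_frag_extend(1)) (simp_all add: pure_tensor_coset[symmetric])
 then have "{K #>\<^bsub>FA\<^esub> frag_extend (%(x, y). frag_of (r \<odot>\<^bsub>M\<^esub> x, y)) c | c. c \<in> V}
   = frag_lift T (%x y. (r \<odot>\<^bsub>M\<^esub> x) \<boxtimes>\<^bsub>T\<^esub> y) ` V"
  by (force simp: image_iff)
 moreover have "r \<odot>\<^bsub>T\<^esub> V = the_elem {K #>\<^bsub>FA\<^esub> frag_extend (%(x, y). frag_of (r \<odot>\<^bsub>M\<^esub> x, y)) c | c. c \<in> V}"
  by (simp add: tensor_def Let_def)
 ultimately show ?thesis
  by (simp add: tlift_def frag_lift_def[abs_def])
qed

lemma smult_add_maps: "r \<in> carrier R ==> (%x. r \<odot>\<^bsub>M\<^esub> x) \<in> add_maps M M"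
 by (intro add_mapsI) (simp_all add: smult_r_distr)

lemma smult_balanced: "r \<in> carrier R ==> balanced T (%x y. (r \<odot>\<^bsub>M\<^esub> x) \<boxtimes>\<^bsub>T\<^esub> y)"
 using tmap_balanced[OF tensor_product_axioms tensor_product_axioms refl smult_add_maps add_maps_id]
 by (simp add: ra_smult[symmetric] pure_balanced)

lemma smult_pure [simp]:
 "r \<in> carrier R ==> x \<in> carrier M ==> y \<in> carrier N ==> r \<odot>\<^bsub>T\<^esub> (x \<boxtimes>\<^bsub>T\<^esub> y) = (r \<odot>\<^bsub>M\<^esub> x) \<boxtimes>\<^bsub>T\<^esub> y"
 by (simp add: tensor_smult pure_closed smult_balanced)

lemma tensor_smult_closed: "r \<in> carrier R ==> V \<in> carrier T ==> r \<odot>\<^bsub>T\<^esub> V \<in> carrier T"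
 by (simp add: tensor_smult tlift_closed[OF smult_balanced])

lemma tensor_smult_add:
 "r \<in> carrier R ==> V \<in> carrier T ==> W \<in> carrier T ==> r \<odot>\<^bsub>T\<^esub> (V \<oplus>\<^bsub>T\<^esub> W) = r \<odot>\<^bsub>T\<^esub> V \<oplus>\<^bsub>T\<^esub> r \<odot>\<^bsub>T\<^esub> W"
 using abelian_groupE(1)[OF tensor_abelian_group]
 by (simp add: tensor_smult tlift_add[OF smult_balanced])

lemma tensor_smult_add_maps: "r \<in> carrier R ==> (%V. r \<odot>\<^bsub>T\<^esub> V) \<in> add_maps T T"
 by (intro add_mapsI) (simp_all add: tensor_smult_closed tensor_smult_add)

lemma tensor_is_module: "module R T"
proof -
 interpret T: abelian_group T by (rule tensor_abelian_group)
 have [simp]: "r \<odot>\<^bsub>T\<^esub> \<zero>\<^bsub>T\<^esub> = \<zero>\<^bsub>T\<^esub>" if "r \<in> carrier R" for r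
  using that by (intro add_maps_zero tensor_smult_add_maps tensor_abelian_group)
 show ?thesis
 proof (intro moduleI R.is_cring tensor_abelian_group tensor_smult_closed tensor_smult_add)
  fix a b V assume ab: "a \<in> carrier R" "b \<in> carrier R" and V: "V \<in> carrier T"
  show "(a \<oplus>\<^bsub>R\<^esub> b) \<odot>\<^bsub>T\<^esub> V = a \<odot>\<^bsub>T\<^esub> V \<oplus>\<^bsub>T\<^esub> b \<odot>\<^bsub>T\<^esub> V"
   using V
  proof (induction rule: tensor_induct)
   case (add V W)
   then have "(a \<oplus>\<^bsub>R\<^esub> b) \<odot>\<^bsub>T\<^esub> (V \<oplus>\<^bsub>T\<^esub> W)
     = (a \<odot>\<^bsub>T\<^esub> V \<oplus>\<^bsub>T\<^esub> b \<odot>\<^bsub>T\<^esub> V) \<oplus>\<^bsub>T\<^esub> (a \<odot>\<^bsub>T\<^esub> W \<oplus>\<^bsub>T\<^esub> b \<odot>\<^bsub>T\<^esub> W)"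
    using ab by (simp add: tensor_smult_add)
   then show ?case
    using ab add(1,2) by (simp add: tensor_smult_add tensor_smult_closed T.a_ac)
  qed (simp_all add: ab smult_l_distr pure_add_left)
  show "(a \<otimes>\<^bsub>R\<^esub> b) \<odot>\<^bsub>T\<^esub> V = a \<odot>\<^bsub>T\<^esub> (b \<odot>\<^bsub>T\<^esub> V)"
   using V
   by (induction rule: tensor_induct)
    (simp_all add: ab smult_assoc1 tensor_smult_add tensor_smult_closed)
 next
  fix V assume "V \<in> carrier T"
  then show "\<one>\<^bsub>R\<^esub> \<odot>\<^bsub>T\<^esub> V = V"
   by (induction rule: tensor_induct) (simp_all add: tensor_smult_add)
 qed
qed

lemma tlift_linear:
 assumes "balanced G be" "module R G"
  and "!!r x y. [|r \<in> carrier R; x \<in> carrier M; y \<in> carrier N|] ==> be (r \<odot>\<^bsub>M\<^esub> x) y = r \<odot>\<^bsub>G\<^esub> be x y"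
 shows "tlift G be \<in> linear_maps R T G"
proof -
 interpret G: module R G by fact
 show ?thesis
 proof (rule linear_mapsI)
  fix r V assume r: "r \<in> carrier R" and V: "V \<in> carrier T"
  have "(%V. r \<odot>\<^bsub>G\<^esub> tlift G be V) \<in> add_maps T G"
   using r by (intro add_mapsI) (simp_all add: tlift_closed[OF assms(1)] tlift_add[OF assms(1)] G.smult_r_distr)
  then show "tlift G be (r \<odot>\<^bsub>T\<^esub> V) = r \<odot>\<^bsub>G\<^esub> tlift G be V"
   by (rule tensor_map_eqI[OF V G.abelian_group_axioms add_maps_comp[OF tensor_smult_add_maps[OF r] tlift_add_maps[OF assms(1)]]])
    (simp add: r assms)
 qed (simp_all add: tlift_closed[OF assms(1)] tlift_add[OF assms(1)])
qed

end

section \<open>The Takeuchi product\<close>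

locale takeuchi = B: k_algebra R B
 for R :: "('k, 'r) ring_scheme" and B :: "('k, 'b, 'z) module_scheme" (structure) and A :: "('a, 'y) ring_scheme"
  and s :: "'a => 'b" and t :: "'a => 'b" +
 assumes source_closed: "a \<in> carrier A ==> s a \<in> carrier B"
  and target_closed: "a \<in> carrier A ==> t a \<in> carrier B"
begin

sublocale tensor_module R B B "carrier A" "%h a. t a \<otimes> h" "%a h. s a \<otimes> h"
 by unfold_locales
  (simp_all add: source_closed target_closed B.smult_mult_right)

abbreviation (input) "TB \<equiv> left_tensor B A s t"
abbreviation tensor_TB (infixl "\<bowtie>" 70) where "x \<bowtie> y \<equiv> x \<boxtimes>\<^bsub>TB\<^esub> y"

lemma TB_def: "TB = tensor B B (carrier A) (%h a. t a \<otimes> h) (%a h. s a \<otimes> h)"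
 by (simp add: left_tensor_def tensor_square_def)

sublocale TB: module R TB
 unfolding TB_def by (rule tensor_is_module)

lemmas TB_pure_closed = pure_closed[folded TB_def]
lemmas TB_induct = tensor_induct[folded TB_def, consumes 1, case_names zero pure add]
lemmas TB_eqI = tensor_map_eqI[folded TB_def]
lemmas TB_balanced = pure_balanced[folded TB_def]
lemmas TB_pure_left = pure_left_add_maps[folded TB_def]
lemmas TB_pure_right = pure_right_add_maps[folded TB_def]
lemmas TB_smult_pure = smult_pure[folded TB_def]
lemmas TB_one = tensor_one[folded TB_def]
lemmas TB_tlift_pure = tlift_pure[folded TB_def]
lemmas TB_tlift_add_maps = tlift_add_maps[folded TB_def]
lemmas TB_tlift_linear = tlift_linear[folded TB_def]
lemmas TB_tlift_cong = tlift_cong[folded TB_def]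

text \<open>The base acts by left multiplications, which commute with right multiplications. So
  multiplying an arbitrary tensor on the right by u (x) v is well defined, and this is the part of
  the componentwise product that exists outside the Takeuchi product.\<close>

definition rmul :: "'b => 'b => ('b \<times> 'b \<Rightarrow>\<^sub>0 int) set => ('b \<times> 'b \<Rightarrow>\<^sub>0 int) set"
 where "rmul u v = tlift TB (%x y. (x \<otimes> u) \<bowtie> (y \<otimes> v))"

lemma mult_left_add_maps: "u \<in> carrier B ==> (%x. u \<otimes> x) \<in> add_maps B B"
 and mult_right_add_maps: "u \<in> carrier B ==> (%x. x \<otimes> u) \<in> add_maps B B"
 by (auto intro!: add_mapsI simp: B.l_distr B.r_distr)

lemma rmul_balanced:
 assumes "u \<in> carrier B" "v \<in> carrier B"
 shows "balanced TB (%x y. (x \<otimes> u) \<bowtie> (y \<otimes> v))"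
proof (rule tmap_balanced[OF tensor_product_axioms tensor_product_axioms TB_def])
 fix x a y assume "x \<in> carrier B" "a \<in> carrier A" "y \<in> carrier B"
 then show "(t a \<otimes> x \<otimes> u) \<bowtie> (y \<otimes> v) = (x \<otimes> u) \<bowtie> (s a \<otimes> y \<otimes> v)"
  using assms TB_balanced[of "x \<otimes> u" a "y \<otimes> v"]
  by (simp add: B.m_assoc source_closed target_closed)
qed (simp_all add: assms mult_right_add_maps)

lemma rmul_pure [simp]:
 "[|u \<in> carrier B; v \<in> carrier B; x \<in> carrier B; y \<in> carrier B|] ==>
  rmul u v (x \<bowtie> y) = (x \<otimes> u) \<bowtie> (y \<otimes> v)"
 unfolding rmul_def by (simp add: TB_tlift_pure rmul_balanced)

lemma rmul_linear: "u \<in> carrier B ==> v \<in> carrier B ==> rmul u v \<in> linear_maps R TB TB"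
 unfolding rmul_def
 by (intro TB_tlift_linear rmul_balanced TB.module_axioms)
  (simp_all add: B.smult_mult_left TB_smult_pure)

lemmas rmul_add_maps = linear_maps_add_maps[OF rmul_linear]
lemmas rmul_closed = linear_maps_closed[OF rmul_linear]
lemmas rmul_add = linear_maps_add[OF rmul_linear]
lemmas rmul_smult = linear_maps_smult[OF rmul_linear]

lemma rmul_zero: "u \<in> carrier B ==> v \<in> carrier B ==> rmul u v \<zero>\<^bsub>TB\<^esub> = \<zero>\<^bsub>TB\<^esub>"
 by (rule add_maps_zero[OF TB.abelian_group_axioms TB.abelian_group_axioms rmul_add_maps])

lemma rmul_add_left:
 assumes "V \<in> carrier TB" "u \<in> carrier B" "u' \<in> carrier B" "v \<in> carrier B"
 shows "rmul (u \<oplus> u') v V = rmul u v V \<oplus>\<^bsub>TB\<^esub> rmul u' v V"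
 using assms(1)
proof (induction rule: TB_induct)
 case (add V W)
 then show ?case
  using assms by (simp add: rmul_add rmul_closed TB.a_ac)
qed (use assms in "simp_all add: rmul_zero B.r_distr add_maps_add[OF TB_pure_left]")

lemma rmul_add_right:
 assumes "V \<in> carrier TB" "u \<in> carrier B" "v \<in> carrier B" "v' \<in> carrier B"
 shows "rmul u (v \<oplus> v') V = rmul u v V \<oplus>\<^bsub>TB\<^esub> rmul u v' V"
 using assms(1)
proof (induction rule: TB_induct)
 case (add V W)
 then show ?case
  using assms by (simp add: rmul_add rmul_closed TB.a_ac)
qed (use assms in "simp_all add: rmul_zero B.r_distr add_maps_add[OF TB_pure_right]")

lemma rmul_smult_left:
 assumes "V \<in> carrier TB" "u \<in> carrier B" "v \<in> carrier B" "r \<in> carrier R"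
 shows "rmul (r \<odot> u) v V = r \<odot>\<^bsub>TB\<^esub> rmul u v V"
 using assms(1)
 by (induction rule: TB_induct)
  (use assms in "simp_all add: rmul_zero rmul_add rmul_closed TB.smult_r_distr B.smult_mult_right TB_smult_pure")

lemma rmul_rmul:
 assumes "V \<in> carrier TB" "u \<in> carrier B" "v \<in> carrier B" "u' \<in> carrier B" "v' \<in> carrier B"
 shows "rmul u' v' (rmul u v V) = rmul (u \<otimes> u') (v \<otimes> v') V"
 using assms(1)
 by (induction rule: TB_induct) (use assms in "simp_all add: rmul_zero rmul_add rmul_closed B.m_assoc")

lemma rmul_one: "V \<in> carrier TB ==> rmul \<one> \<one> V = V"
 by (induction rule: TB_induct) (simp_all add: rmul_zero rmul_add)

abbreviation (input) "TK \<equiv> left_takeuchi B A s t"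

lemma TK_simps:
 "\<zero>\<^bsub>TK\<^esub> = \<zero>\<^bsub>TB\<^esub>" "ring.add TK = ring.add TB" "smult TK = smult TB"
 "monoid.mult TK = monoid.mult TB" "monoid.one TK = monoid.one TB" "pure_tensor TK = pure_tensor TB"
 by (simp_all add: left_takeuchi_def Let_def fun_eq_iff pure_tensor_def)

lemma TK_iff:
 "V \<in> carrier TK \<longleftrightarrow> V \<in> carrier TB \<and> (\<forall>a\<in>carrier A. rmul (t a) \<one> V = rmul \<one> (s a) V)"
proof -
 have "tmap TB (%h. h \<otimes> t a) (%h. h) V = rmul (t a) \<one> V"
  "tmap TB (%h. h) (%h. h \<otimes> s a) V = rmul \<one> (s a) V"
  if "V \<in> carrier TB" "a \<in> carrier A" for a
  unfolding tmap_def rmul_def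
  by (intro TB_tlift_cong;
    use that in \<open>simp add: TB_pure_closed source_closed target_closed\<close>)+
 then show ?thesis by (auto simp: left_takeuchi_def Let_def)
qed

lemma TK_TB: "V \<in> carrier TK ==> V \<in> carrier TB"
 and TK_rmul: "V \<in> carrier TK ==> a \<in> carrier A ==> rmul (t a) \<one> V = rmul \<one> (s a) V"
 by (simp_all add: TK_iff)

text \<open>The product V W as a function of W: a pure tensor u (x) v in W multiplies V on the
  right. The Takeuchi condition on \<open>V\<close> says precisely that \<open>rmul u v V\<close> is
  balanced in \<open>u\<close> and \<open>v\<close>.\<close>

definition tmul where "tmul V = tlift TB (%u v. rmul u v V)"

lemma tmul_balanced:
 assumes "V \<in> carrier TK"
 shows "balanced TB (%u v. rmul u v V)"
proof (intro balancedI TB.abelian_group_axioms biadditiveI add_mapsI)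
 fix u a v assume *: "u \<in> carrier B" "a \<in> carrier A" "v \<in> carrier B"
 note V = TK_TB[OF assms]
 have "rmul (t a \<otimes> u) v V = rmul u v (rmul (t a) \<one> V)"
  using * V by (simp add: rmul_rmul target_closed)
 also have "... = rmul u (s a \<otimes> v) V"
  using * V by (simp add: rmul_rmul source_closed TK_rmul[OF assms])
 finally show "rmul (t a \<otimes> u) v V = rmul u (s a \<otimes> v) V" .
qed (use TK_TB[OF assms] in "simp_all add: rmul_closed rmul_add_left rmul_add_right")

lemma tmul_linear: "V \<in> carrier TK ==> tmul V \<in> linear_maps R TB TB"
 unfolding tmul_def
 by (intro TB_tlift_linear tmul_balanced TB.module_axioms) (simp_all add: rmul_smult_left TK_TB)

lemmas tmul_closed = linear_maps_closed[OF tmul_linear]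
lemmas tmul_add = linear_maps_add[OF tmul_linear]
lemmas tmul_smult = linear_maps_smult[OF tmul_linear]

lemma tmul_zero: "V \<in> carrier TK ==> tmul V \<zero>\<^bsub>TB\<^esub> = \<zero>\<^bsub>TB\<^esub>"
 by (rule add_maps_zero[OF TB.abelian_group_axioms TB.abelian_group_axioms linear_maps_add_maps[OF tmul_linear]])

lemma tmul_pure [simp]:
 "V \<in> carrier TK ==> u \<in> carrier B ==> v \<in> carrier B ==> tmul V (u \<bowtie> v) = rmul u v V"
 unfolding tmul_def by (simp add: TB_tlift_pure tmul_balanced)

lemma rmul_tmul:
 assumes "V \<in> carrier TK" "W \<in> carrier TB" "u \<in> carrier B" "v \<in> carrier B"
 shows "rmul u v (tmul V W) = tmul V (rmul u v W)"
 using assms(2)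
 by (induction rule: TB_induct)
  (use assms TK_TB[OF assms(1)] in "simp_all add: tmul_zero rmul_zero tmul_add rmul_add tmul_closed rmul_closed rmul_rmul")

lemma tmul_TK: "V \<in> carrier TK ==> W \<in> carrier TK ==> tmul V W \<in> carrier TK"
 by (simp add: TK_iff[of "tmul V W"] tmul_closed TK_TB rmul_tmul source_closed target_closed TK_rmul)

lemma tmul_assoc:
 assumes "V \<in> carrier TK" "W \<in> carrier TK" "Y \<in> carrier TB"
 shows "tmul (tmul V W) Y = tmul V (tmul W Y)"
 using assms(3)
 by (induction rule: TB_induct)
  (use assms in "simp_all add: tmul_TK TK_TB tmul_zero tmul_add tmul_closed rmul_tmul")

text \<open>Both arguments enter through arbitrary representatives \<open>c\<close> and
  \<open>d\<close>. Summing over \<open>c\<close> first gives \<open>rmul u v V\<close> whatever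
  \<open>c\<close> was, and summing over \<open>d\<close> then gives \<open>tmul V Y\<close>; so the
  set in the definition of the product is a singleton.\<close>

lemma mult_eq_tmul:
 assumes "V \<in> carrier TK" "Y \<in> carrier TB"
 shows "V \<otimes>\<^bsub>TB\<^esub> Y = tmul V Y"
proof -
 note V = TK_TB[OF assms(1)]
 let ?g = "%(x, y) (x', y'). frag_of (x \<otimes> x', y \<otimes> y')"
 have gcl: "?g p q \<in> carrier FA" if "p \<in> carrier B \<times> carrier B" "q \<in> carrier B \<times> carrier B" for p q
  using that by auto
 have key: "K #>\<^bsub>FA\<^esub> frag_extend (%p. frag_extend (?g p) d) c = tmul V Y"
  if cd: "c \<in> V" "d \<in> Y" for c d
 proof -
  have c: "c \<in> carrier FA" "V = K #>\<^bsub>FA\<^esub> c" and d: "d \<in> carrier FA" "Y = K #>\<^bsub>FA\<^esub> d"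
   using in_coset_carrier[OF V[unfolded TB_def] cd(1)] in_coset_carrier[OF assms(2)[unfolded TB_def] cd(2)] by blast+
  have inner: "K #>\<^bsub>FA\<^esub> frag_extend (%p. ?g p (u, v)) c = rmul u v V"
   "frag_extend (%p. ?g p (u, v)) c \<in> carrier FA"
   if "u \<in> carrier B" "v \<in> carrier B" for u v
  proof -
   have 1: "(%p. ?g p (u, v)) (x, y) \<in> carrier FA" if "x \<in> carrier B" "y \<in> carrier B" for x y
    using that \<open>u \<in> carrier B\<close> \<open>v \<in> carrier B\<close> by simp
   have "rmul u v V = frag_lift T (%x y. (x \<otimes> u) \<boxtimes>\<^bsub>T\<^esub> (y \<otimes> v)) c"
    unfolding rmul_def c(2) TB_def
    by (rule tlift_coset[OF rmul_balanced[OF that, unfolded TB_def] c(1)])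
   then show "K #>\<^bsub>FA\<^esub> frag_extend (%p. ?g p (u, v)) c = rmul u v V"
    using coset_frag_extend(1)[where g = "%p. ?g p (u, v)", OF 1 c(1)]
    by (simp only: pure_tensor_coset prod.case)
   show "frag_extend (%p. ?g p (u, v)) c \<in> carrier FA"
    by (rule coset_frag_extend(2)[where g = "%p. ?g p (u, v)", OF 1 c(1)])
  qed
  have "K #>\<^bsub>FA\<^esub> frag_extend (%p. frag_extend (?g p) d) c
    = K #>\<^bsub>FA\<^esub> frag_extend (%q. frag_extend (%p. ?g p q) c) d"
   by (subst frag_extend_swap) (rule refl)
  also have "... = frag_lift T (%u v. K #>\<^bsub>FA\<^esub> frag_extend (%p. ?g p (u, v)) c) d"
   by (rule coset_frag_extend(1)[where g = "%q. frag_extend (%p. ?g p q) c", OF inner(2) d(1)])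
  also have "... = frag_lift T (%u v. rmul u v V) d"
   unfolding frag_lift_def
   using d(1) inner(1) rmul_closed[OF _ _ V, unfolded TB_def]
   by (intro abelian_monoid.finsum_cong' abelian_group.axioms(1) tensor_abelian_group)
    (auto intro!: group.int_pow_closed[OF abelian_group.a_group[OF tensor_abelian_group], simplified] simp: add_pow_def simp del: subset_antisym)
  also have "... = tmul V Y"
   unfolding tmul_def unfolding d(2) TB_def
   by (rule tlift_coset[OF tmul_balanced[OF assms(1), unfolded TB_def] d(1), symmetric])
  finally show ?thesis .
 qed
 obtain c0 d0 where "c0 \<in> V" "d0 \<in> Y"
  using carrier_nonempty V assms(2) unfolding TB_def by blast
 then have "{K #>\<^bsub>FA\<^esub> frag_extend (%p. frag_extend (?g p) d) c | c d. c \<in> V \<and> d \<in> Y} = {tmul V Y}"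
  using key by blast
 then show ?thesis
  unfolding TB_def
  by (simp add: tensor_def Let_def case_prod_beta')
qed

lemma one_TK: "monoid.one TB \<in> carrier TK"
 unfolding TK_iff TB_one
 using TB_balanced[of "\<one>" _ "\<one>"]
 by (simp add: TB_pure_closed source_closed target_closed)

lemma takeuchi_algebra: "k_algebra R TK"
proof (intro k_algebraI)
 have zero: "\<zero>\<^bsub>TB\<^esub> \<in> carrier TK"
  by (simp add: TK_iff rmul_zero source_closed target_closed)
 have add: "V \<oplus>\<^bsub>TB\<^esub> W \<in> carrier TK" if "V \<in> carrier TK" "W \<in> carrier TK" for V W
  using that by (simp add: TK_iff rmul_add source_closed target_closed)
 have smult: "r \<odot>\<^bsub>TB\<^esub> V \<in> carrier TK" if "r \<in> carrier R" "V \<in> carrier TK" for r V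
  using that by (simp add: TK_iff rmul_smult source_closed target_closed)
 have minus: "\<exists>W\<in>carrier TK. W \<oplus>\<^bsub>TB\<^esub> V = \<zero>\<^bsub>TB\<^esub>" if V: "V \<in> carrier TK" for V
  using smult[OF B.R.a_inv_closed[OF B.R.one_closed] V] TB.smult_l_minus[OF B.R.one_closed TK_TB[OF V]] TK_TB[OF V]
  by (intro bexI[of _ "(\<ominus>\<^bsub>R\<^esub> \<one>\<^bsub>R\<^esub>) \<odot>\<^bsub>TB\<^esub> V"]) (simp_all add: TB.l_neg)
 have minus': "\<exists>W\<in>carrier TK. V \<oplus>\<^bsub>TB\<^esub> W = \<zero>\<^bsub>TB\<^esub>" if "V \<in> carrier TK" for V
  using minus[OF that] TB.a_comm[OF TK_TB TK_TB, OF _ that] by metis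
 show "module R TK"
 proof (intro moduleI B.R.is_cring abelian_groupI)
 qed (simp_all add: TK_simps zero add smult minus minus' TB.a_ac TK_TB TB.smult_l_distr TB.smult_r_distr TB.smult_assoc1)
 show "monoid TK"
 proof (rule monoidI)
  fix V assume V: "V \<in> carrier TK"
  show "\<one>\<^bsub>TK\<^esub> \<otimes>\<^bsub>TK\<^esub> V = V"
   using TK_TB[OF V] unfolding TK_simps mult_eq_tmul[OF one_TK TK_TB[OF V]]
   by (induction rule: TB_induct)
    (use one_TK[unfolded TB_one] in "simp_all add: tmul_zero tmul_add TB_one")
  show "V \<otimes>\<^bsub>TK\<^esub> \<one>\<^bsub>TK\<^esub> = V"
   unfolding TK_simps TB_one mult_eq_tmul[OF V TK_TB[OF one_TK[unfolded TB_one]]] using V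
   by (simp add: rmul_one TK_TB)
 qed (simp_all add: TK_simps one_TK mult_eq_tmul tmul_TK TK_TB tmul_assoc)
 fix V W Y assume V: "V \<in> carrier TK" and W: "W \<in> carrier TK" and Y: "Y \<in> carrier TK"
 show "Y \<otimes>\<^bsub>TK\<^esub> (V \<oplus>\<^bsub>TK\<^esub> W) = Y \<otimes>\<^bsub>TK\<^esub> V \<oplus>\<^bsub>TK\<^esub> Y \<otimes>\<^bsub>TK\<^esub> W"
  using V W Y by (simp add: TK_simps mult_eq_tmul TK_TB tmul_add)
 have "tmul (V \<oplus>\<^bsub>TB\<^esub> W) Y = tmul V Y \<oplus>\<^bsub>TB\<^esub> tmul W Y"
  using TK_TB[OF Y]
  by (induction rule: TB_induct)
   (use V W add[OF V W] in "simp_all add: tmul_zero tmul_add rmul_add TK_TB tmul_closed TB.a_ac")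
 then show "(V \<oplus>\<^bsub>TK\<^esub> W) \<otimes>\<^bsub>TK\<^esub> Y = V \<otimes>\<^bsub>TK\<^esub> Y \<oplus>\<^bsub>TK\<^esub> W \<otimes>\<^bsub>TK\<^esub> Y"
  using V W Y by (simp add: TK_simps mult_eq_tmul add TK_TB)
next
 fix r V W assume r: "r \<in> carrier R" and V: "V \<in> carrier TK" and W: "W \<in> carrier TK"
 have rV: "r \<odot>\<^bsub>TB\<^esub> V \<in> carrier TK"
  using r V by (simp add: TK_iff rmul_smult source_closed target_closed)
 have "tmul (r \<odot>\<^bsub>TB\<^esub> V) W = r \<odot>\<^bsub>TB\<^esub> tmul V W"
  using TK_TB[OF W]
  by (induction rule: TB_induct)
   (use r V rV in "simp_all add: tmul_zero tmul_add rmul_smult TK_TB tmul_closed TB.smult_r_distr")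
 then show "(r \<odot>\<^bsub>TK\<^esub> V) \<otimes>\<^bsub>TK\<^esub> W = r \<odot>\<^bsub>TK\<^esub> (V \<otimes>\<^bsub>TK\<^esub> W)"
  using V W rV by (simp add: TK_simps mult_eq_tmul TK_TB)
 have "r \<odot>\<^bsub>TB\<^esub> W \<in> carrier TB" using r W by (simp add: TK_TB)
 then show "V \<otimes>\<^bsub>TK\<^esub> (r \<odot>\<^bsub>TK\<^esub> W) = r \<odot>\<^bsub>TK\<^esub> (V \<otimes>\<^bsub>TK\<^esub> W)"
  using r V W by (simp add: TK_simps mult_eq_tmul TK_TB tmul_smult)
qed

end

section \<open>Associativity of tensor products over two bases\<close>

context tensor_product begin

lemma tlift_plus:
 assumes "balanced G be" "balanced G ga" "V \<in> carrier T"
 shows "tlift G (%x y. be x y \<oplus>\<^bsub>G\<^esub> ga x y) V = tlift G be V \<oplus>\<^bsub>G\<^esub> tlift G ga V"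
proof -
 interpret G: abelian_group G using assms(1) by (simp add: balanced_def)
 show ?thesis
  by (rule tlift_comp'[of "%V. tlift G be V \<oplus>\<^bsub>G\<^esub> tlift G ga V", OF _ G.abelian_group_axioms _ assms(3)])
   (auto intro!: add_mapsI simp: assms tlift_closed tlift_add G.a_ac)
qed

end

text \<open>The middle factor carries two commuting actions (\<open>la_rb\<close>), so each outer
  base acts on the tensor product formed over the other one. The bases are kept apart because mixed
  coassociativity uses the left base in one place and the right base in the other.\<close>

locale tensor_assoc =
 l: tensor_product M N A ra la + r: tensor_product N P B rb lb
 for M :: "('k, 'm, 'x) module_scheme" and N :: "('k, 'n, 'y) module_scheme"
  and P :: "('p, 'z) ring_scheme"
  and A :: "'a set" and ra :: "'m => 'a => 'm" and la :: "'a => 'n => 'n"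
  and B :: "'b set" and rb :: "'n => 'b => 'n" and lb :: "'b => 'p => 'p" +
 assumes la_add_maps: "a \<in> A ==> la a \<in> add_maps N N"
  and rb_add_maps: "b \<in> B ==> (%y. rb y b) \<in> add_maps N N"
  and la_rb: "[|a \<in> A; y \<in> carrier N; b \<in> B|] ==> rb (la a y) b = la a (rb y b)"
begin

abbreviation (input) "MN \<equiv> tensor M N A ra la"
abbreviation (input) "NP \<equiv> tensor N P B rb lb"
abbreviation (input) "rb' \<equiv> %V b. tmap MN (%x. x) (%y. rb y b) V"
abbreviation (input) "la' \<equiv> %a Y. tmap NP (la a) (%z. z) Y"
abbreviation (input) "MN_P \<equiv> tensor MN P B rb' lb"
abbreviation (input) "M_NP \<equiv> tensor M NP A ra la'"

lemma rb'_balanced: "b \<in> B ==> l.balanced MN (%x y. x \<boxtimes>\<^bsub>MN\<^esub> rb y b)"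
 by (rule tmap_balanced[OF l.tensor_product_axioms l.tensor_product_axioms refl add_maps_id rb_add_maps])
  (simp_all add: la_rb l.pure_balanced add_maps_closed[OF rb_add_maps])

lemma la'_balanced: "a \<in> A ==> r.balanced NP (%y z. la a y \<boxtimes>\<^bsub>NP\<^esub> z)"
 by (rule tmap_balanced[OF r.tensor_product_axioms r.tensor_product_axioms refl la_add_maps add_maps_id])
  (simp_all add: la_rb[symmetric] r.pure_balanced l.la_closed)

lemma rb'_pure [simp]:
 "b \<in> B ==> x \<in> carrier M ==> y \<in> carrier N ==> rb' (x \<boxtimes>\<^bsub>MN\<^esub> y) b = x \<boxtimes>\<^bsub>MN\<^esub> rb y b"
 by (simp add: tmap_def rb'_balanced)

lemma la'_pure [simp]:
 "a \<in> A ==> y \<in> carrier N ==> z \<in> carrier P ==> la' a (y \<boxtimes>\<^bsub>NP\<^esub> z) = la a y \<boxtimes>\<^bsub>NP\<^esub> z"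
 by (simp add: tmap_def la'_balanced)

lemma rb'_add_maps: "b \<in> B ==> (%V. rb' V b) \<in> add_maps MN MN"
 unfolding tmap_def by (rule l.tlift_add_maps[OF rb'_balanced])

lemma la'_add_maps: "a \<in> A ==> la' a \<in> add_maps NP NP"
 unfolding tmap_def by (rule r.tlift_add_maps[OF la'_balanced])

sublocale ll: tensor_product MN P B rb' lb
 by (intro tensor_product.intro l.tensor_abelian_group r.right.abelian_group_axioms tensor_product_axioms.intro)
  (simp_all add: add_maps_closed[OF rb'_add_maps] r.la_closed)

sublocale rr: tensor_product M NP A ra la'
 by (intro tensor_product.intro r.tensor_abelian_group l.left.abelian_group_axioms tensor_product_axioms.intro)
  (simp_all add: add_maps_closed[OF la'_add_maps] l.ra_closed)

lemma assoc_inner_balanced: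
 assumes "z \<in> carrier P"
 shows "l.balanced M_NP (%x y. x \<boxtimes>\<^bsub>M_NP\<^esub> (y \<boxtimes>\<^bsub>NP\<^esub> z))"
proof (intro l.balancedI rr.tensor_abelian_group biadditiveI)
 fix x assume "x \<in> carrier M"
 then show "(%y. x \<boxtimes>\<^bsub>M_NP\<^esub> (y \<boxtimes>\<^bsub>NP\<^esub> z)) \<in> add_maps N M_NP"
  by (rule add_maps_comp[OF r.pure_left_add_maps[OF assms] rr.pure_right_add_maps])
next
 fix y assume "y \<in> carrier N"
 then show "(%x. x \<boxtimes>\<^bsub>M_NP\<^esub> (y \<boxtimes>\<^bsub>NP\<^esub> z)) \<in> add_maps M M_NP"
  using assms by (intro rr.pure_left_add_maps r.pure_closed)
next
 fix x a y assume *: "x \<in> carrier M" "a \<in> A" "y \<in> carrier N"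
 then show "ra x a \<boxtimes>\<^bsub>M_NP\<^esub> (y \<boxtimes>\<^bsub>NP\<^esub> z) = x \<boxtimes>\<^bsub>M_NP\<^esub> (la a y \<boxtimes>\<^bsub>NP\<^esub> z)"
  using rr.pure_balanced[of x a "y \<boxtimes>\<^bsub>NP\<^esub> z"] assms by (simp add: r.pure_closed)
qed

lemma assoc_outer_balanced:
 "ll.balanced M_NP (%U z. tlift M_NP (%x y. x \<boxtimes>\<^bsub>M_NP\<^esub> (y \<boxtimes>\<^bsub>NP\<^esub> z)) U)"
proof (intro ll.balancedI rr.tensor_abelian_group biadditiveI)
 fix z assume "z \<in> carrier P"
 then show "(%U. tlift M_NP (%x y. x \<boxtimes>\<^bsub>M_NP\<^esub> (y \<boxtimes>\<^bsub>NP\<^esub> z)) U) \<in> add_maps MN M_NP"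
  by (rule l.tlift_add_maps[OF assoc_inner_balanced])
next
 fix U assume U: "U \<in> carrier MN"
 interpret T: abelian_group M_NP by (rule rr.tensor_abelian_group)
 show "(%z. tlift M_NP (%x y. x \<boxtimes>\<^bsub>M_NP\<^esub> (y \<boxtimes>\<^bsub>NP\<^esub> z)) U) \<in> add_maps P M_NP"
 proof (rule add_mapsI)
  fix z z' assume z: "z \<in> carrier P" "z' \<in> carrier P"
  have "tlift M_NP (%x y. x \<boxtimes>\<^bsub>M_NP\<^esub> (y \<boxtimes>\<^bsub>NP\<^esub> (z \<oplus>\<^bsub>P\<^esub> z'))) U
    = tlift M_NP (%x y. x \<boxtimes>\<^bsub>M_NP\<^esub> (y \<boxtimes>\<^bsub>NP\<^esub> z) \<oplus>\<^bsub>M_NP\<^esub> x \<boxtimes>\<^bsub>M_NP\<^esub> (y \<boxtimes>\<^bsub>NP\<^esub> z')) U"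
   using z by (intro l.tlift_cong[OF U])
    (simp add: r.pure_add_right rr.pure_add_right r.pure_closed)
  then show "tlift M_NP (%x y. x \<boxtimes>\<^bsub>M_NP\<^esub> (y \<boxtimes>\<^bsub>NP\<^esub> (z \<oplus>\<^bsub>P\<^esub> z'))) U
    = tlift M_NP (%x y. x \<boxtimes>\<^bsub>M_NP\<^esub> (y \<boxtimes>\<^bsub>NP\<^esub> z)) U \<oplus>\<^bsub>M_NP\<^esub> tlift M_NP (%x y. x \<boxtimes>\<^bsub>M_NP\<^esub> (y \<boxtimes>\<^bsub>NP\<^esub> z')) U"
   by (simp add: l.tlift_plus[OF assoc_inner_balanced assoc_inner_balanced U] z)
 qed (rule l.tlift_closed[OF assoc_inner_balanced U])
next
 fix U b z assume *: "U \<in> carrier MN" "b \<in> B" "z \<in> carrier P"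
 let ?f = "%z. tlift M_NP (%x y. x \<boxtimes>\<^bsub>M_NP\<^esub> (y \<boxtimes>\<^bsub>NP\<^esub> z))"
 have bz: "lb b z \<in> carrier P" using * by (simp add: r.la_closed)
 show "?f z (rb' U b) = ?f (lb b z) U"
  by (rule l.tensor_map_eqI[OF *(1) rr.tensor_abelian_group add_maps_comp[OF rb'_add_maps[OF *(2)] l.tlift_add_maps[OF assoc_inner_balanced[OF *(3)]]]
    l.tlift_add_maps[OF assoc_inner_balanced[OF bz]]])
   (use * bz in "simp add: assoc_inner_balanced r.ra_closed r.pure_balanced")
qed

lemma tassoc_pure:
 assumes "U \<in> carrier MN" "z \<in> carrier P"
 shows "tassoc M_NP NP (U \<boxtimes>\<^bsub>MN_P\<^esub> z) = tlift M_NP (%x y. x \<boxtimes>\<^bsub>M_NP\<^esub> (y \<boxtimes>\<^bsub>NP\<^esub> z)) U"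
 unfolding tassoc_def by (rule ll.tlift_pure[OF assoc_outer_balanced assms])

lemma tassoc_add_maps: "tassoc M_NP NP \<in> add_maps MN_P M_NP"
 unfolding tassoc_def by (rule ll.tlift_add_maps[OF assoc_outer_balanced])

end

section \<open>Linear and bilinear maps\<close>

text \<open>Bundling linearity with the module property of the target makes both travel together, so
  that linearity of deeply nested Sweedler sums is proved by rewriting alone.\<close>

definition lin ::
 "('k, 'r) ring_scheme => ('k, 'm, 'x) module_scheme => ('k, 'n, 'y) module_scheme => ('m => 'n) => bool"
 where "lin R M N f \<longleftrightarrow> module R N \<and> f \<in> linear_maps R M N"

definition bilin ::
 "('k, 'r) ring_scheme => ('k, 'm, 'x) module_scheme => ('k, 'n, 'y) module_scheme =>
  ('k, 'g, 'z) module_scheme => ('m => 'n => 'g) => bool"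
 where "bilin R M N G be \<longleftrightarrow> (\<forall>x\<in>carrier M. lin R N G (be x)) \<and> (\<forall>y\<in>carrier N. lin R M G (%x. be x y)) \<and> module R G"

lemma lin_closed: "lin R M N f ==> x \<in> carrier M ==> f x \<in> carrier N"
 by (auto simp: lin_def linear_maps_closed)

lemma bilin_closed: "bilin R M N G be ==> x \<in> carrier M ==> y \<in> carrier N ==> be x y \<in> carrier G"
 by (auto simp: bilin_def lin_closed)

lemma lin_id: "module R M ==> lin R M M (%x. x)"
 by (simp add: lin_def linear_maps_id)

lemma lin_comp: "lin R N P g ==> lin R M N f ==> lin R M P (%x. g (f x))"
 by (auto simp: lin_def intro: linear_maps_comp)

lemma lin_mult_left: "k_algebra R B ==> b \<in> carrier B ==> lin R M B f ==> lin R M B (%x. b \<otimes>\<^bsub>B\<^esub> f x)"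
proof -
 assume "k_algebra R B" and b: "b \<in> carrier B" and f: "lin R M B f"
 then interpret k_algebra R B by simp
 have "lin R B B (%x. b \<otimes>\<^bsub>B\<^esub> x)"
  using b module_axioms by (auto simp: lin_def intro!: linear_mapsI simp: r_distr smult_mult_right)
 then show ?thesis using f by (rule lin_comp)
qed

lemma lin_mult_right: "k_algebra R B ==> b \<in> carrier B ==> lin R M B f ==> lin R M B (%x. f x \<otimes>\<^bsub>B\<^esub> b)"
proof -
 assume "k_algebra R B" and b: "b \<in> carrier B" and f: "lin R M B f"
 then interpret k_algebra R B by simp
 have "lin R B B (%x. x \<otimes>\<^bsub>B\<^esub> b)"
  using b module_axioms by (auto simp: lin_def intro!: linear_mapsI simp: l_distr smult_mult_left)
 then show ?thesis using f by (rule lin_comp)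
qed

lemma lin_smult: "r \<in> carrier R ==> lin R M N f ==> lin R M N (%x. r \<odot>\<^bsub>N\<^esub> f x)"
proof -
 assume r: "r \<in> carrier R" and f: "lin R M N f"
 then interpret module R N by (simp add: lin_def)
 have "lin R N N (%x. r \<odot>\<^bsub>N\<^esub> x)"
  using r module_axioms
  by (auto simp: lin_def intro!: linear_mapsI simp: smult_r_distr smult_assoc1[symmetric] R.m_comm)
 then show ?thesis using f by (rule lin_comp)
qed

lemma (in tensor_module) lin_pure_left: "y \<in> carrier N ==> lin R Q M f ==> lin R Q T (%x. pure_tensor T (f x) y)"
 by (rule lin_comp[of R M T "%x. pure_tensor T x y" Q f])
  (simp_all add: lin_def linear_maps_def tensor_is_module pure_closed pure_add_left)

section \<open>Sweedler calculus\<close>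

no_notation ideal_prod (infixl "\<cdot>\<index>" 80)

context hopf_algebra begin

abbreviation mult_H (infixl "\<cdot>" 70) where "x \<cdot> y \<equiv> x \<otimes>\<^bsub>H\<^esub> y"

sublocale HH: tensor_module R H H "carrier R" "%x r. r \<odot>\<^bsub>H\<^esub> x" "%r x. r \<odot>\<^bsub>H\<^esub> x"
 by unfold_locales (simp_all add: algebra.smult_assoc1[symmetric] algebra.R.m_comm)

abbreviation (input) "H2 \<equiv> tensor H H (carrier R) (%x r. r \<odot>\<^bsub>H\<^esub> x) (%r x. r \<odot>\<^bsub>H\<^esub> x)"
abbreviation "sw G be h \<equiv> sweedler G H be h"
abbreviation "linH \<equiv> lin R H"
abbreviation "bilinH \<equiv> bilin R H H"
abbreviation "S \<equiv> antipode H"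

lemma square_def: "tensor_square R H (%r x. r \<odot>\<^bsub>H\<^esub> x) (%x r. r \<odot>\<^bsub>H\<^esub> x) = H2"
 "k_tensor_square R H = H2"
 by (simp_all add: tensor_square_def k_tensor_square_def)

lemma comult_H2: "h \<in> carrier H ==> comult H h \<in> carrier H2"
 using coalgebra.comult_closed by (simp add: square_def)

lemma bilin_balanced: "bilinH G be ==> HH.balanced G be"
 by (intro HH.balancedI biadditiveI)
  (auto simp: bilin_def lin_def linear_maps_def add_maps_def module.axioms)

text \<open>As a congruence rule this supplies membership in \<open>carrier H\<close> for the two
  letters bound by a Sweedler sum, which is what rewriting inside nested sums relies on.\<close>

lemma sw_cong [cong]:
 assumes "h = h'" "(h' \<in> carrier H) = True"
  and "!!x y. [|x \<in> carrier H; y \<in> carrier H|] ==> be x y = ga x y"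
 shows "sw G be h = sw G ga h'"
 using assms by (auto intro!: HH.tlift_cong comult_H2 simp del: subset_antisym)

lemma sw_closed [simp]: "bilinH G be ==> h \<in> carrier H ==> sw G be h \<in> carrier G"
 by (intro HH.tlift_closed bilin_balanced comult_H2)

lemma comult_linear: "comult H \<in> linear_maps R H H2"
 using comult_alg_hom by (simp add: alg_hom_linear square_def)

lemma tlift_bilin_linear: "bilinH G be ==> tlift G be \<in> linear_maps R H2 G"
 by (rule HH.tlift_linear[OF bilin_balanced])
  (auto simp: bilin_def lin_def linear_maps_def)

lemma lin_sw: "bilinH G be ==> linH G (%h. sw G be h)"
 using linear_maps_comp[OF comult_linear tlift_bilin_linear] by (auto simp: lin_def bilin_def)

lemma lin_sw_arg: "bilinH G be ==> lin R M H f ==> lin R M G (%x. sw G be (f x))"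
 by (rule lin_comp[OF lin_sw])

lemma lin_sw_param:
 assumes "\<forall>x\<in>carrier M. bilinH G (be x)" "\<forall>y\<in>carrier H. \<forall>z\<in>carrier H. lin R M G (%x. be x y z)"
  and "module R G" "module R M" "h \<in> carrier H"
 shows "lin R M G (%x. sw G (be x) h)"
proof -
 interpret G: module R G by fact
 interpret M: module R M by fact
 note bal = bilin_balanced[OF assms(1)[rule_format]]
 have bl: "be (x \<oplus>\<^bsub>M\<^esub> x') y z = be x y z \<oplus>\<^bsub>G\<^esub> be x' y z"
  if "x \<in> carrier M" "x' \<in> carrier M" "y \<in> carrier H" "z \<in> carrier H" for x x' y z
  using assms(2) that by (auto simp: lin_def linear_maps_def)
 have bs: "be (r \<odot>\<^bsub>M\<^esub> x) y z = r \<odot>\<^bsub>G\<^esub> be x y z"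
  if "x \<in> carrier M" "y \<in> carrier H" "z \<in> carrier H" "r \<in> carrier R" for x y z r
  using assms(2) that by (auto simp: lin_def linear_maps_def)
 show ?thesis
  unfolding lin_def
 proof (intro conjI linear_mapsI)
  fix x x' assume x: "x \<in> carrier M" "x' \<in> carrier M"
  have "sw G (be (x \<oplus>\<^bsub>M\<^esub> x')) h = sw G (%y z. be x y z \<oplus>\<^bsub>G\<^esub> be x' y z) h"
   using x bl assms(5) by (intro HH.tlift_cong comult_H2) auto
  also have "... = sw G (be x) h \<oplus>\<^bsub>G\<^esub> sw G (be x') h"
   using x assms(5) by (intro HH.tlift_plus bal comult_H2)
  finally show "sw G (be (x \<oplus>\<^bsub>M\<^esub> x')) h = sw G (be x) h \<oplus>\<^bsub>G\<^esub> sw G (be x') h" .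
 next
  fix r x assume r: "r \<in> carrier R" "x \<in> carrier M"
  have "sw G (be (r \<odot>\<^bsub>M\<^esub> x)) h = sw G (%y z. r \<odot>\<^bsub>G\<^esub> be x y z) h"
   using r bs assms(5) by (intro HH.tlift_cong comult_H2) auto
  also have "... = r \<odot>\<^bsub>G\<^esub> sw G (be x) h"
   using r assms(5)
   by (intro HH.tlift_comp[symmetric] bal comult_H2 G.abelian_group_axioms add_mapsI) (auto simp: G.smult_r_distr)
  finally show "sw G (be (r \<odot>\<^bsub>M\<^esub> x)) h = r \<odot>\<^bsub>G\<^esub> sw G (be x) h" .
 qed (use assms in auto)
qed

lemma sw_map:
 assumes "lin R G G' f" "bilinH G be" "h \<in> carrier H"
 shows "f (sw G be h) = sw G' (%x y. f (be x y)) h"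
 using assms by (intro HH.tlift_comp bilin_balanced comult_H2) (auto simp: lin_def linear_maps_add_maps module.axioms)

text \<open>Fubini for two independent Sweedler sums. The coproduct of \<open>k\<close> is replaced
  by an arbitrary tensor \<open>W\<close>; both sides are additive in \<open>W\<close>, and on a
  pure tensor they agree by inspection.\<close>

lemma sw_swap:
 assumes h: "h \<in> carrier H" "k \<in> carrier H"
  and bi: "!!u v. [|u \<in> carrier H; v \<in> carrier H|] ==> bilinH G (%x y. ga x y u v)"
   "!!x y. [|x \<in> carrier H; y \<in> carrier H|] ==> bilinH G (ga x y)"
  and G: "module R G"
 shows "sw G (%x y. sw G (%u v. ga x y u v) k) h = sw G (%u v. sw G (%x y. ga x y u v) h) k"
proof -
 interpret G: module R G by fact
 have linu: "linH G (%u. ga x y u v)" "linH G (%v. ga x y u v)"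
  if "x \<in> carrier H" "y \<in> carrier H" "u \<in> carrier H" "v \<in> carrier H" for x y u v
  using bi(2)[OF that(1,2)] that by (auto simp: bilin_def)
 have linx: "linH G (%x. ga x y u v)" "linH G (%y. ga x y u v)"
  if "x \<in> carrier H" "y \<in> carrier H" "u \<in> carrier H" "v \<in> carrier H" for x y u v
  using bi(1)[OF that(3,4)] that by (auto simp: bilin_def)
 have bal_out: "HH.balanced G (%u v. sw G (%x y. ga x y u v) h)"
  using h bi linu
  by (intro bilin_balanced) (auto simp: bilin_def G.module_axioms algebra.module_axioms intro!: lin_sw_param)
 have "tlift G (%x y. tlift G (ga x y) W) (comult H h) = tlift G (%u v. sw G (%x y. ga x y u v) h) W"
  if "W \<in> carrier H2" for W
  using that
 proof (induction rule: HH.tensor_induct)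
  case zero
  have "tlift G (ga x y) \<zero>\<^bsub>H2\<^esub> = \<zero>\<^bsub>G\<^esub>" if "x \<in> carrier H" "y \<in> carrier H" for x y
   by (intro add_maps_zero HH.tensor_abelian_group G.abelian_group_axioms HH.tlift_add_maps bilin_balanced bi that)
  then have "tlift G (%x y. tlift G (ga x y) \<zero>\<^bsub>H2\<^esub>) (comult H h) = tlift G (%x y. \<zero>\<^bsub>G\<^esub>) (comult H h)"
   using h by (intro HH.tlift_cong comult_H2) auto
  also have "... = \<zero>\<^bsub>G\<^esub>"
   using h by (intro HH.tlift_comp'[where f = "%_. \<zero>\<^bsub>G\<^esub>"] comult_H2) (auto intro!: add_mapsI G.abelian_group_axioms)
  finally show ?case
   using add_maps_zero[OF HH.tensor_abelian_group G.abelian_group_axioms HH.tlift_add_maps[OF bal_out]] by simp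
 next
  case (pure u v)
  have "tlift G (%x y. tlift G (ga x y) (u \<boxtimes>\<^bsub>H2\<^esub> v)) (comult H h) = tlift G (%x y. ga x y u v) (comult H h)"
   using h pure by (intro HH.tlift_cong comult_H2) (auto intro!: HH.tlift_pure bilin_balanced bi)
  then show ?case using pure bal_out by simp
 next
  case (add V W)
  \<comment> \<open>The outer lift is additive only on balanced maps, and that the inner sum over an
    arbitrary tensor \<open>Y\<close> is balanced in the other pair takes an induction on
    \<open>Y\<close> of its own.\<close>
  have b: "HH.balanced G (%x y. tlift G (ga x y) Y)" if "Y \<in> carrier H2" for Y
   using that
  proof (induction rule: HH.tensor_induct)
   case zero
   have z: "tlift G (ga x y) \<zero>\<^bsub>H2\<^esub> = \<zero>\<^bsub>G\<^esub>" if "x \<in> carrier H" "y \<in> carrier H" for x y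
    by (intro add_maps_zero HH.tensor_abelian_group G.abelian_group_axioms HH.tlift_add_maps bilin_balanced bi that)
   show ?case
    by (intro HH.balancedI biadditiveI add_mapsI G.abelian_group_axioms) (simp_all add: z)
  next
   case (pure u v)
   have "HH.balanced G (%x y. ga x y u v)" using pure bi by (intro bilin_balanced)
   moreover have "tlift G (ga x y) (u \<boxtimes>\<^bsub>H2\<^esub> v) = ga x y u v" if "x \<in> carrier H" "y \<in> carrier H" for x y
    using pure that by (intro HH.tlift_pure bilin_balanced bi)
   ultimately show ?case
    unfolding HH.balanced_def biadditive_def add_maps_def by (simp add: Pi_iff)
  next
   case (add V W)
   have "tlift G (ga x y) (V \<oplus>\<^bsub>H2\<^esub> W) = tlift G (ga x y) V \<oplus>\<^bsub>G\<^esub> tlift G (ga x y) W"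
    if "x \<in> carrier H" "y \<in> carrier H" for x y
    using add that by (intro HH.tlift_add bilin_balanced bi)
   then show ?case
    using add(3,4) unfolding HH.balanced_def biadditive_def add_maps_def
    by (simp add: Pi_iff G.a_ac)
  qed
  have "tlift G (ga x y) (V \<oplus>\<^bsub>H2\<^esub> W) = tlift G (ga x y) V \<oplus>\<^bsub>G\<^esub> tlift G (ga x y) W"
   if "x \<in> carrier H" "y \<in> carrier H" for x y
   using add that by (intro HH.tlift_add bilin_balanced bi)
  then have "tlift G (%x y. tlift G (ga x y) (V \<oplus>\<^bsub>H2\<^esub> W)) (comult H h)
    = tlift G (%x y. tlift G (ga x y) V \<oplus>\<^bsub>G\<^esub> tlift G (ga x y) W) (comult H h)"
   using h by (intro HH.tlift_cong comult_H2) auto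
  also have "... = tlift G (%x y. tlift G (ga x y) V) (comult H h) \<oplus>\<^bsub>G\<^esub> tlift G (%x y. tlift G (ga x y) W) (comult H h)"
   using add h by (intro HH.tlift_plus b comult_H2)
  finally show ?case
   using add by (simp add: HH.tlift_add[OF bal_out])
 qed
 from this[OF comult_H2[OF h(2)]] show ?thesis .
qed

end

lemma tensor_cong_actions:
 assumes "!!x a. [|x \<in> carrier M; a \<in> A|] ==> ra x a = ra' x a"
  and "!!y a. [|y \<in> carrier N; a \<in> A|] ==> la a y = la' a y"
 shows "tensor M N A ra la = tensor M N A ra' la'"
proof -
 have "tensor_rels M N A ra la = tensor_rels M N A ra' la'"
  unfolding tensor_rels_def
  by (intro arg_cong2[where f = "(\<union>)"] refl Collect_cong iff_exI) (auto simp: assms)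
 then show ?thesis by (simp add: tensor_def)
qed

definition trilin ::
 "('k, 'r) ring_scheme => ('k, 'm, 'x) module_scheme => ('k, 'g, 'z) module_scheme
  => ('m => 'm => 'm => 'g) => bool"
 where "trilin R M G ga \<longleftrightarrow> (\<forall>x\<in>carrier M. bilin R M M G (ga x)) \<and>
  (\<forall>y\<in>carrier M. \<forall>z\<in>carrier M. lin R M G (%x. ga x y z)) \<and> module R G"

section \<open>Coassociativity, counit and antipode inside Sweedler sums\<close>

context hopf_algebra begin

lemma lin_antipode: "lin R M H f ==> lin R M H (%x. S (f x))"
 by (rule lin_comp[of R H H S]) (simp_all add: lin_def antipode_linear algebra.module_axioms)

lemma antipode_closed [simp]: "h \<in> carrier H ==> S h \<in> carrier H"
 by (rule linear_maps_closed[OF antipode_linear])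

lemma counit_closed [simp]: "h \<in> carrier H ==> counit H h \<in> carrier R"
 by (rule coalgebra.counit_closed)

lemma lin_counit:
 assumes "module R G" "g \<in> carrier G" "lin R M H f"
 shows "lin R M G (%x. counit H (f x) \<odot>\<^bsub>G\<^esub> g)"
proof -
 interpret G: module R G by fact
 have "linH G (%x. counit H x \<odot>\<^bsub>G\<^esub> g)"
  using assms(2) coalgebra.counit_add coalgebra.counit_la
  by (auto simp: lin_def assms(1) G.smult_l_distr G.smult_assoc1 intro!: linear_mapsI)
 then show ?thesis using assms(3) by (rule lin_comp)
qed

sublocale assoc: tensor_assoc H H H "carrier R" "%x r. r \<odot>\<^bsub>H\<^esub> x" "%r x. r \<odot>\<^bsub>H\<^esub> x"
  "carrier R" "%x r. r \<odot>\<^bsub>H\<^esub> x" "%r x. r \<odot>\<^bsub>H\<^esub> x"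
 by unfold_locales (simp_all add: HH.smult_add_maps algebra.smult_assoc1[symmetric] algebra.R.m_comm)

lemma cube_defs:
 "tensor_cube_left R H (%r x. r \<odot>\<^bsub>H\<^esub> x) (%x r. r \<odot>\<^bsub>H\<^esub> x)
  = tensor H2 H (carrier R) (%V b. tmap H2 (%x. x) (%y. b \<odot>\<^bsub>H\<^esub> y) V) (%r x. r \<odot>\<^bsub>H\<^esub> x)"
 "tensor_cube_right R H (%r x. r \<odot>\<^bsub>H\<^esub> x) (%x r. r \<odot>\<^bsub>H\<^esub> x)
  = tensor H H2 (carrier R) (%x r. r \<odot>\<^bsub>H\<^esub> x) (%a Y. tmap H2 (%x. a \<odot>\<^bsub>H\<^esub> x) (%z. z) Y)"
 by (simp_all add: tensor_cube_left_def tensor_cube_right_def square_def)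

lemma comult_add_maps: "comult H \<in> add_maps H H2"
 by (rule linear_maps_add_maps[OF comult_linear])

text \<open>A trilinear \<open>ga\<close> is an additive map \<open>?\<Phi>\<close> on H (x) (H (x)
  H). Applied to the two sides of the coassociativity axiom it gives the two iterated sums.\<close>

lemma sw_coassoc:
 assumes "trilin R H G ga" "h \<in> carrier H"
 shows "sw G (%x z. sw G (%u v. ga u v z) x) h = sw G (%x r. sw G (%u v. ga x u v) r) h" (is "?l = _")
proof -
 interpret G: module R G using assms(1) by (simp add: trilin_def)
 have lin: "linH G (ga x y)" "linH G (%y. ga x y z)" "linH G (%x. ga x y z)"
  if "x \<in> carrier H" "y \<in> carrier H" "z \<in> carrier H" for x y z
  using assms(1) that by (auto simp: trilin_def bilin_def)
 have bal: "HH.balanced G (ga x)" "HH.balanced G (%x y. ga x y z)" if "x \<in> carrier H" "z \<in> carrier H" for x z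
  using that lin by (auto intro!: bilin_balanced simp: bilin_def G.module_axioms)
 let ?L = "tensor H2 H (carrier R) (%V b. tmap H2 (%x. x) (%y. b \<odot>\<^bsub>H\<^esub> y) V) (%r x. r \<odot>\<^bsub>H\<^esub> x)"
 let ?R = "tensor H H2 (carrier R) (%x r. r \<odot>\<^bsub>H\<^esub> x) (%a Y. tmap H2 (%x. a \<odot>\<^bsub>H\<^esub> x) (%z. z) Y)"
 let ?\<Phi> = "tlift G (%x Y. tlift G (ga x) Y)"
 have co: "tassoc ?R H2 (tmap ?L (comult H) (%y. y) (comult H h)) = tmap ?R (%x. x) (comult H) (comult H h)"
  using coalgebra.coassoc[OF assms(2)] by (simp add: square_def cube_defs)
 have hL: "HH.balanced ?L (%x y. comult H x \<boxtimes>\<^bsub>?L\<^esub> y)"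
  by (rule tmap_balanced[OF HH.tensor_product_axioms assoc.ll.tensor_product_axioms refl comult_add_maps add_maps_id])
   (use coalgebra.comult_ra in "simp add: square_def assoc.ll.pure_balanced comult_H2")
 have hR: "HH.balanced ?R (%x y. x \<boxtimes>\<^bsub>?R\<^esub> comult H y)"
  by (rule tmap_balanced[OF HH.tensor_product_axioms assoc.rr.tensor_product_axioms refl add_maps_id comult_add_maps])
   (use coalgebra.comult_la in "simp add: square_def assoc.rr.pure_balanced comult_H2")
 have \<Phi>: "assoc.rr.balanced G (%x Y. tlift G (ga x) Y)"
 proof (intro assoc.rr.balancedI G.abelian_group_axioms biadditiveI)
  fix x assume "x \<in> carrier H"
  then show "tlift G (ga x) \<in> add_maps H2 G" by (intro HH.tlift_add_maps bal)
 next
  fix Y assume Y: "Y \<in> carrier H2"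
  show "(%x. tlift G (ga x) Y) \<in> add_maps H G"
  proof (rule add_mapsI)
   fix x x' assume x: "x \<in> carrier H" "x' \<in> carrier H"
   have "tlift G (ga (x \<oplus>\<^bsub>H\<^esub> x')) Y = tlift G (%y z. ga x y z \<oplus>\<^bsub>G\<^esub> ga x' y z) Y"
    using lin(3) x by (intro HH.tlift_cong Y) (auto simp: lin_def linear_maps_def)
   then show "tlift G (ga (x \<oplus>\<^bsub>H\<^esub> x')) Y = tlift G (ga x) Y \<oplus>\<^bsub>G\<^esub> tlift G (ga x') Y"
    using x by (simp add: HH.tlift_plus[OF bal(1) bal(1) Y])
  qed (intro HH.tlift_closed bal Y)
 next
  fix x r Y assume *: "x \<in> carrier H" "r \<in> carrier R" "Y \<in> carrier H2"
  have rx: "r \<odot>\<^bsub>H\<^esub> x \<in> carrier H" using * by simp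
  show "tlift G (ga (r \<odot>\<^bsub>H\<^esub> x)) Y = tlift G (ga x) (tmap H2 (%x. r \<odot>\<^bsub>H\<^esub> x) (%z. z) Y)"
   by (rule HH.tensor_map_eqI[OF *(3) G.abelian_group_axioms HH.tlift_add_maps[OF bal(1)[OF rx rx]]
     add_maps_comp[OF assoc.la'_add_maps[OF *(2)] HH.tlift_add_maps[OF bal(1)[OF *(1) *(1)]]]])
    (use * rx lin in "auto simp: bal lin_def linear_maps_def")
 qed
 have "?l = sw G (%x z. ?\<Phi> (tassoc ?R H2 (comult H x \<boxtimes>\<^bsub>?L\<^esub> z))) h"
 proof (intro HH.tlift_cong comult_H2 assms(2))
  fix x z assume xz: "x \<in> carrier H" "z \<in> carrier H"
  have "?\<Phi> (tassoc ?R H2 (comult H x \<boxtimes>\<^bsub>?L\<^esub> z)) = sw G (%u v. ?\<Phi> (u \<boxtimes>\<^bsub>?R\<^esub> (v \<boxtimes>\<^bsub>H2\<^esub> z))) x"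
   unfolding assoc.tassoc_pure[OF comult_H2[OF xz(1)] xz(2)]
   by (intro HH.tlift_comp assoc.assoc_inner_balanced xz G.abelian_group_axioms assoc.rr.tlift_add_maps \<Phi> comult_H2)
  also have "... = sw G (%u v. ga u v z) x"
   using xz \<Phi> bal by (intro HH.tlift_cong comult_H2) (simp_all add: HH.pure_closed)
  finally show "sw G (%u v. ga u v z) x = ?\<Phi> (tassoc ?R H2 (comult H x \<boxtimes>\<^bsub>?L\<^esub> z))" by simp
 qed
 also have "... = ?\<Phi> (tassoc ?R H2 (tmap ?L (comult H) (%y. y) (comult H h)))"
  unfolding tmap_def[of ?L]
  by (rule HH.tlift_comp[OF hL G.abelian_group_axioms add_maps_comp[OF assoc.tassoc_add_maps assoc.rr.tlift_add_maps[OF \<Phi>]] comult_H2[OF assms(2)], symmetric])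
 also have "... = ?\<Phi> (tmap ?R (%x. x) (comult H) (comult H h))" by (simp only: co)
 also have "... = sw G (%x y. ?\<Phi> (x \<boxtimes>\<^bsub>?R\<^esub> comult H y)) h"
  unfolding tmap_def[of ?R]
  by (rule HH.tlift_comp[OF hR G.abelian_group_axioms assoc.rr.tlift_add_maps[OF \<Phi>] comult_H2[OF assms(2)]])
 also have "... = sw G (%x r. sw G (%u v. ga x u v) r) h"
  using assms(2) \<Phi> by (intro HH.tlift_cong comult_H2) (simp_all add: comult_H2)
 finally show ?thesis .
qed

lemma sw_counit_left:
 assumes "linH G f" "h \<in> carrier H"
 shows "sw G (%x y. counit H x \<odot>\<^bsub>G\<^esub> f y) h = f h"
proof -
 have b: "bilinH H (%x y. counit H x \<odot>\<^bsub>H\<^esub> y)"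
  by (auto simp: bilin_def algebra.module_axioms lin_smult lin_counit lin_id)
 have "f h = f (sw H (%x y. counit H x \<odot>\<^bsub>H\<^esub> y) h)"
  using coalgebra.counit_left[OF assms(2)] by simp
 also have "... = sw G (%x y. f (counit H x \<odot>\<^bsub>H\<^esub> y)) h"
  by (rule sw_map[OF assms(1) b assms(2)])
 also have "... = sw G (%x y. counit H x \<odot>\<^bsub>G\<^esub> f y) h"
  using assms by (intro HH.tlift_cong comult_H2) (auto simp: lin_def linear_maps_def)
 finally show ?thesis by simp
qed

lemma sw_counit_right:
 assumes "linH G f" "h \<in> carrier H"
 shows "sw G (%x y. counit H y \<odot>\<^bsub>G\<^esub> f x) h = f h"
proof -
 have b: "bilinH H (%x y. counit H y \<odot>\<^bsub>H\<^esub> x)"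
  by (auto simp: bilin_def algebra.module_axioms lin_smult lin_counit lin_id)
 have "f h = f (sw H (%x y. counit H y \<odot>\<^bsub>H\<^esub> x) h)"
  using coalgebra.counit_right[OF assms(2)] by simp
 also have "... = sw G (%x y. f (counit H y \<odot>\<^bsub>H\<^esub> x)) h"
  by (rule sw_map[OF assms(1) b assms(2)])
 also have "... = sw G (%x y. counit H y \<odot>\<^bsub>G\<^esub> f x) h"
  using assms by (intro HH.tlift_cong comult_H2) (auto simp: lin_def linear_maps_def)
 finally show ?thesis by simp
qed

text \<open>Coassociativity brings two adjacent legs together, \<open>\<mu>\<close> turns them into
  a counit, and the counit disappears. Leaving \<open>\<mu>\<close> abstract covers the antipode
  axioms and those of the inverse antipode alike.\<close>

lemma sw_contract_left:
 assumes \<mu>: "bilinH H \<mu>" "!!h. h \<in> carrier H ==> sw H \<mu> h = counit H h \<odot>\<^bsub>H\<^esub> \<one>\<^bsub>H\<^esub>"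
  and ga: "bilinH G ga" and h: "h \<in> carrier H"
 shows "sw G (%x r. sw G (%y z. ga (\<mu> x y) z) r) h = ga \<one>\<^bsub>H\<^esub> h" (is "?l = _")
proof -
 have gal: "linH G (%x. ga x z)" if "z \<in> carrier H" for z using ga that by (simp add: bilin_def)
 have gar: "linH G (ga x)" if "x \<in> carrier H" for x using ga that by (simp add: bilin_def)
 have "trilin R H G (%x y z. ga (\<mu> x y) z)"
  using \<mu>(1) ga by (auto simp: trilin_def bilin_def lin_comp[OF gal] lin_closed)
 then have "?l = sw G (%p z. sw G (%x y. ga (\<mu> x y) z) p) h"
  using sw_coassoc[of G "%x y z. ga (\<mu> x y) z"] h by simp
 also have "... = sw G (%p z. counit H p \<odot>\<^bsub>G\<^esub> ga \<one>\<^bsub>H\<^esub> z) h"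
 proof (intro HH.tlift_cong comult_H2 h)
  fix p z assume p: "p \<in> carrier H" "z \<in> carrier H"
  have "sw G (%x y. ga (\<mu> x y) z) p = ga (sw H \<mu> p) z"
   by (rule sw_map[OF gal[OF p(2)] \<mu>(1) p(1), symmetric])
  also have "... = counit H p \<odot>\<^bsub>G\<^esub> ga \<one>\<^bsub>H\<^esub> z"
   using p gal[OF p(2)] by (auto simp: \<mu>(2) lin_def linear_maps_def)
  finally show "sw G (%x y. ga (\<mu> x y) z) p = counit H p \<odot>\<^bsub>G\<^esub> ga \<one>\<^bsub>H\<^esub> z" .
 qed
 also have "... = ga \<one>\<^bsub>H\<^esub> h" by (rule sw_counit_left[OF gar h]) simp
 finally show ?thesis .
qed

lemma sw_contract_right:
 assumes \<mu>: "bilinH H \<mu>" "!!h. h \<in> carrier H ==> sw H \<mu> h = counit H h \<odot>\<^bsub>H\<^esub> \<one>\<^bsub>H\<^esub>"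
  and ga: "bilinH G ga" and h: "h \<in> carrier H"
 shows "sw G (%x r. sw G (%y z. ga x (\<mu> y z)) r) h = ga h \<one>\<^bsub>H\<^esub>" (is "?l = _")
proof -
 have gal: "linH G (%x. ga x z)" if "z \<in> carrier H" for z using ga that by (simp add: bilin_def)
 have gar: "linH G (ga x)" if "x \<in> carrier H" for x using ga that by (simp add: bilin_def)
 have "?l = sw G (%x r. counit H r \<odot>\<^bsub>G\<^esub> ga x \<one>\<^bsub>H\<^esub>) h"
 proof (intro HH.tlift_cong comult_H2 h)
  fix x p assume p: "x \<in> carrier H" "p \<in> carrier H"
  have "sw G (%y z. ga x (\<mu> y z)) p = ga x (sw H \<mu> p)"
   by (rule sw_map[OF gar[OF p(1)] \<mu>(1) p(2), symmetric])
  also have "... = counit H p \<odot>\<^bsub>G\<^esub> ga x \<one>\<^bsub>H\<^esub>"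
   using p gar[OF p(1)] by (auto simp: \<mu>(2) lin_def linear_maps_def)
  finally show "sw G (%y z. ga x (\<mu> y z)) p = counit H p \<odot>\<^bsub>G\<^esub> ga x \<one>\<^bsub>H\<^esub>" .
 qed
 also have "... = ga h \<one>\<^bsub>H\<^esub>" by (rule sw_counit_right[OF gal h]) simp
 finally show ?thesis .
qed

lemma H_alg: "k_algebra R H" and H_mod: "module R H"
 using algebra.k_algebra_axioms algebra.module_axioms by simp_all

lemmas lin_rules = lin_id[OF H_mod] lin_antipode lin_mult_left lin_mult_right lin_sw_arg lin_sw_param
 bilin_def trilin_def H_alg H_mod

lemma comult_one: "comult H \<one>\<^bsub>H\<^esub> = \<one>\<^bsub>H\<^esub> \<boxtimes>\<^bsub>H2\<^esub> \<one>\<^bsub>H\<^esub>"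
 using alg_hom_one[OF comult_alg_hom] by (simp add: square_def HH.tensor_one)

lemma sw_one: "bilinH G be ==> sw G be \<one>\<^bsub>H\<^esub> = be \<one>\<^bsub>H\<^esub> \<one>\<^bsub>H\<^esub>"
 by (subst comult_one) (simp add: bilin_balanced)

text \<open>Over the commutative base \<open>k\<close> every element of \<open>H \<otimes> H\<close> lies in the Takeuchi product.\<close>

interpretation tk: takeuchi R H R "%r. r \<odot>\<^bsub>H\<^esub> \<one>\<^bsub>H\<^esub>" "%r. r \<odot>\<^bsub>H\<^esub> \<one>\<^bsub>H\<^esub>"
 by unfold_locales simp_all

lemma tk_TB: "left_tensor H R (%r. r \<odot>\<^bsub>H\<^esub> \<one>\<^bsub>H\<^esub>) (%r. r \<odot>\<^bsub>H\<^esub> \<one>\<^bsub>H\<^esub>) = H2"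
 unfolding tk.TB_def by (rule tensor_cong_actions) (simp_all add: algebra.smult_mult_left)

lemma tk_rmul:
 "u \<in> carrier H ==> v \<in> carrier H ==> x \<in> carrier H ==> y \<in> carrier H ==>
  tk.rmul u v (x \<boxtimes>\<^bsub>H2\<^esub> y) = (x \<cdot> u) \<boxtimes>\<^bsub>H2\<^esub> (y \<cdot> v)"
 using tk.rmul_pure by (simp only: tk_TB)

lemma tk_TK: "carrier (left_takeuchi H R (%r. r \<odot>\<^bsub>H\<^esub> \<one>\<^bsub>H\<^esub>) (%r. r \<odot>\<^bsub>H\<^esub> \<one>\<^bsub>H\<^esub>)) = carrier H2"
proof (intro equalityI subsetI)
 fix V assume V: "V \<in> carrier H2"
 have "tk.rmul (a \<odot>\<^bsub>H\<^esub> \<one>\<^bsub>H\<^esub>) \<one>\<^bsub>H\<^esub> V = tk.rmul \<one>\<^bsub>H\<^esub> (a \<odot>\<^bsub>H\<^esub> \<one>\<^bsub>H\<^esub>) V" if a: "a \<in> carrier R" for a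
  by (rule HH.tensor_map_eqI[OF V HH.tensor_abelian_group])
   (use a tk.rmul_add_maps[unfolded tk_TB] in "simp_all add: tk_rmul algebra.smult_mult_right HH.pure_balanced")
 then show "V \<in> carrier (left_takeuchi H R (%r. r \<odot>\<^bsub>H\<^esub> \<one>\<^bsub>H\<^esub>) (%r. r \<odot>\<^bsub>H\<^esub> \<one>\<^bsub>H\<^esub>))"
  unfolding tk.TK_iff using V by (simp add: tk_TB)
qed (use tk.TK_TB in "simp add: tk_TB")

lemma H2_algebra: "k_algebra R H2"
proof -
 have "left_takeuchi H R (%r. r \<odot>\<^bsub>H\<^esub> \<one>\<^bsub>H\<^esub>) (%r. r \<odot>\<^bsub>H\<^esub> \<one>\<^bsub>H\<^esub>) = H2"
  using tk_TK by (simp add: left_takeuchi_def Let_def tk_TB)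
 then show ?thesis using tk.takeuchi_algebra by simp
qed

lemma H2_mult_pure:
 assumes "u \<in> carrier H" "v \<in> carrier H" "x \<in> carrier H" "y \<in> carrier H"
 shows "(x \<boxtimes>\<^bsub>H2\<^esub> y) \<otimes>\<^bsub>H2\<^esub> (u \<boxtimes>\<^bsub>H2\<^esub> v) = (x \<cdot> u) \<boxtimes>\<^bsub>H2\<^esub> (y \<cdot> v)"
 using tk.mult_eq_tmul[unfolded tk_TB tk_TK, of "x \<boxtimes>\<^bsub>H2\<^esub> y" "u \<boxtimes>\<^bsub>H2\<^esub> v"]
  tk.tmul_pure[unfolded tk_TB tk_TK, of "x \<boxtimes>\<^bsub>H2\<^esub> y" u v] assms
 by (simp add: HH.pure_closed tk_rmul)

text \<open>Multiplicativity of the comultiplication: \<open>comult H (h \<cdot> k)\<close> is the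
  product in H (x) H, which the instance \<open>tk\<close> of the Takeuchi locale expresses as right
  multiplication of the coproduct of \<open>h\<close> by the legs of \<open>k\<close>.\<close>

lemma sw_mult:
 assumes "bilinH G be" "h \<in> carrier H" "k \<in> carrier H"
 shows "sw G be (h \<cdot> k) = sw G (%u v. sw G (%x y. be (x \<cdot> u) (y \<cdot> v)) h) k"
proof -
 interpret G: module R G using assms(1) by (simp add: bilin_def)
 note bal = bilin_balanced[OF assms(1)]
 have tb: "tk.balanced H2 (%u v. tk.rmul u v (comult H h))"
  using tk.tmul_balanced[unfolded tk_TB tk_TK] assms comult_H2 by blast
 have HT: "HH.balanced H2 (%u v. tk.rmul u v (comult H h))"
  using tb unfolding tk.balanced_def HH.balanced_def by (simp add: algebra.smult_mult_left)
 have "comult H (h \<cdot> k) = tlift H2 (%u v. tk.rmul u v (comult H h)) (comult H k)"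
  using alg_hom_mult[OF comult_alg_hom] assms tk.mult_eq_tmul[unfolded tk_TB tk_TK]
  by (simp add: square_def comult_H2 tk.tmul_def tk_TB)
 then have "sw G be (h \<cdot> k) = sw G (%u v. tlift G be (tk.rmul u v (comult H h))) k"
  using HH.tlift_comp[OF HT G.abelian_group_axioms HH.tlift_add_maps[OF bal] comult_H2[OF assms(3)]]
  by (rule ssubst)
 also have "... = sw G (%u v. sw G (%x y. be (x \<cdot> u) (y \<cdot> v)) h) k"
 proof (intro HH.tlift_cong comult_H2 assms(3))
  fix u v assume uv: "u \<in> carrier H" "v \<in> carrier H"
  show "tlift G be (tk.rmul u v (comult H h)) = sw G (%x y. be (x \<cdot> u) (y \<cdot> v)) h"
   by (rule HH.tlift_comp'[OF _ G.abelian_group_axioms add_maps_comp[OF tk.rmul_add_maps[unfolded tk_TB] HH.tlift_add_maps[OF bal]] comult_H2, symmetric])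
    (simp_all add: uv assms tk_rmul bal)
 qed
 finally show ?thesis .
qed

end

lemma (in tensor_product) tlift_id: "V \<in> carrier T ==> tlift T (%x y. x \<boxtimes>\<^bsub>T\<^esub> y) V = V"
 by (rule tlift_comp'[where f = "%V. V"]) (simp_all add: tensor_abelian_group add_maps_id)

section \<open>The antipode reverses products and coproducts\<close>

context hopf_algebra begin

lemma counit_one [simp]: "counit H \<one>\<^bsub>H\<^esub> = \<one>\<^bsub>R\<^esub>"
 and counit_mult: "h \<in> carrier H ==> k \<in> carrier H ==> counit H (h \<cdot> k) = counit H h \<otimes>\<^bsub>R\<^esub> counit H k"
 using counit_ring_hom by (auto simp: ring_hom_def)

lemma mult_sw_left:
 "[|k_algebra R B; b \<in> carrier B; bilinH B be; h \<in> carrier H|] ==>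
  b \<otimes>\<^bsub>B\<^esub> sw B be h = sw B (%x y. b \<otimes>\<^bsub>B\<^esub> be x y) h"
 by (rule sw_map[OF lin_mult_left]) (auto simp: bilin_def intro: lin_id)

lemma mult_sw_right:
 "[|k_algebra R B; b \<in> carrier B; bilinH B be; h \<in> carrier H|] ==>
  sw B be h \<otimes>\<^bsub>B\<^esub> b = sw B (%x y. be x y \<otimes>\<^bsub>B\<^esub> b) h"
 by (rule sw_map[OF lin_mult_right, of _ _ B "%x. x"]) (auto simp: bilin_def intro: lin_id)

lemma bilin_mult:
 "k_algebra R B ==> linH B f ==> linH B g ==> bilinH B (%x y. f x \<otimes>\<^bsub>B\<^esub> g y)"
 by (simp add: bilin_def lin_closed lin_mult_left lin_mult_right k_algebra.axioms(1))

text \<open>Left and right inverse of \<open>p\<close> in the convolution algebra coincide: u =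
  u(pv) = (up)v = v, with convolution products.\<close>

lemma convolution_inverse_unique:
 assumes B: "k_algebra R B" and lin: "linH B u" "linH B p" "linH B v"
  and up: "!!h. h \<in> carrier H ==> sw B (%x y. u x \<otimes>\<^bsub>B\<^esub> p y) h = counit H h \<odot>\<^bsub>B\<^esub> \<one>\<^bsub>B\<^esub>"
  and pv: "!!h. h \<in> carrier H ==> sw B (%x y. p x \<otimes>\<^bsub>B\<^esub> v y) h = counit H h \<odot>\<^bsub>B\<^esub> \<one>\<^bsub>B\<^esub>"
  and h: "h \<in> carrier H"
 shows "u h = v h"
proof -
 interpret B: k_algebra R B by fact
 note cl = lin(1)[THEN lin_closed] lin(2)[THEN lin_closed] lin(3)[THEN lin_closed]
 have "u h = sw B (%x r. counit H r \<odot>\<^bsub>B\<^esub> u x) h"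
  by (rule sw_counit_right[OF lin(1) h, symmetric])
 also have "... = sw B (%x r. u x \<otimes>\<^bsub>B\<^esub> sw B (%y z. p y \<otimes>\<^bsub>B\<^esub> v z) r) h"
  using h by (intro sw_cong) (simp_all add: pv cl B.smult_mult_right)
 also have "... = sw B (%x r. sw B (%y z. u x \<otimes>\<^bsub>B\<^esub> p y \<otimes>\<^bsub>B\<^esub> v z) r) h"
  using h by (intro sw_cong) (simp_all add: mult_sw_left[OF B] bilin_mult[OF B lin(2,3)] cl B.m_assoc)
 also have "... = sw B (%p' z. sw B (%x y. u x \<otimes>\<^bsub>B\<^esub> p y \<otimes>\<^bsub>B\<^esub> v z) p') h"
  by (rule sw_coassoc[symmetric])
   (simp_all add: h trilin_def bilin_def B lin cl lin_mult_left lin_mult_right B.module_axioms)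
 also have "... = sw B (%p' z. sw B (%x y. u x \<otimes>\<^bsub>B\<^esub> p y) p' \<otimes>\<^bsub>B\<^esub> v z) h"
  using h by (intro sw_cong) (simp_all add: mult_sw_right[OF B] bilin_mult[OF B lin(1,2)] cl)
 also have "... = sw B (%p' z. counit H p' \<odot>\<^bsub>B\<^esub> v z) h"
  using h by (intro sw_cong) (simp_all add: up cl B.smult_mult_left)
 also have "... = v h" by (rule sw_counit_left[OF lin(3) h])
 finally show ?thesis .
qed

lemma antipode_one [simp]: "S \<one>\<^bsub>H\<^esub> = \<one>\<^bsub>H\<^esub>"
 using antipode_left[OF algebra.one_closed] by (simp add: sw_one lin_rules)

lemma contract_SL:
 "bilinH G ga ==> h \<in> carrier H ==> sw G (%x r. sw G (%y z. ga (S x \<cdot> y) z) r) h = ga \<one>\<^bsub>H\<^esub> h"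
 "bilinH G ga ==> h \<in> carrier H ==> sw G (%x r. sw G (%y z. ga x (S y \<cdot> z)) r) h = ga h \<one>\<^bsub>H\<^esub>"
 by (rule sw_contract_left[of "%x y. S x \<cdot> y"] sw_contract_right[of "%x y. S x \<cdot> y"];
   simp add: antipode_left lin_rules)+

lemma contract_SR:
 "bilinH G ga ==> h \<in> carrier H ==> sw G (%x r. sw G (%y z. ga (x \<cdot> S y) z) r) h = ga \<one>\<^bsub>H\<^esub> h"
 "bilinH G ga ==> h \<in> carrier H ==> sw G (%x r. sw G (%y z. ga x (y \<cdot> S z)) r) h = ga h \<one>\<^bsub>H\<^esub>"
 by (rule sw_contract_left[of "%x y. x \<cdot> S y"] sw_contract_right[of "%x y. x \<cdot> S y"];
   simp add: antipode_right lin_rules)+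

text \<open>Both sides are convolution inverses of the multiplication H (x) H -> H. The argument for
  uniqueness of inverses is written out with explicit sums, because
  \<open>convolution_inverse_unique\<close> concerns maps defined on \<open>H\<close> and not on H
  (x) H.\<close>

lemma antipode_mult:
 assumes h: "h \<in> carrier H" and k: "k \<in> carrier H"
 shows "S (h \<cdot> k) = S k \<cdot> S h"
proof -
 \<comment> \<open>The pair h_(2) S(h_(3)) is inserted behind S(h_(1) k); the next step inserts
   k_(2) S(k_(3)) between its two members.\<close>
 have "S (h \<cdot> k) = sw H (%x r. sw H (%y z. S (x \<cdot> k) \<cdot> (y \<cdot> S z)) r) h"
  using h k by (subst contract_SR(2)[where ga = "%x w. S (x \<cdot> k) \<cdot> w"]) (simp_all add: lin_rules)
 also have "... = sw H (%x r. sw H (%y z. sw H (%a s. sw H (%b c.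
   S (x \<cdot> a) \<cdot> (y \<cdot> b) \<cdot> (S c \<cdot> S z)) s) k) r) h"
 proof (intro sw_cong; (simp add: h)?)
  fix x r y z assume *: "x \<in> carrier H" "r \<in> carrier H" "y \<in> carrier H" "z \<in> carrier H"
  have "sw H (%a s. sw H (%b c. S (x \<cdot> a) \<cdot> (y \<cdot> b) \<cdot> (S c \<cdot> S z)) s) k
    = sw H (%a s. sw H (%b c. S (x \<cdot> a) \<cdot> (y \<cdot> (b \<cdot> S c) \<cdot> S z)) s) k"
   using * k by (intro sw_cong) (simp_all add: algebra.m_assoc)
  also have "... = S (x \<cdot> k) \<cdot> (y \<cdot> S z)"
   using * k by (subst contract_SR(2)[where ga = "%a w. S (x \<cdot> a) \<cdot> (y \<cdot> w \<cdot> S z)"])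
    (simp_all add: lin_rules)
  finally show "S (x \<cdot> k) \<cdot> (y \<cdot> S z) =
   sw H (%a s. sw H (%b c. S (x \<cdot> a) \<cdot> (y \<cdot> b) \<cdot> (S c \<cdot> S z)) s) k" ..
 qed
 also have "... = sw H (%p z. sw H (%x y. sw H (%a s. sw H (%b c.
   S (x \<cdot> a) \<cdot> (y \<cdot> b) \<cdot> (S c \<cdot> S z)) s) k) p) h"
  using h k by (intro sw_coassoc[symmetric]) (simp_all add: lin_rules)
 also have "... = sw H (%p z. sw H (%x y. sw H (%q c. sw H (%a b.
   S (x \<cdot> a) \<cdot> (y \<cdot> b) \<cdot> (S c \<cdot> S z)) q) k) p) h"
  using h k by (simp add: sw_coassoc lin_rules)
 also have "... = sw H (%p z. sw H (%q c. sw H (%x y. sw H (%a b.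
   S (x \<cdot> a) \<cdot> (y \<cdot> b) \<cdot> (S c \<cdot> S z)) q) p) k) h"
  using h k by (intro sw_cong refl sw_swap) (simp_all add: lin_rules)
 \<comment> \<open>After regrouping, S(p_(1) q_(1)) p_(2) q_(2) is the left antipode axiom at the
   product of \<open>p\<close> and \<open>q\<close>, so it contributes two counits.\<close>
 also have "... = sw H (%p z. sw H (%q c. counit H p \<odot>\<^bsub>H\<^esub> (counit H q \<odot>\<^bsub>H\<^esub> (S c \<cdot> S z))) k) h"
 proof (intro sw_cong refl; (simp add: h k)?)
  fix p z q c assume *: "p \<in> carrier H" "z \<in> carrier H" "q \<in> carrier H" "c \<in> carrier H"
  have "sw H (%x y. sw H (%a b. S (x \<cdot> a) \<cdot> (y \<cdot> b) \<cdot> (S c \<cdot> S z)) q) p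
    = sw H (%a b. sw H (%x y. S (x \<cdot> a) \<cdot> (y \<cdot> b) \<cdot> (S c \<cdot> S z)) p) q"
   using * by (intro sw_swap) (simp_all add: lin_rules)
  also have "... = sw H (%u v. S u \<cdot> v \<cdot> (S c \<cdot> S z)) (p \<cdot> q)"
   using * by (intro sw_mult[symmetric]) (simp_all add: lin_rules)
  also have "... = sw H (%u v. S u \<cdot> v) (p \<cdot> q) \<cdot> (S c \<cdot> S z)"
   using * by (intro mult_sw_right[symmetric]) (simp_all add: lin_rules)
  also have "... = counit H p \<odot>\<^bsub>H\<^esub> (counit H q \<odot>\<^bsub>H\<^esub> (S c \<cdot> S z))"
   using * by (simp add: antipode_left counit_mult algebra.smult_mult_left algebra.smult_assoc1)
  finally show "sw H (%x y. sw H (%a b. S (x \<cdot> a) \<cdot> (y \<cdot> b) \<cdot> (S c \<cdot> S z)) q) p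
   = counit H p \<odot>\<^bsub>H\<^esub> (counit H q \<odot>\<^bsub>H\<^esub> (S c \<cdot> S z))" .
 qed
 also have "... = sw H (%p z. counit H p \<odot>\<^bsub>H\<^esub> (S k \<cdot> S z)) h"
 proof (intro sw_cong refl; (simp add: h k)?)
  fix p z assume *: "p \<in> carrier H" "z \<in> carrier H"
  have "sw H (%q c. counit H p \<odot>\<^bsub>H\<^esub> (counit H q \<odot>\<^bsub>H\<^esub> (S c \<cdot> S z))) k
    = sw H (%q c. counit H q \<odot>\<^bsub>H\<^esub> (counit H p \<odot>\<^bsub>H\<^esub> (S c \<cdot> S z))) k"
   using * k by (intro sw_cong) (simp_all add: algebra.smult_assoc1[symmetric] algebra.R.m_comm)
  also have "... = counit H p \<odot>\<^bsub>H\<^esub> (S k \<cdot> S z)"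
   using * k by (intro sw_counit_left) (simp_all add: lin_rules lin_smult)
  finally show "sw H (%q c. counit H p \<odot>\<^bsub>H\<^esub> (counit H q \<odot>\<^bsub>H\<^esub> (S c \<cdot> S z))) k
   = counit H p \<odot>\<^bsub>H\<^esub> (S k \<cdot> S z)" by simp
 qed
 also have "... = S k \<cdot> S h"
  using h k by (intro sw_counit_left) (simp_all add: lin_rules)
 finally show ?thesis .
qed

lemma lin_pure_right: "x \<in> carrier H ==> lin R Q H f ==> lin R Q H2 (%y. pure_tensor H2 x (f y))"
 by (rule lin_comp[of R H H2 "%y. pure_tensor H2 x y" Q f])
  (simp_all add: lin_def linear_maps_def HH.tensor_is_module HH.pure_closed HH.pure_add_right HH.pure_balanced[symmetric])

lemma lin_comult: "linH H2 (comult H)"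
 by (simp add: lin_def comult_linear HH.tensor_is_module)

text \<open>In the convolution algebra of maps H -> H (x) H, the composite of Delta with S is a left
  inverse of Delta and h -> S(h_(2)) (x) S(h_(1)) is a right inverse.\<close>

lemma comult_antipode:
 assumes "h \<in> carrier H"
 shows "comult H (S h) = sw H2 (%x y. S y \<boxtimes>\<^bsub>H2\<^esub> S x) h"
proof (rule convolution_inverse_unique[OF H2_algebra, where u = "%h. comult H (S h)" and p = "comult H"])
 note rules = lin_rules HH.lin_pure_left lin_pure_right HH.tensor_is_module H2_algebra
 interpret H2: k_algebra R H2 by (rule H2_algebra)
 have sq: "comult H x \<in> carrier H2" if "x \<in> carrier H" for x using that by (rule comult_H2)
 show l1: "linH H2 (%h. comult H (S h))"
  by (rule lin_comp[OF lin_comult]) (simp add: lin_rules)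
 show "linH H2 (comult H)" by (rule lin_comult)
 show "linH H2 (%h. sw H2 (%x y. S y \<boxtimes>\<^bsub>H2\<^esub> S x) h)"
  by (simp add: rules)
 show "h \<in> carrier H" by fact
 have com: "comult H (x \<cdot> y) = comult H x \<otimes>\<^bsub>H2\<^esub> comult H y" if "x \<in> carrier H" "y \<in> carrier H" for x y
  using alg_hom_mult[OF comult_alg_hom that] by (simp add: square_def)
 show "sw H2 (%x y. comult H (S x) \<otimes>\<^bsub>H2\<^esub> comult H y) h = counit H h \<odot>\<^bsub>H2\<^esub> \<one>\<^bsub>H2\<^esub>"
  if h: "h \<in> carrier H" for h
 proof -
  have "sw H2 (%x y. comult H (S x) \<otimes>\<^bsub>H2\<^esub> comult H y) h = sw H2 (%x y. comult H (S x \<cdot> y)) h"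
   using h by (intro sw_cong) (simp_all add: com)
  also have "... = comult H (sw H (%x y. S x \<cdot> y) h)"
   using h by (intro sw_map[OF lin_comult, symmetric]) (simp_all add: lin_rules)
  also have "... = comult H (counit H h \<odot>\<^bsub>H\<^esub> \<one>\<^bsub>H\<^esub>)" using h by (simp add: antipode_left)
  also have "... = counit H h \<odot>\<^bsub>H2\<^esub> comult H \<one>\<^bsub>H\<^esub>"
   using h by (intro linear_maps_smult[OF comult_linear]) simp_all
  finally show ?thesis by (simp only: comult_one HH.tensor_one)
 qed
 show "sw H2 (%x y. comult H x \<otimes>\<^bsub>H2\<^esub> sw H2 (%x y. S y \<boxtimes>\<^bsub>H2\<^esub> S x) y) h = counit H h \<odot>\<^bsub>H2\<^esub> \<one>\<^bsub>H2\<^esub>"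
  if h: "h \<in> carrier H" for h
 proof -
  have c: "comult H x = sw H2 (%a b. a \<boxtimes>\<^bsub>H2\<^esub> b) x" if "x \<in> carrier H" for x
   using HH.tlift_id[OF sq[OF that]] ..
  have "sw H2 (%x y. comult H x \<otimes>\<^bsub>H2\<^esub> sw H2 (%x y. S y \<boxtimes>\<^bsub>H2\<^esub> S x) y) h
    = sw H2 (%x y. sw H2 (%a b. sw H2 (%c d. (a \<cdot> S d) \<boxtimes>\<^bsub>H2\<^esub> (b \<cdot> S c)) y) x) h"
  proof (intro sw_cong refl; (simp add: h)?)
   fix x y assume *: "x \<in> carrier H" "y \<in> carrier H"
   have "comult H x \<otimes>\<^bsub>H2\<^esub> sw H2 (%x y. S y \<boxtimes>\<^bsub>H2\<^esub> S x) y
     = sw H2 (%a b. a \<boxtimes>\<^bsub>H2\<^esub> b) x \<otimes>\<^bsub>H2\<^esub> sw H2 (%x y. S y \<boxtimes>\<^bsub>H2\<^esub> S x) y"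
    using c[OF *(1)] by (rule arg_cong)
   also have "... = sw H2 (%a b. sw H2 (%c d. (a \<cdot> S d) \<boxtimes>\<^bsub>H2\<^esub> (b \<cdot> S c)) y) x"
    using * by (simp add: mult_sw_right rules HH.pure_closed)
     (simp add: mult_sw_left rules HH.pure_closed H2_mult_pure)
   finally show "comult H x \<otimes>\<^bsub>H2\<^esub> sw H2 (%x y. S y \<boxtimes>\<^bsub>H2\<^esub> S x) y
     = sw H2 (%a b. sw H2 (%c d. (a \<cdot> S d) \<boxtimes>\<^bsub>H2\<^esub> (b \<cdot> S c)) y) x" .
  qed
  also have "... = sw H2 (%a r. sw H2 (%b y. sw H2 (%c d. (a \<cdot> S d) \<boxtimes>\<^bsub>H2\<^esub> (b \<cdot> S c)) y) r) h"
   using h by (intro sw_coassoc) (simp_all add: rules)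
  also have "... = sw H2 (%a r. (a \<cdot> S r) \<boxtimes>\<^bsub>H2\<^esub> \<one>\<^bsub>H\<^esub>) h"
   using h by (intro sw_cong refl contract_SR(1)[where ga = "%w d. (_ \<cdot> S d) \<boxtimes>\<^bsub>H2\<^esub> w"]) (simp_all add: rules)
  also have "... = sw H (%a r. a \<cdot> S r) h \<boxtimes>\<^bsub>H2\<^esub> \<one>\<^bsub>H\<^esub>"
   using h by (intro sw_map[OF HH.lin_pure_left, of _ H "%x. x", symmetric]) (simp_all add: rules)
  also have "... = counit H h \<odot>\<^bsub>H2\<^esub> (\<one>\<^bsub>H\<^esub> \<boxtimes>\<^bsub>H2\<^esub> \<one>\<^bsub>H\<^esub>)"
   using h by (simp add: antipode_right)
  finally show ?thesis by (simp only: HH.tensor_one)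
 qed
qed

lemma sw_antipode:
 assumes "bilinH G be" "h \<in> carrier H"
 shows "sw G be (S h) = sw G (%x y. be (S y) (S x)) h"
proof -
 interpret G: module R G using assms(1) by (simp add: bilin_def)
 have b: "bilinH H2 (%x y. S y \<boxtimes>\<^bsub>H2\<^esub> S x)"
  by (simp add: lin_rules HH.lin_pure_left lin_pure_right HH.tensor_is_module)
 have "sw G be (S h) = tlift G be (sw H2 (%x y. S y \<boxtimes>\<^bsub>H2\<^esub> S x) h)"
  by (subst comult_antipode[OF assms(2)]) (rule refl)
 also have "... = sw G (%x y. tlift G be (S y \<boxtimes>\<^bsub>H2\<^esub> S x)) h"
  by (rule HH.tlift_comp[OF bilin_balanced[OF b] G.abelian_group_axioms HH.tlift_add_maps[OF bilin_balanced[OF assms(1)]] comult_H2[OF assms(2)]])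
 also have "... = sw G (%x y. be (S y) (S x)) h"
  using assms by (intro sw_cong) (simp_all add: bilin_balanced)
 finally show ?thesis .
qed

end

section \<open>Hopf algebras with invertible antipode\<close>

text \<open>The inverse antipode is a parameter, fixed only by its equations on the carrier. Then
  \<open>H\<close> with inverse \<open>Z\<close>, and the opposite algebra with antipode
  \<open>Z\<close> and inverse S, are instances of the same locale.\<close>

locale hopf_inv = hopf_algebra R H
 for R :: "'k ring" and H :: "('k, 'h) hopf_algebra" +
 fixes Z :: "'h => 'h"
 assumes Z_closed [simp]: "h \<in> carrier H ==> Z h \<in> carrier H"
  and antipode_Z [simp]: "h \<in> carrier H ==> antipode H (Z h) = h"
  and Z_antipode [simp]: "h \<in> carrier H ==> Z (antipode H h) = h"
begin

lemma Z_linear: "Z \<in> linear_maps R H H"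
proof (rule linear_mapsI)
 fix x y assume *: "x \<in> carrier H" "y \<in> carrier H"
 have "S (Z x \<oplus>\<^bsub>H\<^esub> Z y) = x \<oplus>\<^bsub>H\<^esub> y"
  using * by (simp add: linear_maps_add[OF antipode_linear])
 then show "Z (x \<oplus>\<^bsub>H\<^esub> y) = Z x \<oplus>\<^bsub>H\<^esub> Z y" using * by (metis Z_antipode Z_closed algebra.a_closed)
next
 fix r x assume *: "r \<in> carrier R" "x \<in> carrier H"
 have "S (r \<odot>\<^bsub>H\<^esub> Z x) = r \<odot>\<^bsub>H\<^esub> x"
  using * by (simp add: linear_maps_smult[OF antipode_linear])
 then show "Z (r \<odot>\<^bsub>H\<^esub> x) = r \<odot>\<^bsub>H\<^esub> Z x" using * by (metis Z_antipode Z_closed algebra.smult_closed)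
qed simp

lemma lin_Z: "lin R M H f ==> lin R M H (%x. Z (f x))"
 by (rule lin_comp[of R H H Z]) (simp_all add: lin_def Z_linear algebra.module_axioms)

lemma Z_mult: "h \<in> carrier H ==> k \<in> carrier H ==> Z (h \<cdot> k) = Z k \<cdot> Z h"
 using antipode_mult[of "Z k" "Z h"] Z_antipode[of "Z k \<cdot> Z h"] by simp

lemma Z_one [simp]: "Z \<one>\<^bsub>H\<^esub> = \<one>\<^bsub>H\<^esub>"
 using Z_antipode[OF algebra.one_closed] by simp

lemma sw_Z:
 assumes "bilinH G be" "h \<in> carrier H"
 shows "sw G be (Z h) = sw G (%x y. be (Z y) (Z x)) h"
proof -
 have "bilinH G (%x y. be (Z y) (Z x))"
  using assms(1) unfolding bilin_def by (auto intro: lin_comp[OF _ lin_Z] simp: lin_id[OF H_mod])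
 then have "sw G (%x y. be (Z y) (Z x)) (S (Z h)) = sw G (%x y. be (Z (S x)) (Z (S y))) (Z h)"
  using assms(2) by (intro sw_antipode) simp_all
 also have "... = sw G be (Z h)"
  using assms(2) by (intro sw_cong) simp_all
 finally show ?thesis using assms(2) by simp
qed

text \<open>Applying S, which is injective on the carrier, reverses the product and leaves the left
  antipode axiom.\<close>

lemma Z_left: "h \<in> carrier H ==> sw H (%x y. Z y \<cdot> x) h = counit H h \<odot>\<^bsub>H\<^esub> \<one>\<^bsub>H\<^esub>"
proof -
 assume h: "h \<in> carrier H"
 have "S (sw H (%x y. Z y \<cdot> x) h) = sw H (%x y. S (Z y \<cdot> x)) h"
  using h by (intro sw_map) (simp_all add: lin_rules lin_Z)
 also have "... = sw H (%x y. S x \<cdot> y) h" using h by (intro sw_cong) (simp_all add: antipode_mult)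
 finally have "Z (S (sw H (%x y. Z y \<cdot> x) h)) = Z (counit H h \<odot>\<^bsub>H\<^esub> \<one>\<^bsub>H\<^esub>)"
  using h by (simp add: antipode_left)
 then show ?thesis
  using h by (simp add: linear_maps_smult[OF Z_linear] lin_rules lin_Z)
qed

lemma Z_right: "h \<in> carrier H ==> sw H (%x y. y \<cdot> Z x) h = counit H h \<odot>\<^bsub>H\<^esub> \<one>\<^bsub>H\<^esub>"
proof -
 assume h: "h \<in> carrier H"
 have "S (sw H (%x y. y \<cdot> Z x) h) = sw H (%x y. S (y \<cdot> Z x)) h"
  using h by (intro sw_map) (simp_all add: lin_rules lin_Z)
 also have "... = sw H (%x y. x \<cdot> S y) h" using h by (intro sw_cong) (simp_all add: antipode_mult)
 finally have "Z (S (sw H (%x y. y \<cdot> Z x) h)) = Z (counit H h \<odot>\<^bsub>H\<^esub> \<one>\<^bsub>H\<^esub>)"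
  using h by (simp add: antipode_right)
 then show ?thesis
  using h by (simp add: linear_maps_smult[OF Z_linear] lin_rules lin_Z)
qed

lemma contract_ZL:
 "bilinH G ga ==> h \<in> carrier H ==> sw G (%x r. sw G (%y z. ga (Z y \<cdot> x) z) r) h = ga \<one>\<^bsub>H\<^esub> h"
 "bilinH G ga ==> h \<in> carrier H ==> sw G (%x r. sw G (%y z. ga x (Z z \<cdot> y)) r) h = ga h \<one>\<^bsub>H\<^esub>"
 by (rule sw_contract_left[of "%x y. Z y \<cdot> x"] sw_contract_right[of "%x y. Z y \<cdot> x"];
   simp add: Z_left lin_rules lin_Z)+

lemma contract_ZR:
 "bilinH G ga ==> h \<in> carrier H ==> sw G (%x r. sw G (%y z. ga (y \<cdot> Z x) z) r) h = ga \<one>\<^bsub>H\<^esub> h"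
 "bilinH G ga ==> h \<in> carrier H ==> sw G (%x r. sw G (%y z. ga x (z \<cdot> Z y)) r) h = ga h \<one>\<^bsub>H\<^esub>"
 by (rule sw_contract_left[of "%x y. y \<cdot> Z x"] sw_contract_right[of "%x y. y \<cdot> Z x"];
   simp add: Z_right lin_rules lin_Z)+

end

text \<open>The opposite algebra with unchanged coalgebra structure; its antipode is the inverse of
  the original one. Applied a second time, with the original antipode, the construction returns
  \<open>H\<close> itself and not merely an isomorphic copy.\<close>

definition op_hopf :: "('h => 'h) => ('k, 'h) hopf_algebra => ('k, 'h) hopf_algebra"
 where "op_hopf Z H = op_alg (H\<lparr>antipode := Z\<rparr>)"

lemma op_hopf_simps [simp]:
 "carrier (op_hopf Z H) = carrier H" "\<one>\<^bsub>op_hopf Z H\<^esub> = \<one>\<^bsub>H\<^esub>" "\<zero>\<^bsub>op_hopf Z H\<^esub> = \<zero>\<^bsub>H\<^esub>"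
 "ring.add (op_hopf Z H) = ring.add H" "smult (op_hopf Z H) = smult H"
 "x \<otimes>\<^bsub>op_hopf Z H\<^esub> y = y \<otimes>\<^bsub>H\<^esub> x" "comult (op_hopf Z H) = comult H" "counit (op_hopf Z H) = counit H"
 "antipode (op_hopf Z H) = Z" "op_hopf (antipode H) (op_hopf Z H) = H"
 by (simp_all add: op_hopf_def) (simp_all add: op_alg_def)

lemma linear_maps_op_hopf [simp]:
 "linear_maps R (op_hopf Z H) N = linear_maps R H N" "linear_maps R N (op_hopf Z H) = linear_maps R N H"
 by (simp_all add: linear_maps_def)

lemma tlift_op_hopf [simp]: "tlift (op_hopf Z H) = tlift H"
 by (simp add: op_hopf_def) (intro ext, simp add: tlift_def finsum_def add_pow_def)

lemma hopf_inv_op: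
 assumes "hopf_inv R H Z"
 shows "hopf_inv R (op_hopf Z H) (antipode H)"
proof -
 interpret hopf_inv R H Z by fact
 let ?H = "H\<lparr>antipode := Z\<rparr>"
 \<comment> \<open>Replacing the antipode changes the record but none of the operations seen by
   tensor products and lifts, so the coring axioms carry over unchanged.\<close>
 have tens: "tensor ?H ?H A ra la = tensor H H A ra la" "tensor N ?H A' ra' la' = tensor N H A' ra' la'"
  "tensor ?H N'' A'' ra'' la'' = tensor H N'' A'' ra'' la''"
  for A ra la A' ra' la' N A'' ra'' la'' N''
  by (simp_all add: tensor_def tensor_rels_def)
 have tl: "tlift ?H = tlift H"
  by (intro ext) (simp add: tlift_def finsum_def add_pow_def)
 have grp_eq: "abelian_group ?H = abelian_group H"
  by (simp add: abelian_group_def abelian_monoid_def abelian_group_axioms_def)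
 then have grp: "abelian_group ?H" using algebra.abelian_group_axioms by simp
 have alg: "k_algebra R ?H"
 proof (rule k_algebraI)
  show "module R ?H" using algebra.module_axioms grp by (simp add: module_def module_axioms_def)
  show "monoid ?H" by (rule monoidI) (simp_all add: algebra.m_assoc)
 qed (simp_all add: algebra.l_distr algebra.r_distr algebra.smult_mult_left algebra.smult_mult_right)
 have "coring R ?H (%r x. r \<odot>\<^bsub>H\<^esub> x) (%x r. r \<odot>\<^bsub>H\<^esub> x) (comult H) (counit H)
   = coring R H (%r x. r \<odot>\<^bsub>H\<^esub> x) (%x r. r \<odot>\<^bsub>H\<^esub> x) (comult H) (counit H)"
  by (simp add: coring_def coring_axioms_def bimodule_def bimodule_axioms_def tensor_square_def
    tensor_cube_left_def tensor_cube_right_def tens tl grp_eq)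
 then have "coring R ?H (%r x. r \<odot>\<^bsub>?H\<^esub> x) (%x r. r \<odot>\<^bsub>?H\<^esub> x) (comult H) (counit H)"
  using coalgebra.coring_axioms by simp
 then have cor: "coring R (op_hopf Z H) (%r x. r \<odot>\<^bsub>op_hopf Z H\<^esub> x) (%x r. r \<odot>\<^bsub>op_hopf Z H\<^esub> x)
   (comult (op_hopf Z H)) (counit (op_hopf Z H))"
  by (simp add: op_hopf_def coring_op_alg) (simp add: op_alg_def)
 have sq: "k_tensor_square R (op_hopf Z H) = op_alg (k_tensor_square R H)"
  by (simp add: k_tensor_square_def op_hopf_def tensor_square_op_alg) (simp add: tensor_square_def tens)
 have "comult H \<in> alg_hom R (op_hopf Z H) (k_tensor_square R (op_hopf Z H))"
  using comult_alg_hom unfolding sq by (auto simp: alg_hom_def ring_hom_def linear_maps_def)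
 moreover have "counit H \<in> ring_hom (op_hopf Z H) R"
  using counit_ring_hom by (auto simp: ring_hom_def algebra.R.m_comm)
 ultimately have "hopf_algebra R (op_hopf Z H)"
  using cor k_algebra_op_alg[OF alg] Z_linear Z_left Z_right
  by (simp add: hopf_algebra_def hopf_algebra_axioms_def op_hopf_def[symmetric])
 then show ?thesis by (simp add: hopf_inv_def hopf_inv_axioms_def)
qed

section \<open>Partial representations\<close>

text \<open>\<open>p_one\<close> and \<open>PR2\<close> to \<open>PR5\<close> are the five families
  of relations of H_par with [h] replaced by \<open>p h\<close>.\<close>

locale partial_rep = hopf_inv R H Z + B: k_algebra R B
 for R :: "'k ring" and H :: "('k, 'h) hopf_algebra" and Z :: "'h => 'h"
  and B :: "('k, 'b) module" (structure) +
 fixes p :: "'h => 'b"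
 assumes p_linear: "p \<in> linear_maps R H B"
  and p_one: "p \<one>\<^bsub>H\<^esub> = \<one>"
  and PR2: "[|h \<in> carrier H; l \<in> carrier H|] ==>
   sw B (%x y. p h \<otimes> p x \<otimes> p (S y)) l = sw B (%x y. p (h \<cdot> x) \<otimes> p (S y)) l"
  and PR3: "[|h \<in> carrier H; l \<in> carrier H|] ==>
   sw B (%x y. p x \<otimes> p (S y) \<otimes> p l) h = sw B (%x y. p x \<otimes> p (S y \<cdot> l)) h"
  and PR4: "[|h \<in> carrier H; l \<in> carrier H|] ==>
   sw B (%x y. p h \<otimes> p (S x) \<otimes> p y) l = sw B (%x y. p (h \<cdot> S x) \<otimes> p y) l"
  and PR5: "[|h \<in> carrier H; l \<in> carrier H|] ==>
   sw B (%x y. p (S x) \<otimes> p y \<otimes> p l) h = sw B (%x y. p (S x) \<otimes> p (y \<cdot> l)) h"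
begin

lemma B_alg: "k_algebra R B" and B_mod: "module R B"
 using B.k_algebra_axioms B.module_axioms by simp_all

text \<open>For the canonical representation, \<open>e\<close> and the companion \<open>e'\<close>
  are the generators epsilon_h and tilde-epsilon_h of the two bases.\<close>

definition e :: "'h => 'b"
 where "e h = sw B (%x y. p x \<otimes> p (S y)) h"

definition e' :: "'h => 'b"
 where "e' h = sw B (%x y. p (S x) \<otimes> p y) h"

lemma lin_p: "lin R M H f ==> lin R M B (%x. p (f x))"
 by (rule lin_comp[of R H B p]) (simp_all add: lin_def p_linear B_mod)

lemma p_closed [simp]: "h \<in> carrier H ==> p h \<in> carrier B"
 by (rule linear_maps_closed[OF p_linear])

lemma lin_e: "lin R M H f ==> lin R M B (%x. e (f x))"
 and lin_e': "lin R M H f ==> lin R M B (%x. e' (f x))"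
 by (simp_all add: e_def e'_def lin_rules lin_p B_alg B_mod)

lemma e_closed [simp]: "h \<in> carrier H ==> e h \<in> carrier B"
 and e'_closed [simp]: "h \<in> carrier H ==> e' h \<in> carrier B"
 by (simp_all add: e_def e'_def lin_rules lin_p B_alg B_mod)

lemmas p_rules = lin_rules lin_Z lin_p lin_e lin_e' B_alg B_mod

lemma e_one [simp]: "e \<one>\<^bsub>H\<^esub> = \<one>" and e'_one [simp]: "e' \<one>\<^bsub>H\<^esub> = \<one>"
 by (simp_all add: e_def e'_def sw_one p_rules p_one)

lemma p_e: "[|h \<in> carrier H; l \<in> carrier H|] ==> p h \<otimes> e l = sw B (%x y. p (h \<cdot> x) \<otimes> p (S y)) l"
 using PR2[of h l] by (simp add: e_def mult_sw_left p_rules B.m_assoc)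

lemma e_p: "[|h \<in> carrier H; l \<in> carrier H|] ==> e h \<otimes> p l = sw B (%x y. p x \<otimes> p (S y \<cdot> l)) h"
 using PR3[of h l] by (simp add: e_def mult_sw_right p_rules)

lemma p_e': "[|h \<in> carrier H; l \<in> carrier H|] ==> p h \<otimes> e' l = sw B (%x y. p (h \<cdot> S x) \<otimes> p y) l"
 using PR4[of h l] by (simp add: e'_def mult_sw_left p_rules B.m_assoc)

lemma e'_p: "[|h \<in> carrier H; l \<in> carrier H|] ==> e' h \<otimes> p l = sw B (%x y. p (S x) \<otimes> p (y \<cdot> l)) h"
 using PR5[of h l] by (simp add: e'_def mult_sw_right p_rules)

text \<open>By \<open>e_p\<close> and the coproduct of a product, e_{h_(1) k} [h_(2)] is the sum of
  [h_(1) k_(1)] [S(k_(2)) S(h_(2)) h_(3)]. The pair S(h_(2)) h_(3) contracts, and what remains is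
  \<open>p_e\<close>.\<close>

lemma p_e_commute:
 assumes h: "h \<in> carrier H" and k: "k \<in> carrier H"
 shows "p h \<otimes> e k = sw B (%x y. e (x \<cdot> k) \<otimes> p y) h"
proof -
 have "sw B (%x y. e (x \<cdot> k) \<otimes> p y) h
   = sw B (%x y. sw B (%a b. sw B (%u v. p (a \<cdot> u) \<otimes> p (S v \<cdot> (S b \<cdot> y))) k) x) h"
 proof (rule sw_cong[OF refl])
  fix x y assume *: "x \<in> carrier H" "y \<in> carrier H"
  have "e (x \<cdot> k) \<otimes> p y
    = sw B (%u v. sw B (%a b. p (a \<cdot> u) \<otimes> p (S v \<cdot> (S b \<cdot> y))) x) k"
   using * k by (simp add: e_p sw_mult p_rules antipode_mult algebra.m_assoc)
  also have "... = sw B (%a b. sw B (%u v. p (a \<cdot> u) \<otimes> p (S v \<cdot> (S b \<cdot> y))) k) x"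
   using * k by (intro sw_swap) (simp_all add: p_rules)
  finally show "e (x \<cdot> k) \<otimes> p y
   = sw B (%a b. sw B (%u v. p (a \<cdot> u) \<otimes> p (S v \<cdot> (S b \<cdot> y))) k) x" .
 qed (simp add: h)
 also have "... = sw B (%a r. sw B (%b y. sw B (%u v. p (a \<cdot> u) \<otimes> p (S v \<cdot> (S b \<cdot> y))) k) r) h"
  using h k by (intro sw_coassoc) (simp_all add: p_rules)
 also have "... = sw B (%u v. p (h \<cdot> u) \<otimes> p (S v \<cdot> \<one>\<^bsub>H\<^esub>)) k"
  using h k
  by (intro contract_SL(2)[where ga = "%a w. sw B (%u v. p (a \<cdot> u) \<otimes> p (S v \<cdot> w)) k"])
   (simp_all add: p_rules)
 also have "... = p h \<otimes> e k"
  using h k by (simp add: p_e)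
 finally show ?thesis by simp
qed

text \<open>The mirror image of \<open>p_e_commute\<close>: after \<open>p_e'\<close> it is the pair
  h_(1) S(h_(2)) that contracts.\<close>

lemma e'_p_commute:
 assumes h: "h \<in> carrier H" and k: "k \<in> carrier H"
 shows "e' k \<otimes> p h = sw B (%x y. p x \<otimes> e' (k \<cdot> y)) h"
proof -
 have "sw B (%x y. p x \<otimes> e' (k \<cdot> y)) h
   = sw B (%x y. sw B (%u v. sw B (%a b. p ((x \<cdot> S u) \<cdot> S a) \<otimes> p (b \<cdot> v)) k) y) h"
  using h k by (simp add: p_e' sw_mult p_rules antipode_mult algebra.m_assoc)
 also have "... = sw B (%a b. p (\<one>\<^bsub>H\<^esub> \<cdot> S a) \<otimes> p (b \<cdot> h)) k"
  using h k
  by (intro contract_SR(1)[where ga = "%w v. sw B (%a b. p (w \<cdot> S a) \<otimes> p (b \<cdot> v)) k"])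
   (simp_all add: p_rules)
 also have "... = e' k \<otimes> p h"
  using h k by (simp add: e'_p)
 finally show ?thesis by simp
qed

text \<open>Solves the exchange rule for the other order. Moving each \<open>e\<close> back to the
  left with \<open>p_e_commute\<close> creates the pair h_(2) Z(h_(1)), which contracts; this is
  where the inverse antipode enters.\<close>

lemma e_p_commute:
 assumes h: "h \<in> carrier H" and k: "k \<in> carrier H"
 shows "e k \<otimes> p h = sw B (%x y. p y \<otimes> e (Z x \<cdot> k)) h"
proof -
 have "sw B (%x y. p y \<otimes> e (Z x \<cdot> k)) h
   = sw B (%x y. sw B (%a b. e ((a \<cdot> Z x) \<cdot> k) \<otimes> p b) y) h"
  using h k by (simp add: p_e_commute algebra.m_assoc)
 also have "... = e (\<one>\<^bsub>H\<^esub> \<cdot> k) \<otimes> p h"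
  using h k by (intro contract_ZR(1)[where ga = "%w b. e (w \<cdot> k) \<otimes> p b"]) (simp_all add: p_rules)
 finally show ?thesis using k by simp
qed

lemma p_e'_commute:
 assumes h: "h \<in> carrier H" and k: "k \<in> carrier H"
 shows "p h \<otimes> e' k = sw B (%x y. e' (k \<cdot> Z y) \<otimes> p x) h"
proof -
 have "sw B (%x y. e' (k \<cdot> Z y) \<otimes> p x) h
   = sw B (%x y. sw B (%a b. p a \<otimes> e' (k \<cdot> (Z y \<cdot> b))) x) h"
  using h k by (simp add: e'_p_commute algebra.m_assoc)
 also have "... = sw B (%a r. sw B (%b y. p a \<otimes> e' (k \<cdot> (Z y \<cdot> b))) r) h"
  using h k by (intro sw_coassoc) (simp_all add: p_rules)
 also have "... = p h \<otimes> e' (k \<cdot> \<one>\<^bsub>H\<^esub>)"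
  using h k by (intro contract_ZL(2)[where ga = "%a w. p a \<otimes> e' (k \<cdot> w)"]) (simp_all add: p_rules)
 finally show ?thesis using k by simp
qed

lemma sw_e_p: "h \<in> carrier H ==> sw B (%x y. e x \<otimes> p y) h = p h"
 using p_e_commute[of h "\<one>\<^bsub>H\<^esub>"] by simp

lemma sw_e'_p: "h \<in> carrier H ==> sw B (%x y. e' (Z y) \<otimes> p x) h = p h"
 using p_e'_commute[of h "\<one>\<^bsub>H\<^esub>"] by simp

lemma sw_p_e': "h \<in> carrier H ==> sw B (%x y. p x \<otimes> e' y) h = p h"
 using e'_p_commute[of h "\<one>\<^bsub>H\<^esub>"] by simp

lemma sw_p_e: "h \<in> carrier H ==> sw B (%x y. p y \<otimes> e (Z x)) h = p h"
 using e_p_commute[of h "\<one>\<^bsub>H\<^esub>"] by simp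

text \<open>Moving \<open>e' k\<close> through the two factors of \<open>e h\<close> multiplies its
  index by two adjacent legs, h_(2) S(h_(3)), which contract; the index returns to
  \<open>k\<close>.\<close>

lemma e_e'_commute:
 assumes h: "h \<in> carrier H" and k: "k \<in> carrier H"
 shows "e' k \<otimes> e h = e h \<otimes> e' k"
proof -
 have "e' k \<otimes> e h = sw B (%x y. e' k \<otimes> p x \<otimes> p (S y)) h"
  using h k by (simp add: e_def mult_sw_left p_rules B.m_assoc)
 also have "... = sw B (%x y. sw B (%a b. p a \<otimes> (e' (k \<cdot> b) \<otimes> p (S y))) x) h"
  using h k by (simp add: e'_p_commute mult_sw_right p_rules B.m_assoc)
 also have "... = sw B (%a r. sw B (%b y. p a \<otimes> (e' (k \<cdot> b) \<otimes> p (S y))) r) h"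
  using h k by (intro sw_coassoc) (simp_all add: p_rules)
 also have "... = sw B (%a r. sw B (%b y. sw B (%u v. p a \<otimes> (p (S v) \<otimes> e' (k \<cdot> (b \<cdot> S u)))) y) r) h"
  using h k by (simp add: e'_p_commute sw_antipode mult_sw_left p_rules algebra.m_assoc)
 also have "... = sw B (%a r. p a \<otimes> (p (S r) \<otimes> e' (k \<cdot> \<one>\<^bsub>H\<^esub>))) h"
  using h k
  by (intro sw_cong refl contract_SR(1)[where ga = "%w v. p _ \<otimes> (p (S v) \<otimes> e' (k \<cdot> w))"])
   (simp_all add: p_rules)
 also have "... = e h \<otimes> e' k"
  using h k by (simp add: e_def mult_sw_right p_rules B.m_assoc)
 finally show ?thesis .
qed

end

text \<open>Reversing all products and inverting the antipode exchanges \<open>PR2\<close> with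
  \<open>PR3\<close> and \<open>PR4\<close> with \<open>PR5\<close>, each read at an argument under
  \<open>Z\<close>. Since Delta(Z h) = Z(h_(2)) (x) Z(h_(1)), the element \<open>e h\<close> formed
  in the opposite data is \<open>e (Z h)\<close>.\<close>

lemma partial_rep_op:
 assumes "partial_rep R H Z B p"
 shows "partial_rep R (op_hopf Z H) (antipode H) (op_alg B) p"
  and "h \<in> carrier H ==> partial_rep.e (op_hopf Z H) (op_alg B) p h = partial_rep.e H B p (Z h)"
  and "h \<in> carrier H ==> partial_rep.e' (op_hopf Z H) (op_alg B) p h = partial_rep.e' H B p (Z h)"
proof -
 interpret partial_rep R H Z B p by fact
 interpret B': k_algebra R "op_alg B" by (rule k_algebra_op_alg[OF B_alg])
 show rep: "partial_rep R (op_hopf Z H) S (op_alg B) p"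
 proof (intro partial_rep.intro partial_rep_axioms.intro hopf_inv_op hopf_inv_axioms B'.k_algebra_axioms; simp?)
  show "p \<in> linear_maps R H B" by (rule p_linear)
  show "p \<one>\<^bsub>H\<^esub> = \<one>\<^bsub>B\<^esub>" by (rule p_one)
  fix h l assume *: "h \<in> carrier H" "l \<in> carrier H"
  show "sw B (%x y. p (Z y) \<otimes>\<^bsub>B\<^esub> (p x \<otimes>\<^bsub>B\<^esub> p h)) l = sw B (%x y. p (Z y) \<otimes>\<^bsub>B\<^esub> p (x \<otimes>\<^bsub>H\<^esub> h)) l"
   using PR3[of "Z l" h] * by (simp add: sw_Z p_rules B.m_assoc)
  show "sw B (%x y. p l \<otimes>\<^bsub>B\<^esub> (p (Z y) \<otimes>\<^bsub>B\<^esub> p x)) h = sw B (%x y. p (l \<otimes>\<^bsub>H\<^esub> Z y) \<otimes>\<^bsub>B\<^esub> p x) h"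
   using PR2[of l "Z h"] * by (simp add: sw_Z p_rules B.m_assoc)
  show "sw B (%x y. p y \<otimes>\<^bsub>B\<^esub> (p (Z x) \<otimes>\<^bsub>B\<^esub> p h)) l = sw B (%x y. p y \<otimes>\<^bsub>B\<^esub> p (Z x \<otimes>\<^bsub>H\<^esub> h)) l"
   using PR5[of "Z l" h] * by (simp add: sw_Z p_rules B.m_assoc)
  show "sw B (%x y. p l \<otimes>\<^bsub>B\<^esub> (p y \<otimes>\<^bsub>B\<^esub> p (Z x))) h = sw B (%x y. p (l \<otimes>\<^bsub>H\<^esub> y) \<otimes>\<^bsub>B\<^esub> p (Z x)) h"
   using PR4[of l "Z h"] * by (simp add: sw_Z p_rules B.m_assoc)
 qed
 interpret o: partial_rep R "op_hopf Z H" S "op_alg B" p by (rule rep)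
 note sw_cong [cong]
 show "h \<in> carrier H ==> o.e h = e (Z h)" "h \<in> carrier H ==> o.e' h = e' (Z h)"
  unfolding o.e_def o.e'_def e_def e'_def op_hopf_simps op_alg_simps tlift_op_alg by (simp_all add: sw_Z p_rules)
qed

section \<open>The comultiplication as a partial representation\<close>

text \<open>That \<open>A\<close> is generated by the elements \<open>E h\<close> is expressed as
  the induction principle \<open>A_induct\<close>. The source is not assumed to be an inclusion: the
  same locale also describes the right base inside the opposite algebra, where the source is the map
  S' and the target is the inclusion.\<close>

locale par_base = partial_rep R H Z B p + A: k_algebra R A
 for R :: "'k ring" and H :: "('k, 'h) hopf_algebra" and Z :: "'h => 'h"
  and B :: "('k, 'b) module" (structure) and p :: "'h => 'b" and A :: "('k, 'a) module" +
 fixes s :: "'a => 'b" and t :: "'a => 'b" and E :: "'h => 'a"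
 assumes s_hom: "s \<in> alg_hom R A B"
  and t_hom: "t \<in> alg_hom R A (op_alg B)"
  and E_linear: "E \<in> linear_maps R H A"
  and s_E: "h \<in> carrier H ==> s (E h) = e h"
  and t_E: "h \<in> carrier H ==> t (E h) = e' (Z h)"
  and A_induct: "[|a \<in> carrier A; !!h. h \<in> carrier H ==> P (E h); P \<one>\<^bsub>A\<^esub>;
   !!x y. [|x \<in> carrier A; y \<in> carrier A; P x; P y|] ==> P (x \<oplus>\<^bsub>A\<^esub> y);
   !!x y. [|x \<in> carrier A; y \<in> carrier A; P x; P y|] ==> P (x \<otimes>\<^bsub>A\<^esub> y);
   !!r x. [|r \<in> carrier R; x \<in> carrier A; P x|] ==> P (r \<odot>\<^bsub>A\<^esub> x)|] ==> P a"
begin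

abbreviation mult_A (infixl "\<star>" 70) where "x \<star> y \<equiv> x \<otimes>\<^bsub>A\<^esub> y"

lemma E_closed [simp]: "h \<in> carrier H ==> E h \<in> carrier A"
 by (rule linear_maps_closed[OF E_linear])

lemma s_closed [simp]: "a \<in> carrier A ==> s a \<in> carrier B"
 by (rule alg_hom_closed[OF s_hom])

lemma t_closed [simp]: "a \<in> carrier A ==> t a \<in> carrier B"
 using alg_hom_closed[OF t_hom] by simp

lemmas s_rules = alg_hom_add[OF s_hom] alg_hom_mult[OF s_hom] alg_hom_one[OF s_hom] alg_hom_smult[OF s_hom]
lemmas t_rules = alg_hom_add[OF t_hom, simplified] alg_hom_mult[OF t_hom, simplified]
 alg_hom_one[OF t_hom, simplified] alg_hom_smult[OF t_hom, simplified]

lemma s_e'_commute: "a \<in> carrier A ==> k \<in> carrier H ==> s a \<otimes> e' k = e' k \<otimes> s a"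
proof (induction a rule: A_induct[consumes 1])
 case (4 x y)
 have "s x \<otimes> s y \<otimes> e' k = s x \<otimes> e' k \<otimes> s y" using 4(1,2,4,5) by (simp add: B.m_assoc)
 then show ?case using 4(1-3,5) by (simp add: s_rules) (simp add: B.m_assoc)
qed (simp_all add: s_E e_e'_commute s_rules B.l_distr B.r_distr B.smult_mult_left B.smult_mult_right)

lemma s_t_commute:
 assumes "a \<in> carrier A" "b \<in> carrier A"
 shows "s a \<otimes> t b = t b \<otimes> s a"
 using assms(2)
proof (induction b rule: A_induct[consumes 1])
 case (4 x y)
 have "s a \<otimes> t y \<otimes> t x = t y \<otimes> s a \<otimes> t x" using 4 by simp
 also have "... = t y \<otimes> t x \<otimes> s a" using 4 assms(1) by (simp add: B.m_assoc)
 finally show ?case using 4(1,2) assms(1) by (simp add: t_rules B.m_assoc)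
qed (use assms(1) in "simp_all add: t_E s_e'_commute t_rules B.l_distr B.r_distr B.smult_mult_left B.smult_mult_right")

sublocale takeuchi R B A s t
 by unfold_locales simp_all

lemma TB_alg: "module R TB" by (rule TB.module_axioms)

lemma lin_pl: "y \<in> carrier B ==> lin R Q B f ==> lin R Q TB (%x. pure_tensor TB (f x) y)"
 by (rule lin_pure_left[folded TB_def])

lemma pure_smult_right:
 "[|r \<in> carrier R; x \<in> carrier B; y \<in> carrier B|] ==> x \<bowtie> (r \<odot> y) = r \<odot>\<^bsub>TB\<^esub> (x \<bowtie> y)"
 using TB_balanced[of x "r \<odot>\<^bsub>A\<^esub> \<one>\<^bsub>A\<^esub>" y]
 by (simp add: s_rules t_rules B.smult_mult_left TB_smult_pure)

lemma lin_pr: "x \<in> carrier B ==> lin R Q B f ==> lin R Q TB (%y. pure_tensor TB x (f y))"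
 by (rule lin_comp[of R B TB "%y. pure_tensor TB x y" Q f])
  (simp_all add: lin_def linear_maps_def TB_alg TB_pure_closed add_maps_add[OF TB_pure_right] pure_smult_right)

lemma lin_rmul: "u \<in> carrier B ==> v \<in> carrier B ==> lin R Q TB f ==> lin R Q TB (%x. rmul u v (f x))"
 by (rule lin_comp[of R TB TB "rmul u v" Q f]) (simp_all add: lin_def TB_alg rmul_linear)

lemma lin_rmul_left: "V \<in> carrier TB ==> v \<in> carrier B ==> lin R Q B f ==> lin R Q TB (%x. rmul (f x) v V)"
 by (rule lin_comp[of R B TB "%u. rmul u v V" Q f])
  (simp_all add: lin_def linear_maps_def TB_alg rmul_add_left rmul_smult_left rmul_closed)

lemma rmul_smult_right:
 assumes "V \<in> carrier TB" "u \<in> carrier B" "v \<in> carrier B" "r \<in> carrier R"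
 shows "rmul u (r \<odot> v) V = r \<odot>\<^bsub>TB\<^esub> rmul u v V"
 using assms(1)
 by (induction rule: TB_induct)
  (use assms in "simp_all add: rmul_zero rmul_add rmul_closed TB.smult_r_distr B.smult_mult_right pure_smult_right")

lemma lin_rmul_right: "V \<in> carrier TB ==> u \<in> carrier B ==> lin R Q B f ==> lin R Q TB (%x. rmul u (f x) V)"
 by (rule lin_comp[of R B TB "%v. rmul u v V" Q f])
  (simp_all add: lin_def linear_maps_def TB_alg rmul_add_right rmul_smult_right rmul_closed)

definition dl :: "'h => ('b \<times> 'b \<Rightarrow>\<^sub>0 int) set"
 where "dl h = sw TB (%x y. p x \<bowtie> p y) h"

lemma lin_dl: "lin R Q H f ==> lin R Q TB (%x. dl (f x))"
 by (simp add: dl_def p_rules lin_pl lin_pr TB_alg)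

lemma dl_closed [simp]: "h \<in> carrier H ==> dl h \<in> carrier TB"
 by (simp add: dl_def p_rules lin_pl lin_pr TB_alg)

lemmas b_rules = p_rules lin_pl lin_pr TB_alg lin_rmul lin_rmul_left lin_rmul_right lin_dl
 TB_pure_closed rmul_closed

text \<open>The balancing relation at the generator \<open>E h\<close>: acting through the source on
  the right factor is acting through the target on the left factor, which turns e_h into e'_{Z h}.
  All later cancellations across the tensor sign use this.\<close>

lemma pure_e: "[|x \<in> carrier B; y \<in> carrier B; h \<in> carrier H|] ==> x \<bowtie> (e h \<otimes> y) = (e' (Z h) \<otimes> x) \<bowtie> y"
 using TB_balanced[of x "E h" y] by (simp add: s_E t_E)

lemma pure_e': "[|x \<in> carrier B; y \<in> carrier B; h \<in> carrier H|] ==> (e' h \<otimes> x) \<bowtie> y = x \<bowtie> (e (S h) \<otimes> y)"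
 using pure_e[of x y "S h"] by simp

lemma pure_sw_right: "[|x \<in> carrier B; bilinH B be; h \<in> carrier H|] ==> x \<bowtie> sw B be h = sw TB (%a b. x \<bowtie> be a b) h"
 by (rule sw_map[OF lin_pr, of _ B "%x. x"]) (simp_all add: b_rules lin_id)

lemma pure_sw_left: "[|y \<in> carrier B; bilinH B be; h \<in> carrier H|] ==> sw B be h \<bowtie> y = sw TB (%a b. be a b \<bowtie> y) h"
 by (rule sw_map[OF lin_pl, of _ B "%x. x"]) (simp_all add: b_rules lin_id)

lemma rmul_sw: "[|u \<in> carrier B; v \<in> carrier B; bilinH TB be; h \<in> carrier H|] ==>
  rmul u v (sw TB be h) = sw TB (%a b. rmul u v (be a b)) h"
 by (rule sw_map[OF lin_rmul, of _ _ TB "%x. x"]) (simp_all add: b_rules lin_id)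

text \<open>The base elements at which \<open>V\<close> satisfies the Takeuchi condition are closed
  under sums, scalars and products, so the generators suffice.\<close>

lemma TK_I:
 assumes V: "V \<in> carrier TB"
  and "!!k. k \<in> carrier H ==> rmul (e' (Z k)) \<one> V = rmul \<one> (e k) V"
 shows "V \<in> carrier TK"
 unfolding TK_iff
proof (intro conjI ballI V)
 fix a assume "a \<in> carrier A"
 then show "rmul (t a) \<one> V = rmul \<one> (s a) V"
 proof (induction a rule: A_induct[consumes 1])
  case (4 x y)
  have "rmul (t (x \<star> y)) \<one> V = rmul (t x) \<one> (rmul (t y) \<one> V)"
   using 4(1,2) V by (subst rmul_rmul) (simp_all add: t_rules)
  also have "... = rmul \<one> (s y) (rmul (t x) \<one> V)"
   using 4(1,2,4) V by (simp add: rmul_rmul)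
  also have "... = rmul \<one> (s y) (rmul \<one> (s x) V)"
   by (simp only: 4)
  also have "... = rmul \<one> (s (x \<star> y)) V"
   using 4(1,2) V by (simp add: rmul_rmul s_rules)
  finally show ?case .
 qed (use assms in "simp_all add: s_E t_E s_rules t_rules rmul_add_left rmul_add_right rmul_smult_left rmul_smult_right")
qed

text \<open>On the second factor, [h_(2)] e_k becomes e_{h_(2) k} [h_(3)], and the new element
  crosses the tensor sign as e'_{Z(k) Z(h_(2))}. The same element arises when e'_{Z k} is moved to
  the left of [h_(1)] in the first factor.\<close>

lemma dl_TK:
 assumes h: "h \<in> carrier H"
 shows "dl h \<in> carrier TK"
proof (rule TK_I)
 fix k assume k: "k \<in> carrier H"
 have "rmul \<one> (e k) (dl h) = sw TB (%x r. sw TB (%a b. (e' (Z k \<cdot> Z a) \<otimes> p x) \<bowtie> p b) r) h"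
  using h k by (simp add: dl_def rmul_sw b_rules p_e_commute pure_sw_right pure_e Z_mult)
 also have "... = sw TB (%q b. sw TB (%x a. (e' (Z k \<cdot> Z a) \<otimes> p x) \<bowtie> p b) q) h"
  using h k by (intro sw_coassoc[symmetric]) (simp_all add: b_rules)
 also have "... = rmul (e' (Z k)) \<one> (dl h)"
  using h k by (simp add: dl_def rmul_sw b_rules p_e'_commute pure_sw_left)
 finally show "rmul (e' (Z k)) \<one> (dl h) = rmul \<one> (e k) (dl h)" by simp
qed (simp add: h)

end

section \<open>The relations of a partial representation in the Takeuchi product\<close>

context par_base begin

text \<open>For a multiplicative \<open>p\<close> the legs q_(2) S(q_(3)) would simply cancel. Here
  \<open>p_e\<close> leaves e_{q_(2)} behind [h_(2)]; the exchange rule moves it to the front of the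
  second factor, \<open>pure_e\<close> carries it to the first factor, and there
  \<open>sw_e'_p\<close> absorbs it at the element \<open>w \<cdot> q\<close>.\<close>

lemma sw_rmul_dl_mult:
 assumes h: "h \<in> carrier H" and q: "q \<in> carrier H"
 shows "sw TB (%a u. rmul \<one> (p (S u)) (dl (h \<cdot> a))) q = sw TB (%x y. p (x \<cdot> q) \<bowtie> p y) h" (is "?l = _")
proof -
 have "?l = sw TB (%a u. sw TB (%c d. sw TB (%x y. p (x \<cdot> c) \<bowtie> (p (y \<cdot> d) \<otimes> p (S u))) h) a) q"
  using h q by (simp add: dl_def sw_mult rmul_sw b_rules)
 also have "... = sw TB (%c r. sw TB (%d u. sw TB (%x y. p (x \<cdot> c) \<bowtie> (p (y \<cdot> d) \<otimes> p (S u))) h) r) q"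
  using h q by (intro sw_coassoc) (simp_all add: b_rules)
 also have "... = sw TB (%c r. sw TB (%x y. sw TB (%m n. (e' (Z (m \<cdot> r)) \<otimes> p (x \<cdot> c)) \<bowtie> p n) y) h) q"
 proof (rule sw_cong[OF refl], goal_cases)
  case *: (2 c r)
  have "sw TB (%d u. sw TB (%x y. p (x \<cdot> c) \<bowtie> (p (y \<cdot> d) \<otimes> p (S u))) h) r
    = sw TB (%x y. sw TB (%d u. p (x \<cdot> c) \<bowtie> (p (y \<cdot> d) \<otimes> p (S u))) r) h"
   using h * by (intro sw_swap) (simp_all add: b_rules)
  also have "... = sw TB (%x y. p (x \<cdot> c) \<bowtie> (p y \<otimes> e r)) h"
   using h * by (simp add: p_e pure_sw_right b_rules)
  also have "... = sw TB (%x y. sw TB (%m n. (e' (Z (m \<cdot> r)) \<otimes> p (x \<cdot> c)) \<bowtie> p n) y) h"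
   using h * by (simp add: p_e_commute pure_sw_right b_rules pure_e)
  finally show ?case .
 qed (simp add: q)
 also have "... = sw TB (%x y. sw TB (%c r. sw TB (%m n. (e' (Z (m \<cdot> r)) \<otimes> p (x \<cdot> c)) \<bowtie> p n) y) q) h"
  using h q by (intro sw_swap) (simp_all add: b_rules)
 also have "... = sw TB (%x y. sw TB (%m n. sw TB (%c r. (e' (Z (m \<cdot> r)) \<otimes> p (x \<cdot> c)) \<bowtie> p n) q) y) h"
  by (rule sw_cong[OF refl], simp add: h, rule sw_swap) (use q in "simp_all add: b_rules")
 also have "... = sw TB (%w n. sw TB (%x m. sw TB (%c r. (e' (Z (m \<cdot> r)) \<otimes> p (x \<cdot> c)) \<bowtie> p n) q) w) h"
  using h q by (intro sw_coassoc[symmetric]) (simp_all add: b_rules)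
 also have "... = sw TB (%w n. p (w \<cdot> q) \<bowtie> p n) h"
 proof (rule sw_cong[OF refl], goal_cases)
  case *: (2 w n)
  have "sw TB (%x m. sw TB (%c r. (e' (Z (m \<cdot> r)) \<otimes> p (x \<cdot> c)) \<bowtie> p n) q) w
    = sw TB (%c r. sw TB (%x m. (e' (Z (m \<cdot> r)) \<otimes> p (x \<cdot> c)) \<bowtie> p n) w) q"
   using q * by (intro sw_swap) (simp_all add: b_rules)
  also have "... = sw TB (%x y. (e' (Z y) \<otimes> p x) \<bowtie> p n) (w \<cdot> q)"
   using q * by (intro sw_mult[symmetric]) (simp_all add: b_rules)
  also have "... = p (w \<cdot> q) \<bowtie> p n"
   using q * by (subst pure_sw_left[symmetric]) (simp_all add: b_rules sw_e'_p)
  finally show ?case .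
 qed (simp add: h)
 finally show ?thesis .
qed

text \<open>Here \<open>e_p\<close> produces e_{q_(2)} already in front of the second factor, so it
  crosses the tensor sign at once and is absorbed.\<close>

lemma sw_rmul_antipode_dl:
 assumes q: "q \<in> carrier H" and d: "d \<in> carrier H"
 shows "sw TB (%x u. rmul \<one> (p (S u \<cdot> d)) (dl x)) q = p q \<bowtie> p d" (is "?l = _")
proof -
 have "?l = sw TB (%x u. sw TB (%a b. p a \<bowtie> (p b \<otimes> p (S u \<cdot> d))) x) q"
  using q d by (simp add: dl_def rmul_sw b_rules)
 also have "... = sw TB (%a r. sw TB (%b u. p a \<bowtie> (p b \<otimes> p (S u \<cdot> d))) r) q"
  using q d by (intro sw_coassoc) (simp_all add: b_rules)
 also have "... = sw TB (%a r. p a \<bowtie> (e r \<otimes> p d)) q"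
  using q d by (simp add: e_p pure_sw_right b_rules)
 also have "... = sw TB (%a r. (e' (Z r) \<otimes> p a) \<bowtie> p d) q"
  using q d by (simp add: pure_e)
 also have "... = p q \<bowtie> p d"
  using q d by (subst pure_sw_left[symmetric]) (simp_all add: b_rules sw_e'_p)
 finally show ?thesis .
qed

text \<open>The same mechanism in the other direction: \<open>p_e'\<close> leaves a tilde element in
  the first factor, which crosses to the second factor and is absorbed there by
  \<open>sw_e_p\<close>.\<close>

lemma sw_rmul_dl_mult_antipode:
 assumes h: "h \<in> carrier H" and q: "q \<in> carrier H"
 shows "sw TB (%x u. rmul (p u) \<one> (dl (h \<cdot> S x))) q = sw TB (%m b. p m \<bowtie> p (b \<cdot> S q)) h" (is "?l = _")
proof -
 have "?l = sw TB (%x u. sw TB (%d c. sw TB (%a b. (p (a \<cdot> S c) \<otimes> p u) \<bowtie> p (b \<cdot> S d)) h) x) q"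
  using h q by (simp add: dl_def sw_mult sw_antipode rmul_sw b_rules)
 also have "... = sw TB (%d r. sw TB (%c u. sw TB (%a b. (p (a \<cdot> S c) \<otimes> p u) \<bowtie> p (b \<cdot> S d)) h) r) q"
  using h q by (intro sw_coassoc) (simp_all add: b_rules)
 also have "... = sw TB (%d r. sw TB (%a b. sw TB (%m n. p m \<bowtie> (e (n \<cdot> S r) \<otimes> p (b \<cdot> S d))) a) h) q"
 proof (rule sw_cong[OF refl], goal_cases)
  case *: (2 d r)
  have "sw TB (%c u. sw TB (%a b. (p (a \<cdot> S c) \<otimes> p u) \<bowtie> p (b \<cdot> S d)) h) r
    = sw TB (%a b. sw TB (%c u. (p (a \<cdot> S c) \<otimes> p u) \<bowtie> p (b \<cdot> S d)) r) h"
   using h * by (intro sw_swap) (simp_all add: b_rules)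
  also have "... = sw TB (%a b. (p a \<otimes> e' r) \<bowtie> p (b \<cdot> S d)) h"
   using h * by (simp add: p_e' pure_sw_left b_rules)
  also have "... = sw TB (%a b. sw TB (%m n. p m \<bowtie> (e (n \<cdot> S r) \<otimes> p (b \<cdot> S d))) a) h"
   using h * by (simp add: p_e'_commute pure_sw_left b_rules pure_e' antipode_mult)
  finally show ?case .
 qed (simp add: q)
 also have "... = sw TB (%d r. sw TB (%m w. sw TB (%n b. p m \<bowtie> (e (n \<cdot> S r) \<otimes> p (b \<cdot> S d))) w) h) q"
  by (rule sw_cong[OF refl], simp add: q, rule sw_coassoc) (use h in "simp_all add: b_rules")
 also have "... = sw TB (%m w. sw TB (%d r. sw TB (%n b. p m \<bowtie> (e (n \<cdot> S r) \<otimes> p (b \<cdot> S d))) w) q) h"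
  using h q by (intro sw_swap) (simp_all add: b_rules)
 also have "... = sw TB (%m w. p m \<bowtie> p (w \<cdot> S q)) h"
 proof (rule sw_cong[OF refl], goal_cases)
  case *: (2 m w)
  have "sw TB (%d r. sw TB (%n b. p m \<bowtie> (e (n \<cdot> S r) \<otimes> p (b \<cdot> S d))) w) q
    = sw TB (%x y. p m \<bowtie> (e x \<otimes> p y)) (w \<cdot> S q)"
   using q * by (simp add: sw_mult sw_antipode b_rules)
  also have "... = p m \<bowtie> p (w \<cdot> S q)"
   using q * by (subst pure_sw_right[symmetric]) (simp_all add: b_rules sw_e_p)
  finally show ?case .
 qed (simp add: h)
 finally show ?thesis .
qed

lemma sw_rmul_dl_antipode:
 assumes q: "q \<in> carrier H" and c: "c \<in> carrier H"
 shows "sw TB (%x u. rmul (p (u \<cdot> c)) \<one> (dl (S x))) q = p c \<bowtie> p (S q)" (is "?l = _")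
proof -
 have "?l = sw TB (%x u. sw TB (%d a. (p (S a) \<otimes> p (u \<cdot> c)) \<bowtie> p (S d)) x) q"
  using q c by (simp add: dl_def sw_antipode rmul_sw b_rules)
 also have "... = sw TB (%d r. sw TB (%a u. (p (S a) \<otimes> p (u \<cdot> c)) \<bowtie> p (S d)) r) q"
  using q c by (intro sw_coassoc) (simp_all add: b_rules)
 also have "... = sw TB (%d r. (e' r \<otimes> p c) \<bowtie> p (S d)) q"
  using q c by (simp add: e'_p pure_sw_left b_rules)
 also have "... = sw TB (%x y. p c \<bowtie> (e x \<otimes> p y)) (S q)"
  using q c by (simp add: pure_e' sw_antipode b_rules)
 also have "... = p c \<bowtie> p (S q)"
  using q c by (subst pure_sw_right[symmetric]) (simp_all add: b_rules sw_e_p)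
 finally show ?thesis .
qed

lemma lin_tmul: "V \<in> carrier TK ==> lin R Q TB f ==> lin R Q TB (%x. tmul V (f x))"
 by (rule lin_comp[of R TB TB "tmul V" Q f]) (simp_all add: lin_def TB_alg tmul_linear)

lemma tmul_dl:
 assumes "V \<in> carrier TK" "l \<in> carrier H"
 shows "tmul V (dl l) = sw TB (%u v. rmul (p u) (p v) V) l"
proof -
 have "tmul V (dl l) = sw TB (%x y. tmul V (p x \<bowtie> p y)) l"
  unfolding dl_def by (rule sw_map[OF lin_tmul, of _ TB "%x. x"]) (use assms in "simp_all add: b_rules lin_id")
 then show ?thesis using assms by simp
qed

text \<open>The right-hand side of \<open>PR2\<close> for \<open>dl\<close> is \<open>dl h\<close>
  times e_l (x) 1. Its case h = 1 evaluates the product on the left-hand side of \<open>PR2\<close>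
  to e_l (x) 1 as well, so the two sides agree. The three companions below play the same role for
  \<open>PR3\<close> to \<open>PR5\<close>.\<close>

lemma sw_tmul_PR2:
 assumes h: "h \<in> carrier H" and l: "l \<in> carrier H"
 shows "sw TB (%x y. tmul (dl (h \<cdot> x)) (dl (S y))) l = sw TB (%x y. (p x \<otimes> e l) \<bowtie> p y) h" (is "?l = _")
proof -
 have "?l = sw TB (%x y. sw TB (%u v. rmul (p (S v)) (p (S u)) (dl (h \<cdot> x))) y) l"
  using h l by (simp add: tmul_dl dl_TK sw_antipode b_rules)
 also have "... = sw TB (%q v. sw TB (%x u. rmul (p (S v)) (p (S u)) (dl (h \<cdot> x))) q) l"
  using h l by (intro sw_coassoc[symmetric]) (simp_all add: b_rules)
 also have "... = sw TB (%q v. rmul (p (S v)) \<one> (sw TB (%x u. rmul \<one> (p (S u)) (dl (h \<cdot> x))) q)) l"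
  using h l by (simp add: rmul_sw b_rules rmul_rmul)
 also have "... = sw TB (%q v. sw TB (%x y. (p (x \<cdot> q) \<otimes> p (S v)) \<bowtie> p y) h) l"
  using h l by (simp add: sw_rmul_dl_mult rmul_sw b_rules)
 also have "... = sw TB (%x y. sw TB (%q v. (p (x \<cdot> q) \<otimes> p (S v)) \<bowtie> p y) l) h"
  using h l by (intro sw_swap) (simp_all add: b_rules)
 also have "... = sw TB (%x y. (p x \<otimes> e l) \<bowtie> p y) h"
  using h l by (simp add: p_e pure_sw_left b_rules)
 finally show ?thesis .
qed

lemma sw_tmul_PR3:
 assumes h: "h \<in> carrier H" and l: "l \<in> carrier H"
 shows "sw TB (%x y. tmul (dl x) (dl (S y \<cdot> l))) h = sw TB (%c d. (e h \<otimes> p c) \<bowtie> p d) l" (is "?l = _")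
proof -
 have "?l = sw TB (%x y. sw TB (%c d. sw TB (%u v. rmul (p (S v \<cdot> c)) (p (S u \<cdot> d)) (dl x)) y) l) h"
  using h l by (simp add: tmul_dl dl_TK sw_mult sw_antipode b_rules)
 also have "... = sw TB (%c d. sw TB (%x y. sw TB (%u v. rmul (p (S v \<cdot> c)) (p (S u \<cdot> d)) (dl x)) y) h) l"
  using h l by (intro sw_swap) (simp_all add: b_rules)
 also have "... = sw TB (%c d. (e h \<otimes> p c) \<bowtie> p d) l"
 proof (rule sw_cong[OF refl], goal_cases)
  case *: (2 c d)
  have "sw TB (%x y. sw TB (%u v. rmul (p (S v \<cdot> c)) (p (S u \<cdot> d)) (dl x)) y) h
    = sw TB (%q v. sw TB (%x u. rmul (p (S v \<cdot> c)) (p (S u \<cdot> d)) (dl x)) q) h"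
   using h * by (intro sw_coassoc[symmetric]) (simp_all add: b_rules)
  also have "... = sw TB (%q v. rmul (p (S v \<cdot> c)) \<one> (sw TB (%x u. rmul \<one> (p (S u \<cdot> d)) (dl x)) q)) h"
   using h * by (simp add: rmul_sw b_rules rmul_rmul)
  also have "... = sw TB (%q v. (p q \<otimes> p (S v \<cdot> c)) \<bowtie> p d) h"
   using h * by (simp add: sw_rmul_antipode_dl)
  also have "... = (e h \<otimes> p c) \<bowtie> p d"
   using h * by (simp add: e_p pure_sw_left b_rules)
  finally show ?case .
 qed (simp add: l)
 finally show ?thesis .
qed

lemma sw_tmul_PR4:
 assumes h: "h \<in> carrier H" and l: "l \<in> carrier H"
 shows "sw TB (%x y. tmul (dl (h \<cdot> S x)) (dl y)) l = sw TB (%x y. p x \<bowtie> (p y \<otimes> e' l)) h" (is "?l = _")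
proof -
 have "?l = sw TB (%x y. sw TB (%u v. rmul (p u) (p v) (dl (h \<cdot> S x))) y) l"
  using h l by (simp add: tmul_dl dl_TK)
 also have "... = sw TB (%q v. sw TB (%x u. rmul (p u) (p v) (dl (h \<cdot> S x))) q) l"
  using h l by (intro sw_coassoc[symmetric]) (simp_all add: b_rules)
 also have "... = sw TB (%q v. rmul \<one> (p v) (sw TB (%x u. rmul (p u) \<one> (dl (h \<cdot> S x))) q)) l"
  using h l by (simp add: rmul_sw b_rules rmul_rmul)
 also have "... = sw TB (%q v. sw TB (%x y. p x \<bowtie> (p (y \<cdot> S q) \<otimes> p v)) h) l"
  using h l by (simp add: sw_rmul_dl_mult_antipode rmul_sw b_rules)
 also have "... = sw TB (%x y. sw TB (%q v. p x \<bowtie> (p (y \<cdot> S q) \<otimes> p v)) l) h"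
  using h l by (intro sw_swap) (simp_all add: b_rules)
 also have "... = sw TB (%x y. p x \<bowtie> (p y \<otimes> e' l)) h"
  using h l by (simp add: p_e' pure_sw_right b_rules)
 finally show ?thesis .
qed

lemma sw_tmul_PR5:
 assumes h: "h \<in> carrier H" and l: "l \<in> carrier H"
 shows "sw TB (%x y. tmul (dl (S x)) (dl (y \<cdot> l))) h = sw TB (%c d. p c \<bowtie> (e' h \<otimes> p d)) l" (is "?l = _")
proof -
 have "?l = sw TB (%x y. sw TB (%c d. sw TB (%u v. rmul (p (u \<cdot> c)) (p (v \<cdot> d)) (dl (S x))) y) l) h"
  using h l by (simp add: tmul_dl dl_TK sw_mult b_rules)
 also have "... = sw TB (%c d. sw TB (%x y. sw TB (%u v. rmul (p (u \<cdot> c)) (p (v \<cdot> d)) (dl (S x))) y) h) l"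
  using h l by (intro sw_swap) (simp_all add: b_rules)
 also have "... = sw TB (%c d. p c \<bowtie> (e' h \<otimes> p d)) l"
 proof (rule sw_cong[OF refl], goal_cases)
  case *: (2 c d)
  have "sw TB (%x y. sw TB (%u v. rmul (p (u \<cdot> c)) (p (v \<cdot> d)) (dl (S x))) y) h
    = sw TB (%q v. sw TB (%x u. rmul (p (u \<cdot> c)) (p (v \<cdot> d)) (dl (S x))) q) h"
   using h * by (intro sw_coassoc[symmetric]) (simp_all add: b_rules)
  also have "... = sw TB (%q v. rmul \<one> (p (v \<cdot> d)) (sw TB (%x u. rmul (p (u \<cdot> c)) \<one> (dl (S x))) q)) h"
   using h * by (simp add: rmul_sw b_rules rmul_rmul)
  also have "... = sw TB (%q v. p c \<bowtie> (p (S q) \<otimes> p (v \<cdot> d))) h"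
   using h * by (simp add: sw_rmul_dl_antipode)
  also have "... = p c \<bowtie> (e' h \<otimes> p d)"
   using h * by (simp add: e'_p pure_sw_right b_rules)
  finally show ?case .
 qed (simp add: l)
 finally show ?thesis .
qed

lemma dl_one: "dl \<one>\<^bsub>H\<^esub> = \<one> \<bowtie> \<one>"
 by (simp add: dl_def sw_one b_rules p_one)

lemma sw_tmul_e: "l \<in> carrier H ==> sw TB (%x y. tmul (dl x) (dl (S y))) l = e l \<bowtie> \<one>"
 using sw_tmul_PR2[of "\<one>\<^bsub>H\<^esub>" l] by (simp add: sw_one b_rules p_one)

lemma sw_tmul_e': "l \<in> carrier H ==> sw TB (%x y. tmul (dl (S x)) (dl y)) l = \<one> \<bowtie> e' l"
 using sw_tmul_PR4[of "\<one>\<^bsub>H\<^esub>" l] by (simp add: sw_one b_rules p_one)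

lemma TK_alg: "k_algebra R TK"
 by (rule takeuchi_algebra)

lemma TK_mod: "module R TK"
 using TK_alg by (rule k_algebra.axioms(1))

lemma lin_dl_TK: "lin R Q H f ==> lin R Q TK (%x. dl (f x))"
 using lin_dl[of Q f] lin_closed[of R Q H f]
 by (auto simp: lin_def linear_maps_def TK_simps TK_mod dl_TK)

lemma sw_TK: "bilinH TK be ==> h \<in> carrier H ==> sw TK be h = sw TB be h"
 by (rule sw_map[where f = "%x. x"]) (auto simp: lin_def linear_maps_def TB_alg TK_simps TK_TB)

lemma sw_in_TK: "bilinH TK be ==> h \<in> carrier H ==> sw TB be h \<in> carrier TK"
 using sw_closed sw_TK by metis

lemma TK_mult: "V \<in> carrier TK ==> W \<in> carrier TK ==> V \<otimes>\<^bsub>TK\<^esub> W = tmul V W"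
 by (simp add: TK_simps mult_eq_tmul TK_TB)

text \<open>Membership is inherited: each element is a Sweedler sum of products of values of
  \<open>dl\<close>, formed inside the Takeuchi algebra.\<close>

lemma e_TK: "l \<in> carrier H ==> e l \<bowtie> \<one> \<in> carrier TK"
 and e'_TK: "l \<in> carrier H ==> \<one> \<bowtie> e' l \<in> carrier TK"
 using sw_in_TK[of "%x y. dl x \<otimes>\<^bsub>TK\<^esub> dl (S y)" l] sw_in_TK[of "%x y. dl (S x) \<otimes>\<^bsub>TK\<^esub> dl y" l]
 by (simp_all add: TK_mult dl_TK sw_tmul_e[symmetric] sw_tmul_e'[symmetric] b_rules TK_alg TK_mod lin_dl_TK)

lemma dl_partial_rep: "partial_rep R H Z TK dl"
proof -
 interpret TK: k_algebra R TK by (rule TK_alg)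
 note r = lin_rules TK_alg TK_mod lin_dl_TK dl_TK
 have E: "sw TK (%x y. dl x \<otimes>\<^bsub>TK\<^esub> dl (S y)) l = e l \<bowtie> \<one>"
  "sw TK (%x y. dl (S x) \<otimes>\<^bsub>TK\<^esub> dl y) l = \<one> \<bowtie> e' l" if "l \<in> carrier H" for l
  using that by (simp_all add: sw_TK r) (simp_all add: TK_mult dl_TK sw_tmul_e sw_tmul_e')
 have "linH TK dl" by (rule lin_dl_TK) (simp add: lin_rules)
 then show ?thesis
 proof (intro partial_rep.intro partial_rep_axioms.intro hopf_inv_axioms TK_alg)
  show "dl \<one>\<^bsub>H\<^esub> = \<one>\<^bsub>TK\<^esub>" by (simp add: dl_one TK_simps TB_one)
  fix h l assume hl: "h \<in> carrier H" "l \<in> carrier H"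
  have "sw TK (%x y. dl h \<otimes>\<^bsub>TK\<^esub> dl x \<otimes>\<^bsub>TK\<^esub> dl (S y)) l = dl h \<otimes>\<^bsub>TK\<^esub> (e l \<bowtie> \<one>)"
   using hl by (simp add: E[symmetric] mult_sw_left r TK.m_assoc)
  also have "... = sw TB (%x y. (p x \<otimes> e l) \<bowtie> p y) h"
   using hl by (simp add: TK_mult dl_TK e_TK) (simp add: dl_def rmul_sw b_rules)
  also have "... = sw TK (%x y. dl (h \<cdot> x) \<otimes>\<^bsub>TK\<^esub> dl (S y)) l"
   using hl by (simp add: sw_TK r) (simp add: TK_mult dl_TK sw_tmul_PR2)
  finally show "sw TK (%x y. dl h \<otimes>\<^bsub>TK\<^esub> dl x \<otimes>\<^bsub>TK\<^esub> dl (S y)) l = sw TK (%x y. dl (h \<cdot> x) \<otimes>\<^bsub>TK\<^esub> dl (S y)) l" .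
  have "sw TK (%x y. dl x \<otimes>\<^bsub>TK\<^esub> dl (S y) \<otimes>\<^bsub>TK\<^esub> dl l) h = (e h \<bowtie> \<one>) \<otimes>\<^bsub>TK\<^esub> dl l"
   using hl by (simp add: E[symmetric] mult_sw_right r)
  also have "... = sw TB (%c d. (e h \<otimes> p c) \<bowtie> p d) l"
   using hl by (simp add: TK_mult dl_TK e_TK tmul_dl)
  also have "... = sw TK (%x y. dl x \<otimes>\<^bsub>TK\<^esub> dl (S y \<cdot> l)) h"
   using hl by (simp add: sw_TK r) (simp add: TK_mult dl_TK sw_tmul_PR3)
  finally show "sw TK (%x y. dl x \<otimes>\<^bsub>TK\<^esub> dl (S y) \<otimes>\<^bsub>TK\<^esub> dl l) h = sw TK (%x y. dl x \<otimes>\<^bsub>TK\<^esub> dl (S y \<cdot> l)) h" .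
  have "sw TK (%x y. dl h \<otimes>\<^bsub>TK\<^esub> dl (S x) \<otimes>\<^bsub>TK\<^esub> dl y) l = dl h \<otimes>\<^bsub>TK\<^esub> (\<one> \<bowtie> e' l)"
   using hl by (simp add: E[symmetric] mult_sw_left r TK.m_assoc)
  also have "... = sw TB (%x y. p x \<bowtie> (p y \<otimes> e' l)) h"
   using hl by (simp add: TK_mult dl_TK e'_TK) (simp add: dl_def rmul_sw b_rules)
  also have "... = sw TK (%x y. dl (h \<cdot> S x) \<otimes>\<^bsub>TK\<^esub> dl y) l"
   using hl by (simp add: sw_TK r) (simp add: TK_mult dl_TK sw_tmul_PR4)
  finally show "sw TK (%x y. dl h \<otimes>\<^bsub>TK\<^esub> dl (S x) \<otimes>\<^bsub>TK\<^esub> dl y) l = sw TK (%x y. dl (h \<cdot> S x) \<otimes>\<^bsub>TK\<^esub> dl y) l" .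
  have "sw TK (%x y. dl (S x) \<otimes>\<^bsub>TK\<^esub> dl y \<otimes>\<^bsub>TK\<^esub> dl l) h = (\<one> \<bowtie> e' h) \<otimes>\<^bsub>TK\<^esub> dl l"
   using hl by (simp add: E[symmetric] mult_sw_right r)
  also have "... = sw TB (%c d. p c \<bowtie> (e' h \<otimes> p d)) l"
   using hl by (simp add: TK_mult dl_TK e'_TK tmul_dl)
  also have "... = sw TK (%x y. dl (S x) \<otimes>\<^bsub>TK\<^esub> dl (y \<cdot> l)) h"
   using hl by (simp add: sw_TK r) (simp add: TK_mult dl_TK sw_tmul_PR5)
  finally show "sw TK (%x y. dl (S x) \<otimes>\<^bsub>TK\<^esub> dl y \<otimes>\<^bsub>TK\<^esub> dl l) h = sw TK (%x y. dl (S x) \<otimes>\<^bsub>TK\<^esub> dl (y \<cdot> l)) h" .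
 qed (simp add: lin_def)
qed

end

section \<open>The free algebra\<close>

definition word_fun :: "('k, 'r) ring_scheme => 's list => 's list => 'k"
 where "word_fun R u = (%w. if w = u then \<one>\<^bsub>R\<^esub> else \<zero>\<^bsub>R\<^esub>)"

lemma list_prod_closed:
 assumes "k_algebra R B" "set xs \<subseteq> carrier B"
 shows "list_prod B xs \<in> carrier B"
proof -
 interpret B: k_algebra R B by fact
 show ?thesis using assms(2) by (induction xs) (auto simp: list_prod_def)
qed

lemma list_prod_append:
 assumes "k_algebra R B" "set xs \<subseteq> carrier B" "set ys \<subseteq> carrier B"
 shows "list_prod B (xs @ ys) = list_prod B xs \<otimes>\<^bsub>B\<^esub> list_prod B ys"
proof -
 interpret B: k_algebra R B by fact
 show ?thesis using assms(2)
  by (induction xs) (use list_prod_closed[OF assms(1)] assms(3) in "auto simp: list_prod_def B.m_assoc")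
qed

locale free_alg = cring R for R :: "('k, 'r) ring_scheme" and V :: "'s set"
begin

abbreviation "F \<equiv> free_algebra R V"

lemma F_simps:
 "carrier F = {f. f \<in> UNIV \<rightarrow> carrier R \<and> finite {w. f w \<noteq> \<zero>\<^bsub>R\<^esub>} \<and> {w. f w \<noteq> \<zero>\<^bsub>R\<^esub>} \<subseteq> lists V}"
 "monoid.mult F = (%f g w. \<Oplus>\<^bsub>R\<^esub>i\<in>{..length w}. f (take i w) \<otimes>\<^bsub>R\<^esub> g (drop i w))"
 "\<one>\<^bsub>F\<^esub> = word_fun R []" "\<zero>\<^bsub>F\<^esub> = (%w. \<zero>\<^bsub>R\<^esub>)"
 "ring.add F = (%f g w. f w \<oplus>\<^bsub>R\<^esub> g w)" "smult F = (%r f w. r \<otimes>\<^bsub>R\<^esub> f w)"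
 by (simp_all add: free_algebra_def word_fun_def)

lemma F_closed: "f \<in> carrier F ==> f w \<in> carrier R"
 by (auto simp: F_simps)

lemma F_carrierI:
 assumes "!!w. f w \<in> carrier R" "finite S" "!!w. f w \<noteq> \<zero>\<^bsub>R\<^esub> ==> w \<in> S \<and> w \<in> lists V"
 shows "f \<in> carrier F"
 using assms(1,3) finite_subset[of "{w. f w \<noteq> \<zero>\<^bsub>R\<^esub>}" S] assms(2) by (auto simp: F_simps)

lemma F_supp: "f \<in> carrier F ==> f w \<noteq> \<zero>\<^bsub>R\<^esub> ==> w \<in> lists V"
 and F_finite: "f \<in> carrier F ==> finite {w. f w \<noteq> \<zero>\<^bsub>R\<^esub>}"
 unfolding F_simps by blast+

lemma word_fun_closed: "w \<in> lists V ==> word_fun R w \<in> carrier F"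
 by (rule F_carrierI[of _ "{w}"]) (auto simp: word_fun_def split: if_splits)

lemma F_add_closed: "f \<in> carrier F ==> g \<in> carrier F ==> f \<oplus>\<^bsub>F\<^esub> g \<in> carrier F"
proof -
 assume fg: "f \<in> carrier F" "g \<in> carrier F"
 have cl: "f w \<in> carrier R" "g w \<in> carrier R" for w using fg by (simp_all add: F_closed)
 show ?thesis
 proof (rule F_carrierI[of _ "{w. f w \<noteq> \<zero>\<^bsub>R\<^esub>} \<union> {w. g w \<noteq> \<zero>\<^bsub>R\<^esub>}"])
  fix w assume "(f \<oplus>\<^bsub>F\<^esub> g) w \<noteq> \<zero>\<^bsub>R\<^esub>"
  then have "f w \<noteq> \<zero>\<^bsub>R\<^esub> \<or> g w \<noteq> \<zero>\<^bsub>R\<^esub>" by (auto simp: F_simps(5))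
  then show "w \<in> {w. f w \<noteq> \<zero>\<^bsub>R\<^esub>} \<union> {w. g w \<noteq> \<zero>\<^bsub>R\<^esub>} \<and> w \<in> lists V"
   using F_supp fg by blast
 qed (use fg cl in "simp_all add: F_simps(5) F_finite")
qed

lemma F_smult_closed: "r \<in> carrier R ==> f \<in> carrier F ==> r \<odot>\<^bsub>F\<^esub> f \<in> carrier F"
proof -
 assume rf: "r \<in> carrier R" "f \<in> carrier F"
 have cl: "f w \<in> carrier R" for w using rf by (simp add: F_closed)
 show ?thesis
 proof (rule F_carrierI[of _ "{w. f w \<noteq> \<zero>\<^bsub>R\<^esub>}"])
  fix w assume "(r \<odot>\<^bsub>F\<^esub> f) w \<noteq> \<zero>\<^bsub>R\<^esub>"
  then have "f w \<noteq> \<zero>\<^bsub>R\<^esub>" using rf(1) by (auto simp: F_simps(6))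
  then show "w \<in> {w. f w \<noteq> \<zero>\<^bsub>R\<^esub>} \<and> w \<in> lists V" using F_supp rf by blast
 qed (use rf cl in "simp_all add: F_simps(6) F_finite")
qed

lemma F_zero_closed: "\<zero>\<^bsub>F\<^esub> \<in> carrier F"
 by (rule F_carrierI[of _ "{}"]) (auto simp: F_simps)

lemma F_mult_closed: "f \<in> carrier F ==> g \<in> carrier F ==> f \<otimes>\<^bsub>F\<^esub> g \<in> carrier F"
proof -
 assume fg: "f \<in> carrier F" "g \<in> carrier F"
 have cl: "f w \<in> carrier R" "g w \<in> carrier R" for w using fg by (simp_all add: F_closed)
 let ?S = "(%(u, v). u @ v) ` ({w. f w \<noteq> \<zero>\<^bsub>R\<^esub>} \<times> {w. g w \<noteq> \<zero>\<^bsub>R\<^esub>})"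
 show ?thesis
 proof (rule F_carrierI[of _ ?S])
  fix w assume nz: "(f \<otimes>\<^bsub>F\<^esub> g) w \<noteq> \<zero>\<^bsub>R\<^esub>"
  have "\<exists>i\<in>{..length w}. f (take i w) \<otimes>\<^bsub>R\<^esub> g (drop i w) \<noteq> \<zero>\<^bsub>R\<^esub>"
  proof (rule ccontr)
   assume "\<not> ?thesis"
   then have "(f \<otimes>\<^bsub>F\<^esub> g) w = (\<Oplus>\<^bsub>R\<^esub>i\<in>{..length w}. \<zero>\<^bsub>R\<^esub>)"
    by (simp only: F_simps) (rule finsum_cong_on, auto)
   then show False using nz by simp
  qed
  then obtain i where "f (take i w) \<noteq> \<zero>\<^bsub>R\<^esub>" "g (drop i w) \<noteq> \<zero>\<^bsub>R\<^esub>"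
   using cl by (metis l_null r_null)
  moreover from this have "take i w @ drop i w \<in> lists V"
   unfolding append_in_lists_conv using F_supp fg by blast
  ultimately show "w \<in> ?S \<and> w \<in> lists V"
   by (auto intro!: image_eqI[of _ _ "(take i w, drop i w)"])
 next
  show "finite ?S" using fg by (simp add: F_finite)
 qed (use cl in "auto simp: F_simps intro!: finsum_closed")
qed

lemma F_module: "module R F"
proof (rule moduleI)
 show "abelian_group F"
 proof (rule abelian_groupI)
  fix f assume f: "f \<in> carrier F"
  have cl: "f w \<in> carrier R" for w using f by (simp add: F_closed)
  show "\<exists>g\<in>carrier F. g \<oplus>\<^bsub>F\<^esub> f = \<zero>\<^bsub>F\<^esub>"
   using F_smult_closed[OF a_inv_closed[OF one_closed] f] cl
   by (intro bexI[of _ "(\<ominus>\<^bsub>R\<^esub> \<one>\<^bsub>R\<^esub>) \<odot>\<^bsub>F\<^esub> f"]) (auto simp: F_simps l_minus l_neg)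
 qed (auto simp: F_add_closed F_zero_closed, auto simp: F_simps fun_eq_iff Pi_iff a_ac)
qed (auto simp: F_smult_closed is_cring, auto simp: F_simps fun_eq_iff Pi_iff l_distr r_distr m_assoc)

lemma F_l_distr:
 assumes "f \<in> carrier F" "g \<in> carrier F" "h \<in> carrier F"
 shows "(f \<oplus>\<^bsub>F\<^esub> g) \<otimes>\<^bsub>F\<^esub> h = f \<otimes>\<^bsub>F\<^esub> h \<oplus>\<^bsub>F\<^esub> g \<otimes>\<^bsub>F\<^esub> h"
  and "h \<otimes>\<^bsub>F\<^esub> (f \<oplus>\<^bsub>F\<^esub> g) = h \<otimes>\<^bsub>F\<^esub> f \<oplus>\<^bsub>F\<^esub> h \<otimes>\<^bsub>F\<^esub> g"
proof -
 note cl = assms[THEN F_closed]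
 have "(\<Oplus>\<^bsub>R\<^esub>i\<in>I. (f (u i) \<oplus>\<^bsub>R\<^esub> g (u i)) \<otimes>\<^bsub>R\<^esub> h (v i))
   = (\<Oplus>\<^bsub>R\<^esub>i\<in>I. f (u i) \<otimes>\<^bsub>R\<^esub> h (v i)) \<oplus>\<^bsub>R\<^esub> (\<Oplus>\<^bsub>R\<^esub>i\<in>I. g (u i) \<otimes>\<^bsub>R\<^esub> h (v i))"
  "(\<Oplus>\<^bsub>R\<^esub>i\<in>I. h (u i) \<otimes>\<^bsub>R\<^esub> (f (v i) \<oplus>\<^bsub>R\<^esub> g (v i)))
   = (\<Oplus>\<^bsub>R\<^esub>i\<in>I. h (u i) \<otimes>\<^bsub>R\<^esub> f (v i)) \<oplus>\<^bsub>R\<^esub> (\<Oplus>\<^bsub>R\<^esub>i\<in>I. h (u i) \<otimes>\<^bsub>R\<^esub> g (v i))"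
  if "finite I" for I :: "nat set" and u v
  using cl by (subst finsum_addf[symmetric]; auto intro!: finsum_cong_on simp: l_distr r_distr)+
 then show "(f \<oplus>\<^bsub>F\<^esub> g) \<otimes>\<^bsub>F\<^esub> h = f \<otimes>\<^bsub>F\<^esub> h \<oplus>\<^bsub>F\<^esub> g \<otimes>\<^bsub>F\<^esub> h"
  "h \<otimes>\<^bsub>F\<^esub> (f \<oplus>\<^bsub>F\<^esub> g) = h \<otimes>\<^bsub>F\<^esub> f \<oplus>\<^bsub>F\<^esub> h \<otimes>\<^bsub>F\<^esub> g"
  by (simp_all add: F_simps fun_eq_iff)
qed

lemma F_smult_mult:
 assumes "r \<in> carrier R" "f \<in> carrier F" "g \<in> carrier F"
 shows "(r \<odot>\<^bsub>F\<^esub> f) \<otimes>\<^bsub>F\<^esub> g = r \<odot>\<^bsub>F\<^esub> (f \<otimes>\<^bsub>F\<^esub> g)" "f \<otimes>\<^bsub>F\<^esub> (r \<odot>\<^bsub>F\<^esub> g) = r \<odot>\<^bsub>F\<^esub> (f \<otimes>\<^bsub>F\<^esub> g)"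
 using assms(1) assms(2,3)[THEN F_closed]
 by (simp_all add: F_simps fun_eq_iff finsum_rdistr m_ac)

text \<open>Among all cuts of \<open>w\<close> only the one after \<open>length u\<close> letters
  can contribute to the convolution.\<close>

lemma word_fun_mult: "word_fun R u \<otimes>\<^bsub>F\<^esub> word_fun R v = word_fun R (u @ v)"
proof
 fix w
 have eq: "word_fun R u (take i w) \<otimes>\<^bsub>R\<^esub> word_fun R v (drop i w)
   = (if length u = i then word_fun R (u @ v) w else \<zero>\<^bsub>R\<^esub>)" if "i \<in> {..length w}" for i
  using that by (auto simp: word_fun_def min_def split: if_splits)
 have "(word_fun R u \<otimes>\<^bsub>F\<^esub> word_fun R v) w
   = (\<Oplus>\<^bsub>R\<^esub>i\<in>{..length w}. if length u = i then word_fun R (u @ v) w else \<zero>\<^bsub>R\<^esub>)"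
  by (simp only: F_simps) (rule finsum_cong_on, rule eq)
 also have "... = word_fun R (u @ v) w"
 proof (cases "length u \<le> length w")
  case True
  then show ?thesis
   using add.finprod_singleton[of "length u" "{..length w}" "%_. word_fun R (u @ v) w"]
   by (auto simp: word_fun_def)
 next
  case False
  then have "(\<Oplus>\<^bsub>R\<^esub>i\<in>{..length w}. if length u = i then word_fun R (u @ v) w else \<zero>\<^bsub>R\<^esub>) = (\<Oplus>\<^bsub>R\<^esub>i\<in>{..length w}. \<zero>\<^bsub>R\<^esub>)"
   by (intro finsum_cong_on) auto
  then show ?thesis using False by (auto simp: word_fun_def)
 qed
 finally show "(word_fun R u \<otimes>\<^bsub>F\<^esub> word_fun R v) w = word_fun R (u @ v) w" .
qed

text \<open>Induction on a finite set containing the support, splitting off the coefficient of one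
  word at a time.\<close>

lemma F_induct [consumes 1, case_names zero word add]:
 assumes "f \<in> carrier F"
  and zero: "P \<zero>\<^bsub>F\<^esub>"
  and word: "!!r w. r \<in> carrier R ==> w \<in> lists V ==> P (r \<odot>\<^bsub>F\<^esub> word_fun R w)"
  and add: "!!f g. f \<in> carrier F ==> g \<in> carrier F ==> P f ==> P g ==> P (f \<oplus>\<^bsub>F\<^esub> g)"
 shows "P f"
proof -
 have "\<forall>f. f \<in> carrier F \<and> {w. f w \<noteq> \<zero>\<^bsub>R\<^esub>} \<subseteq> S --> P f" if "finite S" for S
  using that
 proof (induction S)
  case empty
  then show ?case using zero by (auto simp: F_simps fun_eq_iff)
 next
  case (insert w S)
  show ?case
  proof (intro allI impI)
   fix f assume f: "f \<in> carrier F \<and> {w. f w \<noteq> \<zero>\<^bsub>R\<^esub>} \<subseteq> insert w S"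
   have cl: "f u \<in> carrier R" for u using f by (simp add: F_closed)
   show "P f"
   proof (cases "f w = \<zero>\<^bsub>R\<^esub>")
    case True
    then have "{w. f w \<noteq> \<zero>\<^bsub>R\<^esub>} \<subseteq> S" using f by auto
    then show ?thesis using insert.IH f by blast
   next
    case False
    then have w: "w \<in> lists V" using f unfolding F_simps by blast
    let ?g = "f(w := \<zero>\<^bsub>R\<^esub>)"
    have g: "?g \<in> carrier F"
     by (rule F_carrierI[of _ "{w. f w \<noteq> \<zero>\<^bsub>R\<^esub>}"]) (use f cl in "auto simp: F_simps split: if_splits")
    have "f = ?g \<oplus>\<^bsub>F\<^esub> (f w \<odot>\<^bsub>F\<^esub> word_fun R w)"
     using cl by (auto simp: F_simps fun_eq_iff word_fun_def)
    moreover have "{u. ?g u \<noteq> \<zero>\<^bsub>R\<^esub>} \<subseteq> S" using f by auto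
    then have "P ?g" using insert.IH g by blast
    ultimately show ?thesis
     using add[OF g F_smult_closed[OF cl word_fun_closed[OF w]] _ word[OF cl w]] by metis
   qed
  qed
 qed
 then show ?thesis using assms(1) by (auto simp: F_simps)
qed

lemma F_algebra: "k_algebra R F"
proof -
 interpret M: module R F by (rule F_module)
 have z: "\<zero>\<^bsub>F\<^esub> \<otimes>\<^bsub>F\<^esub> f = \<zero>\<^bsub>F\<^esub>" "f \<otimes>\<^bsub>F\<^esub> \<zero>\<^bsub>F\<^esub> = \<zero>\<^bsub>F\<^esub>" if "f \<in> carrier F" for f
  using F_closed[OF that] by (simp_all add: F_simps)
 have wc: "word_fun R w \<in> carrier F" if "w \<in> lists V" for w using that by (rule word_fun_closed)
 note r = z wc F_mult_closed F_l_distr F_smult_mult F_smult_closed word_fun_mult F_add_closed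
  M.smult_r_distr
 have one_closed: "\<one>\<^bsub>F\<^esub> \<in> carrier F" by (simp add: F_simps(3) wc)
 have one: "\<one>\<^bsub>F\<^esub> \<otimes>\<^bsub>F\<^esub> f = f" "f \<otimes>\<^bsub>F\<^esub> \<one>\<^bsub>F\<^esub> = f" if "f \<in> carrier F" for f
  using that by (induction rule: F_induct) (simp_all add: r one_closed, simp_all add: F_simps(3) r)
 have assoc: "f \<otimes>\<^bsub>F\<^esub> g \<otimes>\<^bsub>F\<^esub> h = f \<otimes>\<^bsub>F\<^esub> (g \<otimes>\<^bsub>F\<^esub> h)"
  if f: "f \<in> carrier F" and g: "g \<in> carrier F" and h: "h \<in> carrier F" for f g h
  using f
 proof (induction rule: F_induct)
  case (word r u)
  show ?case using g
  proof (induction rule: F_induct)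
   case (word r' v)
   show ?case using h
    by (induction rule: F_induct) (use \<open>r \<in> carrier R\<close> \<open>u \<in> lists V\<close> word in "simp_all add: r")
  qed (use h word in "simp_all add: r")
 qed (use g h in "simp_all add: r")
 show ?thesis
  by (intro k_algebraI monoidI F_module) (simp_all add: F_mult_closed one_closed one assoc F_l_distr F_smult_mult)
qed

definition ev :: "('k, 'b, 'z) module_scheme => ('s => 'b) => ('s list => 'k) => 'b"
 where "ev B q f = (\<Oplus>\<^bsub>B\<^esub>w\<in>{w. f w \<noteq> \<zero>\<^bsub>R\<^esub>}. f w \<odot>\<^bsub>B\<^esub> list_prod B (map q w))"

context
 fixes B :: "('k, 'b, 'z) module_scheme" and q :: "'s => 'b"
 assumes B: "k_algebra R B" and q: "!!x. x \<in> V ==> q x \<in> carrier B"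
begin

interpretation B: k_algebra R B by (rule B)

lemma word_closed: "w \<in> lists V ==> list_prod B (map q w) \<in> carrier B"
 using q by (intro list_prod_closed[OF B]) auto

text \<open>Additivity of the substitution map compares three sums over different supports; a common
  finite set of words makes them comparable.\<close>

lemma ev_superset:
 assumes "f \<in> carrier F" "finite S" "{w. f w \<noteq> \<zero>\<^bsub>R\<^esub>} \<subseteq> S" "S \<subseteq> lists V"
 shows "ev B q f = (\<Oplus>\<^bsub>B\<^esub>w\<in>S. f w \<odot>\<^bsub>B\<^esub> list_prod B (map q w))"
 unfolding ev_def
 by (rule B.add.finprod_mono_neutral_cong_left)
  (use assms word_closed F_closed[OF assms(1)] in "auto simp: subset_iff")

lemma ev_linear: "ev B q \<in> linear_maps R F B"
proof (rule linear_mapsI)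
 fix f assume f: "f \<in> carrier F"
 then show "ev B q f \<in> carrier B"
  unfolding ev_def using word_closed[OF F_supp[OF f]] F_closed[OF f] by (intro B.finsum_closed) auto
next
 fix f g assume fg: "f \<in> carrier F" "g \<in> carrier F"
 let ?S = "{w. f w \<noteq> \<zero>\<^bsub>R\<^esub>} \<union> {w. g w \<noteq> \<zero>\<^bsub>R\<^esub>}"
 have S: "finite ?S" "?S \<subseteq> lists V" using fg by (auto simp: F_simps)
 note cl = F_closed[OF fg(1)] F_closed[OF fg(2)]
 have "ev B q (f \<oplus>\<^bsub>F\<^esub> g) = (\<Oplus>\<^bsub>B\<^esub>w\<in>?S. (f \<oplus>\<^bsub>F\<^esub> g) w \<odot>\<^bsub>B\<^esub> list_prod B (map q w))"
  using fg S cl by (intro ev_superset F_add_closed) (auto simp: F_simps(5))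
 also have "... = (\<Oplus>\<^bsub>B\<^esub>w\<in>?S. f w \<odot>\<^bsub>B\<^esub> list_prod B (map q w) \<oplus>\<^bsub>B\<^esub> g w \<odot>\<^bsub>B\<^esub> list_prod B (map q w))"
  using S cl word_closed by (intro finsum_cong_on) (auto simp: F_simps(5) B.smult_l_distr subset_iff)
 also have "... = ev B q f \<oplus>\<^bsub>B\<^esub> ev B q g"
  using fg S cl word_closed by (simp add: ev_superset[of _ ?S] B.finsum_addf Pi_iff subset_iff)
 finally show "ev B q (f \<oplus>\<^bsub>F\<^esub> g) = ev B q f \<oplus>\<^bsub>B\<^esub> ev B q g" .
next
 fix r f assume r: "r \<in> carrier R" and f: "f \<in> carrier F"
 let ?S = "{w. f w \<noteq> \<zero>\<^bsub>R\<^esub>}"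
 have S: "finite ?S" "?S \<subseteq> lists V" using f by (auto simp: F_simps)
 note cl = F_closed[OF f]
 have "ev B q (r \<odot>\<^bsub>F\<^esub> f) = (\<Oplus>\<^bsub>B\<^esub>w\<in>?S. (r \<odot>\<^bsub>F\<^esub> f) w \<odot>\<^bsub>B\<^esub> list_prod B (map q w))"
  using f S cl r by (intro ev_superset F_smult_closed) (auto simp: F_simps(6))
 also have "... = (\<Oplus>\<^bsub>B\<^esub>w\<in>?S. r \<odot>\<^bsub>B\<^esub> (f w \<odot>\<^bsub>B\<^esub> list_prod B (map q w)))"
  using S cl word_closed r by (intro finsum_cong_on) (auto simp: F_simps(6) B.smult_assoc1 subset_iff)
 also have "... = r \<odot>\<^bsub>B\<^esub> ev B q f"
  unfolding ev_def using S cl word_closed r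
  by (intro B.finsum_smult_ldistr[symmetric]) (auto simp: subset_iff)
 finally show "ev B q (r \<odot>\<^bsub>F\<^esub> f) = r \<odot>\<^bsub>B\<^esub> ev B q f" .
qed

lemma ev_word: "w \<in> lists V ==> ev B q (word_fun R w) = list_prod B (map q w)"
proof -
 assume w: "w \<in> lists V"
 have "ev B q (word_fun R w) = (\<Oplus>\<^bsub>B\<^esub>u\<in>{w}. word_fun R w u \<odot>\<^bsub>B\<^esub> list_prod B (map q u))"
  using w by (intro ev_superset word_fun_closed) (auto simp: word_fun_def)
 then show ?thesis using word_closed[OF w] by (simp add: word_fun_def)
qed

lemma ev_alg_hom: "ev B q \<in> alg_hom R F B"
proof (rule alg_homI[OF ev_linear])
 interpret F: k_algebra R F by (rule F_algebra)
 note lin = linear_maps_add[OF ev_linear] linear_maps_smult[OF ev_linear]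
 have z: "ev B q \<zero>\<^bsub>F\<^esub> = \<zero>\<^bsub>B\<^esub>"
  by (rule add_maps_zero[OF F.abelian_group_axioms B.abelian_group_axioms linear_maps_add_maps[OF ev_linear]])
 note r = lin z word_fun_closed linear_maps_closed[OF ev_linear] F.l_distr F.r_distr B.l_distr B.r_distr
  F.smult_mult_left F.smult_mult_right B.smult_mult_left B.smult_mult_right word_fun_mult ev_word word_closed
 fix f g assume f: "f \<in> carrier F" and g: "g \<in> carrier F"
 show "ev B q (f \<otimes>\<^bsub>F\<^esub> g) = ev B q f \<otimes>\<^bsub>B\<^esub> ev B q g" using f
 proof (induction rule: F_induct)
  case (word a u)
  show ?case using g
  proof (induction rule: F_induct)
   case (word b v)
   have "list_prod B (map q u @ map q v) = list_prod B (map q u) \<otimes>\<^bsub>B\<^esub> list_prod B (map q v)"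
    using q word \<open>u \<in> lists V\<close> by (intro list_prod_append[OF B]) auto
   then show ?case using word \<open>a \<in> carrier R\<close> \<open>u \<in> lists V\<close> by (simp add: r)
  qed (use word in "simp_all add: r")
 qed (use g in "simp_all add: r")
next
 show "ev B q \<one>\<^bsub>F\<^esub> = \<one>\<^bsub>B\<^esub>"
  using ev_word[of "[]"] by (simp add: F_simps(3) list_prod_def)
qed

lemma ev_gen: "x \<in> V ==> ev B q (free_gen R x) = q x"
 using ev_word[of "[x]"] q by (simp add: free_gen_def word_fun_def[symmetric] list_prod_def)

end

end

section \<open>Quotient algebras\<close>

locale quot = M: k_algebra R M + I: ideal I M
 for R :: "('k, 'r) ring_scheme" and M :: "('k, 'm, 'x) module_scheme" and I :: "'m set"
begin

abbreviation "Q \<equiv> quot_alg M I"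
abbreviation (input) "pr x \<equiv> I +>\<^bsub>M\<^esub> x"

lemma Q_simps: "carrier Q = a_rcosets\<^bsub>M\<^esub> I" "monoid.mult Q = rcoset_mult M I" "\<one>\<^bsub>Q\<^esub> = pr \<one>\<^bsub>M\<^esub>"
 "\<zero>\<^bsub>Q\<^esub> = I" "ring.add Q = set_add M"
 by (simp_all add: quot_alg_def FactRing_def)

lemma pr_eq_iff: "x \<in> carrier M ==> y \<in> carrier M ==> pr x = pr y \<longleftrightarrow> x \<ominus>\<^bsub>M\<^esub> y \<in> I"
 using M.quotient_eq_iff_same_a_r_cos[OF I.ideal_axioms] by blast

lemma Q_ring: "ring Q"
proof -
 interpret q: ring "M Quot I" by (rule I.quotient_is_ring)
 have "abelian_group Q"
  using q.a_closed q.zero_closed q.a_assoc q.a_comm q.l_zero q.add.l_inv_ex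
  by (intro abelian_groupI) (simp_all add: quot_alg_def)
 moreover have "monoid Q"
  using q.m_closed q.one_closed q.m_assoc q.l_one q.r_one by (intro monoidI) (simp_all add: quot_alg_def)
 ultimately show ?thesis
  using q.l_distr q.r_distr by (intro ringI) (simp_all add: quot_alg_def)
qed

text \<open>A scalar acts as multiplication by r 1, so every two-sided ideal is a submodule.\<close>

lemma smult_I: "r \<in> carrier R ==> i \<in> I ==> r \<odot>\<^bsub>M\<^esub> i \<in> I"
 using I.I_l_closed[of i "r \<odot>\<^bsub>M\<^esub> \<one>\<^bsub>M\<^esub>"] I.a_subset by (auto simp: M.smult_mult_left)

lemma pr_ring_hom: "pr \<in> ring_hom M Q"
 using I.rcos_ring_hom by (simp add: ring_hom_def quot_alg_def)

text \<open>The scalar action on the quotient is a union over all representatives of the coset. By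
  \<open>smult_I\<close> the members of this union coincide, so the union is a single coset.\<close>

lemma pr_smult: 
 assumes "r \<in> carrier R" "x \<in> carrier M"
 shows "r \<odot>\<^bsub>Q\<^esub> pr x = pr (r \<odot>\<^bsub>M\<^esub> x)"
proof -
 have sub: "abelian_subgroup I M"
  by (rule abelian_subgroupI3[OF I.additive_subgroup_axioms M.abelian_group_axioms])
 have "pr (r \<odot>\<^bsub>M\<^esub> y) = pr (r \<odot>\<^bsub>M\<^esub> x)" if y: "y \<in> pr x" for y
 proof -
  have yc: "y \<in> carrier M" using y assms(2) M.a_r_coset_subset_G[OF I.a_subset] by blast
  have "pr y = pr x" using M.a_repr_independence[OF y assms(2) I.a_subgroup] by simp
  then have "y \<ominus>\<^bsub>M\<^esub> x \<in> I" using pr_eq_iff[OF yc assms(2)] by simp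
  then have "r \<odot>\<^bsub>M\<^esub> (y \<ominus>\<^bsub>M\<^esub> x) \<in> I" using smult_I assms by blast
  then show ?thesis
   using yc assms by (simp add: pr_eq_iff a_minus_def M.smult_r_distr M.smult_r_minus)
 qed
 moreover have "x \<in> pr x" by (rule abelian_subgroup.a_rcos_self[OF sub assms(2)])
 ultimately have "(\<Union>y\<in>pr x. pr (r \<odot>\<^bsub>M\<^esub> y)) = pr (r \<odot>\<^bsub>M\<^esub> x)" by blast
 then show ?thesis by (simp add: quot_alg_def)
qed

lemma Q_carrierE:
 assumes "W \<in> carrier Q"
 obtains x where "x \<in> carrier M" "W = pr x"
 using assms unfolding Q_simps A_RCOSETS_def' by auto

lemma pr_closed: "x \<in> carrier M ==> pr x \<in> carrier Q"
 using pr_ring_hom by (auto simp: ring_hom_def)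

lemma pr_add: "x \<in> carrier M ==> y \<in> carrier M ==> pr (x \<oplus>\<^bsub>M\<^esub> y) = pr x \<oplus>\<^bsub>Q\<^esub> pr y"
 and pr_mult: "x \<in> carrier M ==> y \<in> carrier M ==> pr (x \<otimes>\<^bsub>M\<^esub> y) = pr x \<otimes>\<^bsub>Q\<^esub> pr y"
 and pr_one: "pr \<one>\<^bsub>M\<^esub> = \<one>\<^bsub>Q\<^esub>"
 using pr_ring_hom by (auto simp: ring_hom_def)

lemma Q_algebra: "k_algebra R Q"
proof -
 interpret Q: ring Q by (rule Q_ring)
 note r = pr_smult pr_add[symmetric] pr_mult[symmetric] pr_closed
 have "module R Q"
  by (intro moduleI M.R.is_cring Q.abelian_group_axioms)
   (auto elim!: Q_carrierE simp: r M.smult_l_distr M.smult_r_distr M.smult_assoc1)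
 then show ?thesis
  using Q_ring
  by (auto simp: k_algebra_def k_algebra_axioms_def r M.smult_mult_left M.smult_mult_right elim!: Q_carrierE)
qed

lemma pr_alg_hom: "pr \<in> alg_hom R M Q"
 by (intro alg_homI linear_mapsI) (simp_all add: pr_closed pr_add pr_smult pr_mult pr_one)

lemma quot_universal:
 assumes "f \<in> alg_hom R M N" "k_algebra R N" "!!x. x \<in> I ==> f x = \<zero>\<^bsub>N\<^esub>"
 shows "\<exists>g\<in>alg_hom R Q N. \<forall>x\<in>carrier M. g (pr x) = f x"
proof -
 interpret N: k_algebra R N by fact
 define g where "g W = f (SOME x. x \<in> carrier M \<and> W = pr x)" for W
 have g: "g (pr x) = f x" if x: "x \<in> carrier M" for x
 proof -
  define y where "y = (SOME y. y \<in> carrier M \<and> pr x = pr y)"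
  have y: "y \<in> carrier M \<and> pr x = pr y"
   unfolding y_def by (rule someI[of _ x]) (simp add: x)
  then have "f (y \<ominus>\<^bsub>M\<^esub> x) = \<zero>\<^bsub>N\<^esub>" using pr_eq_iff[of y x] x assms(3) by simp
  moreover have "f y = f ((y \<ominus>\<^bsub>M\<^esub> x) \<oplus>\<^bsub>M\<^esub> x)" using x y by (simp add: a_minus_def M.a_assoc M.l_neg)
  ultimately have "f y = f x"
   using x y by (simp add: alg_hom_add[OF assms(1)] alg_hom_closed[OF assms(1)])
  then show ?thesis by (simp add: g_def y_def)
 qed
 have "g \<in> alg_hom R Q N"
 proof (intro alg_homI linear_mapsI)
  show "g \<one>\<^bsub>Q\<^esub> = \<one>\<^bsub>N\<^esub>" using g[of "\<one>\<^bsub>M\<^esub>"] by (simp add: pr_one alg_hom_one[OF assms(1)])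
 qed (auto elim!: Q_carrierE simp: g alg_hom_closed[OF assms(1)] pr_add[symmetric] pr_mult[symmetric] pr_smult
   alg_hom_add[OF assms(1)] alg_hom_mult[OF assms(1)] alg_hom_smult[OF assms(1)])
 then show ?thesis using g by blast
qed

end

lemma kernel_Idl:
 assumes "k_algebra R M" "k_algebra R N" "f \<in> alg_hom R M N" "U \<subseteq> carrier M" "!!u. u \<in> U ==> f u = \<zero>\<^bsub>N\<^esub>"
  and "x \<in> Idl\<^bsub>M\<^esub> U"
 shows "f x = \<zero>\<^bsub>N\<^esub>"
proof -
 interpret M: k_algebra R M by fact
 interpret N: k_algebra R N by fact
 interpret h: ring_hom_ring M N f
  using assms(3) by (intro ring_hom_ring.intro M.ring_axioms N.ring_axioms ring_hom_ring_axioms.intro) (simp add: alg_hom_def)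
 have "Idl\<^bsub>M\<^esub> U \<subseteq> a_kernel M N f"
  by (intro M.genideal_minimal h.kernel_is_ideal) (unfold a_kernel_def', use assms(4,5) in blast)
 then show ?thesis using assms(6) unfolding a_kernel_def' by blast
qed

section \<open>The partial Hopf algebra as an algebra\<close>

lemma alg_hom_minus:
 assumes "k_algebra R M" "k_algebra R N" "f \<in> alg_hom R M N" "x \<in> carrier M" "y \<in> carrier M"
 shows "f (x \<ominus>\<^bsub>M\<^esub> y) = f x \<ominus>\<^bsub>N\<^esub> f y"
proof -
 interpret M: k_algebra R M by fact
 interpret N: k_algebra R N by fact
 have "f (\<ominus>\<^bsub>M\<^esub> y) \<oplus>\<^bsub>N\<^esub> f y = \<zero>\<^bsub>N\<^esub>"
  using assms(5) add_maps_zero[OF M.abelian_group_axioms N.abelian_group_axioms linear_maps_add_maps[OF alg_hom_linear[OF assms(3)]]]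
  by (simp add: alg_hom_add[OF assms(3), symmetric] M.l_neg)
 then have "f (\<ominus>\<^bsub>M\<^esub> y) = \<ominus>\<^bsub>N\<^esub> f y"
  using assms(5) alg_hom_closed[OF assms(3)] by (simp add: N.minus_equality)
 then show ?thesis using assms by (simp add: a_minus_def alg_hom_add[OF assms(3)])
qed

context hopf_inv begin

abbreviation "TH \<equiv> tens_alg R H"
abbreviation "PH \<equiv> par_alg R H"
abbreviation "\<tau> \<equiv> tens_gen R H"
abbreviation "\<pi> \<equiv> par_gen R H"

interpretation F: free_alg R "carrier H"
 by (simp add: free_alg_def algebra.R.is_cring)

interpretation FA: k_algebra R F.F by (rule F.F_algebra)

lemma free_gen_closed: "x \<in> carrier H ==> free_gen R x \<in> carrier F.F"
 using F.word_fun_closed[of "[x]"] by (simp add: word_fun_def free_gen_def)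

definition "tens_rel = {free_gen R (x \<oplus>\<^bsub>H\<^esub> y) \<ominus>\<^bsub>F.F\<^esub> (free_gen R x \<oplus>\<^bsub>F.F\<^esub> free_gen R y) | x y.
    x \<in> carrier H \<and> y \<in> carrier H} \<union>
   {free_gen R (r \<odot>\<^bsub>H\<^esub> x) \<ominus>\<^bsub>F.F\<^esub> r \<odot>\<^bsub>F.F\<^esub> free_gen R x | r x. r \<in> carrier R \<and> x \<in> carrier H}"

lemma tens_ideal_eq: "tens_ideal R H = Idl\<^bsub>F.F\<^esub> tens_rel"
 by (simp add: tens_ideal_def tens_rel_def Let_def)

lemma tens_rel_subset: "tens_rel \<subseteq> carrier F.F"
 by (auto simp: tens_rel_def free_gen_closed intro!: FA.minus_closed FA.a_closed FA.smult_closed simp del: FA.minus_closed)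

interpretation TQ: quot R F.F "tens_ideal R H"
 by (intro quot.intro FA.k_algebra_axioms) (simp add: tens_ideal_eq FA.genideal_ideal tens_rel_subset)

lemma T_alg: "k_algebra R TH"
 using TQ.Q_algebra by (simp add: tens_alg_def)

interpretation T: k_algebra R TH by (rule T_alg)

lemma T_mod: "module R TH" by (rule T.module_axioms)

lemma tens_proj_hom: "(%f. tens_ideal R H +>\<^bsub>F.F\<^esub> f) \<in> alg_hom R F.F TH"
 using TQ.pr_alg_hom by (simp add: tens_alg_def)

lemma tens_gen_linear: "\<tau> \<in> linear_maps R H TH"
proof (rule linear_mapsI)
 note hom = alg_hom_closed[OF tens_proj_hom] alg_hom_add[OF tens_proj_hom, symmetric] alg_hom_smult[OF tens_proj_hom, symmetric]
 show "\<tau> x \<in> carrier TH" if "x \<in> carrier H" for x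
  using that by (simp add: tens_gen_def hom free_gen_closed)
 have rel: "u \<in> tens_rel ==> u \<in> tens_ideal R H" for u
  unfolding tens_ideal_eq using FA.genideal_self[OF tens_rel_subset] by blast
 show "\<tau> (x \<oplus>\<^bsub>H\<^esub> y) = \<tau> x \<oplus>\<^bsub>TH\<^esub> \<tau> y" if "x \<in> carrier H" "y \<in> carrier H" for x y
  unfolding tens_gen_def using that
  by (subst alg_hom_add[OF tens_proj_hom, symmetric], simp_all add: free_gen_closed)
   (subst TQ.pr_eq_iff, simp_all add: free_gen_closed, rule rel, unfold tens_rel_def, blast)
 show "\<tau> (r \<odot>\<^bsub>H\<^esub> x) = r \<odot>\<^bsub>TH\<^esub> \<tau> x" if "r \<in> carrier R" "x \<in> carrier H" for r x
  unfolding tens_gen_def using that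
  by (subst alg_hom_smult[OF tens_proj_hom, symmetric], simp_all add: free_gen_closed)
   (subst TQ.pr_eq_iff, simp_all add: free_gen_closed, rule rel, unfold tens_rel_def, blast)
qed

lemma lin_\<tau>: "lin R M H f ==> lin R M TH (%x. \<tau> (f x))"
 by (rule lin_comp[of R H TH \<tau>]) (simp_all add: lin_def tens_gen_linear T_mod)

lemma tens_gen_closed [simp]: "h \<in> carrier H ==> \<tau> h \<in> carrier TH"
 by (rule linear_maps_closed[OF tens_gen_linear])

lemma tens_universal:
 assumes "k_algebra R B" "q \<in> linear_maps R H B"
 shows "\<exists>f\<in>alg_hom R TH B. \<forall>h\<in>carrier H. f (\<tau> h) = q h"
proof -
 interpret B: k_algebra R B by fact
 have q: "q h \<in> carrier B" if "h \<in> carrier H" for h using assms(2) that by (rule linear_maps_closed)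
 note ev = F.ev_alg_hom[OF assms(1) q] and gen = F.ev_gen[OF assms(1) q]
 have "F.ev B q u = \<zero>\<^bsub>B\<^esub>" if "u \<in> tens_rel" for u
  using that unfolding tens_rel_def
  by (auto simp: alg_hom_minus[OF FA.k_algebra_axioms assms(1) ev] free_gen_closed alg_hom_add[OF ev]
    alg_hom_smult[OF ev] gen linear_maps_add[OF assms(2)] linear_maps_smult[OF assms(2)] q)
 then have "F.ev B q u = \<zero>\<^bsub>B\<^esub>" if "u \<in> tens_ideal R H" for u
  using kernel_Idl[OF FA.k_algebra_axioms assms(1) ev tens_rel_subset] that by (simp add: tens_ideal_eq)
 from TQ.quot_universal[OF ev assms(1) this] obtain g where
  "g \<in> alg_hom R (quot_alg F.F (tens_ideal R H)) B" "\<forall>x\<in>carrier F.F. g (tens_ideal R H +>\<^bsub>F.F\<^esub> x) = F.ev B q x"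
  by blast
 then have "g \<in> alg_hom R TH B" "\<forall>h\<in>carrier H. g (\<tau> h) = q h"
  by (simp_all add: tens_alg_def tens_gen_def free_gen_closed gen)
 then show ?thesis by blast
qed

lemmas t_rules = lin_rules lin_Z lin_\<tau> T_alg T_mod

definition "par_rel = ({\<tau> \<one>\<^bsub>H\<^esub> \<ominus>\<^bsub>TH\<^esub> \<one>\<^bsub>TH\<^esub>} \<union>
   {sw TH (%x y. \<tau> h \<otimes>\<^bsub>TH\<^esub> \<tau> x \<otimes>\<^bsub>TH\<^esub> \<tau> (S y)) l \<ominus>\<^bsub>TH\<^esub>
    sw TH (%x y. \<tau> (h \<cdot> x) \<otimes>\<^bsub>TH\<^esub> \<tau> (S y)) l | h l. h \<in> carrier H \<and> l \<in> carrier H} \<union>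
   {sw TH (%x y. \<tau> x \<otimes>\<^bsub>TH\<^esub> \<tau> (S y) \<otimes>\<^bsub>TH\<^esub> \<tau> l) h \<ominus>\<^bsub>TH\<^esub>
    sw TH (%x y. \<tau> x \<otimes>\<^bsub>TH\<^esub> \<tau> (S y \<cdot> l)) h | h l. h \<in> carrier H \<and> l \<in> carrier H} \<union>
   {sw TH (%x y. \<tau> h \<otimes>\<^bsub>TH\<^esub> \<tau> (S x) \<otimes>\<^bsub>TH\<^esub> \<tau> y) l \<ominus>\<^bsub>TH\<^esub>
    sw TH (%x y. \<tau> (h \<cdot> S x) \<otimes>\<^bsub>TH\<^esub> \<tau> y) l | h l. h \<in> carrier H \<and> l \<in> carrier H} \<union>
   {sw TH (%x y. \<tau> (S x) \<otimes>\<^bsub>TH\<^esub> \<tau> y \<otimes>\<^bsub>TH\<^esub> \<tau> l) h \<ominus>\<^bsub>TH\<^esub>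
    sw TH (%x y. \<tau> (S x) \<otimes>\<^bsub>TH\<^esub> \<tau> (y \<cdot> l)) h | h l. h \<in> carrier H \<and> l \<in> carrier H})"

lemma par_ideal_eq: "par_ideal R H = Idl\<^bsub>TH\<^esub> par_rel"
 by (simp only: par_ideal_def par_rel_def Let_def)

lemma par_rel_subset: "par_rel \<subseteq> carrier TH"
 unfolding par_rel_def by (auto intro!: T.minus_closed simp: t_rules simp del: T.minus_closed)

interpretation PQ: quot R TH "par_ideal R H"
 by (intro quot.intro T.k_algebra_axioms) (simp add: par_ideal_eq T.genideal_ideal par_rel_subset)

lemma P_alg: "k_algebra R PH"
 using PQ.Q_algebra by (simp add: par_alg_def)

interpretation P: k_algebra R PH by (rule P_alg)

lemma par_proj_hom: "(%f. par_ideal R H +>\<^bsub>TH\<^esub> f) \<in> alg_hom R TH PH"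
 using PQ.pr_alg_hom by (simp add: par_alg_def)

lemma par_gen_linear: "\<pi> \<in> linear_maps R H PH"
 using linear_maps_comp[OF tens_gen_linear alg_hom_linear[OF par_proj_hom]]
 by (simp add: par_gen_def[abs_def])

lemma par_gen_partial_rep: "partial_rep R H Z PH \<pi>"
proof -
 let ?pr = "%f. par_ideal R H +>\<^bsub>TH\<^esub> f"
 have lpr: "lin R TH PH ?pr" using par_proj_hom by (simp add: lin_def P.module_axioms alg_hom_linear)
 have rel: "?pr u = ?pr v" if "u \<ominus>\<^bsub>TH\<^esub> v \<in> par_rel" "u \<in> carrier TH" "v \<in> carrier TH" for u v
  using that T.genideal_self[OF par_rel_subset] by (subst PQ.pr_eq_iff) (auto simp: par_ideal_eq)
 have gen: "\<pi> h = ?pr (\<tau> h)" for h by (simp add: par_gen_def)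
 note mult = alg_hom_mult[OF par_proj_hom]
 have mp: "?pr (sw TH be h) = sw PH (%x y. ?pr (be x y)) h" if "bilinH TH be" "h \<in> carrier H" for be h
  by (rule sw_map[OF lpr that])
 show ?thesis
 proof (intro partial_rep.intro partial_rep_axioms.intro hopf_inv_axioms P_alg par_gen_linear)
  show "\<pi> \<one>\<^bsub>H\<^esub> = \<one>\<^bsub>PH\<^esub>"
   using rel[of "\<tau> \<one>\<^bsub>H\<^esub>" "\<one>\<^bsub>TH\<^esub>"] by (simp add: gen alg_hom_one[OF par_proj_hom] par_rel_def)
  fix h l assume hl: "h \<in> carrier H" "l \<in> carrier H"
  have "?pr (sw TH (%x y. \<tau> h \<otimes>\<^bsub>TH\<^esub> \<tau> x \<otimes>\<^bsub>TH\<^esub> \<tau> (S y)) l) = ?pr (sw TH (%x y. \<tau> (h \<cdot> x) \<otimes>\<^bsub>TH\<^esub> \<tau> (S y)) l)"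
   by (rule rel) (use hl in "auto simp: par_rel_def, simp_all add: t_rules")
  then show "sw PH (%x y. \<pi> h \<otimes>\<^bsub>PH\<^esub> \<pi> x \<otimes>\<^bsub>PH\<^esub> \<pi> (S y)) l = sw PH (%x y. \<pi> (h \<cdot> x) \<otimes>\<^bsub>PH\<^esub> \<pi> (S y)) l"
   using hl by (simp add: mp t_rules mult gen)
  have "?pr (sw TH (%x y. \<tau> x \<otimes>\<^bsub>TH\<^esub> \<tau> (S y) \<otimes>\<^bsub>TH\<^esub> \<tau> l) h) = ?pr (sw TH (%x y. \<tau> x \<otimes>\<^bsub>TH\<^esub> \<tau> (S y \<cdot> l)) h)"
   by (rule rel) (use hl in "auto simp: par_rel_def, simp_all add: t_rules")
  then show "sw PH (%x y. \<pi> x \<otimes>\<^bsub>PH\<^esub> \<pi> (S y) \<otimes>\<^bsub>PH\<^esub> \<pi> l) h = sw PH (%x y. \<pi> x \<otimes>\<^bsub>PH\<^esub> \<pi> (S y \<cdot> l)) h"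
   using hl by (simp add: mp t_rules mult gen)
  have "?pr (sw TH (%x y. \<tau> h \<otimes>\<^bsub>TH\<^esub> \<tau> (S x) \<otimes>\<^bsub>TH\<^esub> \<tau> y) l) = ?pr (sw TH (%x y. \<tau> (h \<cdot> S x) \<otimes>\<^bsub>TH\<^esub> \<tau> y) l)"
   by (rule rel) (use hl in "auto simp: par_rel_def, simp_all add: t_rules")
  then show "sw PH (%x y. \<pi> h \<otimes>\<^bsub>PH\<^esub> \<pi> (S x) \<otimes>\<^bsub>PH\<^esub> \<pi> y) l = sw PH (%x y. \<pi> (h \<cdot> S x) \<otimes>\<^bsub>PH\<^esub> \<pi> y) l"
   using hl by (simp add: mp t_rules mult gen)
  have "?pr (sw TH (%x y. \<tau> (S x) \<otimes>\<^bsub>TH\<^esub> \<tau> y \<otimes>\<^bsub>TH\<^esub> \<tau> l) h) = ?pr (sw TH (%x y. \<tau> (S x) \<otimes>\<^bsub>TH\<^esub> \<tau> (y \<cdot> l)) h)"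
   by (rule rel) (use hl in "auto simp: par_rel_def, simp_all add: t_rules")
  then show "sw PH (%x y. \<pi> (S x) \<otimes>\<^bsub>PH\<^esub> \<pi> y \<otimes>\<^bsub>PH\<^esub> \<pi> l) h = sw PH (%x y. \<pi> (S x) \<otimes>\<^bsub>PH\<^esub> \<pi> (y \<cdot> l)) h"
   using hl by (simp add: mp t_rules mult gen)
 qed
qed

text \<open>The algebra map on the tensor algebra that extends \<open>p\<close> sends each generator
  of \<open>par_ideal\<close> to the difference of the two sides of a relation satisfied by
  \<open>p\<close>, hence to zero.\<close>

lemma par_universal:
 assumes "partial_rep R H Z B p"
 shows "\<exists>f\<in>alg_hom R PH B. \<forall>h\<in>carrier H. f (\<pi> h) = p h"
proof -
 interpret p: partial_rep R H Z B p by fact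
 obtain f where f: "f \<in> alg_hom R TH B" "\<forall>h\<in>carrier H. f (\<tau> h) = p h"
  using tens_universal[OF p.B_alg p.p_linear] by blast
 have lf: "lin R TH B f" using f(1) by (simp add: lin_def alg_hom_linear p.B_mod)
 have mp: "f (sw TH be h) = sw B (%x y. f (be x y)) h" if "bilinH TH be" "h \<in> carrier H" for be h
  by (rule sw_map[OF lf that])
 note mult = alg_hom_mult[OF f(1)]
 have minus: "f (u \<ominus>\<^bsub>TH\<^esub> v) = \<zero>\<^bsub>B\<^esub>" if "f u = f v" "u \<in> carrier TH" "v \<in> carrier TH" for u v
  using that alg_hom_closed[OF f(1)]
  by (simp add: alg_hom_minus[OF T_alg p.B_alg f(1)])
 have PR: "f (sw TH (%x y. \<tau> h \<otimes>\<^bsub>TH\<^esub> \<tau> x \<otimes>\<^bsub>TH\<^esub> \<tau> (S y)) l) = f (sw TH (%x y. \<tau> (h \<cdot> x) \<otimes>\<^bsub>TH\<^esub> \<tau> (S y)) l)"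
  "f (sw TH (%x y. \<tau> x \<otimes>\<^bsub>TH\<^esub> \<tau> (S y) \<otimes>\<^bsub>TH\<^esub> \<tau> l) h) = f (sw TH (%x y. \<tau> x \<otimes>\<^bsub>TH\<^esub> \<tau> (S y \<cdot> l)) h)"
  "f (sw TH (%x y. \<tau> h \<otimes>\<^bsub>TH\<^esub> \<tau> (S x) \<otimes>\<^bsub>TH\<^esub> \<tau> y) l) = f (sw TH (%x y. \<tau> (h \<cdot> S x) \<otimes>\<^bsub>TH\<^esub> \<tau> y) l)"
  "f (sw TH (%x y. \<tau> (S x) \<otimes>\<^bsub>TH\<^esub> \<tau> y \<otimes>\<^bsub>TH\<^esub> \<tau> l) h) = f (sw TH (%x y. \<tau> (S x) \<otimes>\<^bsub>TH\<^esub> \<tau> (y \<cdot> l)) h)"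
  if "h \<in> carrier H" "l \<in> carrier H" for h l
  using that f(2) p.PR2 p.PR3 p.PR4 p.PR5 by (simp_all add: mp t_rules mult)
 have rel: "f u = \<zero>\<^bsub>B\<^esub>" if "u \<in> par_rel" for u
  using that unfolding par_rel_def
  by (elim UnE) (auto intro!: minus PR simp: f(2) p.p_one alg_hom_one[OF f(1)], simp_all add: t_rules)
 have "f u = \<zero>\<^bsub>B\<^esub>" if "u \<in> par_ideal R H" for u
  by (rule kernel_Idl[OF T_alg p.B_alg f(1) par_rel_subset rel]) (use that in "simp_all add: par_ideal_eq")
 from PQ.quot_universal[OF f(1) p.B_alg this] obtain g where
  "g \<in> alg_hom R (quot_alg TH (par_ideal R H)) B" "\<forall>x\<in>carrier TH. g (par_ideal R H +>\<^bsub>TH\<^esub> x) = f x" by blast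
 then have "g \<in> alg_hom R PH B" "\<forall>h\<in>carrier H. g (\<pi> h) = p h"
  using f(2) by (simp_all add: par_alg_def par_gen_def)
 then show ?thesis by blast
qed

lemma par_gen_closed [simp]: "h \<in> carrier H ==> \<pi> h \<in> carrier PH"
 by (rule linear_maps_closed[OF par_gen_linear])

lemma par_word_Nil [simp]: "par_word R H [] = \<one>\<^bsub>PH\<^esub>"
 and par_word_Cons [simp]: "par_word R H (h # ws) = \<pi> h \<otimes>\<^bsub>PH\<^esub> par_word R H ws"
 by (simp_all add: par_word_def list_prod_def)

lemma par_word_closed [simp]: "ws \<in> lists (carrier H) ==> par_word R H ws \<in> carrier PH"
 by (induction ws) auto

lemma par_word_append: "us \<in> lists (carrier H) ==> vs \<in> lists (carrier H) ==>
  par_word R H (us @ vs) = par_word R H us \<otimes>\<^bsub>PH\<^esub> par_word R H vs"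
 by (induction us) (auto simp: P.m_assoc)

text \<open>H_par is a quotient of a quotient of the free algebra; words are a basis there, and the
  composite projection sends a word to its \<open>par_word\<close>.\<close>

lemma par_induct [consumes 1, case_names word add smult]:
 assumes "x \<in> carrier PH"
  and word: "!!ws. ws \<in> lists (carrier H) ==> P (par_word R H ws)"
  and add: "!!x y. [|x \<in> carrier PH; y \<in> carrier PH; P x; P y|] ==> P (x \<oplus>\<^bsub>PH\<^esub> y)"
  and smult: "!!r x. [|r \<in> carrier R; x \<in> carrier PH; P x|] ==> P (r \<odot>\<^bsub>PH\<^esub> x)"
 shows "P x"
proof -
 let ?q = "%f. par_ideal R H +>\<^bsub>TH\<^esub> (tens_ideal R H +>\<^bsub>F.F\<^esub> f)"
 have hom: "?q \<in> alg_hom R F.F PH" by (rule alg_hom_comp[OF tens_proj_hom par_proj_hom])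
 have gen: "?q (word_fun R w) = par_word R H w" if "w \<in> lists (carrier H)" for w
  using that
 proof (induction w)
  case Nil
  then show ?case using alg_hom_one[OF hom] by (simp add: F.F_simps)
 next
  case (Cons a w)
  have "word_fun R (a # w) = word_fun R [a] \<otimes>\<^bsub>F.F\<^esub> word_fun R w" by (simp add: F.word_fun_mult)
  moreover have "?q (word_fun R [a]) = \<pi> a" by (simp add: par_gen_def tens_gen_def free_gen_def word_fun_def)
  ultimately show ?case using Cons alg_hom_mult[OF hom F.word_fun_closed F.word_fun_closed, of "[a]" w] by simp
 qed
 \<comment> \<open>Zero is covered by the scalar case, as 0 times the empty word.\<close>
 have zero: "P \<zero>\<^bsub>PH\<^esub>"
  using smult[OF algebra.R.zero_closed P.one_closed] word[of "[]"] by simp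
 have "P (?q f)" if "f \<in> carrier F.F" for f
  using that
 proof (induction rule: F.F_induct)
  case zero
  have "?q \<zero>\<^bsub>F.F\<^esub> = \<zero>\<^bsub>PH\<^esub>"
   by (rule add_maps_zero[OF FA.abelian_group_axioms P.abelian_group_axioms linear_maps_add_maps[OF alg_hom_linear[OF hom]]])
  then show ?case using \<open>P \<zero>\<^bsub>PH\<^esub>\<close> by simp
 next
  case (word r w)
  then show ?case
   using smult[OF word(1) par_word_closed[OF word(2)] assms(2)[OF word(2)]] gen alg_hom_smult[OF hom word(1) F.word_fun_closed[OF word(2)]]
   by simp
 next
  case (add f g)
  then show ?case using assms(3) alg_hom_add[OF hom add(1,2)] alg_hom_closed[OF hom] by simp
 qed
 moreover obtain f where "f \<in> carrier F.F" "x = ?q f"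
  using assms(1) unfolding par_alg_def
  by (elim PQ.Q_carrierE) (unfold tens_alg_def, elim TQ.Q_carrierE, blast)
 ultimately show ?thesis by blast
qed

lemma par_linear_eq:
 assumes "f \<in> linear_maps R PH G" "g \<in> linear_maps R PH G" "x \<in> carrier PH"
  and "!!ws. ws \<in> lists (carrier H) ==> f (par_word R H ws) = g (par_word R H ws)"
 shows "f x = g x"
 using assms(3)
 by (induction rule: par_induct)
  (simp_all add: assms(4) linear_maps_add[OF assms(1)] linear_maps_add[OF assms(2)]
   linear_maps_smult[OF assms(1)] linear_maps_smult[OF assms(2)])

end

section \<open>Sweedler notation for words\<close>

text \<open>\<open>wsw G H [h\<^sup>1, ..., h\<^sup>n] ga\<close> is \<open>ga [h\<^sup>1\<^sub>1, ..., h\<^sup>n\<^sub>1] [h\<^sup>1\<^sub>2, ..., h\<^sup>n\<^sub>2]\<close>, summed in \<open>G\<close>.\<close>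

fun wsw ::
 "('g, 'z) ring_scheme => ('k, 'h) hopf_algebra => 'h list => ('h list => 'h list => 'g) => 'g"
 where
  "wsw G H [] ga = ga [] []"
 | "wsw G H (h # ws) ga = sweedler G H (%x y. wsw G H ws (%u v. ga (x # u) (y # v))) h"

lemma legs_0: "legs G H 0 = (%be h. be [h])"
 by (intro ext) simp

lemma multi_legs_wsw:
 "multi_legs G H (map (%h. (h, 1)) ws) (%Ls. ga (map (%L. L ! 0) Ls) (map (%L. L ! 1) Ls)) = wsw G H ws ga"
proof (induction ws arbitrary: ga)
 case (Cons h ws)
 have "multi_legs G H (map (%h. (h, 1)) ws) (%Ls. ga (x # map (%L. L ! 0) Ls) (y # map (%L. L ! 1) Ls))
   = wsw G H ws (%u v. ga (x # u) (y # v))" for x y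
  using Cons.IH[of "%u v. ga (x # u) (y # v)"] .
 then show ?case by (simp add: legs_0)
qed simp

lemma wsw_snoc:
 "wsw G H (ws @ [h]) ga = wsw G H ws (%u v. sweedler G H (%x y. ga (u @ [x]) (v @ [y])) h)"
 by (induction ws arbitrary: ga) simp_all

lemma wsw_op_hopf [simp]: "wsw G (op_hopf Z H) ws ga = wsw G H ws ga"
 by (induction ws arbitrary: ga) simp_all

lemma wsw_op_alg [simp]: "wsw (op_alg G) H ws ga = wsw G H ws ga"
 by (induction ws arbitrary: ga) simp_all

context hopf_algebra begin

abbreviation "LH \<equiv> lists (carrier H)"

text \<open>Multilinearity in every letter of both words. Since the lengths vary, it is expressed
  through a single letter \<open>x\<close> in an arbitrary context \<open>a @ x # b\<close>.\<close>

definition wlin :: "('k, 'g, 'z) module_scheme => ('h list => 'h list => 'g) => bool"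
 where "wlin G ga \<longleftrightarrow> module R G \<and> (\<forall>u\<in>LH. \<forall>v\<in>LH. ga u v \<in> carrier G) \<and>
  (\<forall>a\<in>LH. \<forall>b\<in>LH. \<forall>v\<in>LH. linH G (%x. ga (a @ x # b) v)) \<and>
  (\<forall>u\<in>LH. \<forall>a\<in>LH. \<forall>b\<in>LH. linH G (%x. ga u (a @ x # b)))"

lemma wlin_shift:
 assumes "wlin G ga" "x \<in> carrier H" "y \<in> carrier H"
 shows "wlin G (%u v. ga (x # u) (y # v))"
proof -
 have 1: "linH G (%z. ga (a @ z # b) v)" "linH G (%z. ga v (a @ z # b))"
  if "a \<in> LH" "b \<in> LH" "v \<in> LH" for a b v
  using assms(1) that by (simp_all add: wlin_def)
 show ?thesis
  using assms 1(1)[of "x # _" _ "y # _"] 1(2)[of "y # _" _ "x # _"] by (simp add: wlin_def)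
qed

lemma wlin_heads:
 assumes "wlin G ga" "u \<in> LH" "v \<in> LH"
 shows "x \<in> carrier H ==> linH G (%y. ga (x # u) (y # v))" "y \<in> carrier H ==> linH G (%x. ga (x # u) (y # v))"
proof -
 have 1: "linH G (%z. ga ([] @ z # b) v)" "linH G (%z. ga v ([] @ z # b))"
  if "b \<in> LH" "v \<in> LH" for b v
  using assms(1) that unfolding wlin_def by (metis lists.Nil)+
 show "x \<in> carrier H ==> linH G (%y. ga (x # u) (y # v))"
  using 1(2)[of v "x # u"] assms by simp
 show "y \<in> carrier H ==> linH G (%x. ga (x # u) (y # v))"
  using 1(1)[of u "y # v"] assms by simp
qed

lemma wlin_closed: "wlin G ga ==> u \<in> LH ==> v \<in> LH ==> ga u v \<in> carrier G"
 and wlin_module: "wlin G ga ==> module R G"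
 by (simp_all add: wlin_def)

lemma wsw_cong:
 assumes "ws \<in> LH" "!!u v. u \<in> LH ==> v \<in> LH ==> ga u v = ga' u v"
 shows "wsw G H ws ga = wsw G H ws ga'"
 using assms
proof (induction ws arbitrary: ga ga' rule: list.induct)
 case (Cons h ws)
 then have "wsw G H ws (%u v. ga (x # u) (y # v)) = wsw G H ws (%u v. ga' (x # u) (y # v))"
  if "x \<in> carrier H" "y \<in> carrier H" for x y
  using that by (intro Cons.IH) simp_all
 then show ?case using Cons.prems(1) by simp
qed simp

lemma lin_wsw_H:
 assumes "ws \<in> LH" "\<forall>x\<in>carrier H. wlin G (ga x)" "\<forall>u\<in>LH. \<forall>v\<in>LH. linH G (%x. ga x u v)"
 shows "linH G (%x. wsw G H ws (ga x))"
 using assms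
proof (induction ws arbitrary: ga rule: list.induct)
 case (Cons h ws)
 have G: "module R G" using Cons.prems(3) by (auto simp: lin_def)
 have "linH G (%a. wsw G H ws (%u v. ga x (a # u) (b # v)))"
  "linH G (%b. wsw G H ws (%u v. ga x (a # u) (b # v)))"
  "linH G (%x. wsw G H ws (%u v. ga x (a # u) (b # v)))"
  if "x \<in> carrier H" "a \<in> carrier H" "b \<in> carrier H" for x a b
  using Cons.prems that by (intro Cons.IH; simp add: wlin_shift wlin_heads)+
 then show ?case
  using Cons.prems(1) G by (simp add: lin_sw_param bilin_def H_mod)
qed simp

lemma bilin_wsw:
 "ws \<in> LH ==> wlin G ga ==> bilinH G (%x y. wsw G H ws (%u v. ga (x # u) (y # v)))"
 by (simp add: bilin_def wlin_module wlin_shift wlin_heads lin_wsw_H)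

lemma wsw_closed: "ws \<in> LH ==> wlin G ga ==> wsw G H ws ga \<in> carrier G"
 by (cases ws) (simp_all add: wlin_closed bilin_wsw)

lemma lin_wsw_word:
 assumes "a \<in> LH" "b \<in> LH" "wlin G ga"
 shows "linH G (%x. wsw G H (a @ x # b) ga)"
 using assms
proof (induction a arbitrary: ga rule: list.induct)
 case Nil
 then show ?case by (simp add: lin_sw bilin_wsw)
next
 case (Cons c a)
 then have "linH G (%x. wsw G H (a @ x # b) (%u v. ga (y # u) (z # v)))"
  if "y \<in> carrier H" "z \<in> carrier H" for y z
  using that by (simp add: Cons.IH wlin_shift)
 then show ?case
  using Cons.prems by (simp add: lin_sw_param bilin_wsw H_mod wlin_module)
qed

lemma wsw_map:
 assumes "lin R G G' f" "ws \<in> LH" "wlin G ga"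
 shows "f (wsw G H ws ga) = wsw G' H ws (%u v. f (ga u v))"
 using assms(2,3)
proof (induction ws arbitrary: ga rule: list.induct)
 case (Cons h ws)
 then have "f (wsw G H (h # ws) ga) = sw G' (%x y. f (wsw G H ws (%u v. ga (x # u) (y # v)))) h"
  by (simp add: sw_map[OF assms(1)] bilin_wsw)
 also have "... = wsw G' H (h # ws) (%u v. f (ga u v))"
  using Cons by (simp add: wlin_shift)
 finally show ?case .
qed simp

lemma wsw_exchange:
 assumes "ws \<in> LH" "h \<in> carrier H"
  and "\<forall>x\<in>carrier H. \<forall>y\<in>carrier H. wlin G (g x y)"
  and "\<forall>u\<in>LH. \<forall>v\<in>LH. bilinH G (%x y. g x y u v)"
 shows "wsw G H ws (%u v. sw G (%x y. g x y u v) h) = sw G (%x y. wsw G H ws (g x y)) h"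
 using assms(1,3,4)
proof (induction ws arbitrary: g rule: list.induct)
 case (Cons k ws)
 have G: "module R G" using Cons.prems(3) by (auto simp: bilin_def)
 have "wsw G H (k # ws) (%u v. sw G (%x y. g x y u v) h)
   = sw G (%a b. sw G (%x y. wsw G H ws (%u v. g x y (a # u) (b # v))) h) k"
  using Cons by (simp add: wlin_shift)
 also have "... = sw G (%x y. sw G (%a b. wsw G H ws (%u v. g x y (a # u) (b # v))) k) h"
  using Cons.prems assms(2) G
  by (intro sw_swap) (simp_all add: bilin_wsw, simp add: bilin_def wlin_shift lin_wsw_H)
 finally show ?case using assms(2) by simp
qed (use assms(2) in simp)

text \<open>The letters are split by independent sums, which may be carried out in the opposite
  order. This is needed because words of the opposite algebra are read backwards.\<close>

lemma wsw_rev: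
 assumes "ws \<in> LH" "wlin G ga"
 shows "wsw G H (rev ws) (%u v. ga (rev u) (rev v)) = wsw G H ws ga"
 using assms
proof (induction ws arbitrary: ga rule: list.induct)
 case (Cons h ws)
 have rev: "rev a \<in> LH \<longleftrightarrow> a \<in> LH" for a by auto
 have wl: "wlin G (%u v. ga (x # rev u) (y # rev v))" if "x \<in> carrier H" "y \<in> carrier H" for x y
 proof -
  have "wlin G (%u v. ga (x # u) (y # v))" using Cons.prems that by (intro wlin_shift)
  then show ?thesis unfolding wlin_def by (simp add: rev)
 qed
 have "wsw G H (rev (h # ws)) (%u v. ga (rev u) (rev v))
   = wsw G H (rev ws) (%u v. sw G (%x y. ga (x # rev u) (y # rev v)) h)"
  by (simp only: rev.simps wsw_snoc rev_append append.simps)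
 also have "... = sw G (%x y. wsw G H (rev ws) (%u v. ga (x # rev u) (y # rev v))) h"
  using Cons.prems
  by (intro wsw_exchange) (simp_all add: rev wl bilin_def wlin_module[OF Cons.prems(2)] wlin_heads[OF Cons.prems(2)])
 also have "... = wsw G H (h # ws) ga"
 proof -
  have "wsw G H (rev ws) (%u v. ga (x # rev u) (y # rev v)) = wsw G H ws (%u v. ga (x # u) (y # v))"
   if "x \<in> carrier H" "y \<in> carrier H" for x y
   using Cons.IH[of "%u v. ga (x # u) (y # v)"] Cons.prems that by (simp add: wlin_shift)
  then show ?thesis using Cons.prems(1) by simp
 qed
 finally show ?case .
qed simp

text \<open>Induction on the word: the two splittings of the first letter are exchanged past those
  of the remaining letters, where \<open>sw_coassoc\<close> rearranges the former and the induction
  hypothesis the latter.\<close>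

lemma wsw_coassoc:
 assumes "ws \<in> LH" "\<forall>w\<in>LH. wlin G (%u v. \<delta> u v w)" "\<forall>u\<in>LH. wlin G (\<delta> u)"
 shows "wsw G H ws (%u w. wsw G H u (%u1 u2. \<delta> u1 u2 w)) = wsw G H ws (%u w. wsw G H w (\<delta> u))"
 using assms
proof (induction ws arbitrary: \<delta> rule: list.induct)
 case (Cons h ws)
 have h: "h \<in> carrier H" and ws: "ws \<in> LH" using Cons.prems by simp_all
 have G: "module R G" using Cons.prems(3) by (blast dest: wlin_module)
 note c12 = Cons.prems(2)[rule_format] and c23 = Cons.prems(3)[rule_format]
 have c12': "wlin G (%u v. \<delta> (a # u) (b # v) (c # w))" if "a \<in> carrier H" "b \<in> carrier H" "c \<in> carrier H" "w \<in> LH" for a b c w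
  using wlin_shift[OF c12[of "c # w"]] that by simp
 have c23': "wlin G (%v w. \<delta> (a # u) (b # v) (c # w))" if "a \<in> carrier H" "b \<in> carrier H" "c \<in> carrier H" "u \<in> LH" for a b c u
  using wlin_shift[OF c23[of "a # u"]] that by simp
 have l1: "wlin G (%u w. wsw G H u (%u1 u2. \<delta> (a # u1) (b # u2) (c # w)))"
  if "a \<in> carrier H" "b \<in> carrier H" "c \<in> carrier H" for a b c
 proof -
  have "linH G (%x. \<delta> (a # u1) (b # u2) (c # d @ x # e))" if "u1 \<in> LH" "u2 \<in> LH" "d \<in> LH" "e \<in> LH" for u1 u2 d e
   using c23'[of a b c u1] that \<open>a \<in> _\<close> \<open>b \<in> _\<close> \<open>c \<in> _\<close> by (simp add: wlin_def)
  then show ?thesis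
   unfolding wlin_def using that
   by (simp add: G wsw_closed lin_wsw_word c12' lin_wsw_H)
 qed
 have l2: "wlin G (%u w. wsw G H w (%w1 w2. \<delta> (a # u) (b # w1) (c # w2)))"
  if "a \<in> carrier H" "b \<in> carrier H" "c \<in> carrier H" for a b c
 proof -
  have "linH G (%x. \<delta> (a # d @ x # e) (b # u1) (c # u2))" if "u1 \<in> LH" "u2 \<in> LH" "d \<in> LH" "e \<in> LH" for u1 u2 d e
   using c12'[of a b c u2] that \<open>a \<in> _\<close> \<open>b \<in> _\<close> \<open>c \<in> _\<close> by (simp add: wlin_def)
  then show ?thesis
   unfolding wlin_def using that
   by (simp add: G wsw_closed lin_wsw_word c23' lin_wsw_H)
 qed
 have h1: "linH G (%a. \<delta> (a # u) (b # v) (c # w))" if "b \<in> carrier H" "c \<in> carrier H" "u \<in> LH" "v \<in> LH" "w \<in> LH" for b c u v w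
  using wlin_heads(2)[OF c12[of "c # w"], of u v b] that by simp
 have h2: "linH G (%b. \<delta> (a # u) (b # v) (c # w))" if "a \<in> carrier H" "c \<in> carrier H" "u \<in> LH" "v \<in> LH" "w \<in> LH" for a c u v w
  using wlin_heads(1)[OF c12[of "c # w"], of u v a] that by simp
 have h3: "linH G (%c. \<delta> (a # u) (b # v) (c # w))" if "a \<in> carrier H" "b \<in> carrier H" "u \<in> LH" "v \<in> LH" "w \<in> LH" for a b u v w
  using wlin_heads(1)[OF c23[of "a # u"], of v w b] that by simp
 have "wsw G H (h # ws) (%u w. wsw G H u (%u1 u2. \<delta> u1 u2 w))
   = sw G (%x y. sw G (%a b. wsw G H ws (%u w. wsw G H u (%u1 u2. \<delta> (a # u1) (b # u2) (y # w)))) x) h"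
  using h ws
  by (simp add: wsw_exchange l1 lin_wsw_H bilin_def G c12' h1 h2 h3)
 also have "... = sw G (%a r. sw G (%b y. wsw G H ws (%u w. wsw G H u (%u1 u2. \<delta> (a # u1) (b # u2) (y # w)))) r) h"
  using h ws
  by (intro sw_coassoc)
   (simp_all add: l1 lin_wsw_H trilin_def bilin_def G c12' h1 h2 h3)
 also have "... = sw G (%a r. sw G (%b y. wsw G H ws (%u w. wsw G H w (%w1 w2. \<delta> (a # u) (b # w1) (y # w2)))) r) h"
  using h Cons.IH[OF ws, of "%u v w. \<delta> (_ # u) (_ # v) (_ # w)"] by (simp add: c12' c23')
 also have "... = wsw G H (h # ws) (%u w. wsw G H w (\<delta> u))"
  using h ws
  by (simp add: wsw_exchange l2 lin_wsw_H bilin_def G c23' h1 h2 h3)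
 finally show ?case .
qed simp

end

context partial_rep begin

definition wd :: "'h list => 'b" where "wd ws = list_prod B (map p ws)"

lemma wd_simps [simp]: "wd [] = \<one>" "wd (h # ws) = p h \<otimes> wd ws"
 by (simp_all add: wd_def list_prod_def)

lemma wd_closed [simp]: "ws \<in> LH ==> wd ws \<in> carrier B"
 by (induction ws) auto

lemma wd_append: "us \<in> LH ==> vs \<in> LH ==> wd (us @ vs) = wd us \<otimes> wd vs"
 by (induction us) (auto simp: B.m_assoc)

lemma wd_middle: "us \<in> LH ==> x \<in> carrier H ==> vs \<in> LH ==> wd (us @ x # vs) = wd us \<otimes> (p x \<otimes> wd vs)"
 by (simp add: wd_append)

lemma lin_wd: "us \<in> LH ==> vs \<in> LH ==> linH B (%x. wd (us @ x # vs))"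
proof -
 assume *: "us \<in> LH" "vs \<in> LH"
 then have "linH B (%x. wd us \<otimes> (p x \<otimes> wd vs))" by (simp add: p_rules)
 moreover have "linH B (%x. wd (us @ x # vs)) \<longleftrightarrow> linH B (%x. wd us \<otimes> (p x \<otimes> wd vs))"
  unfolding lin_def using * by (subst linear_maps_cong[OF H_mod wd_middle]) auto
 ultimately show ?thesis by simp
qed

lemma wlin_wd:
 assumes "bilin R B B G f"
 shows "wlin G (%u v. f (wd u) (wd v))"
proof -
 have "linH G (%x. f (wd (a @ x # b)) (wd v))" "linH G (%x. f (wd v) (wd (a @ x # b)))"
  if "a \<in> LH" "b \<in> LH" "v \<in> LH" for a b v
  using assms that lin_comp[of R B G "%x. f x (wd v)" H "%x. wd (a @ x # b)"]
   lin_comp[of R B G "f (wd v)" H "%x. wd (a @ x # b)"]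
  by (simp_all add: bilin_def lin_wd)
 then show ?thesis
  using assms by (simp add: wlin_def bilin_closed) (simp add: bilin_def)
qed

end

section \<open>Bialgebroid structure of an algebra generated by a partial representation\<close>

text \<open>The induction principle says that the words in the elements \<open>p h\<close> span
  \<open>B\<close> over k, so a linear map on \<open>B\<close> is determined by its values on
  words.\<close>

locale generating_rep = partial_rep R H Z B p
 for R :: "'k ring" and H :: "('k, 'h) hopf_algebra" and Z :: "'h => 'h"
  and B :: "('k, 'b) module" (structure) and p :: "'h => 'b" +
 assumes B_induct: "[|x \<in> carrier B; !!ws. ws \<in> LH ==> P (wd ws);
   !!x y. [|x \<in> carrier B; y \<in> carrier B; P x; P y|] ==> P (x \<oplus> y);
   !!r x. [|r \<in> carrier R; x \<in> carrier B; P x|] ==> P (r \<odot> x)|] ==> P x"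
begin

lemma linear_eqI:
 assumes "f \<in> linear_maps R B G" "g \<in> linear_maps R B G" "x \<in> carrier B"
  and "!!ws. ws \<in> LH ==> f (wd ws) = g (wd ws)"
 shows "f x = g x"
 using assms(3)
 by (induction x rule: B_induct[consumes 1])
  (simp_all add: assms(4) linear_maps_add[OF assms(1)] linear_maps_add[OF assms(2)]
   linear_maps_smult[OF assms(1)] linear_maps_smult[OF assms(2)])

text \<open>
 Coassociativity for two comultiplications over possibly different bases. On words both sides
 are given by the same threefold Sweedler sum.
\<close>

lemma mixed_coassoc:
 assumes ta: "tensor_assoc B B B A1 ra la A2 rb lb"
  and tm1: "tensor_module R B B A1 ra la" and tm2: "tensor_module R B B A2 rb lb"
  and T1: "T1 = tensor B B A1 ra la" and T2: "T2 = tensor B B A2 rb lb"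
  and L: "TL = tensor T1 B A2 (%V b. tmap T1 (%x. x) (%y. rb y b) V) lb"
  and TR: "TR = tensor B T2 A1 ra (%a Y. tmap T2 (la a) (%z. z) Y)"
  and k1: "!!r. r \<in> carrier R ==> \<exists>a\<in>A1. \<forall>x\<in>carrier B. ra x a = r \<odot> x \<and> la a x = r \<odot> x"
  and k2: "!!r. r \<in> carrier R ==> \<exists>a\<in>A2. \<forall>x\<in>carrier B. rb x a = r \<odot> x \<and> lb a x = r \<odot> x"
  and D1: "D1 \<in> linear_maps R B T1" "!!ws. ws \<in> LH ==> D1 (wd ws) = wsw T1 H ws (%u v. wd u \<boxtimes>\<^bsub>T1\<^esub> wd v)"
  and D2: "D2 \<in> linear_maps R B T2" "!!ws. ws \<in> LH ==> D2 (wd ws) = wsw T2 H ws (%u v. wd u \<boxtimes>\<^bsub>T2\<^esub> wd v)"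
  and D1b: "!!x b. x \<in> carrier B ==> b \<in> A2 ==> D1 (rb x b) = tmap T1 (%x. x) (%y. rb y b) (D1 x)"
  and D2a: "!!x a. x \<in> carrier B ==> a \<in> A1 ==> D2 (la a x) = tmap T2 (la a) (%z. z) (D2 x)"
  and x: "x \<in> carrier B"
 shows "tassoc TR T2 (tmap TL D1 (%z. z) (D2 x)) = tmap TR (%x. x) D2 (D1 x)"
proof -
 interpret ta: tensor_assoc B B B A1 ra la A2 rb lb by fact
 interpret m1: tensor_module R B B A1 ra la by fact
 interpret m2: tensor_module R B B A2 rb lb by fact
 interpret mR: tensor_module R B T2 A1 ra "%a Y. tmap T2 (la a) (%z. z) Y"
  unfolding T2
  by (intro tensor_module.intro ta.rr.tensor_product_axioms B_mod tensor_module_axioms.intro m1.ra_smult)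
 have mT1: "module R T1" and mT2: "module R T2" and mTR: "module R TR"
  using m1.tensor_is_module m2.tensor_is_module mR.tensor_is_module by (simp_all add: T1 T2 TR)
 have D1c: "D1 x \<in> carrier T1" and D2c: "D2 x \<in> carrier T2" if "x \<in> carrier B" for x
  using that D1(1) D2(1) by (simp_all add: linear_maps_closed)
 \<comment> \<open>The scalar action on a tensor product is defined through the left factor. The
   base element from \<open>k1\<close> acts as \<open>r\<close> on both sides, so balancing moves
   the scalar across.\<close>
 have sm1: "u \<boxtimes>\<^bsub>T1\<^esub> (r \<odot> v) = r \<odot>\<^bsub>T1\<^esub> (u \<boxtimes>\<^bsub>T1\<^esub> v)" if r: "r \<in> carrier R" and uv: "u \<in> carrier B" "v \<in> carrier B" for r u v
 proof -
  obtain a where a: "a \<in> A1" "\<forall>x\<in>carrier B. ra x a = r \<odot> x \<and> la a x = r \<odot> x" using k1[OF r] by blast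
  then show ?thesis using ta.l.pure_balanced[OF uv(1) a(1) uv(2)] r uv by (simp add: T1)
 qed
 have sm2: "u \<boxtimes>\<^bsub>T2\<^esub> (r \<odot> v) = r \<odot>\<^bsub>T2\<^esub> (u \<boxtimes>\<^bsub>T2\<^esub> v)" if r: "r \<in> carrier R" and uv: "u \<in> carrier B" "v \<in> carrier B" for r u v
 proof -
  obtain a where a: "a \<in> A2" "\<forall>x\<in>carrier B. rb x a = r \<odot> x \<and> lb a x = r \<odot> x" using k2[OF r] by blast
  then show ?thesis using ta.r.pure_balanced[OF uv(1) a(1) uv(2)] r uv by (simp add: T2)
 qed
 have smR: "u \<boxtimes>\<^bsub>TR\<^esub> (r \<odot>\<^bsub>T2\<^esub> Y) = r \<odot>\<^bsub>TR\<^esub> (u \<boxtimes>\<^bsub>TR\<^esub> Y)"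
  if r: "r \<in> carrier R" "u \<in> carrier B" and Y: "Y \<in> carrier T2" for r u Y
 proof -
  obtain a where a: "a \<in> A1" "\<forall>x\<in>carrier B. ra x a = r \<odot> x \<and> la a x = r \<odot> x" using k1[OF r(1)] by blast
  have "tmap T2 (la a) (%z. z) Y = r \<odot>\<^bsub>T2\<^esub> Y"
   unfolding T2
   by (rule ta.r.tensor_map_eqI[OF _ ta.r.tensor_abelian_group ta.la'_add_maps[OF a(1)] m2.tensor_smult_add_maps[OF r(1)]])
    (use Y a r in "simp_all add: T2")
  then show ?thesis
   using ta.rr.pure_balanced[OF r(2) a(1) Y[unfolded T2]] a(2) r Y mR.smult_pure[of r u Y] by (simp add: TR T2)
 qed
 have lpR: "lin R B TR (%u. u \<boxtimes>\<^bsub>TR\<^esub> Y)" if "Y \<in> carrier T2" for Y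
  using mR.lin_pure_left[OF that lin_id[OF B_mod]] by (simp add: TR)
 have lpR': "lin R T2 TR (%Y. u \<boxtimes>\<^bsub>TR\<^esub> Y)" if "u \<in> carrier B" for u
 proof -
  have "(%Y. u \<boxtimes>\<^bsub>TR\<^esub> Y) \<in> add_maps T2 TR" using ta.rr.pure_right_add_maps[OF that] by (simp add: TR T2)
  then show ?thesis using mTR mT2 that smR by (simp add: lin_def linear_maps_def add_maps_def)
 qed
 have lp2: "lin R B T2 (%u. u \<boxtimes>\<^bsub>T2\<^esub> v)" "lin R B T2 (%v. u \<boxtimes>\<^bsub>T2\<^esub> v)" if "u \<in> carrier B" "v \<in> carrier B" for u v
  using that m2.lin_pure_left[OF that(2) lin_id[OF B_mod]]
  by (simp_all add: lin_def mT2 linear_maps_def sm2, simp_all add: T2 ta.r.pure_closed ta.r.pure_add_right)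
 have lp1: "lin R B T1 (%u. u \<boxtimes>\<^bsub>T1\<^esub> v)" "lin R B T1 (%v. u \<boxtimes>\<^bsub>T1\<^esub> v)" if "u \<in> carrier B" "v \<in> carrier B" for u v
  using that m1.lin_pure_left[OF that(2) lin_id[OF B_mod]]
  by (simp_all add: lin_def mT1 linear_maps_def sm1, simp_all add: T1 ta.l.pure_closed ta.l.pure_add_right)
 have p2: "u \<boxtimes>\<^bsub>T2\<^esub> v \<in> carrier T2" if "u \<in> carrier B" "v \<in> carrier B" for u v
  using that by (simp add: T2 ta.r.pure_closed)
 have l3: "lin R B TR (%v. u \<boxtimes>\<^bsub>TR\<^esub> (v \<boxtimes>\<^bsub>T2\<^esub> w))" "lin R B TR (%w. u \<boxtimes>\<^bsub>TR\<^esub> (v \<boxtimes>\<^bsub>T2\<^esub> w))"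
  if "u \<in> carrier B" "v \<in> carrier B" "w \<in> carrier B" for u v w
  using lin_comp[OF lpR'[OF that(1)] lp2(1)[OF that(1,3)]] lin_comp[OF lpR'[OF that(1)] lp2(2)[OF that(2,1)]] by simp_all
 \<comment> \<open>\<open>?in z\<close> reassociates a tensor with last factor \<open>z\<close>, and
   \<open>?\<Phi>\<close> applies \<open>D1\<close> before that. The left-hand side thus becomes one
   lift out of \<open>T2\<close>; as this lift is linear, it can be evaluated on words.\<close>
 let ?in = "%z. tlift TR (%x y. x \<boxtimes>\<^bsub>TR\<^esub> (y \<boxtimes>\<^bsub>T2\<^esub> z))"
 let ?\<Phi> = "%x z. ?in z (D1 x)"
 have in_bal: "ta.l.balanced TR (%x y. x \<boxtimes>\<^bsub>TR\<^esub> (y \<boxtimes>\<^bsub>T2\<^esub> z))" if "z \<in> carrier B" for z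
  using ta.assoc_inner_balanced[OF that] by (simp add: TR T2)
 have in_lin: "lin R T1 TR (?in z)" if z: "z \<in> carrier B" for z
  unfolding lin_def T1
  by (intro conjI mTR m1.tlift_linear in_bal z)
   (use lpR[OF p2[OF _ z]] in "auto simp: lin_def linear_maps_def")
 have D1bal: "ta.r.balanced TL (%x y. D1 x \<boxtimes>\<^bsub>TL\<^esub> y)"
  by (rule tmap_balanced[OF ta.r.tensor_product_axioms ta.ll.tensor_product_axioms])
   (use D1(1) D1b D1c ta.ll.pure_balanced in "simp_all add: L T1 linear_maps_add_maps add_maps_id")
 have D2bal: "ta.l.balanced TR (%x y. x \<boxtimes>\<^bsub>TR\<^esub> D2 y)"
  by (rule tmap_balanced[OF ta.l.tensor_product_axioms ta.rr.tensor_product_axioms])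
   (use D2(1) D2a D2c ta.rr.pure_balanced in "simp_all add: TR T2 linear_maps_add_maps add_maps_id")
 have tas: "tassoc TR T2 \<in> add_maps TL TR" using ta.tassoc_add_maps by (simp add: L TR T1 T2)
 have "tassoc TR T2 (tmap TL D1 (%z. z) (D2 x)) = tlift TR (%x z. tassoc TR T2 (D1 x \<boxtimes>\<^bsub>TL\<^esub> z)) (D2 x)" if "x \<in> carrier B" for x
  unfolding tmap_def
  using ta.r.tlift_comp[OF D1bal _ tas] D2c[OF that] mTR by (simp add: T2 module.axioms)
 moreover have \<Phi>: "tassoc TR T2 (D1 x \<boxtimes>\<^bsub>TL\<^esub> z) = ?\<Phi> x z" if "x \<in> carrier B" "z \<in> carrier B" for x z
  using ta.tassoc_pure[of "D1 x" z] D1c that by (simp add: TR T2 L T1)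
 have \<Phi>bal: "ta.r.balanced TR (%x z. tassoc TR T2 (D1 x \<boxtimes>\<^bsub>TL\<^esub> z))"
  using D1bal tas mTR unfolding ta.r.balanced_def biadditive_def
  by (auto intro: add_maps_comp module.axioms)
 have \<Phi>bal': "ta.r.balanced TR ?\<Phi>"
  using \<Phi>bal \<Phi> unfolding ta.r.balanced_def biadditive_def add_maps_def
  by (simp add: Pi_iff ta.r.ra_closed ta.r.la_closed)
 have \<Phi>1: "lin R B TR (%x. ?\<Phi> x z)" if "z \<in> carrier B" for z
  by (rule lin_comp[OF in_lin[OF that]]) (simp add: lin_def mT1 D1(1))
 have \<Phi>lin: "lin R T2 TR (tlift TR ?\<Phi>)"
  using m2.tlift_linear[OF \<Phi>bal' mTR linear_maps_smult[OF \<Phi>1[unfolded lin_def, THEN conjunct2]]]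
  by (simp only: lin_def T2[symmetric] mTR mT2 simp_thms)
 have LHS: "tassoc TR T2 (tmap TL D1 (%z. z) (D2 x)) = tlift TR ?\<Phi> (D2 x)" if "x \<in> carrier B" for x
  using calculation[OF that] ta.r.tlift_cong[of "D2 x" "%x z. tassoc TR T2 (D1 x \<boxtimes>\<^bsub>TL\<^esub> z)" ?\<Phi> TR] \<Phi> D2c[OF that]
  by (simp add: T2)
 have RHSlin: "lin R T1 TR (tmap TR (%x. x) D2)"
  unfolding lin_def T1 tmap_def
  by (intro conjI mTR m1.tlift_linear D2bal)
   (use lpR D2c in "auto simp: lin_def linear_maps_def")
 have b2: "bilin R B B T2 (%u v. u \<boxtimes>\<^bsub>T2\<^esub> v)" and b1: "bilin R B B T1 (%u v. u \<boxtimes>\<^bsub>T1\<^esub> v)"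
  by (simp_all add: bilin_def lp1 lp2 mT1 mT2)
 have b\<Phi>: "bilin R B B TR ?\<Phi>"
 proof -
  have "lin R B TR (%z. ?\<Phi> x z)" if x: "x \<in> carrier B" for x
   unfolding lin_def
  proof (intro conjI mTR linear_mapsI)
   show "?\<Phi> x z \<in> carrier TR" if "z \<in> carrier B" for z using lin_closed[OF in_lin[OF that] D1c[OF x]] .
   fix z z' assume z: "z \<in> carrier B" "z' \<in> carrier B"
   show "?\<Phi> x (z \<oplus> z') = ?\<Phi> x z \<oplus>\<^bsub>TR\<^esub> ?\<Phi> x z'"
    using z x \<Phi>bal' unfolding ta.r.balanced_def biadditive_def add_maps_def by simp
  next
   fix r z assume z: "r \<in> carrier R" "z \<in> carrier B"
   have "?in (r \<odot> z) V = r \<odot>\<^bsub>TR\<^esub> ?in z V" if V: "V \<in> carrier T1" for V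
   proof (rule ta.l.tensor_map_eqI)
    show "V \<in> carrier (tensor B B A1 ra la)" using V by (simp add: T1)
    show "abelian_group TR" using mTR by (rule module.axioms)
    show "?in (r \<odot> z) \<in> add_maps (tensor B B A1 ra la) TR"
     using z by (intro ta.l.tlift_add_maps in_bal) simp
    show "(%V. r \<odot>\<^bsub>TR\<^esub> ?in z V) \<in> add_maps (tensor B B A1 ra la) TR"
     using lin_smult[OF z(1) in_lin[OF z(2)]] unfolding lin_def T1 by (blast intro: linear_maps_add_maps)
    fix u v assume uv: "u \<in> carrier B" "v \<in> carrier B"
    show "?in (r \<odot> z) (u \<boxtimes>\<^bsub>tensor B B A1 ra la\<^esub> v) = r \<odot>\<^bsub>TR\<^esub> ?in z (u \<boxtimes>\<^bsub>tensor B B A1 ra la\<^esub> v)"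
     using z uv by (simp add: in_bal sm2 smR p2)
   qed
   then show "?\<Phi> x (r \<odot> z) = r \<odot>\<^bsub>TR\<^esub> ?\<Phi> x z" using D1c[OF x] by simp
  qed
  then show ?thesis using \<Phi>1 by (simp add: bilin_def mTR)
 qed
 have bR: "bilin R B B TR (%u v. u \<boxtimes>\<^bsub>TR\<^esub> D2 v)"
  using lin_comp[OF lpR', of _ B D2] D2(1) lpR[OF D2c] by (simp add: bilin_def mTR lin_def mT2)
 have b3: "bilin R B B TR (%u v. u \<boxtimes>\<^bsub>TR\<^esub> (v \<boxtimes>\<^bsub>T2\<^esub> w))" "bilin R B B TR (%v w'. w \<boxtimes>\<^bsub>TR\<^esub> (v \<boxtimes>\<^bsub>T2\<^esub> w'))"
  if "w \<in> carrier B" for w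
  using that by (simp_all add: bilin_def l3 lpR p2 mTR)
 have words: "tlift TR ?\<Phi> (D2 (wd ws)) = tmap TR (%x. x) D2 (D1 (wd ws))" if ws: "ws \<in> LH" for ws
 proof -
  have "tlift TR ?\<Phi> (D2 (wd ws)) = wsw TR H ws (%u v. tlift TR ?\<Phi> (wd u \<boxtimes>\<^bsub>T2\<^esub> wd v))"
   unfolding D2(2)[OF ws] by (rule wsw_map[OF \<Phi>lin ws wlin_wd[OF b2]])
  also have "... = wsw TR H ws (%u v. wsw TR H u (%u1 u2. wd u1 \<boxtimes>\<^bsub>TR\<^esub> (wd u2 \<boxtimes>\<^bsub>T2\<^esub> wd v)))"
  proof (rule wsw_cong[OF ws])
   fix u v assume uv: "u \<in> LH" "v \<in> LH"
   have "tlift TR ?\<Phi> (wd u \<boxtimes>\<^bsub>T2\<^esub> wd v) = ?\<Phi> (wd u) (wd v)"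
    using ta.r.tlift_pure[OF \<Phi>bal', of "wd u" "wd v"] uv by (simp add: T2)
   also have "... = wsw TR H u (%u1 u2. ?in (wd v) (wd u1 \<boxtimes>\<^bsub>T1\<^esub> wd u2))"
    unfolding D1(2)[OF uv(1)] using uv by (intro wsw_map[OF in_lin _ wlin_wd[OF b1]]) simp_all
   also have "... = wsw TR H u (%u1 u2. wd u1 \<boxtimes>\<^bsub>TR\<^esub> (wd u2 \<boxtimes>\<^bsub>T2\<^esub> wd v))"
    using uv ta.l.tlift_pure[OF in_bal] by (intro wsw_cong) (simp_all add: T1)
   finally show "tlift TR ?\<Phi> (wd u \<boxtimes>\<^bsub>T2\<^esub> wd v) = wsw TR H u (%u1 u2. wd u1 \<boxtimes>\<^bsub>TR\<^esub> (wd u2 \<boxtimes>\<^bsub>T2\<^esub> wd v))" .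
  qed
  also have "... = wsw TR H ws (%u v. wsw TR H v (%v1 v2. wd u \<boxtimes>\<^bsub>TR\<^esub> (wd v1 \<boxtimes>\<^bsub>T2\<^esub> wd v2)))"
   by (intro wsw_coassoc ws ballI wlin_wd[OF b3(1)] wlin_wd[OF b3(2)] wd_closed)
  also have "... = wsw TR H ws (%u v. tmap TR (%x. x) D2 (wd u \<boxtimes>\<^bsub>T1\<^esub> wd v))"
  proof (rule wsw_cong[OF ws])
   fix u v assume uv: "u \<in> LH" "v \<in> LH"
   have "tmap TR (%x. x) D2 (wd u \<boxtimes>\<^bsub>T1\<^esub> wd v) = wd u \<boxtimes>\<^bsub>TR\<^esub> D2 (wd v)"
    unfolding tmap_def using ta.l.tlift_pure[OF D2bal, of "wd u" "wd v"] uv by (simp add: T1)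
   also have "... = wsw TR H v (%v1 v2. wd u \<boxtimes>\<^bsub>TR\<^esub> (wd v1 \<boxtimes>\<^bsub>T2\<^esub> wd v2))"
    unfolding D2(2)[OF uv(2)] using uv by (intro wsw_map[OF lpR' _ wlin_wd[OF b2]]) simp_all
   finally show "wsw TR H v (%v1 v2. wd u \<boxtimes>\<^bsub>TR\<^esub> (wd v1 \<boxtimes>\<^bsub>T2\<^esub> wd v2)) = tmap TR (%x. x) D2 (wd u \<boxtimes>\<^bsub>T1\<^esub> wd v)" by simp
  qed
  also have "... = tmap TR (%x. x) D2 (D1 (wd ws))"
   unfolding D1(2)[OF ws] by (rule wsw_map[OF RHSlin ws wlin_wd[OF b1], symmetric])
  finally show ?thesis .
 qed
 have "tlift TR ?\<Phi> (D2 x) = tmap TR (%x. x) D2 (D1 x)"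
  using \<Phi>lin RHSlin D1(1) D2(1)
  by (intro linear_eqI[OF linear_maps_comp[OF D2(1), of "tlift TR ?\<Phi>"] linear_maps_comp[OF D1(1), of "tmap TR (%x. x) D2"] x words])
   (simp_all add: lin_def)
 then show ?thesis using LHS[OF x] by simp
qed

end

section \<open>The left comultiplication on an algebra spanned by words\<close>

locale par_comult = par_base R H Z B p A s t E + generating_rep R H Z B p
 for R :: "'k ring" and H :: "('k, 'h) hopf_algebra" and Z :: "'h => 'h"
  and B :: "('k, 'b) module" (structure) and p :: "'h => 'b" and A :: "('k, 'a) module"
  and s :: "'a => 'b" and t :: "'a => 'b" and E :: "'h => 'a" +
 fixes \<Delta> :: "'b => ('b \<times> 'b \<Rightarrow>\<^sub>0 int) set"
 assumes \<Delta>_hom: "\<Delta> \<in> alg_hom R B TK"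
  and \<Delta>_p: "h \<in> carrier H ==> \<Delta> (p h) = dl h"
begin

lemma \<Delta>_TK [simp]: "x \<in> carrier B ==> \<Delta> x \<in> carrier TK"
 by (rule alg_hom_closed[OF \<Delta>_hom])

lemma \<Delta>_closed [simp]: "x \<in> carrier B ==> \<Delta> x \<in> carrier TB"
 by (simp add: TK_TB)

lemmas \<Delta>_rules = alg_hom_add[OF \<Delta>_hom, simplified TK_simps] alg_hom_smult[OF \<Delta>_hom, simplified TK_simps]
 alg_hom_one[OF \<Delta>_hom, simplified TK_simps TB_one]

lemma \<Delta>_linear: "\<Delta> \<in> linear_maps R B TB"
 by (rule linear_mapsI) (simp_all add: \<Delta>_rules)

lemma \<Delta>_mult: "x \<in> carrier B ==> y \<in> carrier B ==> \<Delta> (x \<otimes> y) = tmul (\<Delta> x) (\<Delta> y)"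
 by (simp add: alg_hom_mult[OF \<Delta>_hom] TK_mult)

lemma lin_\<Delta>: "lin R Q B f ==> lin R Q TB (%x. \<Delta> (f x))"
 by (rule lin_comp[of R B TB \<Delta>]) (simp_all add: lin_def \<Delta>_linear TB_alg)

lemma bilin_pure: "bilin R B B TB (%u v. u \<bowtie> v)"
 by (simp add: bilin_def TB_alg lin_pl lin_pr lin_id B_mod)

lemma \<Delta>_wd: "ws \<in> LH ==> \<Delta> (wd ws) = wsw TB H ws (%u v. wd u \<bowtie> wd v)"
proof (induction ws rule: list.induct)
 case (Cons h ws)
 then have h: "h \<in> carrier H" and ws: "ws \<in> LH" by simp_all
 have "\<Delta> (wd (h # ws)) = tmul (dl h) (wsw TB H ws (%u v. wd u \<bowtie> wd v))"
  using Cons.IH h ws by (simp add: \<Delta>_mult \<Delta>_p)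
 also have "... = wsw TB H ws (%u v. tmul (dl h) (wd u \<bowtie> wd v))"
  by (rule wsw_map[OF lin_tmul[OF dl_TK[OF h] lin_id[OF TB_alg]] ws wlin_wd[OF bilin_pure]])
 also have "... = wsw TB H ws (%u v. sw TB (%x y. wd (x # u) \<bowtie> wd (y # v)) h)"
  using h by (intro wsw_cong[OF ws]) (simp add: dl_TK, simp add: dl_def rmul_sw b_rules)
 also have "... = sw TB (%x y. wsw TB H ws (%u v. wd (x # u) \<bowtie> wd (y # v))) h"
  by (rule wsw_exchange[OF ws h])
   (use wlin_shift[OF wlin_wd[OF bilin_pure]] in "simp_all add: b_rules")
 finally show ?case by simp
qed (simp add: \<Delta>_rules)

lemma \<Delta>_e: "h \<in> carrier H ==> \<Delta> (e h) = e h \<bowtie> \<one>"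
 and \<Delta>_e': "h \<in> carrier H ==> \<Delta> (e' h) = \<one> \<bowtie> e' h"
 unfolding e_def e'_def
 by (subst sw_map[OF lin_\<Delta>[OF lin_id[OF B_mod]]];
  simp add: p_rules \<Delta>_mult \<Delta>_p sw_tmul_e sw_tmul_e' e_def[symmetric] e'_def[symmetric])+

lemma \<Delta>_s: "a \<in> carrier A ==> \<Delta> (s a) = s a \<bowtie> \<one>"
proof (induction a rule: A_induct[consumes 1])
 case (4 x y)
 then show ?case using \<Delta>_TK[of "s x"] by (simp add: s_rules \<Delta>_mult)
qed (simp_all add: s_E \<Delta>_e s_rules \<Delta>_rules add_maps_add[OF TB_pure_left] TB_smult_pure)

lemma \<Delta>_t: "a \<in> carrier A ==> \<Delta> (t a) = \<one> \<bowtie> t a"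
proof (induction a rule: A_induct[consumes 1])
 case (4 x y)
 then show ?case using \<Delta>_TK[of "t y"] by (simp add: t_rules \<Delta>_mult)
qed (simp_all add: t_E \<Delta>_e' t_rules \<Delta>_rules add_maps_add[OF TB_pure_right] pure_smult_right)

text \<open>The tensors s(a) (x) 1 and 1 (x) t(a) are values of Delta and so lie in the Takeuchi
  product; multiplying by them on the left is the bimodule action. Bilinearity of Delta over the
  base then follows from its multiplicativity.\<close>

lemma tmap_mult:
 assumes "a \<in> carrier A" "V \<in> carrier TB"
 shows "tmul (s a \<bowtie> \<one>) V = tmap TB (%x. s a \<otimes> x) (%y. y) V"
  and "tmul (\<one> \<bowtie> t a) V = tmap TB (%x. x) (%y. t a \<otimes> y) V"
proof -
 have K: "s a \<bowtie> \<one> \<in> carrier TK" "\<one> \<bowtie> t a \<in> carrier TK"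
  using \<Delta>_TK[of "s a"] \<Delta>_TK[of "t a"] assms by (simp_all add: \<Delta>_s \<Delta>_t)
 have bal: "balanced TB (%x y. (s a \<otimes> x) \<bowtie> y)"
  using assms by (intro tmap_balanced[OF tensor_product_axioms tensor_product_axioms TB_def mult_left_add_maps add_maps_id])
   (simp_all add: TB_balanced[symmetric] B.m_assoc[symmetric] s_t_commute)
 have bal': "balanced TB (%x y. x \<bowtie> (t a \<otimes> y))"
  using assms by (intro tmap_balanced[OF tensor_product_axioms tensor_product_axioms TB_def add_maps_id mult_left_add_maps])
   (simp_all add: TB_balanced B.m_assoc[symmetric] s_t_commute)
 show "tmul (s a \<bowtie> \<one>) V = tmap TB (%x. s a \<otimes> x) (%y. y) V"
  unfolding tmap_def
  by (rule TB_eqI[OF assms(2) TB.abelian_group_axioms linear_maps_add_maps[OF tmul_linear[OF K(1)]] TB_tlift_add_maps[OF bal]])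
   (use assms in "simp add: TB_tlift_pure[OF bal] K")
 show "tmul (\<one> \<bowtie> t a) V = tmap TB (%x. x) (%y. t a \<otimes> y) V"
  unfolding tmap_def
  by (rule TB_eqI[OF assms(2) TB.abelian_group_axioms linear_maps_add_maps[OF tmul_linear[OF K(2)]] TB_tlift_add_maps[OF bal']])
   (use assms in "simp add: TB_tlift_pure[OF bal'] K")
qed

lemma \<Delta>_actions:
 assumes "a \<in> carrier A" "x \<in> carrier B"
 shows "\<Delta> (s a \<otimes> x) = tmap TB (%x. s a \<otimes> x) (%y. y) (\<Delta> x)"
  and "\<Delta> (t a \<otimes> x) = tmap TB (%x. x) (%y. t a \<otimes> y) (\<Delta> x)"
  and "\<Delta> (x \<otimes> s a) = tmap TB (%x. x \<otimes> s a) (%y. y) (\<Delta> x)"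
  and "\<Delta> (x \<otimes> t a) = tmap TB (%x. x) (%y. y \<otimes> t a) (\<Delta> x)"
proof -
 show "\<Delta> (s a \<otimes> x) = tmap TB (%x. s a \<otimes> x) (%y. y) (\<Delta> x)"
  "\<Delta> (t a \<otimes> x) = tmap TB (%x. x) (%y. t a \<otimes> y) (\<Delta> x)"
  using assms by (simp_all add: \<Delta>_mult \<Delta>_s \<Delta>_t tmap_mult)
 have "rmul (s a) \<one> (\<Delta> x) = tmap TB (%x. x \<otimes> s a) (%y. y) (\<Delta> x)"
  "rmul \<one> (t a) (\<Delta> x) = tmap TB (%x. x) (%y. y \<otimes> t a) (\<Delta> x)"
  unfolding rmul_def tmap_def using assms by (auto intro!: TB_tlift_cong simp: TB_pure_closed)
 then show "\<Delta> (x \<otimes> s a) = tmap TB (%x. x \<otimes> s a) (%y. y) (\<Delta> x)"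
  "\<Delta> (x \<otimes> t a) = tmap TB (%x. x) (%y. y \<otimes> t a) (\<Delta> x)"
  using assms \<Delta>_TK[of x] by (simp_all add: \<Delta>_mult \<Delta>_s \<Delta>_t)
qed

lemma coring_bimodule: "bimodule A B (%a h. s a \<otimes> h) (%h a. t a \<otimes> h)"
 by (intro bimodule.intro A.ring_axioms B.abelian_group_axioms bimodule_axioms.intro)
  (simp_all add: s_rules t_rules B.l_distr B.r_distr B.m_assoc, simp_all add: B.m_assoc[symmetric] s_t_commute)

text \<open>Supplies the hypotheses \<open>k1\<close> and \<open>k2\<close> of
  \<open>mixed_coassoc\<close>; the witness is r times the unit of the base.\<close>

lemma smult_via_base:
 assumes "r \<in> carrier R"
 shows "\<exists>a\<in>carrier A. \<forall>x\<in>carrier B. t a \<otimes> x = r \<odot> x \<and> s a \<otimes> x = r \<odot> x \<and>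
  x \<otimes> t a = r \<odot> x \<and> x \<otimes> s a = r \<odot> x"
 using assms by (intro bexI[of _ "r \<odot>\<^bsub>A\<^esub> \<one>\<^bsub>A\<^esub>"]) (simp_all add: s_rules t_rules B.smult_mult_left B.smult_mult_right)

text \<open>The case of \<open>mixed_coassoc\<close> in which the two bases, and the two
  comultiplications, coincide.\<close>

lemma \<Delta>_coassoc:
 assumes "x \<in> carrier B"
 defines "la \<equiv> %a h. s a \<otimes> h" and "ra \<equiv> %h a. t a \<otimes> h"
 shows "tassoc (tensor_cube_right A B la ra) (tensor_square A B la ra)
   (tmap (tensor_cube_left A B la ra) \<Delta> (%z. z) (\<Delta> x))
  = tmap (tensor_cube_right A B la ra) (%x. x) \<Delta> (\<Delta> x)"
proof (rule mixed_coassoc[where ?A1.0 = "carrier A" and ra = ra and la = la and ?A2.0 = "carrier A" and rb = ra and lb = la])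
 have sq: "tensor_square A B la ra = TB"
  by (simp add: tensor_square_def TB_def la_def ra_def)
 show "tensor_assoc B B B (carrier A) ra la (carrier A) ra la"
  unfolding la_def ra_def
  by (intro tensor_assoc.intro tensor_product_axioms tensor_assoc_axioms.intro)
   (simp_all add: mult_left_add_maps B.m_assoc[symmetric] s_t_commute)
 show "tensor_module R B B (carrier A) ra la" "tensor_module R B B (carrier A) ra la"
  unfolding la_def ra_def by (rule tensor_module_axioms)+
 show "tensor_square A B la ra = tensor B B (carrier A) ra la" "tensor_square A B la ra = tensor B B (carrier A) ra la"
  by (simp_all add: tensor_square_def)
 show "\<Delta> \<in> linear_maps R B (tensor_square A B la ra)" "\<Delta> \<in> linear_maps R B (tensor_square A B la ra)"
  by (simp_all add: sq \<Delta>_linear)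
 show "\<Delta> (wd ws) = wsw (tensor_square A B la ra) H ws (%u v. wd u \<boxtimes>\<^bsub>tensor_square A B la ra\<^esub> wd v)"
  "\<Delta> (wd ws) = wsw (tensor_square A B la ra) H ws (%u v. wd u \<boxtimes>\<^bsub>tensor_square A B la ra\<^esub> wd v)"
  if "ws \<in> LH" for ws using that by (simp_all add: sq \<Delta>_wd)
 show "\<Delta> (ra x b) = tmap (tensor_square A B la ra) (%x. x) (%y. ra y b) (\<Delta> x)"
  "\<Delta> (la b x) = tmap (tensor_square A B la ra) (la b) (%z. z) (\<Delta> x)"
  if "x \<in> carrier B" "b \<in> carrier A" for x b
  using that \<Delta>_actions(1,2)[of b x] unfolding sq by (simp_all add: la_def ra_def)
 show "\<exists>a\<in>carrier A. \<forall>x\<in>carrier B. ra x a = r \<odot> x \<and> la a x = r \<odot> x"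
  "\<exists>a\<in>carrier A. \<forall>x\<in>carrier B. ra x a = r \<odot> x \<and> la a x = r \<odot> x" if "r \<in> carrier R" for r
  using smult_via_base[OF that] unfolding la_def ra_def by blast+
qed (use assms(1) in "simp_all add: tensor_cube_left_def tensor_cube_right_def")

end

section \<open>The adjoint action and the counit\<close>

lemma lin_add: "lin R M N f ==> x \<in> carrier M ==> y \<in> carrier M ==> f (x \<oplus>\<^bsub>M\<^esub> y) = f x \<oplus>\<^bsub>N\<^esub> f y"
 and lin_scale: "lin R M N f ==> r \<in> carrier R ==> x \<in> carrier M ==> f (r \<odot>\<^bsub>M\<^esub> x) = r \<odot>\<^bsub>N\<^esub> f x"
 by (simp_all add: lin_def linear_maps_def)

context partial_rep begin

definition ad :: "'h => 'b => 'b"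
 where "ad h y = sw B (%a c. p a \<otimes> y \<otimes> p (S c)) h"

lemma lin_ad_H: "y \<in> carrier B ==> lin R M H f ==> lin R M B (%x. ad (f x) y)"
 by (simp add: ad_def p_rules)

lemma lin_ad_B: "h \<in> carrier H ==> lin R B B (ad h)"
 unfolding ad_def[abs_def] by (simp add: p_rules lin_id)

lemma ad_closed [simp]: "h \<in> carrier H ==> y \<in> carrier B ==> ad h y \<in> carrier B"
 by (rule lin_closed[OF lin_ad_B])

lemmas ad_rules = p_rules lin_ad_H lin_ad_B

lemma ad_one: "h \<in> carrier H ==> ad h \<one> = e h"
 by (simp add: ad_def e_def)

text \<open>By \<open>e_p\<close> the sum consists of [h_(1)] [S(h_(2)) h_(3) l], and the inner pair
  contracts. The closed formula of the left counit rests on this identity, one letter at a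
  time.\<close>

lemma sw_e_p_mult:
 assumes "h \<in> carrier H" "l \<in> carrier H"
 shows "sw B (%x y. e x \<otimes> p (y \<cdot> l)) h = p h \<otimes> p l" (is "?l = _")
proof -
 have "?l = sw B (%x y. sw B (%u v. p u \<otimes> p ((S v \<cdot> y) \<cdot> l)) x) h"
  using assms by (simp add: e_p algebra.m_assoc)
 also have "... = sw B (%u r. sw B (%v y. p u \<otimes> p ((S v \<cdot> y) \<cdot> l)) r) h"
  using assms by (intro sw_coassoc) (simp_all add: p_rules)
 also have "... = p h \<otimes> p (\<one>\<^bsub>H\<^esub> \<cdot> l)"
  using assms by (intro contract_SL(2)[where ga = "%u w. p u \<otimes> p (w \<cdot> l)"]) (simp_all add: p_rules)
 finally show ?thesis using assms by simp
qed

text \<open>After the exchange rule, the remaining product [h_(2)] [S(h_(3))] regroups to e_{h_(2)}.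
  This is why the adjoint action preserves the base.\<close>

lemma ad_e:
 assumes h: "h \<in> carrier H" and k: "k \<in> carrier H"
 shows "ad h (e k) = sw B (%x y. e (x \<cdot> k) \<otimes> e y) h"
proof -
 have "ad h (e k) = sw B (%x y. sw B (%a b. e (a \<cdot> k) \<otimes> (p b \<otimes> p (S y))) x) h"
  using h k by (simp add: ad_def p_e_commute mult_sw_right p_rules B.m_assoc)
 also have "... = sw B (%a r. sw B (%b y. e (a \<cdot> k) \<otimes> (p b \<otimes> p (S y))) r) h"
  using h k by (intro sw_coassoc) (simp_all add: p_rules)
 also have "... = sw B (%x y. e (x \<cdot> k) \<otimes> e y) h"
  using h k by (simp add: e_def[of "_ :: 'h"] mult_sw_left p_rules)
 finally show ?thesis .
qed

lemma sw_p_ad: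
 assumes h: "h \<in> carrier H" and y: "y \<in> carrier B"
 shows "sw B (%a c. p (S a) \<otimes> ad c y) h = sw B (%q c. e' q \<otimes> (y \<otimes> p (S c))) h" (is "?l = _")
proof -
 have "?l = sw B (%a r. sw B (%b c. p (S a) \<otimes> p b \<otimes> (y \<otimes> p (S c))) r) h"
  using assms by (simp add: ad_def mult_sw_left p_rules B.m_assoc)
 also have "... = sw B (%q c. sw B (%a b. p (S a) \<otimes> p b \<otimes> (y \<otimes> p (S c))) q) h"
  using assms by (intro sw_coassoc[symmetric]) (simp_all add: p_rules)
 also have "... = sw B (%q c. e' q \<otimes> (y \<otimes> p (S c))) h"
  using assms by (simp add: e'_def mult_sw_right p_rules)
 finally show ?thesis .
qed

lemma sw_p_commuting:
 assumes h: "h \<in> carrier H" and x: "x \<in> carrier B" "!!k. k \<in> carrier H ==> x \<otimes> e' k = e' k \<otimes> x"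
 shows "sw B (%a q. p a \<otimes> x \<otimes> e' q) h = p h \<otimes> x" (is "?l = _")
proof -
 have "?l = sw B (%a q. p a \<otimes> e' q \<otimes> x) h"
  using h x(1) by (intro sw_cong) (simp_all add: x B.m_assoc)
 then show ?thesis using h x(1) by (simp add: mult_sw_right[symmetric] p_rules sw_p_e')
qed

text \<open>Between x and y stands [S(h_(2))] [h_(3)], which is not a counit but e'_{h_(2)} in the
  regrouped sum. It commutes with \<open>x\<close> by hypothesis and is then absorbed by [h_(1)]
  through \<open>sw_p_e'\<close>. Source images of base elements satisfy the hypothesis by
  \<open>s_e'_commute\<close>.\<close>

lemma ad_mult:
 assumes h: "h \<in> carrier H" and x: "x \<in> carrier B" "!!k. k \<in> carrier H ==> x \<otimes> e' k = e' k \<otimes> x"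
  and y: "y \<in> carrier B"
 shows "ad h (x \<otimes> y) = sw B (%a c. ad a x \<otimes> ad c y) h"
proof -
 have "sw B (%a c. ad a x \<otimes> ad c y) h
   = sw B (%d c. sw B (%a b. p a \<otimes> x \<otimes> (p (S b) \<otimes> ad c y)) d) h"
  using h x(1) y by (simp add: ad_def[of _ x] mult_sw_right p_rules B.m_assoc)
 also have "... = sw B (%a r. sw B (%b c. p a \<otimes> x \<otimes> (p (S b) \<otimes> ad c y)) r) h"
  using h x(1) y by (intro sw_coassoc) (simp_all add: ad_rules)
 also have "... = sw B (%a r. sw B (%q c. p a \<otimes> x \<otimes> e' q \<otimes> (y \<otimes> p (S c))) r) h"
  using h x(1) y by (simp add: mult_sw_left[symmetric] ad_rules sw_p_ad) (simp add: mult_sw_left p_rules B.m_assoc)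
 also have "... = sw B (%d c. sw B (%a q. p a \<otimes> x \<otimes> e' q \<otimes> (y \<otimes> p (S c))) d) h"
  using h x(1) y by (intro sw_coassoc[symmetric]) (simp_all add: p_rules)
 also have "... = sw B (%d c. p d \<otimes> x \<otimes> (y \<otimes> p (S c))) h"
  using h x y by (simp add: mult_sw_right[symmetric] p_rules sw_p_commuting)
 also have "... = ad h (x \<otimes> y)"
  using h x(1) y by (simp add: ad_def B.m_assoc)
 finally show ?thesis by simp
qed

text \<open>The same absorption with a single letter on the right; it later becomes the left counit
  law.\<close>

lemma sw_ad_p:
 assumes h: "h \<in> carrier H" and x: "x \<in> carrier B" "!!k. k \<in> carrier H ==> x \<otimes> e' k = e' k \<otimes> x"
 shows "sw B (%a c. ad a x \<otimes> p c) h = p h \<otimes> x" (is "?l = _")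
proof -
 have "?l = sw B (%d c. sw B (%a b. p a \<otimes> x \<otimes> (p (S b) \<otimes> p c)) d) h"
  using h x(1) by (simp add: ad_def mult_sw_right p_rules B.m_assoc)
 also have "... = sw B (%a r. sw B (%b c. p a \<otimes> x \<otimes> (p (S b) \<otimes> p c)) r) h"
  using h x(1) by (intro sw_coassoc) (simp_all add: p_rules)
 also have "... = sw B (%a r. p a \<otimes> x \<otimes> e' r) h"
  using h x(1) by (simp add: e'_def mult_sw_left p_rules)
 finally show ?thesis using h x by (simp add: sw_p_commuting)
qed

end

context par_base begin

text \<open>The lift \<open>g\<close> to the base is required to be linear in \<open>h\<close>,
  because the product case forms the Sweedler sum of g(h_(1)) g'(h_(2)) inside \<open>A\<close> and
  then moves \<open>s\<close> into it.\<close>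

lemma ad_base_exists:
 assumes "a \<in> carrier A"
 shows "\<exists>g. linH A g \<and> (\<forall>h\<in>carrier H. ad h (s a) = s (g h))"
 using assms
proof (induction a rule: A_induct[consumes 1])
 case (1 k)
 have lE: "lin R M A (%x. E (f x))" if "lin R M H f" for M :: "('k, 'h, 'z) module_scheme" and f
  by (rule lin_comp[OF _ that]) (simp add: lin_def E_linear A.module_axioms)
 have ls: "lin R A B s" by (simp add: lin_def B_mod alg_hom_linear[OF s_hom])
 have bi: "bilinH A (%x y. E (x \<cdot> k) \<star> E y)"
  using 1 by (simp add: lin_rules lE A.k_algebra_axioms A.module_axioms)
 show ?case
 proof (intro exI conjI ballI)
  show "linH A (%h. sw A (%x y. E (x \<cdot> k) \<star> E y) h)"
   by (rule lin_sw[OF bi])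
  fix h assume "h \<in> carrier H"
  then show "ad h (s (E k)) = s (sw A (%x y. E (x \<cdot> k) \<star> E y) h)"
   using 1 sw_map[OF ls bi] by (simp add: s_E ad_e s_rules)
 qed
next
 case 2
 show ?case using E_linear by (intro exI[of _ E]) (simp add: s_rules ad_one s_E lin_def A.module_axioms)
next
 case (4 x y)
 then obtain g g' where g: "linH A g" "\<forall>h\<in>carrier H. ad h (s x) = s (g h)"
  and g': "linH A g'" "\<forall>h\<in>carrier H. ad h (s y) = s (g' h)" by blast
 have ls: "lin R A B s" by (simp add: lin_def B_mod alg_hom_linear[OF s_hom])
 have bi: "bilinH A (%a c. g a \<star> g' c)"
  using g(1) g'(1) by (simp add: lin_rules A.k_algebra_axioms A.module_axioms lin_closed[OF g(1)] lin_closed[OF g'(1)])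
 show ?case
 proof (intro exI conjI ballI)
  show "linH A (%h. sw A (%a c. g a \<star> g' c) h)" by (rule lin_sw[OF bi])
  fix h assume h: "h \<in> carrier H"
  then show "ad h (s (x \<star> y)) = s (sw A (%a c. g a \<star> g' c) h)"
   using 4(1,2) g g' sw_map[OF ls bi h]
   by (simp add: s_rules ad_mult s_e'_commute lin_closed[OF g(1)] lin_closed[OF g'(1)])
 qed
next
 case (3 x y)
 then obtain g g' where g: "linH A g" "\<forall>h\<in>carrier H. ad h (s x) = s (g h)"
  and g': "linH A g'" "\<forall>h\<in>carrier H. ad h (s y) = s (g' h)" by blast
 show ?case
 proof (intro exI conjI ballI)
  show "linH A (%h. g h \<oplus>\<^bsub>A\<^esub> g' h)"
   unfolding lin_def
   by (intro conjI A.module_axioms linear_mapsI)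
    (simp_all add: lin_closed[OF g(1)] lin_closed[OF g'(1)] lin_add[OF g(1)] lin_add[OF g'(1)]
     lin_scale[OF g(1)] lin_scale[OF g'(1)] A.a_ac A.smult_r_distr)
  fix h assume h: "h \<in> carrier H"
  then show "ad h (s (x \<oplus>\<^bsub>A\<^esub> y)) = s (g h \<oplus>\<^bsub>A\<^esub> g' h)"
   using 3(1,2) g g' by (simp add: s_rules lin_add[OF lin_ad_B[OF h]] lin_closed[OF g(1)] lin_closed[OF g'(1)])
 qed
next
 case (5 r x)
 then obtain g where g: "linH A g" "\<forall>h\<in>carrier H. ad h (s x) = s (g h)" by blast
 show ?case
 proof (intro exI conjI ballI)
  show "linH A (%h. r \<odot>\<^bsub>A\<^esub> g h)" by (rule lin_smult[OF 5(1) g(1)])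
  fix h assume h: "h \<in> carrier H"
  then show "ad h (s (r \<odot>\<^bsub>A\<^esub> x)) = s (r \<odot>\<^bsub>A\<^esub> g h)"
   using 5(1,2) g by (simp add: s_rules lin_scale[OF lin_ad_B[OF h]] lin_closed[OF g(1)])
 qed
qed

lemma ad_base: "a \<in> carrier A ==> h \<in> carrier H ==> ad h (s a) \<in> s ` carrier A"
 using ad_base_exists by (metis imageI lin_closed)

end

text \<open>The prefix \<open>o\<close> carries the right-hand structure, as left-hand structure of
  the opposite data; passing to the opposite algebra makes \<open>t'\<close> the source and
  \<open>s'\<close> the target there. The maps \<open>\<sigma>\<close> and \<open>\<sigma>'\<close>
  extend S and its inverse.\<close>

locale par_oid = par_comult R H Z B p A s t E \<Delta> +
 o: par_comult R "op_hopf Z H" "antipode H" "op_alg B" p A' t' s' E' \<Delta>'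
 for R :: "'k ring" and H :: "('k, 'h) hopf_algebra" and Z :: "'h => 'h"
  and B :: "('k, 'b) module" (structure) and p :: "'h => 'b" and A :: "('k, 'a) module"
  and s :: "'a => 'b" and t :: "'a => 'b" and E :: "'h => 'a"
  and \<Delta> :: "'b => ('b \<times> 'b \<Rightarrow>\<^sub>0 int) set"
  and A' :: "('k, 'c) module" and s' :: "'c => 'b" and t' :: "'c => 'b" and E' :: "'h => 'c"
  and \<Delta>' :: "'b => ('b \<times> 'b \<Rightarrow>\<^sub>0 int) set" +
 fixes \<sigma> :: "'b => 'b" and \<sigma>' :: "'b => 'b"
 assumes \<sigma>_hom: "\<sigma> \<in> alg_hom R B (op_alg B)" and \<sigma>'_hom: "\<sigma>' \<in> alg_hom R B (op_alg B)"
  and \<sigma>_p: "h \<in> carrier H ==> \<sigma> (p h) = p (antipode H h)"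
  and \<sigma>'_p: "h \<in> carrier H ==> \<sigma>' (p h) = p (Z h)"
  and s_inj: "inj_on s (carrier A)" and t'_inj: "inj_on t' (carrier A')"
begin

declare sw_cong [cong]

lemma o_e: "h \<in> carrier H ==> o.e h = e (Z h)" and o_e': "h \<in> carrier H ==> o.e' h = e' (Z h)"
 using partial_rep_op(2,3)[OF partial_rep_axioms] by simp_all

lemma s'_closed [simp]: "b \<in> carrier A' ==> s' b \<in> carrier B"
 and t'_closed [simp]: "b \<in> carrier A' ==> t' b \<in> carrier B"
 using o.s_closed o.t_closed by simp_all

lemma t'_E': "h \<in> carrier H ==> t' (E' h) = e (Z h)"
 and s'_E': "h \<in> carrier H ==> s' (E' h) = e' h"
 using o.s_E[of h] o.t_E[of h] by (simp_all add: o_e o_e')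

lemma E'_closed [simp]: "h \<in> carrier H ==> E' h \<in> carrier A'"
 using o.E_closed by simp

lemmas A'_induct = o.A_induct[simplified]
lemmas s'_rules = o.t_rules[simplified]
lemmas t'_rules = o.s_rules[simplified]

lemma \<sigma>_closed [simp]: "x \<in> carrier B ==> \<sigma> x \<in> carrier B"
 and \<sigma>'_closed [simp]: "x \<in> carrier B ==> \<sigma>' x \<in> carrier B"
 using alg_hom_closed[OF \<sigma>_hom] alg_hom_closed[OF \<sigma>'_hom] by simp_all

lemmas \<sigma>_rules = alg_hom_add[OF \<sigma>_hom, simplified] alg_hom_mult[OF \<sigma>_hom, simplified]
 alg_hom_one[OF \<sigma>_hom, simplified] alg_hom_smult[OF \<sigma>_hom, simplified]
lemmas \<sigma>'_rules = alg_hom_add[OF \<sigma>'_hom, simplified] alg_hom_mult[OF \<sigma>'_hom, simplified]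
 alg_hom_one[OF \<sigma>'_hom, simplified] alg_hom_smult[OF \<sigma>'_hom, simplified]

lemma lin_\<sigma>: "lin R M B f ==> lin R M B (%x. \<sigma> (f x))"
 and lin_\<sigma>': "lin R M B f ==> lin R M B (%x. \<sigma>' (f x))"
 using alg_hom_linear[OF \<sigma>_hom] alg_hom_linear[OF \<sigma>'_hom]
 by (auto intro: linear_maps_comp simp: lin_def B_mod)

lemma sw_\<sigma>: "bilinH B be ==> h \<in> carrier H ==> \<sigma> (sw B be h) = sw B (%x y. \<sigma> (be x y)) h"
 and sw_\<sigma>': "bilinH B be ==> h \<in> carrier H ==> \<sigma>' (sw B be h) = sw B (%x y. \<sigma>' (be x y)) h"
 by (rule sw_map[OF lin_\<sigma>[OF lin_id[OF B_mod]]] sw_map[OF lin_\<sigma>'[OF lin_id[OF B_mod]]]; assumption)+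

lemma \<sigma>_e: "h \<in> carrier H ==> \<sigma> (e h) = e' (S h)"
 and \<sigma>_e': "h \<in> carrier H ==> \<sigma> (e' h) = e (S h)"
 and \<sigma>'_e: "h \<in> carrier H ==> \<sigma>' (e h) = e' (Z h)"
 by (simp_all add: e_def e'_def sw_\<sigma> sw_\<sigma>' p_rules \<sigma>_rules \<sigma>'_rules \<sigma>_p \<sigma>'_p sw_antipode sw_Z)

lemma \<sigma>_t: "a \<in> carrier A ==> \<sigma> (t a) = s a"
 by (induction a rule: A_induct[consumes 1]) (simp_all add: t_E s_E \<sigma>_e' \<sigma>_rules t_rules s_rules)

lemma \<sigma>'_s: "a \<in> carrier A ==> \<sigma>' (s a) = t a"
 by (induction a rule: A_induct[consumes 1]) (simp_all add: t_E s_E \<sigma>'_e \<sigma>'_rules t_rules s_rules)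

lemma \<sigma>_t': "b \<in> carrier A' ==> \<sigma> (t' b) = s' b"
 by (induction b rule: A'_induct[consumes 1]) (simp_all add: t'_E' s'_E' \<sigma>_e \<sigma>_rules t'_rules s'_rules)

text \<open>On generators, t'(E' h) = e_{Z h} = s(E(Z h)). As t' reverses products and s preserves
  them, the witness of a product is taken in reverse order.\<close>

lemma t'_s: "b \<in> carrier A' ==> \<exists>a\<in>carrier A. t' b = s a"
proof (induction b rule: A'_induct[consumes 1])
 case (1 h)
 then show ?case by (intro bexI[of _ "E (Z h)"]) (simp_all add: t'_E' s_E)
next
 case 2
 show ?case by (intro bexI[of _ "\<one>\<^bsub>A\<^esub>"]) (simp_all add: t'_rules s_rules)
next
 case (3 x y)
 then obtain a b where "a \<in> carrier A" "b \<in> carrier A" "t' x = s a" "t' y = s b" by blast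
 with 3(1,2) show ?case by (intro bexI[of _ "a \<oplus>\<^bsub>A\<^esub> b"]) (simp_all add: t'_rules s_rules)
next
 case (4 x y)
 then obtain a b where "a \<in> carrier A" "b \<in> carrier A" "t' x = s a" "t' y = s b" by blast
 with 4(1,2) show ?case by (intro bexI[of _ "b \<star> a"]) (simp_all add: t'_rules s_rules)
next
 case (5 r x)
 then obtain a where "a \<in> carrier A" "t' x = s a" by blast
 with 5(1,2) show ?case by (intro bexI[of _ "r \<odot>\<^bsub>A\<^esub> a"]) (simp_all add: t'_rules s_rules)
qed

lemma s'_t: "b \<in> carrier A' ==> \<exists>a\<in>carrier A. s' b = t a"
proof (induction b rule: A'_induct[consumes 1])
 case (1 h)
 then show ?case by (intro bexI[of _ "E (S h)"]) (simp_all add: s'_E' t_E)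
next
 case 2
 show ?case by (intro bexI[of _ "\<one>\<^bsub>A\<^esub>"]) (simp_all add: s'_rules t_rules)
next
 case (3 x y)
 then obtain a b where "a \<in> carrier A" "b \<in> carrier A" "s' x = t a" "s' y = t b" by blast
 with 3(1,2) show ?case by (intro bexI[of _ "a \<oplus>\<^bsub>A\<^esub> b"]) (simp_all add: s'_rules t_rules)
next
 case (4 x y)
 then obtain a b where "a \<in> carrier A" "b \<in> carrier A" "s' x = t a" "s' y = t b" by blast
 with 4(1,2) show ?case by (intro bexI[of _ "b \<star> a"]) (simp_all add: s'_rules t_rules)
next
 case (5 r x)
 then obtain a where "a \<in> carrier A" "s' x = t a" by blast
 with 5(1,2) show ?case by (intro bexI[of _ "r \<odot>\<^bsub>A\<^esub> a"]) (simp_all add: s'_rules t_rules)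
qed

lemma s_s'_commute: "a \<in> carrier A ==> b \<in> carrier A' ==> s a \<otimes> s' b = s' b \<otimes> s a"
 using s'_t[of b] s_t_commute by auto

lemma rev_LH [simp]: "rev ws \<in> LH \<longleftrightarrow> ws \<in> LH"
 by auto

lemma o_wd: "ws \<in> LH ==> o.wd ws = wd (rev ws)"
 by (induction ws rule: list.induct) (simp_all add: wd_append)

lemma wlin_o_pure: "wlin o.TB (%u v. wd u \<boxtimes>\<^bsub>o.TB\<^esub> wd v)"
 by (rule wlin_wd) (use o.bilin_pure in "simp add: bilin_def lin_def")

lemma \<Delta>'_wd:
 assumes ws: "ws \<in> LH"
 shows "\<Delta>' (wd ws) = wsw o.TB H ws (%u v. wd u \<boxtimes>\<^bsub>o.TB\<^esub> wd v)"
proof -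
 have "\<Delta>' (wd ws) = wsw o.TB H (rev ws) (%u v. o.wd u \<boxtimes>\<^bsub>o.TB\<^esub> o.wd v)"
  using o.\<Delta>_wd[of "rev ws"] ws by (simp add: o_wd)
 also have "... = wsw o.TB H (rev ws) (%u v. wd (rev u) \<boxtimes>\<^bsub>o.TB\<^esub> wd (rev v))"
  using ws by (intro wsw_cong) (simp_all add: o_wd)
 also have "... = wsw o.TB H ws (%u v. wd u \<boxtimes>\<^bsub>o.TB\<^esub> wd v)"
  using wsw_rev[OF ws wlin_o_pure] .
 finally show ?thesis .
qed

text \<open>The adjoint action of all of \<open>B\<close>, x -> sum x_(1) b S(x_(2)), with legs
  taken over the right base. There u s'(c) (x) v equals u (x) v t'(c), and \<open>\<sigma>\<close>
  sends v t'(c) to s'(c) times \<open>\<sigma> v\<close>; so the sum is well defined whenever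
  \<open>b\<close> commutes with all s'(c), as source images of \<open>A\<close> do.\<close>

definition act :: "'b => 'b => 'b"
 where "act x b = tlift B (%u v. u \<otimes> b \<otimes> \<sigma> v) (\<Delta>' x)"

lemma act_balanced:
 assumes "b \<in> carrier B" "!!c. c \<in> carrier A' ==> s' c \<otimes> b = b \<otimes> s' c"
 shows "o.balanced B (%u v. u \<otimes> b \<otimes> \<sigma> v)"
proof (intro o.balancedI B.abelian_group_axioms biadditiveI add_mapsI)
 fix u c v assume *: "u \<in> carrier (op_alg B)" "c \<in> carrier A'" "v \<in> carrier (op_alg B)"
 have "u \<otimes> s' c \<otimes> b \<otimes> \<sigma> v = u \<otimes> (s' c \<otimes> b) \<otimes> \<sigma> v"
  using * assms(1) by (simp add: B.m_assoc)
 also have "... = u \<otimes> b \<otimes> \<sigma> (v \<otimes> t' c)"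
  using * assms by (simp add: \<sigma>_rules \<sigma>_t' B.m_assoc)
 finally show "s' c \<otimes>\<^bsub>op_alg B\<^esub> u \<otimes> b \<otimes> \<sigma> v = u \<otimes> b \<otimes> \<sigma> (t' c \<otimes>\<^bsub>op_alg B\<^esub> v)"
  by simp
qed (use assms(1) in "simp_all add: B.l_distr B.r_distr \<sigma>_rules")

lemma act_linear:
 assumes "b \<in> carrier B" "!!c. c \<in> carrier A' ==> s' c \<otimes> b = b \<otimes> s' c"
 shows "lin R o.TB B (tlift B (%u v. u \<otimes> b \<otimes> \<sigma> v))"
 unfolding lin_def
 by (intro conjI B_mod o.TB_tlift_linear act_balanced assms)
  (use assms(1) in "simp_all add: B.smult_mult_left B.smult_mult_right")

lemma commuting_s: "a \<in> carrier A ==> c \<in> carrier A' ==> s' c \<otimes> s a = s a \<otimes> s' c"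
 by (simp add: s_s'_commute)

lemma lin_act: "a \<in> carrier A ==> lin R B B (%x. act x (s a))"
 unfolding act_def[abs_def]
 by (rule lin_comp[OF act_linear]) (use o.\<Delta>_linear o.TB_alg in "simp_all add: commuting_s lin_def")

lemma act_wd:
 assumes a: "a \<in> carrier A" and ws: "ws \<in> LH"
 shows "act (wd ws) (s a) = wsw B H ws (%u v. wd u \<otimes> s a \<otimes> \<sigma> (wd v))"
proof -
 have "act (wd ws) (s a) = wsw B H ws (%u v. tlift B (%u v. u \<otimes> s a \<otimes> \<sigma> v) (wd u \<boxtimes>\<^bsub>o.TB\<^esub> wd v))"
  unfolding act_def \<Delta>'_wd[OF ws]
  using a by (intro wsw_map[OF act_linear ws wlin_o_pure]) (simp_all add: commuting_s)
 also have "... = wsw B H ws (%u v. wd u \<otimes> s a \<otimes> \<sigma> (wd v))"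
  using a by (intro wsw_cong ws o.TB_tlift_pure act_balanced) (simp_all add: commuting_s)
 finally show ?thesis .
qed

lemma act_one [simp]: "a \<in> carrier A ==> act \<one> (s a) = s a"
 using act_wd[of a "[]"] by (simp add: \<sigma>_rules)

text \<open>In a word the splitting of an additional first letter puts [h_(1)] in front and, after
  \<open>\<sigma>\<close>, [S(h_(2))] at the end of every term. Hence words act by iterating
  \<open>ad\<close>.\<close>

lemma act_p_mult:
 assumes a: "a \<in> carrier A" and h: "h \<in> carrier H" and x: "x \<in> carrier B"
 shows "act (p h \<otimes> x) (s a) = ad h (act x (s a))"
proof -
 have l: "lin R B B (%x. act (p h \<otimes> x) (s a))"
  by (rule lin_comp[OF lin_act[OF a]]) (simp add: h p_rules lin_id)
 have r: "lin R B B (%x. ad h (act x (s a)))"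
  by (rule lin_comp[OF lin_ad_B[OF h] lin_act[OF a]])
 have b: "wlin B (%u v. wd u \<otimes> s a \<otimes> \<sigma> (wd v))"
  using a by (intro wlin_wd) (simp add: bilin_def B_mod B_alg lin_mult_left lin_mult_right lin_\<sigma> lin_id)
 show ?thesis
 proof (rule linear_eqI[OF _ _ x, of _ B])
  fix ws assume ws: "ws \<in> LH"
  have "act (p h \<otimes> wd ws) (s a)
    = sw B (%x y. wsw B H ws (%u v. p x \<otimes> (wd u \<otimes> s a \<otimes> \<sigma> (wd v)) \<otimes> p (S y))) h"
  proof -
   have "wsw B H ws (%u v. wd (x # u) \<otimes> s a \<otimes> \<sigma> (wd (y # v)))
    = wsw B H ws (%u v. p x \<otimes> (wd u \<otimes> s a \<otimes> \<sigma> (wd v)) \<otimes> p (S y))"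
    if "x \<in> carrier H" "y \<in> carrier H" for x y
    using that a by (intro wsw_cong ws) (simp add: \<sigma>_rules \<sigma>_p B.m_assoc)
   then show ?thesis using act_wd[OF a, of "h # ws"] h ws by simp
  qed
  also have "... = sw B (%x y. p x \<otimes> act (wd ws) (s a) \<otimes> p (S y)) h"
  proof (rule sw_cong[OF refl])
   fix x y assume *: "x \<in> carrier H" "y \<in> carrier H"
   have f: "lin R B B (%z. p x \<otimes> z \<otimes> p (S y))"
    using * by (simp add: p_rules lin_id)
   show "wsw B H ws (%u v. p x \<otimes> (wd u \<otimes> s a \<otimes> \<sigma> (wd v)) \<otimes> p (S y))
     = p x \<otimes> act (wd ws) (s a) \<otimes> p (S y)"
    unfolding act_wd[OF a ws] by (rule wsw_map[OF f ws b, symmetric])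
  qed (simp add: h)
  finally show "act (p h \<otimes> wd ws) (s a) = ad h (act (wd ws) (s a))" by (simp add: ad_def)
 qed (use l r in "simp_all add: lin_def")
qed

lemma act_p: "a \<in> carrier A ==> h \<in> carrier H ==> act (p h) (s a) = ad h (s a)"
 using act_p_mult[of a h "\<one>"] by simp

lemma act_base:
 assumes x: "x \<in> carrier B" and a: "a \<in> carrier A"
 shows "act x (s a) \<in> s ` carrier A"
 using x
proof (induction x rule: B_induct[consumes 1])
 case (1 ws)
 then show ?case
 proof (induction ws rule: list.induct)
  case (Cons h ws)
  then obtain b where "b \<in> carrier A" "act (wd ws) (s a) = s b" by auto
  then show ?case using Cons.prems a by (simp add: act_p_mult ad_base)
 qed (simp add: a)
next
 case (2 x y)
 then obtain b c where "b \<in> carrier A" "act x (s a) = s b" "c \<in> carrier A" "act y (s a) = s c" by auto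
 with 2(1,2) show ?case
  by (intro image_eqI[of _ _ "b \<oplus>\<^bsub>A\<^esub> c"]) (simp_all add: lin_add[OF lin_act[OF a]] s_rules)
next
 case (3 r x)
 then obtain b where "b \<in> carrier A" "act x (s a) = s b" by auto
 with 3(1,2) show ?case
  by (intro image_eqI[of _ _ "r \<odot>\<^bsub>A\<^esub> b"]) (simp_all add: lin_scale[OF lin_act[OF a]] s_rules)
qed

lemma act_closed [simp]: "x \<in> carrier B ==> a \<in> carrier A ==> act x (s a) \<in> carrier B"
 by (rule lin_closed[OF lin_act])

text \<open>The inner value is a base element \<open>s b\<close> by \<open>act_base\<close>; with it
  fixed, both sides are linear in \<open>x\<close>, and on words \<open>act_p_mult\<close> peels off
  the letters of \<open>x\<close> on both sides.\<close>

lemma act_mult: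
 assumes x: "x \<in> carrier B" and y: "y \<in> carrier B" and a: "a \<in> carrier A"
 shows "act (x \<otimes> y) (s a) = act x (act y (s a))"
proof -
 obtain b where b: "b \<in> carrier A" "act y (s a) = s b" using act_base[OF y a] by auto
 have "act (x \<otimes> y) (s a) = act x (s b)"
 proof (rule linear_eqI[OF _ _ x, of _ B])
  have "lin R B B (%x. act (x \<otimes> y) (s a))"
   by (rule lin_comp[OF lin_act[OF a]]) (simp add: y B_alg lin_mult_right lin_id B_mod)
  then show "(%x. act (x \<otimes> y) (s a)) \<in> linear_maps R B B" by (simp add: lin_def)
  show "(%x. act x (s b)) \<in> linear_maps R B B" using lin_act[OF b(1)] by (simp add: lin_def)
  fix ws assume "ws \<in> LH"
  then show "act (wd ws \<otimes> y) (s a) = act (wd ws) (s b)"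
   by (induction ws rule: list.induct) (simp_all add: y a b act_p_mult B.m_assoc)
 qed
 then show ?thesis by (simp add: b)
qed

end

section \<open>The counit of the left bialgebroid\<close>

context par_oid begin

declare sw_cong [cong]

lemma act_add: "[|a \<in> carrier A; x \<in> carrier B; y \<in> carrier B|] ==> act (x \<oplus> y) (s a) = act x (s a) \<oplus> act y (s a)"
 and act_smult: "[|a \<in> carrier A; r \<in> carrier R; x \<in> carrier B|] ==> act (r \<odot> x) (s a) = r \<odot> act x (s a)"
 by (rule lin_add[OF lin_act] lin_scale[OF lin_act]; assumption)+

text \<open>Only the outer one of the two adjoint actions is expanded. The remaining sum is
  \<open>sw_ad_p\<close> at an element S(r), which returns [S(r)] times \<open>s c\<close>.\<close>

lemma act_e:
 assumes c: "c \<in> carrier A" and k: "k \<in> carrier H"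
 shows "act (e k) (s c) = e k \<otimes> s c"
proof -
 have "act (e k) (s c) = sw B (%x y. ad x (ad (S y) (s c))) k"
  using c k sw_map[OF lin_act[OF c], of "%x y. p x \<otimes> p (S y)" k] by (simp add: e_def p_rules act_p_mult act_p)
 also have "... = sw B (%x y. sw B (%a b. p a \<otimes> (ad (S y) (s c) \<otimes> p (S b))) x) k"
  using c k by (simp add: ad_def[of _ "ad _ _"] B.m_assoc)
 also have "... = sw B (%a r. sw B (%b y. p a \<otimes> (ad (S y) (s c) \<otimes> p (S b))) r) k"
  using c k by (intro sw_coassoc) (simp_all add: ad_rules)
 also have "... = sw B (%a r. p a \<otimes> (p (S r) \<otimes> s c)) k"
 proof -
  have "sw B (%b y. ad (S y) (s c) \<otimes> p (S b)) r = p (S r) \<otimes> s c" if "r \<in> carrier H" for r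
   using sw_ad_p[of "S r" "s c"] sw_antipode[of B "%x y. ad x (s c) \<otimes> p y" r] c that
   by (simp add: s_e'_commute ad_rules)
  then show ?thesis using c k by (simp add: mult_sw_left[symmetric] ad_rules)
 qed
 also have "... = e k \<otimes> s c"
  using c k by (simp add: e_def mult_sw_right p_rules B.m_assoc)
 finally show ?thesis .
qed

text \<open>Dual to \<open>act_e\<close>: the remaining sum of [S(r_(1))] against the adjoint action
  of r_(2) is evaluated by \<open>sw_p_ad\<close>, and the tilde element it leaves is absorbed. So
  tilde elements multiply the base from the right, which is the origin of
  \<open>act_t\<close>.\<close>

lemma act_e':
 assumes c: "c \<in> carrier A" and k: "k \<in> carrier H"
 shows "act (e' k) (s c) = s c \<otimes> e (S k)"
proof -
 have "act (e' k) (s c) = sw B (%x y. ad (S x) (ad y (s c))) k"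
  using c k sw_map[OF lin_act[OF c], of "%x y. p (S x) \<otimes> p y" k] by (simp add: e'_def p_rules act_p_mult act_p)
 also have "... = sw B (%x y. sw B (%a b. (p (S b) \<otimes> ad y (s c)) \<otimes> p (S (S a))) x) k"
  using c k by (simp add: ad_def[of _ "ad _ _"] sw_antipode p_rules)
 also have "... = sw B (%a r. sw B (%b y. (p (S b) \<otimes> ad y (s c)) \<otimes> p (S (S a))) r) k"
  using c k by (intro sw_coassoc) (simp_all add: ad_rules)
 also have "... = sw B (%a r. (s c \<otimes> p (S r)) \<otimes> p (S (S a))) k"
 proof -
  have "sw B (%b y. p (S b) \<otimes> ad y (s c)) r = s c \<otimes> p (S r)" if r: "r \<in> carrier H" for r
  proof -
   have "sw B (%b y. p (S b) \<otimes> ad y (s c)) r = sw B (%x y. s c \<otimes> (e' x \<otimes> p (S y))) r"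
    using r c by (simp add: sw_p_ad B.m_assoc[symmetric] s_e'_commute)
   also have "... = s c \<otimes> p (S r)"
    using sw_e'_p[of "S r"] r c by (simp add: sw_antipode mult_sw_left[symmetric] p_rules)
   finally show ?thesis .
  qed
  then show ?thesis using c k by (simp add: mult_sw_right[symmetric] ad_rules)
 qed
 also have "... = s c \<otimes> e (S k)"
  using c k by (simp add: e_def sw_antipode mult_sw_left p_rules B.m_assoc)
 finally show ?thesis .
qed

text \<open>The argument \<open>c\<close> is kept general in the induction, because the product case
  applies the hypothesis for \<open>x\<close> at the base element
  \<open>y \<star> c\<close>.\<close>

lemma act_s: "a \<in> carrier A ==> c \<in> carrier A ==> act (s a) (s c) = s a \<otimes> s c"
proof (induction a arbitrary: c rule: A_induct[consumes 1])
 case (4 x y)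
 then have "act (s x) (s (y \<star> c)) = s x \<otimes> s (y \<star> c)" by simp
 then show ?case using 4 by (simp add: s_rules act_mult B.m_assoc)
qed (simp_all add: s_E act_e s_rules act_add act_smult B.l_distr B.smult_mult_left)

lemma act_t: "a \<in> carrier A ==> c \<in> carrier A ==> act (t a) (s c) = s c \<otimes> s a"
proof (induction a arbitrary: c rule: A_induct[consumes 1])
 case (4 x y)
 then have "act (t y) (s (c \<star> x)) = s (c \<star> x) \<otimes> s y" by simp
 then show ?case using 4 by (simp add: t_rules s_rules act_mult B.m_assoc)
qed (simp_all add: s_E t_E act_e' s_rules t_rules act_add act_smult B.r_distr B.smult_mult_right)

lemma act_unit: "x \<in> carrier B ==> act x \<one> \<in> s ` carrier A"
 using act_base[of x "\<one>\<^bsub>A\<^esub>"] by (simp add: s_rules)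

text \<open>The result of acting on the unit, read back into \<open>A\<close> through the injective
  source. Extensionality is imposed so that it can coincide with \<open>par_extend\<close>, whose
  values are extensional maps.\<close>

definition \<epsilon> :: "'b => 'a"
 where "\<epsilon> = (\<lambda>x\<in>carrier B. inv_into (carrier A) s (act x \<one>))"

lemma s_\<epsilon>: "x \<in> carrier B ==> s (\<epsilon> x) = act x \<one>"
 and \<epsilon>_closed [simp]: "x \<in> carrier B ==> \<epsilon> x \<in> carrier A"
 using act_unit by (simp_all add: \<epsilon>_def f_inv_into_f inv_into_into)

lemma s_eqI: "[|s a = s b; a \<in> carrier A; b \<in> carrier A|] ==> a = b"
 using s_inj by (simp add: inj_on_def)

lemmas act_one_rules = lin_act[of "\<one>\<^bsub>A\<^esub>", simplified s_rules] act_s[of _ "\<one>\<^bsub>A\<^esub>", simplified s_rules]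
 act_mult[of _ _ "\<one>\<^bsub>A\<^esub>", simplified s_rules]
 act_add[of "\<one>\<^bsub>A\<^esub>", simplified s_rules] act_smult[of "\<one>\<^bsub>A\<^esub>", simplified s_rules]

lemma s_\<epsilon>_mult: "[|x \<in> carrier B; y \<in> carrier B|] ==> s (\<epsilon> (x \<otimes> y)) = act x (s (\<epsilon> y))"
 by (simp add: s_\<epsilon> act_one_rules)

lemma \<epsilon>_s: "a \<in> carrier A ==> \<epsilon> (s a) = a"
 by (rule s_eqI) (simp_all add: s_\<epsilon> act_one_rules)

lemma \<epsilon>_t: "a \<in> carrier A ==> \<epsilon> (t a) = a"
 by (rule s_eqI) (use act_t[of a "\<one>\<^bsub>A\<^esub>"] in \<open>simp_all add: s_\<epsilon> s_rules\<close>)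

text \<open>After applying \<open>s\<close>, the counit of a product x y is the action of x on the
  counit of y. Sources act by left and targets by right multiplication, and \<open>s a\<close> and
  \<open>t a\<close> both take the unit to \<open>a\<close>, so y may be replaced by either image of
  its counit.\<close>

lemma \<epsilon>_s_mult: "a \<in> carrier A ==> x \<in> carrier B ==> \<epsilon> (s a \<otimes> x) = a \<star> \<epsilon> x"
 and \<epsilon>_t_mult: "a \<in> carrier A ==> x \<in> carrier B ==> \<epsilon> (t a \<otimes> x) = \<epsilon> x \<star> a"
 and \<epsilon>_mult_s: "x \<in> carrier B ==> y \<in> carrier B ==> \<epsilon> (x \<otimes> s (\<epsilon> y)) = \<epsilon> (x \<otimes> y)"
 and \<epsilon>_mult_t: "x \<in> carrier B ==> y \<in> carrier B ==> \<epsilon> (x \<otimes> t (\<epsilon> y)) = \<epsilon> (x \<otimes> y)"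
 by (rule s_eqI; simp add: s_\<epsilon>_mult act_s act_t s_rules \<epsilon>_s \<epsilon>_t)+

lemma \<epsilon>_linear: "\<epsilon> \<in> linear_maps R B A"
 by (intro linear_mapsI; (rule s_eqI)?) (simp_all add: s_\<epsilon> s_rules act_one_rules)

lemma lin_\<epsilon>: "lin R M B f ==> lin R M A (%x. \<epsilon> (f x))"
 by (rule lin_comp[of R B]) (simp_all add: lin_def \<epsilon>_linear A.module_axioms)

lemma lin_s: "lin R M A f ==> lin R M B (%x. s (f x))"
 and lin_t: "lin R M A f ==> lin R M B (%x. t (f x))"
 using alg_hom_linear[OF s_hom] alg_hom_linear[OF t_hom] by (auto intro: linear_maps_comp simp: lin_def B_mod)

lemmas \<epsilon>_rules = ad_rules lin_\<epsilon> lin_s lin_t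

lemma sw_s_\<epsilon>_p:
 assumes "u \<in> carrier B" "h \<in> carrier H"
 shows "sw B (%x y. s (\<epsilon> (p x \<otimes> u)) \<otimes> p y) h = p h \<otimes> s (\<epsilon> u)"
 using sw_ad_p[of h "s (\<epsilon> u)"] assms by (simp add: s_\<epsilon>_mult act_p s_e'_commute)

text \<open>The map \<open>\<sigma>'\<close> turns sources into targets; applied to the adjoint
  action it reverses the three factors and replaces the two letters by their images under
  \<open>Z\<close>.\<close>

lemma t_\<epsilon>_p:
 assumes v: "v \<in> carrier B" and y: "y \<in> carrier H"
 shows "t (\<epsilon> (p y \<otimes> v)) = sw B (%a c. p c \<otimes> t (\<epsilon> v) \<otimes> p (Z a)) y" (is "?l = _")
proof -
 have "?l = \<sigma>' (ad y (s (\<epsilon> v)))"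
  using v y \<sigma>'_s[of "\<epsilon> (p y \<otimes> v)"] by (simp add: s_\<epsilon>_mult act_p)
 also have "... = sw B (%a c. p c \<otimes> t (\<epsilon> v) \<otimes> p (Z a)) y"
  using v y by (simp add: ad_def sw_\<sigma>' p_rules \<sigma>'_rules \<sigma>'_p \<sigma>'_s B.m_assoc)
 finally show ?thesis .
qed

text \<open>The pair [Z(h_(2))] [h_(1)] combines to an element e_{Z(q)}, which is a source and so
  commutes with the target in front of it; \<open>sw_p_e\<close> then absorbs it.\<close>

lemma sw_t_\<epsilon>_p:
 assumes v: "v \<in> carrier B" and h: "h \<in> carrier H"
 shows "sw B (%x y. t (\<epsilon> (p y \<otimes> v)) \<otimes> p x) h = p h \<otimes> t (\<epsilon> v)" (is "?l = _")
proof -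
 have eZ: "sw B (%x a. p (Z a) \<otimes> p x) q = e (Z q)" if "q \<in> carrier H" for q
  using that by (simp add: e_def sw_Z p_rules)
 have "?l = sw B (%x r. sw B (%a c. p c \<otimes> t (\<epsilon> v) \<otimes> (p (Z a) \<otimes> p x)) r) h"
  using v h by (simp add: t_\<epsilon>_p mult_sw_right p_rules B.m_assoc)
 also have "... = sw B (%q c. sw B (%x a. p c \<otimes> t (\<epsilon> v) \<otimes> (p (Z a) \<otimes> p x)) q) h"
  using v h by (intro sw_coassoc[symmetric]) (simp_all add: p_rules)
 also have "... = sw B (%q c. p c \<otimes> t (\<epsilon> v) \<otimes> e (Z q)) h"
  using v h by (simp add: mult_sw_left[symmetric] p_rules eZ)
 also have "... = sw B (%q c. p c \<otimes> e (Z q) \<otimes> t (\<epsilon> v)) h"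
  using v h s_t_commute[OF E_closed \<epsilon>_closed] by (intro sw_cong) (simp_all add: s_E[symmetric] B.m_assoc)
 also have "... = p h \<otimes> t (\<epsilon> v)"
  using v h by (simp add: mult_sw_right[symmetric] p_rules sw_p_e)
 finally show ?thesis .
qed

lemma counit_left_balanced: "balanced B (%x y. s (\<epsilon> x) \<otimes> y)"
 by (intro balancedI B.abelian_group_axioms biadditiveI add_mapsI)
  (simp_all add: \<epsilon>_t_mult s_rules linear_maps_add[OF \<epsilon>_linear] B.l_distr B.r_distr B.m_assoc)

lemma counit_right_balanced: "balanced B (%x y. t (\<epsilon> y) \<otimes> x)"
 by (intro balancedI B.abelian_group_axioms biadditiveI add_mapsI)
  (simp_all add: \<epsilon>_s_mult t_rules linear_maps_add[OF \<epsilon>_linear] B.l_distr B.r_distr B.m_assoc)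

text \<open>Common core of both counit laws: by \<open>step\<close>, putting a letter in front of
  both tensor factors and summing over its legs multiplies the value of \<open>g\<close> by that
  letter, so induction on words applies.\<close>

lemma tlift_comult_ident:
 assumes g: "balanced B g" "bilin R B B B g" "g \<one> \<one> = \<one>"
  and smult: "!!r u v. [|r \<in> carrier R; u \<in> carrier B; v \<in> carrier B|] ==> g (r \<odot> u) v = r \<odot> g u v"
  and step: "!!h u v. [|h \<in> carrier H; u \<in> carrier B; v \<in> carrier B|] ==> sw B (%x y. g (p x \<otimes> u) (p y \<otimes> v)) h = p h \<otimes> g u v"
  and x: "x \<in> carrier B"
 shows "tlift B g (\<Delta> x) = x"
proof (rule linear_eqI[OF _ _ x, of _ B])
 have f: "tlift B g \<in> linear_maps R TB B"
  by (intro TB_tlift_linear g B_mod smult)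
 then show "(%x. tlift B g (\<Delta> x)) \<in> linear_maps R B B" by (rule linear_maps_comp[OF \<Delta>_linear])
 show "(%x. x) \<in> linear_maps R B B" using lin_id[OF B_mod] by (simp add: lin_def)
 have l: "linH B (%x. g (f x) y)" "linH B (%x. g y (f x))" if "linH B f" "y \<in> carrier B" for f y
  using g(2) that by (auto simp: bilin_def intro: lin_comp)
 have words: "wsw B H ws (%u v. g (wd u) (wd v)) = wd ws" if "ws \<in> LH" for ws
  using that
 proof (induction ws rule: list.induct)
  case (Cons h ws)
  then have h: "h \<in> carrier H" and ws: "ws \<in> LH" by simp_all
  have "wsw B H (h # ws) (%u v. g (wd u) (wd v))
    = wsw B H ws (%u v. sw B (%x y. g (p x \<otimes> wd u) (p y \<otimes> wd v)) h)"
   unfolding wsw.simps wd_simps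
   by (rule wsw_exchange[OF ws h, symmetric]) (use wlin_shift[OF wlin_wd[OF g(2)]] in "simp_all add: l \<epsilon>_rules")
  also have "... = wsw B H ws (%u v. p h \<otimes> g (wd u) (wd v))"
   by (rule wsw_cong[OF ws]) (simp add: step h)
  also have "... = p h \<otimes> wsw B H ws (%u v. g (wd u) (wd v))"
   by (rule wsw_map[OF _ ws wlin_wd[OF g(2)], symmetric]) (simp add: h p_rules lin_id)
  finally show ?case using Cons by simp
 qed (simp add: g)
 fix ws assume ws: "ws \<in> LH"
 have "tlift B g (\<Delta> (wd ws)) = wsw B H ws (%u v. tlift B g (wd u \<bowtie> wd v))"
  unfolding \<Delta>_wd[OF ws] using f by (intro wsw_map[OF _ ws wlin_wd[OF bilin_pure]]) (simp add: lin_def B_mod)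
 also have "... = wsw B H ws (%u v. g (wd u) (wd v))"
  by (intro wsw_cong[OF ws] TB_tlift_pure g) simp_all
 finally show "tlift B g (\<Delta> (wd ws)) = wd ws" using words[OF ws] by simp
qed

lemma counit_left:
 assumes "x \<in> carrier B"
 shows "tlift B (%x y. s (\<epsilon> x) \<otimes> y) (\<Delta> x) = x"
proof (rule tlift_comult_ident[OF counit_left_balanced _ _ _ _ assms])
 fix h u v assume *: "h \<in> carrier H" "u \<in> carrier B" "v \<in> carrier B"
 have "sw B (%x y. s (\<epsilon> (p x \<otimes> u)) \<otimes> (p y \<otimes> v)) h = sw B (%x y. s (\<epsilon> (p x \<otimes> u)) \<otimes> p y) h \<otimes> v"
  using * by (simp add: mult_sw_right \<epsilon>_rules B.m_assoc)
 then show "sw B (%x y. s (\<epsilon> (p x \<otimes> u)) \<otimes> (p y \<otimes> v)) h = p h \<otimes> (s (\<epsilon> u) \<otimes> v)"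
  using * by (simp add: sw_s_\<epsilon>_p B.m_assoc)
qed (simp_all add: bilin_def B_mod B_alg lin_mult_left lin_mult_right lin_id lin_s lin_\<epsilon>
  linear_maps_smult[OF \<epsilon>_linear] s_rules B.smult_mult_left \<epsilon>_s[of "\<one>\<^bsub>A\<^esub>", simplified s_rules])

lemma counit_right:
 assumes "x \<in> carrier B"
 shows "tlift B (%x y. t (\<epsilon> y) \<otimes> x) (\<Delta> x) = x"
proof (rule tlift_comult_ident[OF counit_right_balanced _ _ _ _ assms])
 fix h u v assume *: "h \<in> carrier H" "u \<in> carrier B" "v \<in> carrier B"
 have "sw B (%x y. t (\<epsilon> (p y \<otimes> v)) \<otimes> (p x \<otimes> u)) h = sw B (%x y. t (\<epsilon> (p y \<otimes> v)) \<otimes> p x) h \<otimes> u"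
  using * by (simp add: mult_sw_right \<epsilon>_rules B.m_assoc)
 then show "sw B (%x y. t (\<epsilon> (p y \<otimes> v)) \<otimes> (p x \<otimes> u)) h = p h \<otimes> (t (\<epsilon> v) \<otimes> u)"
  using * by (simp add: sw_t_\<epsilon>_p B.m_assoc)
qed (simp_all add: bilin_def B_mod B_alg lin_mult_left lin_mult_right lin_id lin_t lin_\<epsilon>
  B.smult_mult_right t_rules \<epsilon>_s[of "\<one>\<^bsub>A\<^esub>", simplified s_rules])

lemma left_bialgebroid: "left_bialgebroid R B A s t \<Delta> \<epsilon>"
proof (intro left_bialgebroid.intro coring.intro left_bialgebroid_axioms.intro coring_axioms.intro
  B_alg A.k_algebra_axioms coring_bimodule s_hom t_hom s_t_commute \<Delta>_hom \<Delta>_coassoc counit_left counit_right \<epsilon>_closed)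
 have sq: "tensor_square A B (%a h. s a \<otimes> h) (%h a. t a \<otimes> h) = TB"
  by (simp add: left_tensor_def)
 let ?T = "tensor_square A B (%a h. s a \<otimes> h) (%h a. t a \<otimes> h)"
 show "\<Delta> x \<in> carrier ?T" if "x \<in> carrier B" for x
  unfolding sq using that by simp
 show "\<Delta> (x \<oplus> y) = \<Delta> x \<oplus>\<^bsub>?T\<^esub> \<Delta> y" if "x \<in> carrier B" "y \<in> carrier B" for x y
  unfolding sq using that by (simp add: \<Delta>_rules)
 show "\<Delta> (s a \<otimes> x) = tmap ?T (%h. s a \<otimes> h) (%y. y) (\<Delta> x)"
  "\<Delta> (t a \<otimes> x) = tmap ?T (%x. x) (%h. t a \<otimes> h) (\<Delta> x)"
  if "a \<in> carrier A" "x \<in> carrier B" for a x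
  unfolding sq using that by (rule \<Delta>_actions)+
qed (simp_all add: linear_maps_add[OF \<epsilon>_linear] \<epsilon>_s_mult \<epsilon>_t_mult \<epsilon>_mult_s \<epsilon>_mult_t)

lemma s_\<epsilon>_t': "b \<in> carrier A' ==> s (\<epsilon> (t' b)) = t' b"
 using t'_s[of b] by (auto simp: \<epsilon>_s)

lemma t_\<epsilon>_s': "b \<in> carrier A' ==> t (\<epsilon> (s' b)) = s' b"
 using s'_t[of b] by (auto simp: \<epsilon>_t)

lemma antipode_right_\<epsilon>: "x \<in> carrier B ==> tlift B (%u v. u \<otimes> \<sigma> v) (\<Delta>' x) = s (\<epsilon> x)"
 using o.TB_tlift_cong[of "\<Delta>' x" "%u v. u \<otimes> \<sigma> v" "%u v. u \<otimes> \<one> \<otimes> \<sigma> v" B]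
 by (simp add: s_\<epsilon> act_def)

lemma \<sigma>_targets:
 "[|a \<in> carrier A; x \<in> carrier B; b \<in> carrier A'|] ==>
  \<sigma> (t a \<otimes> x \<otimes> t' b) = s' b \<otimes> \<sigma> x \<otimes> s a"
 by (simp add: \<sigma>_rules \<sigma>_t \<sigma>_t' B.m_assoc)

end

section \<open>Iterated Sweedler notation\<close>

context hopf_algebra begin

text \<open>Multilinearity on lists of length exactly \<open>n\<close>. The recursion peels off the
  first entry in the same way as \<open>legs\<close> does.\<close>

primrec mlin :: "nat => ('k, 'g, 'z) module_scheme => ('h list => 'g) => bool" where
 "mlin 0 G be \<longleftrightarrow> module R G \<and> be [] \<in> carrier G"
| "mlin (Suc n) G be \<longleftrightarrow> (\<forall>x\<in>carrier H. mlin n G (%L. be (x # L))) \<and>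
  (\<forall>L\<in>LH. length L = n --> linH G (%x. be (x # L)))"

lemma mlin_module: "mlin n G be ==> module R G"
proof (induction n arbitrary: be)
 case (Suc n)
 then have "mlin n G (%L. be (\<one>\<^bsub>H\<^esub> # L))" by simp
 then show ?case by (rule Suc.IH)
qed simp

lemma legs_cong:
 "[|h \<in> carrier H; !!L. L \<in> LH ==> length L = Suc n ==> be L = be' L|] ==> legs G H n be h = legs G H n be' h"
proof (induction n arbitrary: h be be')
 case (Suc n)
 have "legs G H n (%L. be (x # L)) y = legs G H n (%L. be' (x # L)) y"
  if "x \<in> carrier H" "y \<in> carrier H" for x y
  using that by (intro Suc.IH Suc.prems) simp_all
 then show ?case using Suc.prems(1) by simp
qed simp

lemma legs_Suc: "legs G H (Suc n) be = (%h. sw G (%x y. legs G H n (%L. be (x # L)) y) h)"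
 by (simp add: fun_eq_iff)

text \<open>Linearity in the element being split and linearity in a parameter are proved together:
  after one splitting the first leg is a parameter of the remaining sum.\<close>

lemma legs_lin_aux:
 "(\<forall>be. mlin (Suc n) G be --> linH G (legs G H n be)) \<and>
  (\<forall>be k. k \<in> carrier H --> (\<forall>x\<in>carrier H. mlin (Suc n) G (be x)) -->
   (\<forall>L\<in>LH. length L = Suc n --> linH G (%x. be x L)) --> linH G (%x. legs G H n (be x) k))"
proof (induction n)
 case 0
 show ?case by (simp add: legs_0)
next
 case (Suc n)
 note IH1 = Suc[THEN conjunct1, rule_format] and IH2 = Suc[THEN conjunct2, rule_format]
 have bil: "bilinH G (%x y. legs G H n (%L. be (x # L)) y)" if b: "mlin (Suc (Suc n)) G be" for be
  unfolding bilin_def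
 proof (intro conjI ballI)
  show "module R G" by (rule mlin_module[OF b])
  show "linH G (legs G H n (%L. be (x # L)))" if "x \<in> carrier H" for x
   using b that by (intro IH1) simp
  show "linH G (%x. legs G H n (%L. be (x # L)) y)" if "y \<in> carrier H" for y
   using b that by (intro IH2) simp_all
 qed
 show ?case
 proof (intro conjI allI impI)
  fix be assume "mlin (Suc (Suc n)) G be"
  then show "linH G (legs G H (Suc n) be)"
   using lin_sw[OF bil] by (subst legs_Suc)
 next
  fix be k
  assume k: "k \<in> carrier H" and b: "\<forall>x\<in>carrier H. mlin (Suc (Suc n)) G (be x)"
   and l: "\<forall>L\<in>LH. length L = Suc (Suc n) --> linH G (%x. be x L)"
  have "linH G (%x. legs G H n (%L. be x (y # L)) z)" if "y \<in> carrier H" "z \<in> carrier H" for y z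
   using that b l by (intro IH2) simp_all
  then show "linH G (%x. legs G H (Suc n) (be x) k)"
   unfolding legs.simps
   by (intro lin_sw_param ballI bil b[rule_format] H_mod k mlin_module[OF b[rule_format, OF algebra.one_closed]])
 qed
qed

lemmas lin_legs = legs_lin_aux[THEN conjunct1, rule_format]

lemma bilin_legs:
 assumes "mlin (Suc (Suc n)) G be"
 shows "bilinH G (%x y. legs G H n (%L. be (x # L)) y)"
 unfolding bilin_def
proof (intro conjI ballI)
 show "module R G" by (rule mlin_module[OF assms])
 show "linH G (legs G H n (%L. be (x # L)))" if "x \<in> carrier H" for x
  using assms that by (intro lin_legs) simp
 show "linH G (%x. legs G H n (%L. be (x # L)) y)" if "y \<in> carrier H" for y
  using assms that by (intro legs_lin_aux[THEN conjunct2, rule_format]) simp_all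
qed

lemma lin_legs_param:
 assumes "k \<in> carrier H" "!!x. x \<in> carrier M ==> mlin (Suc n) G (be x)"
  and "!!L. L \<in> LH ==> length L = Suc n ==> lin R M G (%x. be x L)" "module R M"
 shows "lin R M G (%x. legs G H n (be x) k)"
 using assms(1-3)
proof (induction n arbitrary: k be)
 case 0
 then show ?case by (simp add: legs_0)
next
 case (Suc n)
 interpret M: module R M by fact
 have "module R G" using mlin_module[OF Suc.prems(2)[OF M.zero_closed]] .
 moreover have "lin R M G (%x. legs G H n (%L. be x (y # L)) z)" if "y \<in> carrier H" "z \<in> carrier H" for y z
  using that Suc.prems(2,3) by (intro Suc.IH) simp_all
 ultimately show ?case
  using Suc.prems(1) bilin_legs[OF Suc.prems(2)] assms(4) by (simp add: lin_sw_param)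
qed

lemma legs_closed: "mlin (Suc n) G be ==> k \<in> carrier H ==> legs G H n be k \<in> carrier G"
 by (rule lin_closed[OF lin_legs])

lemma legs_map:
 assumes "lin R G G' f" "mlin (Suc n) G be" "k \<in> carrier H"
 shows "f (legs G H n be k) = legs G' H n (%L. f (be L)) k"
 using assms(2,3)
proof (induction n arbitrary: k be)
 case (Suc n)
 have "f (legs G H (Suc n) be k) = sw G' (%x y. f (legs G H n (%L. be (x # L)) y)) k"
  using sw_map[OF assms(1) bilin_legs[OF Suc.prems(1)] Suc.prems(2)] by simp
 also have "... = legs G' H (Suc n) (%L. f (be L)) k"
  using Suc by simp
 finally show ?case .
qed (simp add: legs_0)

lemma mlin_legs:
 assumes "k \<in> carrier H" "!!D. D \<in> LH ==> length D = m ==> mlin (Suc n) G (ga D)"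
  and "!!L. L \<in> LH ==> length L = Suc n ==> mlin m G (%D. ga D L)"
 shows "mlin m G (%D. legs G H n (ga D) k)"
 using assms(2,3)
proof (induction m arbitrary: ga)
 case 0
 then show ?case using assms(1) legs_closed[of n G "ga []" k] mlin_module[of "Suc n" G "ga []"] by simp
next
 case (Suc m)
 show ?case
  unfolding mlin.simps
 proof (intro conjI ballI impI)
  fix x assume x: "x \<in> carrier H"
  show "mlin m G (%L. legs G H n (ga (x # L)) k)"
   using Suc.prems x by (intro Suc.IH) simp_all
 next
  fix L assume L: "L \<in> LH" "length L = m"
  show "linH G (%x. legs G H n (ga (x # L)) k)"
  proof (intro lin_legs_param assms(1) H_mod)
   show "mlin (Suc n) G (ga (x # L))" if "x \<in> carrier H" for x
    using that L by (intro Suc.prems) simp_all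
   show "linH G (%x. ga (x # L) D)" if "D \<in> LH" "length D = Suc n" for D
    using Suc.prems(2)[OF that] L by simp
  qed
 qed
qed

lemma mlin_map2_left:
 "mlin n G be ==> ds \<in> LH ==> length ds = n ==> mlin n G (%L. be (map2 (\<cdot>) ds L))"
proof (induction n arbitrary: be ds)
 case (Suc n)
 then obtain d ds' where ds: "ds = d # ds'" "d \<in> carrier H" "ds' \<in> LH" "length ds' = n" by (cases ds) auto
 have "linH G (%x. be (d \<cdot> x # map2 (\<cdot>) ds' L))" if "L \<in> LH" "length L = n" for L
 proof (rule lin_comp[where g = "%x. be (x # map2 (\<cdot>) ds' L)" and f = "%x. d \<cdot> x"])
  have "map2 (\<cdot>) ds' L \<in> LH" using that ds by (auto simp: in_lists_conv_set set_zip)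
  then show "linH G (%x. be (x # map2 (\<cdot>) ds' L))" using Suc.prems(1) that ds by simp
 qed (simp add: ds lin_rules)
 then show ?case using Suc.prems(1) ds Suc.IH[of "%L. be (d \<cdot> _ # L)" ds'] by simp
qed simp

lemma mlin_map2_right:
 "mlin n G be ==> ds \<in> LH ==> length ds = n ==> mlin n G (%L. be (map2 (\<cdot>) L ds))"
proof (induction n arbitrary: be ds)
 case (Suc n)
 then obtain d ds' where ds: "ds = d # ds'" "d \<in> carrier H" "ds' \<in> LH" "length ds' = n" by (cases ds) auto
 have "linH G (%x. be (x \<cdot> d # map2 (\<cdot>) L ds'))" if "L \<in> LH" "length L = n" for L
 proof (rule lin_comp[where g = "%x. be (x # map2 (\<cdot>) L ds')" and f = "%x. x \<cdot> d"])
  have "map2 (\<cdot>) L ds' \<in> LH" using that ds by (auto simp: in_lists_conv_set set_zip)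
  then show "linH G (%x. be (x # map2 (\<cdot>) L ds'))" using Suc.prems(1) that ds by simp
 qed (simp add: ds lin_rules)
 then show ?case using Suc.prems(1) ds Suc.IH[of "%L. be (_ \<cdot> d # L)" ds'] by simp
qed simp

lemma legs_exchange:
 assumes "b \<in> carrier H" "k \<in> carrier H"
  and "!!c d. c \<in> carrier H ==> d \<in> carrier H ==> mlin (Suc n) G (g c d)"
  and "!!L. L \<in> LH ==> length L = Suc n ==> bilinH G (%c d. g c d L)"
 shows "legs G H n (%L. sw G (%c d. g c d L) k) b = sw G (%c d. legs G H n (g c d) b) k"
 using assms(1,3,4)
proof (induction n arbitrary: b g)
 case (Suc n)
 have "legs G H (Suc n) (%L. sw G (%c d. g c d L) k) b
   = sw G (%x y. sw G (%c d. legs G H n (%L. g c d (x # L)) y) k) b"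
  unfolding legs.simps
 proof (rule sw_cong[OF refl])
  fix x y assume xy: "x \<in> carrier H" "y \<in> carrier H"
  show "legs G H n (%L. sw G (%c d. g c d (x # L)) k) y = sw G (%c d. legs G H n (%L. g c d (x # L)) y) k"
   using xy Suc.prems(2,3) by (intro Suc.IH) simp_all
 qed (use Suc.prems(1) in simp)
 also have "... = sw G (%c d. sw G (%x y. legs G H n (%L. g c d (x # L)) y) b) k"
 proof (rule sw_swap[OF Suc.prems(1) assms(2)])
  show G: "module R G" by (rule mlin_module[OF Suc.prems(2)[OF algebra.one_closed algebra.one_closed]])
  show "bilinH G (%x y. legs G H n (%L. g u v (x # L)) y)" if "u \<in> carrier H" "v \<in> carrier H" for u v
   by (rule bilin_legs[OF Suc.prems(2)[OF that]])
  show "bilinH G (%u v. legs G H n (%L. g u v (x # L)) y)" if "x \<in> carrier H" "y \<in> carrier H" for x y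
   unfolding bilin_def
   using that Suc.prems(2,3) by (intro conjI ballI G lin_legs_param H_mod) (simp_all add: bilin_def)
 qed
 finally show ?case using assms(2) by simp
qed (simp add: legs_0 assms(2))

lemma map2_LH: "a \<in> LH ==> b \<in> LH ==> map2 (\<cdot>) a b \<in> LH"
 by (auto simp: in_lists_conv_set set_zip)

text \<open>Iterated multiplicativity of Delta. One leg of each factor is split off by
  \<open>sw_mult\<close>; then the splitting of \<open>k\<close> is moved past the remaining legs of
  \<open>h\<close> by \<open>legs_exchange\<close>.\<close>

lemma legs_mult:
 assumes "mlin (Suc n) G be" "h \<in> carrier H" "k \<in> carrier H"
 shows "legs G H n be (h \<cdot> k) = legs G H n (%D. legs G H n (%L. be (map2 (\<cdot>) D L)) k) h"
 using assms
proof (induction n arbitrary: be h k)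
 case (Suc n)
 note G = mlin_module[OF Suc.prems(1)]
 let ?ga = "%x y. legs G H n (%L. be (x # L)) y"
 have bi: "bilinH G ?ga" by (rule bilin_legs[OF Suc.prems(1)])
 have l1: "linH G (%x. ?ga (f x) y)" if "linH H f" "y \<in> carrier H" for f y
  using lin_comp[of R H G "%x. ?ga x y" H f] bi that by (simp add: bilin_def)
 have l2: "linH G (%y. ?ga x (f y))" if "linH H f" "x \<in> carrier H" for f x
  using lin_comp[of R H G "?ga x" H f] bi that by (simp add: bilin_def)
 have "legs G H (Suc n) be (h \<cdot> k)
   = sw G (%u v. sw G (%x y. ?ga (x \<cdot> u) (y \<cdot> v)) h) k"
  using sw_mult[OF bi Suc.prems(2,3)] by simp
 also have "... = sw G (%x y. sw G (%u v. ?ga (x \<cdot> u) (y \<cdot> v)) k) h"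
  by (rule sw_swap[OF Suc.prems(3,2)]) (simp_all add: bilin_def G l1 l2 lin_rules)
 also have "... = sw G (%x y. legs G H n (%D. sw G (%u v. legs G H n (%L. be ((x \<cdot> u) # map2 (\<cdot>) D L)) v) k) y) h"
 proof (rule sw_cong[OF refl])
  fix x y assume x: "x \<in> carrier H" and y: "y \<in> carrier H"
  have m: "mlin (Suc n) G (%L. be ((x \<cdot> u) # L))" if "u \<in> carrier H" for u
   using Suc.prems(1) that x by simp
  have "sw G (%u v. ?ga (x \<cdot> u) (y \<cdot> v)) k
    = sw G (%u v. legs G H n (%D. legs G H n (%L. be ((x \<cdot> u) # map2 (\<cdot>) D L)) v) y) k"
   using Suc.prems(3) x y by (intro sw_cong refl Suc.IH m) simp_all
  also have "... = legs G H n (%D. sw G (%u v. legs G H n (%L. be ((x \<cdot> u) # map2 (\<cdot>) D L)) v) k) y"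
  proof (rule legs_exchange[symmetric, OF y Suc.prems(3)])
   fix u v assume u: "u \<in> carrier H" and v: "v \<in> carrier H"
   show "mlin (Suc n) G (%D. legs G H n (%L. be ((x \<cdot> u) # map2 (\<cdot>) D L)) v)"
    by (intro mlin_legs v mlin_map2_left[OF m[OF u]] mlin_map2_right[OF m[OF u]])
  next
   fix D assume D: "D \<in> LH" "length D = Suc n"
   show "bilinH G (%u v. legs G H n (%L. be ((x \<cdot> u) # map2 (\<cdot>) D L)) v)"
    unfolding bilin_def
   proof (intro conjI ballI G)
    fix u assume "u \<in> carrier H"
    then show "linH G (legs G H n (%L. be ((x \<cdot> u) # map2 (\<cdot>) D L)))"
     by (intro lin_legs mlin_map2_left[OF m] D)
   next
    fix v assume v: "v \<in> carrier H"
    show "linH G (%u. legs G H n (%L. be ((x \<cdot> u) # map2 (\<cdot>) D L)) v)"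
    proof (intro lin_legs_param v mlin_map2_left[OF m] D H_mod)
     fix L assume L: "L \<in> LH" "length L = Suc n"
     show "linH G (%u. be (x \<cdot> u # map2 (\<cdot>) D L))"
      by (rule lin_comp[where N = H and g = "%w. be (w # map2 (\<cdot>) D L)" and f = "%u. x \<cdot> u"])
       (use Suc.prems(1) D L x map2_LH[OF D(1) L(1)] in "simp_all add: lin_rules")
    qed
   qed
  qed
  finally show "sw G (%u v. ?ga (x \<cdot> u) (y \<cdot> v)) k
    = legs G H n (%D. sw G (%u v. legs G H n (%L. be ((x \<cdot> u) # map2 (\<cdot>) D L)) v) k) y" .
 qed (simp add: Suc.prems)
 finally show ?case using Suc.prems(2,3) by simp
qed (simp add: legs_0)

text \<open>The shape recorded by \<open>list_all2\<close> guarantees that the positions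
  \<open>Ls ! i ! j\<close> in the counit formulas exist and lie in the carrier.\<close>

lemma multi_legs_cong:
 assumes "fst ` set hs \<subseteq> carrier H"
  and "!!Ls. list_all2 (%(h, m) L. L \<in> LH \<and> length L = Suc m) hs Ls ==> be Ls = be' Ls"
 shows "multi_legs G H hs be = multi_legs G H hs be'"
 using assms
proof (induction hs arbitrary: be be')
 case (Cons q hs)
 obtain h m where q: "q = (h, m)" by force
 show ?case
  unfolding q multi_legs.simps
 proof (rule legs_cong)
  fix L assume L: "L \<in> LH" "length L = Suc m"
  show "multi_legs G H hs (%Ls. be (L # Ls)) = multi_legs G H hs (%Ls. be' (L # Ls))"
   using Cons.prems(1) L by (intro Cons.IH Cons.prems(2)) (simp_all add: q)
 qed (use Cons.prems in "simp add: q")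
qed simp

end

section \<open>The counit on words\<close>

lemma list_prod_simps [simp]: "list_prod M [] = \<one>\<^bsub>M\<^esub>" "list_prod M (x # xs) = x \<otimes>\<^bsub>M\<^esub> list_prod M xs"
 by (simp_all add: list_prod_def)

context hopf_algebra begin

lemma mlin_comp: "lin R G G' f ==> mlin n G be ==> mlin n G' (%L. f (be L))"
 by (induction n arbitrary: be) (auto intro: lin_comp simp: lin_closed, simp add: lin_def)

lemma map2_one_left: "L \<in> LH ==> map2 (\<cdot>) (replicate (length L) \<one>\<^bsub>H\<^esub>) L = L"
 by (induction L rule: list.induct) simp_all

lemma hd_tl_LH: "D \<in> LH ==> length D = Suc n ==> hd D \<in> carrier H \<and> tl D \<in> LH \<and> length (tl D) = n"
 by (cases D) auto

end

context par_oid begin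

declare sw_cong [cong]

lemma A_mod: "module R A" and A_alg: "k_algebra R A"
 by (rule A.module_axioms A.k_algebra_axioms)+

lemma lin_E: "lin R M H f ==> lin R M A (%x. E (f x))"
 by (rule lin_comp[of R H]) (simp_all add: lin_def E_linear A_mod)

text \<open>An intermediate state of the left counit formula: \<open>b\<close> is the product of the
  finished factors, and \<open>cs\<close> lists, for each factor still open, the product of the legs
  contributed by earlier letters. The next letter gives one leg to every open factor and completes
  the first of them.\<close>

fun lq :: "'h list => 'a => 'h list => 'a" where
 "lq [] b cs = b"
| "lq (k # ws) b cs = legs A H (length ws)
  (%L. lq ws (b \<star> E (hd cs \<cdot> hd L)) (map2 (\<cdot>) (tl cs) (tl L))) k"

text \<open>The two clauses need each other: in the recursion the first entry of \<open>cs\<close>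
  enters through \<open>b\<close>, and the other entries through the new list of prefixes.\<close>

lemma lq_mlin:
 assumes "ws \<in> LH"
 shows "(\<forall>b\<in>carrier A. mlin (length ws) A (lq ws b)) \<and>
  (\<forall>cs\<in>LH. length cs = length ws --> lin R A A (%b. lq ws b cs))"
 using assms
proof (induction ws rule: list.induct)
 case (Cons k ws)
 let ?n = "length ws"
 have k: "k \<in> carrier H" and ws: "ws \<in> LH" using Cons.prems by simp_all
 note IH1 = Cons.IH[OF ws, THEN conjunct1, rule_format] and IH2 = Cons.IH[OF ws, THEN conjunct2, rule_format]
 let ?ga = "%b c cs L. lq ws (b \<star> E (c \<cdot> hd L)) (map2 (\<cdot>) cs (tl L))"
 have bE: "b \<star> E (c \<cdot> x) \<in> carrier A" if "b \<in> carrier A" "c \<in> carrier H" "x \<in> carrier H" for b c x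
  using that by simp
 have gab: "lin R A A (%b. ?ga b c cs L)"
  if "c \<in> carrier H" "cs \<in> LH" "length cs = ?n" "L \<in> LH" "length L = Suc ?n" for c cs L
  using that hd_tl_LH[OF that(4,5)]
  by (intro lin_comp[OF IH2]) (simp_all add: map2_LH lin_mult_right A_alg lin_id A_mod)
 have gac: "linH A (%c. ?ga b c cs L)"
  if "b \<in> carrier A" "cs \<in> LH" "length cs = ?n" "L \<in> LH" "length L = Suc ?n" for b cs L
  using that hd_tl_LH[OF that(4,5)]
  by (intro lin_comp[OF IH2]) (simp_all add: map2_LH lin_mult_left A_alg lin_E lin_rules)
 have gaL: "mlin (Suc ?n) A (?ga b c cs)"
  if "b \<in> carrier A" "c \<in> carrier H" "cs \<in> LH" "length cs = ?n" for b c cs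
  unfolding mlin.simps
 proof (intro conjI ballI impI)
  show "mlin ?n A (%L. ?ga b c cs (x # L))" if "x \<in> carrier H" for x
   using that \<open>b \<in> carrier A\<close> \<open>c \<in> carrier H\<close> \<open>cs \<in> LH\<close> \<open>length cs = ?n\<close> mlin_map2_left[OF IH1[OF bE]] by simp
  show "linH A (%x. ?ga b c cs (x # L))" if "L \<in> LH" "length L = ?n" for L
  proof -
   have "linH A (%x. lq ws (b \<star> E (c \<cdot> x)) (map2 (\<cdot>) cs L))"
    using that \<open>b \<in> carrier A\<close> \<open>c \<in> carrier H\<close> \<open>cs \<in> LH\<close> \<open>length cs = ?n\<close>
    by (intro lin_comp[OF IH2]) (simp_all add: map2_LH lin_mult_left A_alg lin_E lin_rules)
   then show ?thesis by simp
  qed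
 qed
 have gacs: "mlin ?n A (%cs. ?ga b c cs L)"
  if "b \<in> carrier A" "c \<in> carrier H" "L \<in> LH" "length L = Suc ?n" for b c L
  using that hd_tl_LH[OF that(3,4)] mlin_map2_right[OF IH1[OF bE]] by simp
 show ?case
 proof (intro conjI ballI impI)
  fix b assume b: "b \<in> carrier A"
  show "mlin (length (k # ws)) A (lq (k # ws) b)"
   unfolding list.size add_Suc_right add_0_right mlin.simps
  proof (intro conjI ballI impI)
   fix c assume "c \<in> carrier H"
   then show "mlin ?n A (%cs. lq (k # ws) b (c # cs))"
    using mlin_legs[OF k, of ?n ?n A "?ga b c"] gaL[OF b] gacs[OF b] by simp
  next
   fix cs assume cs: "cs \<in> LH" "length cs = ?n"
   then show "linH A (%c. lq (k # ws) b (c # cs))"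
    using lin_legs_param[OF k, of H ?n A "%c. ?ga b c cs"] gaL[OF b _ cs] gac[OF b cs] H_mod by simp
  qed
 next
  fix cs assume "cs \<in> LH" "length cs = length (k # ws)"
  then have cs: "hd cs \<in> carrier H" "tl cs \<in> LH" "length (tl cs) = ?n" using hd_tl_LH[of cs ?n] by simp_all
  then show "lin R A A (%b. lq (k # ws) b cs)"
   using lin_legs_param[OF k, of A ?n A "%b. ?ga b (hd cs) (tl cs)"] gaL[OF _ cs] gab[OF cs] A_mod by simp
 qed
qed (simp add: A_mod lin_id)

lemma lq_legs_mlin:
 assumes "ws \<in> LH" "b \<in> carrier A"
 shows "mlin (Suc (length ws)) A (%M. lq ws (b \<star> E (hd M)) (tl M))"
 using lq_mlin[OF assms(1)] assms(2)
  lin_comp[of R A A "%b. lq ws b _" H "%x. b \<star> E x"]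
 by (simp add: lin_mult_left A_alg lin_E lin_rules)

text \<open>Since e_{h_(1)} is a source, it can be taken into the counit, where
  \<open>sw_e_p_mult\<close> applies.\<close>

lemma sw_E_\<epsilon>:
 assumes "h \<in> carrier H" "k \<in> carrier H" "x \<in> carrier B"
 shows "sw A (%a c. E a \<star> \<epsilon> (p (c \<cdot> k) \<otimes> x)) h = \<epsilon> (p h \<otimes> (p k \<otimes> x))" (is "?l = _")
proof -
 have "?l = sw A (%a c. \<epsilon> (e a \<otimes> p (c \<cdot> k) \<otimes> x)) h"
  using assms by (simp add: \<epsilon>_s_mult[symmetric] s_E B.m_assoc)
 also have "... = \<epsilon> (sw B (%a c. e a \<otimes> p (c \<cdot> k) \<otimes> x) h)"
  using assms by (intro sw_map[OF lin_\<epsilon>[OF lin_id[OF B_mod]], symmetric]) (simp_all add: p_rules)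
 also have "... = \<epsilon> (p h \<otimes> (p k \<otimes> x))"
  using assms mult_sw_right[OF B_alg assms(3), of "%a c. e a \<otimes> p (c \<cdot> k)" h]
  by (simp add: p_rules sw_e_p_mult B.m_assoc[of "p h"])
 finally show ?thesis .
qed

text \<open>With the legs of \<open>h\<close> as prefixes and \<open>k\<close> as next letter, the
  first leg of \<open>h\<close> is finished and its remaining part \<open>y\<close> multiplies
  \<open>k\<close> leg by leg, so \<open>legs_mult\<close> presents the sum as one over the legs of
  \<open>y \<cdot> k\<close>. The hypothesis evaluates that sum, and \<open>sw_E_\<epsilon>\<close>
  reassembles [h] [k].\<close>

lemma legs_lq:
 assumes "ws \<in> LH" "b \<in> carrier A" "h \<in> carrier H"
 shows "legs A H (length ws) (%D. lq ws (b \<star> E (hd D)) (tl D)) h = b \<star> \<epsilon> (p h \<otimes> wd ws)"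
 using assms
proof (induction ws arbitrary: b h rule: list.induct)
 case Nil
 then have "\<epsilon> (p h) = E h" by (intro s_eqI) (simp_all add: s_\<epsilon> s_E act_p[of "\<one>\<^bsub>A\<^esub>", simplified s_rules] ad_one)
 then show ?case using Nil by (simp add: legs_0)
next
 case (Cons k ws)
 then have k: "k \<in> carrier H" and ws: "ws \<in> LH" and b: "b \<in> carrier A" and h: "h \<in> carrier H" by simp_all
 let ?n = "length ws"
 have "legs A H (length (k # ws)) (%D. lq (k # ws) (b \<star> E (hd D)) (tl D)) h
   = sw A (%x y. legs A H ?n (%D. legs A H ?n (%L. lq ws (b \<star> E x \<star> E (hd (map2 (\<cdot>) D L)))
     (tl (map2 (\<cdot>) D L))) k) y) h"
  unfolding list.size add_Suc_right add_0_right legs.simps lq.simps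
 proof (intro sw_cong refl legs_cong)
  fix x y D L
  assume "D \<in> LH" "length D = Suc ?n" "L \<in> LH" "length L = Suc ?n"
  then show "lq ws (b \<star> E (hd (x # D)) \<star> E (hd (tl (x # D)) \<cdot> hd L))
     (map2 (\<cdot>) (tl (tl (x # D))) (tl L))
    = lq ws (b \<star> E x \<star> E (hd (map2 (\<cdot>) D L))) (tl (map2 (\<cdot>) D L))"
   by (cases D; cases L) simp_all
 qed (use h k in simp_all)
 also have "... = sw A (%x y. legs A H ?n (%M. lq ws (b \<star> E x \<star> E (hd M)) (tl M)) (y \<cdot> k)) h"
  using h k b ws by (intro sw_cong refl legs_mult[symmetric] lq_legs_mlin) simp_all
 also have "... = sw A (%x y. b \<star> E x \<star> \<epsilon> (p (y \<cdot> k) \<otimes> wd ws)) h"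
  using h k b ws by (intro sw_cong refl Cons.IH) simp_all
 also have "... = b \<star> \<epsilon> (p h \<otimes> wd (k # ws))"
  using h k b ws
  by (simp add: sw_E_\<epsilon>[symmetric] mult_sw_left A_alg A_mod lin_E lin_mult_left lin_mult_right lin_rules lin_\<epsilon> p_rules A.m_assoc)
 finally show ?case .
qed

text \<open>The j-th factor of the left counit formula with an additional prefix; prefixes equal to
  1 give back the formula.\<close>

abbreviation "lfactor cs Ls j \<equiv> E (cs ! j \<cdot> list_prod H (map (%i. Ls ! i ! (j - i)) [0..<Suc j]))"

lemma lfactor_closed:
 assumes "list_all2 (%(h, m) L. L \<in> LH \<and> length L = Suc m) (map (%i. (ws ! i, n - 1 - i)) [0..<n]) Ls" "j < n"
 shows "list_prod H (map (%i. Ls ! i ! (j - i)) [0..<Suc j]) \<in> carrier H"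
proof (rule list_prod_closed[OF H_alg], clarsimp simp del: upt_Suc)
 fix i assume i: "i < Suc j"
 then have "i < length (map (%i. (ws ! i, n - 1 - i)) [0..<n])" using assms(2) by simp
 from list_all2_nthD[OF assms(1) this] i assms(2)
 have "Ls ! i \<in> LH" "length (Ls ! i) = Suc (n - 1 - i)" by simp_all
 then show "Ls ! i ! (j - i) \<in> carrier H" using i assms(2) by (auto simp: in_lists_conv_set)
qed

text \<open>Absorbing the first letter into the prefixes shifts the indices: factor
  \<open>Suc j\<close> over \<open>L # Ls\<close> is factor \<open>j\<close> over \<open>Ls\<close>
  with new prefix \<open>cs ! Suc j\<close> times \<open>L ! Suc j\<close>. Factor 0 is complete and
  moves into \<open>b\<close>.\<close>

lemma multi_legs_lq:
 assumes "ws \<in> LH" "cs \<in> LH" "length cs = length ws" "b \<in> carrier A"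
 shows "multi_legs A H (map (%i. (ws ! i, length ws - 1 - i)) [0..<length ws])
   (%Ls. b \<star> list_prod A (map (lfactor cs Ls) [0..<length ws])) = lq ws b cs"
 using assms
proof (induction ws arbitrary: b cs rule: list.induct)
 case (Cons k ws)
 let ?n = "length ws"
 obtain c cs' where cs: "cs = c # cs'" "c \<in> carrier H" "cs' \<in> LH" "length cs' = ?n"
  using Cons.prems by (cases cs) auto
 have k: "k \<in> carrier H" and ws: "ws \<in> LH" and b: "b \<in> carrier A" using Cons.prems by simp_all
 let ?hs = "map (%i. (ws ! i, ?n - 1 - i)) [0..<?n]"
 have hs: "map (%i. ((k # ws) ! i, length (k # ws) - 1 - i)) [0..<length (k # ws)] = (k, ?n) # ?hs"
  by (simp add: map_upt_Suc del: upt_Suc)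
 have "legs A H ?n (%L. multi_legs A H ?hs (%Ls. b \<star> list_prod A (map (lfactor cs (L # Ls)) [0..<Suc ?n]))) k
   = legs A H ?n (%L. lq ws (b \<star> E (c \<cdot> hd L)) (map2 (\<cdot>) cs' (tl L))) k"
 proof (rule legs_cong[OF k])
  fix L assume "L \<in> LH" "length L = Suc ?n"
  then obtain l L' where L: "L = l # L'" "l \<in> carrier H" "L' \<in> LH" "length L' = ?n" by (cases L) auto
  let ?ds = "map2 (\<cdot>) cs' L'"
  have "multi_legs A H ?hs (%Ls. b \<star> list_prod A (map (lfactor cs (L # Ls)) [0..<Suc ?n]))
    = multi_legs A H ?hs (%Ls. b \<star> E (c \<cdot> l) \<star> list_prod A (map (lfactor ?ds Ls) [0..<?n]))"
  proof (rule multi_legs_cong)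
   fix Ls assume Ls: "list_all2 (%(h, m) L. L \<in> LH \<and> length L = Suc m) ?hs Ls"
   have f: "lfactor cs (L # Ls) (Suc j) = lfactor ?ds Ls j" if j: "j < ?n" for j
    using lfactor_closed[OF Ls j] cs L j
    by (auto simp: map_upt_Suc algebra.m_assoc in_lists_conv_set simp del: upt_Suc)
   have "map (lfactor cs (L # Ls)) [0..<Suc ?n] = E (c \<cdot> l) # map (lfactor ?ds Ls) [0..<?n]"
    using f cs L by (simp add: map_upt_Suc del: upt_Suc)
   moreover have "list_prod A (map (lfactor ?ds Ls) [0..<?n]) \<in> carrier A"
    using lfactor_closed[OF Ls] cs L
    by (intro list_prod_closed[OF A_alg]) (auto simp: in_lists_conv_set simp del: upt_Suc)
   ultimately show "b \<star> list_prod A (map (lfactor cs (L # Ls)) [0..<Suc ?n])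
     = b \<star> E (c \<cdot> l) \<star> list_prod A (map (lfactor ?ds Ls) [0..<?n])"
    using b cs L by (simp add: A.m_assoc)
  qed (use ws in "auto simp: in_lists_conv_set")
  also have "... = lq ws (b \<star> E (c \<cdot> l)) ?ds"
   using ws b cs L by (intro Cons.IH) (simp_all add: map2_LH)
  finally show "multi_legs A H ?hs (%Ls. b \<star> list_prod A (map (lfactor cs (L # Ls)) [0..<Suc ?n]))
    = lq ws (b \<star> E (c \<cdot> hd L)) (map2 (\<cdot>) cs' (tl L))"
   using L by simp
 qed
 then show ?case unfolding hs by (simp add: cs del: upt_Suc)
qed simp

lemma \<epsilon>_one: "\<epsilon> \<one> = \<one>\<^bsub>A\<^esub>"
 using \<epsilon>_s[of "\<one>\<^bsub>A\<^esub>"] by (simp add: s_rules)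

lemma left_counit_word:
 assumes ws: "ws \<in> LH"
 shows "multi_legs A H (map (%i. (ws ! i, length ws - 1 - i)) [0..<length ws])
   (%Ls. list_prod A (map (%j. E (list_prod H (map (%i. Ls ! i ! (j - i)) [0..<Suc j]))) [0..<length ws]))
  = \<epsilon> (wd ws)"
proof -
 let ?n = "length ws" and ?cs = "replicate (length ws) \<one>\<^bsub>H\<^esub>"
 let ?hs = "map (%i. (ws ! i, ?n - 1 - i)) [0..<?n]"
 have "multi_legs A H ?hs
   (%Ls. list_prod A (map (%j. E (list_prod H (map (%i. Ls ! i ! (j - i)) [0..<Suc j]))) [0..<?n]))
  = multi_legs A H ?hs (%Ls. \<one>\<^bsub>A\<^esub> \<star> list_prod A (map (lfactor ?cs Ls) [0..<?n]))"
 proof (rule multi_legs_cong)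
  fix Ls assume Ls: "list_all2 (%(h, m) L. L \<in> LH \<and> length L = Suc m) ?hs Ls"
  have eq: "map (%j. E (list_prod H (map (%i. Ls ! i ! (j - i)) [0..<Suc j]))) [0..<?n] = map (lfactor ?cs Ls) [0..<?n]"
   using lfactor_closed[OF Ls] by (simp del: upt_Suc)
  have cl: "list_prod A (map (lfactor ?cs Ls) [0..<?n]) \<in> carrier A"
   using lfactor_closed[OF Ls] by (intro list_prod_closed[OF A_alg]) (auto simp del: upt_Suc)
  show "list_prod A (map (%j. E (list_prod H (map (%i. Ls ! i ! (j - i)) [0..<Suc j]))) [0..<?n])
    = \<one>\<^bsub>A\<^esub> \<star> list_prod A (map (lfactor ?cs Ls) [0..<?n])"
   unfolding eq A.l_one[OF cl] ..
 qed (use ws in "auto simp: in_lists_conv_set")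
 also have "... = lq ws \<one>\<^bsub>A\<^esub> ?cs"
  using ws by (intro multi_legs_lq) (auto simp: in_lists_conv_set)
 also have "... = \<epsilon> (wd ws)"
 proof (cases ws)
  case Nil
  then show ?thesis by (simp add: \<epsilon>_one)
 next
  case (Cons k ws')
  have "lq ws \<one>\<^bsub>A\<^esub> ?cs = legs A H (length ws') (%L. lq ws' (\<one>\<^bsub>A\<^esub> \<star> E (hd L)) (tl L)) k"
   unfolding Cons lq.simps
  proof (rule legs_cong)
   fix L assume "L \<in> LH" "length L = Suc (length ws')"
   then show "lq ws' (\<one>\<^bsub>A\<^esub> \<star> E (hd (replicate (length (k # ws')) \<one>\<^bsub>H\<^esub>) \<cdot> hd L))
     (map2 (\<cdot>) (tl (replicate (length (k # ws')) \<one>\<^bsub>H\<^esub>)) (tl L))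
    = lq ws' (\<one>\<^bsub>A\<^esub> \<star> E (hd L)) (tl L)"
    using hd_tl_LH[of L "length ws'"] map2_one_left[of "tl L"] by simp
  qed (use ws Cons in simp)
  then show ?thesis using legs_lq[of ws' "\<one>\<^bsub>A\<^esub>" k] ws Cons by simp
 qed
 finally show ?thesis .
qed

text \<open>The recursion behind the right counit formula, stated on the left side so that it can be
  mirrored. Here \<open>cs\<close> lists the indices of the factors opened so far; a new letter
  multiplies each of them by one leg from the left and opens one more factor with its last leg, the
  appended 1 being the empty index.\<close>

fun rq :: "'h list => 'h list => 'a" where
 "rq cs [] = list_prod A (map E cs)"
| "rq cs (h # ws) = legs A H (length cs) (%L. rq (map2 (\<cdot>) L (cs @ [\<one>\<^bsub>H\<^esub>])) ws) h"

lemma list_prod_E_closed [simp]: "cs \<in> LH ==> list_prod A (map E cs) \<in> carrier A"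
 by (rule list_prod_closed[OF A_alg]) (auto simp: in_lists_conv_set)

lemma mlin_prod_E: "mlin n A (%L. list_prod A (map E L))"
proof (induction n)
 case (Suc n)
 have "mlin n A (%L. E x \<star> list_prod A (map E L))" if "x \<in> carrier H" for x
  using that by (intro mlin_comp[OF _ Suc.IH] lin_mult_left A_alg lin_id A_mod) simp
 then show ?case by (simp add: lin_mult_right A_alg lin_E lin_rules)
qed (simp add: A_mod)

lemma sw_E_\<epsilon>_s:
 assumes "k \<in> carrier H" "c \<in> carrier H" "a \<in> carrier A"
 shows "sw A (%x y. E (x \<cdot> c) \<star> \<epsilon> (p y \<otimes> s a)) k = \<epsilon> (p k \<otimes> (e c \<otimes> s a))"
proof -
 have "\<epsilon> (p k \<otimes> (e c \<otimes> s a)) = \<epsilon> (sw B (%x y. e (x \<cdot> c) \<otimes> p y \<otimes> s a) k)"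
  using assms by (simp add: B.m_assoc[symmetric] p_e_commute mult_sw_right p_rules)
 also have "... = sw A (%x y. \<epsilon> (e (x \<cdot> c) \<otimes> p y \<otimes> s a)) k"
  using assms by (intro sw_map[OF lin_\<epsilon>[OF lin_id[OF B_mod]]]) (simp_all add: p_rules)
 also have "... = sw A (%x y. E (x \<cdot> c) \<star> \<epsilon> (p y \<otimes> s a)) k"
  using assms by (simp add: \<epsilon>_s_mult[symmetric] s_E B.m_assoc)
 finally show ?thesis by simp
qed

text \<open>Acting by [k] on a product of generators distributes the legs of \<open>k\<close> over
  the generators, and one last leg is left to act on the unit. This leg accounts for the additional
  entry 1.\<close>

lemma legs_prod_E:
 assumes "cs \<in> LH" "k \<in> carrier H"
 shows "legs A H (length cs) (%L. list_prod A (map E (map2 (\<cdot>) L (cs @ [\<one>\<^bsub>H\<^esub>])))) k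
  = \<epsilon> (p k \<otimes> s (list_prod A (map E cs)))"
 using assms
proof (induction cs arbitrary: k rule: list.induct)
 case Nil
 then have "\<epsilon> (p k) = E k" by (intro s_eqI) (simp_all add: s_\<epsilon> s_E act_p[of "\<one>\<^bsub>A\<^esub>", simplified s_rules] ad_one)
 then show ?case using Nil by (simp add: legs_0 s_rules)
next
 case (Cons c cs)
 then have c: "c \<in> carrier H" and cs: "cs \<in> LH" and k: "k \<in> carrier H" by simp_all
 have m: "mlin (Suc (length cs)) A (%L. list_prod A (map E (map2 (\<cdot>) L (cs @ [\<one>\<^bsub>H\<^esub>]))))"
  using cs by (intro mlin_map2_right[OF mlin_prod_E]) simp_all
 have "legs A H (length (c # cs)) (%L. list_prod A (map E (map2 (\<cdot>) L ((c # cs) @ [\<one>\<^bsub>H\<^esub>])))) k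
   = sw A (%x y. E (x \<cdot> c) \<star> legs A H (length cs) (%L. list_prod A (map E (map2 (\<cdot>) L (cs @ [\<one>\<^bsub>H\<^esub>])))) y) k"
  using k c legs_map[OF lin_mult_left[OF A_alg _ lin_id[OF A_mod]] m] by simp
 also have "... = sw A (%x y. E (x \<cdot> c) \<star> \<epsilon> (p y \<otimes> s (list_prod A (map E cs)))) k"
  using Cons.IH[OF cs] k by simp
 finally show ?case using c cs k by (simp add: sw_E_\<epsilon>_s s_rules s_E)
qed

lemma rq_eq:
 assumes "ws \<in> LH" "cs \<in> LH"
 shows "rq cs ws = \<epsilon> (wd (rev ws) \<otimes> s (list_prod A (map E cs)))"
 using assms
proof (induction ws arbitrary: cs rule: list.induct)
 case Nil
 then show ?case by (simp add: \<epsilon>_s)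
next
 case (Cons h ws)
 then have h: "h \<in> carrier H" and ws: "ws \<in> LH" and cs: "cs \<in> LH" by simp_all
 let ?\<pi> = "%L. list_prod A (map E (map2 (\<cdot>) L (cs @ [\<one>\<^bsub>H\<^esub>])))"
 have m: "mlin (Suc (length cs)) A ?\<pi>"
  using cs by (intro mlin_map2_right[OF mlin_prod_E]) simp_all
 have f: "lin R A A (%a. \<epsilon> (wd (rev ws) \<otimes> s a))"
  using ws by (intro lin_\<epsilon> lin_mult_left B_alg lin_s lin_id A_mod) simp
 have "rq cs (h # ws) = legs A H (length cs) (%L. \<epsilon> (wd (rev ws) \<otimes> s (?\<pi> L))) h"
  unfolding rq.simps by (intro legs_cong h Cons.IH ws map2_LH) (simp_all add: cs)
 also have "... = \<epsilon> (wd (rev ws) \<otimes> s (\<epsilon> (p h \<otimes> s (list_prod A (map E cs)))))"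
  using legs_map[OF f m h] legs_prod_E[OF cs h] by simp
 also have "... = \<epsilon> (wd (rev (h # ws)) \<otimes> s (list_prod A (map E cs)))"
  using h ws cs by (simp add: \<epsilon>_mult_s wd_append B.m_assoc)
 finally show ?case .
qed

text \<open>The index of factor \<open>j\<close>: its accumulated part if the factor is already
  open, then the j-th leg of each remaining letter that has one. The i-th remaining letter has
  \<open>length cs + i + 1\<close> legs, so the first such letter is number
  \<open>j - length cs\<close>, truncated at 0.\<close>

abbreviation "rword cs n Ls j \<equiv> (if j < length cs then [cs ! j] else []) @ map (%i. Ls ! i ! j) [j - length cs..<n]"

lemma list_prod_op_closed: "set xs \<subseteq> carrier H ==> list_prod (op_hopf Z H) xs \<in> carrier H"
 by (induction xs) simp_all

lemma multi_legs_rq: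
 assumes "ws \<in> LH" "cs \<in> LH"
 shows "multi_legs A H (map (%i. (ws ! i, length cs + i)) [0..<length ws])
   (%Ls. list_prod A (map (%j. E (list_prod (op_hopf Z H) (rword cs (length ws) Ls j))) [0..<length cs + length ws]))
  = rq cs ws"
 using assms
proof (induction ws arbitrary: cs rule: list.induct)
 case Nil
 have "map (%j. E (list_prod (op_hopf Z H) (rword cs 0 [] j))) [0..<length cs] = map E cs"
  using Nil by (intro nth_equalityI) (auto simp: in_lists_conv_set)
 then show ?case by simp
next
 case (Cons h ws)
 then have h: "h \<in> carrier H" and ws: "ws \<in> LH" and cs: "cs \<in> LH" by simp_all
 let ?n = "length ws" and ?c = "length cs"
 let ?hs = "map (%i. (ws ! i, Suc ?c + i)) [0..<?n]"
 have hs: "map (%i. ((h # ws) ! i, ?c + i)) [0..<length (h # ws)] = (h, ?c) # ?hs"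
  by (simp add: map_upt_Suc del: upt_Suc)
 show ?case
  unfolding hs multi_legs.simps rq.simps
 proof (rule legs_cong[OF h])
  fix L assume L: "L \<in> LH" "length L = Suc ?c"
  let ?ds = "map2 (\<cdot>) L (cs @ [\<one>\<^bsub>H\<^esub>])"
  have ds: "?ds \<in> LH" "length ?ds = Suc ?c" using L cs map2_LH[of L "cs @ [\<one>\<^bsub>H\<^esub>]"] by simp_all
  have Lj: "L ! j \<in> carrier H" if "j < Suc ?c" for j using that L by (auto simp: in_lists_conv_set)
  have csj: "cs ! j \<in> carrier H" if "j < ?c" for j using that cs by (auto simp: in_lists_conv_set)
  have "multi_legs A H ?hs (%Ls. list_prod A (map (%j. E (list_prod (op_hopf Z H) (rword cs (length (h # ws)) (L # Ls) j)))
     [0..<?c + length (h # ws)]))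
    = multi_legs A H ?hs (%Ls. list_prod A (map (%j. E (list_prod (op_hopf Z H) (rword ?ds ?n Ls j)))
     [0..<length ?ds + ?n]))"
  proof (rule multi_legs_cong)
   fix Ls assume Ls: "list_all2 (%(h, m) L. L \<in> LH \<and> length L = Suc m) ?hs Ls"
   have lc: "list_prod (op_hopf Z H) (map (%i. Ls ! i ! j) [a..<?n]) \<in> carrier H" if "j < Suc ?c + a" for j a
   proof (rule list_prod_op_closed, clarsimp)
    fix i assume i: "a \<le> i" "i < ?n"
    then have "i < length ?hs" by simp
    from list_all2_nthD[OF Ls this] i
    have "Ls ! i \<in> LH" "length (Ls ! i) = Suc (Suc ?c + i)" by simp_all
    then show "Ls ! i ! j \<in> carrier H" using that i by (auto simp: in_lists_conv_set)
   qed
   have "list_prod (op_hopf Z H) (rword cs (Suc ?n) (L # Ls) j) = list_prod (op_hopf Z H) (rword ?ds ?n Ls j)"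
    if "j < Suc ?c + ?n" for j
   proof (cases "j < Suc ?c")
    case True
    then show ?thesis
     using ds Lj[of j] csj[of j] lc[of j 0] L(2)
     by (cases "j = ?c") (simp_all add: map_upt_Suc nth_append algebra.m_assoc del: upt_Suc)
   next
    case False
    have "map (%i. (L # Ls) ! i ! j) [j - ?c..<Suc ?n] = map (%i. Ls ! i ! j) [j - Suc ?c..<?n]"
    proof -
     have "[j - ?c..<Suc ?n] = map Suc [j - Suc ?c..<?n]" using False by (simp add: map_Suc_upt Suc_diff_Suc del: upt_Suc)
     then show ?thesis by (simp add: comp_def del: upt_Suc)
    qed
    then show ?thesis using False ds by (simp del: upt_Suc)
   qed
   then have "map (%j. E (list_prod (op_hopf Z H) (rword cs (length (h # ws)) (L # Ls) j))) [0..<?c + length (h # ws)]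
     = map (%j. E (list_prod (op_hopf Z H) (rword ?ds ?n Ls j))) [0..<length ?ds + ?n]"
    unfolding ds(2) by (auto simp del: upt_Suc length_map length_zip simp: nth_append)
   then show "list_prod A (map (%j. E (list_prod (op_hopf Z H) (rword cs (length (h # ws)) (L # Ls) j))) [0..<?c + length (h # ws)])
     = list_prod A (map (%j. E (list_prod (op_hopf Z H) (rword ?ds ?n Ls j))) [0..<length ?ds + ?n])"
    by (rule arg_cong)
  qed (use ws in "auto simp: in_lists_conv_set")
  also have "... = rq ?ds ws"
   using Cons.IH[OF ws ds(1)] unfolding ds(2) .
  finally show "multi_legs A H ?hs (%Ls. list_prod A (map (%j. E (list_prod (op_hopf Z H) (rword cs (length (h # ws)) (L # Ls) j)))
     [0..<?c + length (h # ws)])) = rq ?ds ws" .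
 qed
qed

text \<open>No factor is open at the start, so \<open>multi_legs_rq\<close> and \<open>rq_eq\<close>
  apply with empty \<open>cs\<close>. The indices are multiplied in \<open>op_hopf Z H\<close> and
  the word is reversed so that, after mirroring, both become the products of the right counit
  formula in \<open>H\<close> and \<open>B\<close>.\<close>

lemma right_counit_word:
 assumes ws: "ws \<in> LH"
 shows "multi_legs A H (map (%i. (ws ! i, i)) [0..<length ws])
   (%Ls. list_prod A (map (%j. E (list_prod (op_hopf Z H) (map (%i. Ls ! i ! j) [j..<length ws]))) [0..<length ws]))
  = \<epsilon> (wd (rev ws))"
 using multi_legs_rq[OF ws, of "[]"] rq_eq[OF ws, of "[]"] ws by (simp add: s_rules)

end

section \<open>The Hopf algebroid of a generating partial representation\<close>

lemma legs_op_hopf [simp]: "legs G (op_hopf Z H) n = legs G H n"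
proof (induction n)
 case (Suc n)
 then show ?case by (intro ext) simp
qed (simp add: legs_0)

lemma multi_legs_op_hopf [simp]: "multi_legs G (op_hopf Z H) hs = multi_legs G H hs"
 by (induction hs) (auto simp: fun_eq_iff)

section \<open>Mirror symmetry and the mixed axioms\<close>

context par_oid begin

declare sw_cong [cong]

lemma \<sigma>_\<sigma>':
 assumes "x \<in> carrier B"
 shows "\<sigma> (\<sigma>' x) = x"
proof (rule linear_eqI[OF _ _ assms, of _ B])
 have "lin R B B (%x. \<sigma> (\<sigma>' x))" by (intro lin_\<sigma> lin_\<sigma>' lin_id B_mod)
 then show "(%x. \<sigma> (\<sigma>' x)) \<in> linear_maps R B B" by (simp add: lin_def)
 show "(%x. x) \<in> linear_maps R B B" using lin_id[OF B_mod] by (simp add: lin_def)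
 fix ws assume "ws \<in> LH"
 then show "\<sigma> (\<sigma>' (wd ws)) = wd ws"
  by (induction ws rule: list.induct) (simp_all add: \<sigma>_rules \<sigma>'_rules \<sigma>_p \<sigma>'_p)
qed

text \<open>Because taking opposites twice returns the original data, exchanging the two halves of
  the locale gives another instance of it, and every left-hand result becomes available on the
  right.\<close>

lemma mirror: "par_oid R (op_hopf Z H) (antipode H) (op_alg B) p A' t' s' E' \<Delta>' A t s E \<Delta> \<sigma>' \<sigma>"
proof (intro par_oid.intro o.par_comult_axioms par_oid_axioms.intro)
 show "par_comult R (op_hopf (antipode H) (op_hopf Z H)) (antipode (op_hopf Z H)) (op_alg (op_alg B)) p A s t E \<Delta>"
  using par_comult_axioms by simp
qed (use \<sigma>_hom \<sigma>'_hom in "simp_all add: alg_hom_op_alg \<sigma>_p \<sigma>'_p s_inj t'_inj alg_hom_op_alg'")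

definition \<epsilon>' :: "'b => 'c"
 where "\<epsilon>' = par_oid.\<epsilon> (op_alg B) A' t' \<Delta> \<sigma>'"

abbreviation TB' where "TB' \<equiv> right_tensor B A' s' t'"

lemma o_TB: "o.TB = op_alg TB'"
 by (rule left_tensor_op_alg)

lemma TB'_def: "TB' = tensor B B (carrier A') (%h b. h \<otimes> s' b) (%b h. h \<otimes> t' b)"
 by (simp add: right_tensor_def tensor_square_def)

lemma TB_tensor: "TB = tensor B B (carrier A) (%h a. t a \<otimes> h) (%a h. s a \<otimes> h)"
 by (rule TB_def)

lemma TB'_module: "tensor_module R B B (carrier A') (%h b. h \<otimes> s' b) (%b h. h \<otimes> t' b)"
 by unfold_locales (simp_all add: B.smult_mult_left)

lemma \<Delta>'_linear: "\<Delta>' \<in> linear_maps R B TB'"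
 using o.\<Delta>_linear by (simp add: o_TB)

lemma \<Delta>'_word: "ws \<in> LH ==> \<Delta>' (wd ws) = wsw TB' H ws (%u v. wd u \<boxtimes>\<^bsub>TB'\<^esub> wd v)"
 using \<Delta>'_wd[of ws] by (simp add: o_TB)

text \<open>The hypotheses of \<open>mixed_coassoc\<close> ask that each comultiplication be
  compatible with an action of the other base. This holds because every s'(b) is a target of
  \<open>A\<close> and every s(a) has the form t'(b).\<close>

lemma coassoc_lr_generic:
 assumes "x \<in> carrier B"
 defines "TR \<equiv> tensor B TB' (carrier A) (%h a. t a \<otimes> h) (%a Y. tmap TB' (%y. s a \<otimes> y) (%z. z) Y)"
  and "TL \<equiv> tensor TB B (carrier A') (%V b. tmap TB (%x. x) (%y. y \<otimes> s' b) V) (%b z. z \<otimes> t' b)"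
 shows "tassoc TR TB' (tmap TL \<Delta> (%z. z) (\<Delta>' x)) = tmap TR (%x. x) \<Delta>' (\<Delta> x)"
proof (rule mixed_coassoc[OF _ tensor_module_axioms TB'_module TB_tensor TB'_def])
 show "tensor_assoc B B B (carrier A) (%h a. t a \<otimes> h) (%a h. s a \<otimes> h)
   (carrier A') (%h b. h \<otimes> s' b) (%b h. h \<otimes> t' b)"
  using TB'_module
  by (intro tensor_assoc.intro tensor_product_axioms tensor_assoc_axioms.intro)
   (simp_all add: tensor_module_def mult_left_add_maps mult_right_add_maps B.m_assoc)
 show "\<exists>a\<in>carrier A. \<forall>x\<in>carrier B. t a \<otimes> x = r \<odot> x \<and> s a \<otimes> x = r \<odot> x" if "r \<in> carrier R" for r
  using smult_via_base[OF that] by blast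
 show "\<exists>a\<in>carrier A'. \<forall>x\<in>carrier B. x \<otimes> s' a = r \<odot> x \<and> x \<otimes> t' a = r \<odot> x" if "r \<in> carrier R" for r
  using o.smult_via_base[OF that] by auto
 show "\<Delta> (x \<otimes> s' b) = tmap TB (%x. x) (%y. y \<otimes> s' b) (\<Delta> x)" if "x \<in> carrier B" "b \<in> carrier A'" for x b
  using s'_t[OF that(2)] \<Delta>_actions(4) that(1) by auto
 show "\<Delta>' (s a \<otimes> x) = tmap TB' (%y. s a \<otimes> y) (%z. z) (\<Delta>' x)" if x: "x \<in> carrier B" and a: "a \<in> carrier A" for x a
 proof -
  obtain b where "b \<in> carrier A'" "s a = t' b" using par_oid.t'_s[OF mirror a] by auto
  then show ?thesis using o.\<Delta>_actions(3)[of b x] x by (simp add: o_TB)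
 qed
qed (simp_all add: \<Delta>_linear \<Delta>'_linear \<Delta>_wd \<Delta>'_word TL_def TR_def assms(1))

lemma coassoc_rl_generic:
 assumes "x \<in> carrier B"
 defines "TR \<equiv> tensor B TB (carrier A') (%h b. h \<otimes> s' b) (%b Y. tmap TB (%y. y \<otimes> t' b) (%z. z) Y)"
  and "TL \<equiv> tensor TB' B (carrier A) (%V a. tmap TB' (%x. x) (%y. t a \<otimes> y) V) (%a z. s a \<otimes> z)"
 shows "tassoc TR TB (tmap TL \<Delta>' (%z. z) (\<Delta> x)) = tmap TR (%x. x) \<Delta> (\<Delta>' x)"
proof (rule mixed_coassoc[OF _ TB'_module tensor_module_axioms TB'_def TB_tensor])
 show "tensor_assoc B B B (carrier A') (%h b. h \<otimes> s' b) (%b h. h \<otimes> t' b)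
   (carrier A) (%h a. t a \<otimes> h) (%a h. s a \<otimes> h)"
  using TB'_module
  by (intro tensor_assoc.intro tensor_product_axioms tensor_assoc_axioms.intro)
   (simp_all add: tensor_module_def mult_left_add_maps mult_right_add_maps B.m_assoc)
 show "\<exists>a\<in>carrier A. \<forall>x\<in>carrier B. t a \<otimes> x = r \<odot> x \<and> s a \<otimes> x = r \<odot> x" if "r \<in> carrier R" for r
  using smult_via_base[OF that] by blast
 show "\<exists>a\<in>carrier A'. \<forall>x\<in>carrier B. x \<otimes> s' a = r \<odot> x \<and> x \<otimes> t' a = r \<odot> x" if "r \<in> carrier R" for r
  using o.smult_via_base[OF that] by auto
 show "\<Delta>' (t a \<otimes> x) = tmap TB' (%x. x) (%y. t a \<otimes> y) (\<Delta>' x)" if x: "x \<in> carrier B" and a: "a \<in> carrier A" for x a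
 proof -
  obtain b where "b \<in> carrier A'" "t a = s' b" using par_oid.s'_t[OF mirror a] by auto
  then show ?thesis using o.\<Delta>_actions(4)[of b x] x by (simp add: o_TB)
 qed
 show "\<Delta> (x \<otimes> t' b) = tmap TB (%y. y \<otimes> t' b) (%z. z) (\<Delta> x)" if "x \<in> carrier B" "b \<in> carrier A'" for x b
  using t'_s[OF that(2)] \<Delta>_actions(3) that(1) by auto
qed (simp_all add: \<Delta>_linear \<Delta>'_linear \<Delta>_wd \<Delta>'_word TL_def TR_def assms(1))

lemma right_bialgebroid: "right_bialgebroid R B A' s' t' \<Delta>' \<epsilon>'"
 unfolding \<epsilon>'_def by (rule right_bialgebroid_op[OF B_alg par_oid.left_bialgebroid[OF mirror]])

lemma \<epsilon>'_closed: "x \<in> carrier B ==> \<epsilon>' x \<in> carrier A'"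
 using par_oid.\<epsilon>_closed[OF mirror] by (simp add: \<epsilon>'_def)

lemma t'_\<epsilon>'_s: "a \<in> carrier A ==> t' (\<epsilon>' (s a)) = s a"
 using par_oid.s_\<epsilon>_t'[OF mirror] by (simp add: \<epsilon>'_def)

lemma s'_\<epsilon>'_t: "a \<in> carrier A ==> s' (\<epsilon>' (t a)) = t a"
 using par_oid.t_\<epsilon>_s'[OF mirror] by (simp add: \<epsilon>'_def)

text \<open>Mirroring \<open>antipode_right_\<epsilon>\<close> gives the identity with
  \<open>\<sigma>'\<close> and reversed product, whose value is a target of the right base; applying
  \<open>\<sigma>\<close> undoes \<open>\<sigma>'\<close> and turns this target into a
  source.\<close>

lemma antipode_left_\<epsilon>':
 assumes x: "x \<in> carrier B"
 shows "tlift B (%u v. \<sigma> u \<otimes> v) (\<Delta> x) = s' (\<epsilon>' x)"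
proof -
 have bal: "balanced B (%u v. \<sigma>' v \<otimes> u)"
  by (intro balancedI B.abelian_group_axioms biadditiveI add_mapsI)
   (simp_all add: \<sigma>'_rules \<sigma>'_s B.l_distr B.r_distr B.m_assoc)
 have \<Delta>x: "\<Delta> x \<in> carrier (tensor B B (carrier A) (%h a. t a \<otimes> h) (%a h. s a \<otimes> h))"
  using x by (simp add: TB_def[symmetric])
 have \<sigma>: "\<sigma> \<in> add_maps B B"
  using alg_hom_linear[OF \<sigma>_hom] by (simp add: linear_maps_add_maps)
 have "tlift B (%u v. \<sigma>' v \<otimes> u) (\<Delta> x) = t' (\<epsilon>' x)"
  using par_oid.antipode_right_\<epsilon>[OF mirror, of x] x by (simp add: \<epsilon>'_def)
 then have "s' (\<epsilon>' x) = \<sigma> (tlift B (%u v. \<sigma>' v \<otimes> u) (\<Delta> x))"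
  using x by (simp add: \<sigma>_t' \<epsilon>'_closed)
 also have "... = tlift B (%u v. \<sigma> (\<sigma>' v \<otimes> u)) (\<Delta> x)"
  by (rule tlift_comp[OF bal B.abelian_group_axioms \<sigma> \<Delta>x])
 also have "... = tlift B (%u v. \<sigma> u \<otimes> v) (\<Delta> x)"
  by (rule tlift_cong[OF \<Delta>x]) (simp add: \<sigma>_rules \<sigma>_\<sigma>')
 finally show ?thesis by simp
qed

lemma right_counit_formula:
 assumes "ws \<in> LH"
 shows "multi_legs A' H (map (%i. (ws ! i, i)) [0..<length ws])
   (%Ls. list_prod A' (map (%j. E' (list_prod H (map (%i. Ls ! i ! j) [j..<length ws]))) [0..<length ws]))
  = \<epsilon>' (wd ws)"
 using par_oid.right_counit_word[OF mirror, of ws] assms o_wd[of "rev ws"] by (simp add: \<epsilon>'_def)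

definition D :: "('k, 'b, 'a, 'c) hopf_algebroid"
 where "D = \<lparr>total = B, lbase = A, rbase = A', lsource = s, ltarget = t, lcomult = \<Delta>, lcounit = \<epsilon>,
  rsource = s', rtarget = t', rcomult = \<Delta>', rcounit = \<epsilon>', antip = \<sigma>\<rparr>"

text \<open>The source of \<open>A\<close> and the target of \<open>A'\<close> have the same image
  in \<open>B\<close>. The isomorphism is \<open>s\<close> followed by the inverse of
  \<open>t'\<close>, and it reverses products because \<open>t'\<close> does.\<close>

lemma bases_anti_iso:
 "\<exists>\<theta>\<in>alg_hom R A (op_alg A'). bij_betw \<theta> (carrier A) (carrier A')"
proof -
 define \<theta> where "\<theta> = (%a. inv_into (carrier A') t' (s a))"
 have im: "s a \<in> t' ` carrier A'" if "a \<in> carrier A" for a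
  using par_oid.t'_s[OF mirror that] by auto
 have cl: "\<theta> a \<in> carrier A'" and t': "t' (\<theta> a) = s a" if "a \<in> carrier A" for a
  using im[OF that] by (simp_all add: \<theta>_def inv_into_into f_inv_into_f)
 have eqI: "x = y" if "t' x = t' y" "x \<in> carrier A'" "y \<in> carrier A'" for x y
  using that t'_inj by (simp add: inj_on_def)
 have "\<theta> \<in> alg_hom R A (op_alg A')"
  by (intro alg_homI linear_mapsI; (rule eqI)?) (simp_all add: cl t' t'_rules s_rules o.A.one_closed[simplified])
 moreover have "bij_betw \<theta> (carrier A) (carrier A')"
 proof (rule bij_betwI')
  show "(\<theta> x = \<theta> y) = (x = y)" if "x \<in> carrier A" "y \<in> carrier A" for x y
   using t' that s_eqI by metis
  show "\<theta> x \<in> carrier A'" if "x \<in> carrier A" for x by (rule cl[OF that])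
  show "\<exists>x\<in>carrier A. y = \<theta> x" if y: "y \<in> carrier A'" for y
  proof -
   obtain a where "a \<in> carrier A" "t' y = s a" using t'_s[OF y] by blast
   then show ?thesis using eqI[of y "\<theta> a"] y cl t' by auto
  qed
 qed
 ultimately show ?thesis by blast
qed

theorem hopf_algebroid_D: "hopf_algebroid R D"
 unfolding D_def
 by (intro hopf_algebroid.intro hopf_algebroid_axioms.intro; unfold hopf_algebroid.simps)
  (simp_all add: left_bialgebroid right_bialgebroid bases_anti_iso \<sigma>_hom s_\<epsilon>_t' t_\<epsilon>_s' t'_\<epsilon>'_s s'_\<epsilon>'_t
   tensor_lr_left_def tensor_lr_right_def tensor_rl_left_def tensor_rl_right_def
   coassoc_lr_generic coassoc_rl_generic \<sigma>_targets antipode_left_\<epsilon>' antipode_right_\<epsilon>)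

end

section \<open>The Hopf algebroid structure of the partial Hopf algebra\<close>

lemma alg_hom_restrict:
 assumes "k_algebra R M" "f \<in> alg_hom R M N"
 shows "restrict f (carrier M) \<in> alg_hom R M N"
proof -
 interpret M: k_algebra R M by fact
 show ?thesis
  by (intro alg_homI linear_mapsI)
   (use alg_hom_closed[OF assms(2)] alg_hom_add[OF assms(2)] alg_hom_mult[OF assms(2)] alg_hom_one[OF assms(2)]
    alg_hom_smult[OF assms(2)] in simp_all)
qed

lemma list_prod_op_alg:
 assumes "k_algebra R B" "set xs \<subseteq> carrier B"
 shows "list_prod (op_alg B) xs = list_prod B (rev xs)"
proof -
 interpret B: k_algebra R B by fact
 show ?thesis using assms(2)
  by (induction xs) (simp_all add: list_prod_append[OF assms(1)])
qed

context k_algebra begin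

lemma subalg_generated:
 assumes "V \<subseteq> carrier M"
 shows "subalg R M (subalg_generated R M V)" "V \<subseteq> subalg_generated R M V"
  "subalg_generated R M V \<subseteq> carrier M"
proof -
 have c: "subalg R M (carrier M)"
  by (simp add: subalg_def carrier_is_subring)
 note sub = subringE
 show g: "V \<subseteq> subalg_generated R M V" "subalg_generated R M V \<subseteq> carrier M"
  using c assms by (auto simp: subalg_generated_def)
 have "subring (subalg_generated R M V) M"
 proof (rule subringI)
  show "subalg_generated R M V \<subseteq> carrier M" by (rule g)
 qed (auto simp: subalg_generated_def subalg_def intro: subringE)
 then show "subalg R M (subalg_generated R M V)"
  by (auto simp: subalg_def subalg_generated_def)
qed

lemma subalg_algebra:
 assumes "subalg R M C"
 shows "k_algebra R (M\<lparr>carrier := C\<rparr>)"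
proof -
 have C: "C \<subseteq> carrier M" "!!r x. r \<in> carrier R ==> x \<in> C ==> r \<odot>\<^bsub>M\<^esub> x \<in> C" and r: "subring C M"
  using assms subringE(1) by (auto simp: subalg_def)
 interpret C: ring "M\<lparr>carrier := C\<rparr>" by (rule subring_is_ring[OF r])
 have "module R (M\<lparr>carrier := C\<rparr>)"
  by (intro moduleI R.is_cring C.abelian_group_axioms)
   (use C in "simp_all add: subset_iff smult_l_distr smult_r_distr smult_assoc1")
 then show ?thesis
  by (intro k_algebra.intro C.ring_axioms k_algebra_axioms.intro)
   (use C in "simp_all add: subset_iff smult_mult_left smult_mult_right")
qed

text \<open>The generated elements with property \<open>P\<close> form a subalgebra containing the
  generators; closure under negation comes from the scalar -1.\<close>

lemma subalg_generated_induct [consumes 2]: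
 assumes "V \<subseteq> carrier M" "x \<in> subalg_generated R M V"
  and gen: "!!v. v \<in> V ==> P v" and one: "P \<one>\<^bsub>M\<^esub>"
  and add: "!!x y. [|x \<in> subalg_generated R M V; y \<in> subalg_generated R M V; P x; P y|] ==> P (x \<oplus>\<^bsub>M\<^esub> y)"
  and mult: "!!x y. [|x \<in> subalg_generated R M V; y \<in> subalg_generated R M V; P x; P y|] ==> P (x \<otimes>\<^bsub>M\<^esub> y)"
  and smult: "!!r x. [|r \<in> carrier R; x \<in> subalg_generated R M V; P x|] ==> P (r \<odot>\<^bsub>M\<^esub> x)"
 shows "P x"
proof -
 let ?G = "subalg_generated R M V" and ?C = "{x \<in> subalg_generated R M V. P x}"
 note G = subalg_generated[OF assms(1)]
 have r: "subring ?G M" and sm: "!!r x. r \<in> carrier R ==> x \<in> ?G ==> r \<odot>\<^bsub>M\<^esub> x \<in> ?G"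
  using G(1) by (auto simp: subalg_def)
 have neg: "\<ominus>\<^bsub>M\<^esub> x \<in> ?C" if "x \<in> ?C" for x
 proof -
  have "\<ominus>\<^bsub>M\<^esub> x = (\<ominus>\<^bsub>R\<^esub> \<one>\<^bsub>R\<^esub>) \<odot>\<^bsub>M\<^esub> x" using that G(3) by (auto simp: smult_l_minus)
  then show ?thesis using that smult[of "\<ominus>\<^bsub>R\<^esub> \<one>\<^bsub>R\<^esub>" x] sm[of "\<ominus>\<^bsub>R\<^esub> \<one>\<^bsub>R\<^esub>" x] by simp
 qed
 have "subring ?C M"
 proof (rule subringI)
  show "?C \<subseteq> carrier M" using G(3) by blast
  show "\<one>\<^bsub>M\<^esub> \<in> ?C" using one subringE(3)[OF r] by simp
  show "h1 \<otimes>\<^bsub>M\<^esub> h2 \<in> ?C" "h1 \<oplus>\<^bsub>M\<^esub> h2 \<in> ?C" if "h1 \<in> ?C" "h2 \<in> ?C" for h1 h2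
   using that mult add subringE(6,7)[OF r] by simp_all
 qed (rule neg)
 then have "subalg R M ?C" using sm smult by (simp add: subalg_def)
 moreover have "V \<subseteq> ?C" using G(2) gen by blast
 ultimately have "?G \<subseteq> ?C" by (auto simp: subalg_generated_def)
 then show ?thesis using assms(2) by blast
qed

end

lemma alg_hom_subset:
 assumes "f \<in> alg_hom R M N" "C \<subseteq> carrier M"
 shows "f \<in> alg_hom R (M\<lparr>carrier := C\<rparr>) N"
proof (intro alg_homI linear_mapsI)
 fix x assume "x \<in> carrier (M\<lparr>carrier := C\<rparr>)"
 then show "f x \<in> carrier N" using assms(2) by (auto intro: alg_hom_closed[OF assms(1)])
qed (use assms(2) alg_hom_add[OF assms(1)] alg_hom_mult[OF assms(1)] alg_hom_one[OF assms(1)]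
  alg_hom_smult[OF assms(1)] in "simp_all add: subset_iff")

lemma alg_hom_id: "C \<subseteq> carrier M ==> (%a. a) \<in> alg_hom R (M\<lparr>carrier := C\<rparr>) M"
 by (auto simp: alg_hom_def ring_hom_def linear_maps_def)

section \<open>Antipode maps and base algebras of the partial Hopf algebra\<close>

context partial_rep begin

text \<open>Reversing the products in \<open>H\<close> and in \<open>B\<close> together with the two
  legs exchanges \<open>PR2\<close> with \<open>PR5\<close> and \<open>PR3\<close> with
  \<open>PR4\<close>. The maps S and \<open>Z\<close> both qualify as \<open>F\<close>.\<close>

lemma partial_rep_anti:
 assumes F: "!!h. h \<in> carrier H ==> F h \<in> carrier H" "!!f. linH H f ==> linH H (%x. F (f x))"
   "F \<one>\<^bsub>H\<^esub> = \<one>\<^bsub>H\<^esub>" "!!h k. h \<in> carrier H ==> k \<in> carrier H ==> F (h \<cdot> k) = F k \<cdot> F h"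
   "!!h. h \<in> carrier H ==> S (F h) = F (S h)"
  and sw_F: "!!b h. bilinH B b ==> h \<in> carrier H ==> sw B b (F h) = sw B (%x y. b (F y) (F x)) h"
 shows "partial_rep R H Z (op_alg B) (%h. p (F h))"
proof -
 note r = F sw_F p_rules B.m_assoc
 have "linH B (%h. p (F h))" by (simp add: r)
 then have "(%h. p (F h)) \<in> linear_maps R H (op_alg B)" by (simp add: lin_def)
 then show ?thesis
 proof (intro partial_rep.intro partial_rep_axioms.intro hopf_inv_axioms k_algebra_op_alg[OF B_alg]; simp?)
  show "p (F \<one>\<^bsub>H\<^esub>) = \<one>" by (simp add: F p_one)
  fix h k assume *: "h \<in> carrier H" "k \<in> carrier H"
  show "sw B (%x y. p (F (S y)) \<otimes> (p (F x) \<otimes> p (F h))) k = sw B (%x y. p (F (S y)) \<otimes> p (F (h \<cdot> x))) k"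
   using PR5[of "F k" "F h"] * by (simp add: r)
  show "sw B (%x y. p (F k) \<otimes> (p (F (S y)) \<otimes> p (F x))) h = sw B (%x y. p (F (S y \<cdot> k)) \<otimes> p (F x)) h"
   using PR4[of "F k" "F h"] * by (simp add: r)
  show "sw B (%x y. p (F y) \<otimes> (p (F (S x)) \<otimes> p (F h))) k = sw B (%x y. p (F y) \<otimes> p (F (h \<cdot> S x))) k"
   using PR3[of "F k" "F h"] * by (simp add: r)
  show "sw B (%x y. p (F k) \<otimes> (p (F y) \<otimes> p (F (S x)))) h = sw B (%x y. p (F (y \<cdot> k)) \<otimes> p (F (S x))) h"
   using PR2[of "F k" "F h"] * by (simp add: r)
 qed
qed

lemma partial_rep_antipodes:
 "partial_rep R H Z (op_alg B) (%h. p (S h))" "partial_rep R H Z (op_alg B) (%h. p (Z h))"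
 by (rule partial_rep_anti; simp add: antipode_mult Z_mult sw_antipode sw_Z lin_antipode lin_Z)+

end

context hopf_inv begin

interpretation P: k_algebra R PH by (rule P_alg)

interpretation pr: partial_rep R H Z PH \<pi> by (rule par_gen_partial_rep)

lemma extends_words_unique:
 assumes "extends_words R H G be f" "extends_words R H G be g"
 shows "f = g"
proof (rule extensionalityI[of _ "carrier PH"])
 fix x assume "x \<in> carrier PH"
 then show "f x = g x"
  using assms unfolding extends_words_def by (intro par_linear_eq[of f G g x]) (blast | simp)+
qed (use assms in "simp_all add: extends_words_def")

text \<open>Replaces a map defined by description with one already constructed: words span, so a
  linear map with the prescribed values on words is, after restriction, the described one.\<close>

lemma par_extend_eq:
 assumes "f \<in> linear_maps R PH G" "!!ws. ws \<in> LH ==> f (par_word R H ws) = be ws"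
 shows "\<exists>!f. extends_words R H G be f" "par_extend R H G be = restrict f (carrier PH)"
proof -
 have "restrict f (carrier PH) \<in> linear_maps R PH G"
  by (rule linear_mapsI)
   (simp_all add: linear_maps_closed[OF assms(1)] linear_maps_add[OF assms(1)] linear_maps_smult[OF assms(1)])
 then have e: "extends_words R H G be (restrict f (carrier PH))"
  using assms(2) by (simp add: extends_words_def)
 then show "\<exists>!f. extends_words R H G be f" by (blast intro: extends_words_unique)
 show "par_extend R H G be = restrict f (carrier PH)"
  unfolding par_extend_def by (rule the_equality[of "extends_words R H G be", OF e]) (rule extends_words_unique[OF _ e])
qed

lemma par_word_wd: "par_word R H ws = pr.wd ws"
 by (simp add: par_word_def pr.wd_def)

lemma par_eps_e: "par_eps R H = pr.e" and par_eps_e': "par_eps' R H = pr.e'"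
 by (simp_all add: fun_eq_iff par_eps_def par_eps'_def pr.e_def pr.e'_def)

lemma anti_extension:
 assumes "partial_rep R H Z (op_alg PH) (%h. \<pi> (F h))" "F \<in> carrier H \<rightarrow> carrier H"
 shows "\<exists>!f. extends_words R H PH (%ws. par_word R H (rev (map F ws))) f"
  and "par_extend R H PH (%ws. par_word R H (rev (map F ws))) \<in> alg_hom R PH (op_alg PH)"
  and "h \<in> carrier H ==> par_extend R H PH (%ws. par_word R H (rev (map F ws))) (\<pi> h) = \<pi> (F h)"
proof -
 have F: "F h \<in> carrier H" if "h \<in> carrier H" for h using assms(2) that by auto
 obtain f where f: "f \<in> alg_hom R PH (op_alg PH)" "!!h. h \<in> carrier H ==> f (\<pi> h) = \<pi> (F h)"
  using par_universal[OF assms(1)] by blast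
 have fw: "f (par_word R H ws) = par_word R H (rev (map F ws))" if "ws \<in> LH" for ws
  using that
 proof (induction ws rule: list.induct)
  case (Cons h ws)
  then have "rev (map F ws) \<in> LH" using F by auto
  then show ?case using Cons F alg_hom_mult[OF f(1)] by (simp add: f(2) par_word_append)
 qed (use alg_hom_one[OF f(1)] in simp)
 have fl: "f \<in> linear_maps R PH PH" using alg_hom_linear[OF f(1)] by simp
 note e = par_extend_eq[OF fl fw]
 show "\<exists>!f. extends_words R H PH (%ws. par_word R H (rev (map F ws))) f" by (rule e(1))
 show "par_extend R H PH (%ws. par_word R H (rev (map F ws))) \<in> alg_hom R PH (op_alg PH)"
  using alg_hom_restrict[OF P_alg f(1)] by (simp only: e(2))
 show "h \<in> carrier H ==> par_extend R H PH (%ws. par_word R H (rev (map F ws))) (\<pi> h) = \<pi> (F h)"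
  by (simp add: e(2) f(2))
qed

abbreviation "anti \<equiv> par_extend R H PH (par_antip_word R H)"
abbreviation "anti' \<equiv> par_extend R H PH (%ws. par_word R H (rev (map Z ws)))"

lemma antip_word_eq: "par_antip_word R H = (%ws. par_word R H (rev (map S ws)))"
 by (simp add: fun_eq_iff par_antip_word_def)

lemma antipode_funcset: "S \<in> carrier H \<rightarrow> carrier H" "Z \<in> carrier H \<rightarrow> carrier H"
 by auto

lemmas antip_ext = anti_extension[OF pr.partial_rep_antipodes(1) antipode_funcset(1), folded antip_word_eq]
lemmas antip'_ext = anti_extension[OF pr.partial_rep_antipodes(2) antipode_funcset(2)]

lemma par_eps_closed: "par_eps R H ` carrier H \<subseteq> carrier PH" and par_eps'_closed: "par_eps' R H ` carrier H \<subseteq> carrier PH"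
 by (auto simp: par_eps_e par_eps_e')

abbreviation "AL \<equiv> par_lbase R H"
abbreviation "AR \<equiv> par_rbase R H"

lemma bases_algebra: "k_algebra R AL" "k_algebra R AR"
 unfolding par_lbase_def par_rbase_def
 by (intro P.subalg_algebra P.subalg_generated(1) par_eps_closed par_eps'_closed)+

lemma bases_subset: "carrier AL \<subseteq> carrier PH" "carrier AR \<subseteq> carrier PH"
 using P.subalg_generated(3) par_eps_closed par_eps'_closed by (simp_all add: par_lbase_def par_rbase_def)

lemma base_ops:
 "x \<otimes>\<^bsub>AL\<^esub> y = x \<otimes>\<^bsub>PH\<^esub> y" "x \<oplus>\<^bsub>AL\<^esub> y = x \<oplus>\<^bsub>PH\<^esub> y" "\<one>\<^bsub>AL\<^esub> = \<one>\<^bsub>PH\<^esub>" "r \<odot>\<^bsub>AL\<^esub> x = r \<odot>\<^bsub>PH\<^esub> x"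
 "x \<otimes>\<^bsub>AR\<^esub> y = x \<otimes>\<^bsub>PH\<^esub> y" "x \<oplus>\<^bsub>AR\<^esub> y = x \<oplus>\<^bsub>PH\<^esub> y" "\<one>\<^bsub>AR\<^esub> = \<one>\<^bsub>PH\<^esub>" "r \<odot>\<^bsub>AR\<^esub> x = r \<odot>\<^bsub>PH\<^esub> x"
 by (simp_all add: par_lbase_def par_rbase_def)

lemma par_eps_base: "h \<in> carrier H ==> par_eps R H h \<in> carrier AL"
 and par_eps'_base: "h \<in> carrier H ==> par_eps' R H h \<in> carrier AR"
 using P.subalg_generated(2)[OF par_eps_closed] P.subalg_generated(2)[OF par_eps'_closed]
 by (auto simp: par_lbase_def par_rbase_def)

lemma par_eps_linear: "par_eps R H \<in> linear_maps R H AL" "par_eps' R H \<in> linear_maps R H AR"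
proof -
 have l: "linH PH (par_eps R H)" "linH PH (par_eps' R H)"
  using pr.lin_e[OF lin_id[OF H_mod]] pr.lin_e'[OF lin_id[OF H_mod]] by (simp_all add: par_eps_e par_eps_e')
 show "par_eps R H \<in> linear_maps R H AL" "par_eps' R H \<in> linear_maps R H AR"
  by (intro linear_mapsI; simp add: par_eps_base par_eps'_base lin_add[OF l(1)] lin_add[OF l(2)]
    lin_scale[OF l(1)] lin_scale[OF l(2)] base_ops)+
qed

lemmas antip'_rules = alg_hom_add[OF antip'_ext(2), simplified] alg_hom_mult[OF antip'_ext(2), simplified]
 alg_hom_one[OF antip'_ext(2), simplified] alg_hom_smult[OF antip'_ext(2), simplified]

lemma antip'_eps:
 assumes "h \<in> carrier H"
 shows "anti' (par_eps R H h) = pr.e' (Z h)" "anti' (par_eps' R H h) = pr.e (Z h)"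
proof -
 have l: "lin R PH PH anti'" using alg_hom_linear[OF antip'_ext(2)] by (simp add: lin_def P.module_axioms)
 show "anti' (par_eps R H h) = pr.e' (Z h)" "anti' (par_eps' R H h) = pr.e (Z h)"
  using assms sw_map[OF l, of "%x y. \<pi> x \<otimes>\<^bsub>PH\<^esub> \<pi> (S y)"] sw_map[OF l, of "%x y. \<pi> (S x) \<otimes>\<^bsub>PH\<^esub> \<pi> y"]
  by (simp_all add: par_eps_e par_eps_e' pr.e_def pr.e'_def pr.p_rules antip'_rules antip'_ext(3) sw_Z)
qed

lemma par_base_left: "par_base R H Z PH \<pi> AL (%a. a) anti' (par_eps R H)"
proof (intro par_base.intro par_gen_partial_rep bases_algebra par_base_axioms.intro)
 show "(%a. a) \<in> alg_hom R AL PH" "anti' \<in> alg_hom R AL (op_alg PH)"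
  using alg_hom_id alg_hom_subset[OF antip'_ext(2)] bases_subset(1) by (simp_all add: par_lbase_def)
 show "par_eps R H \<in> linear_maps R H AL" by (rule par_eps_linear)
 show "par_eps R H h = pr.e h" "anti' (par_eps R H h) = pr.e' (Z h)" if "h \<in> carrier H" for h
  using that antip'_eps by (simp_all add: par_eps_e)
 show "P a"
  if "a \<in> carrier AL" "!!h. h \<in> carrier H ==> P (par_eps R H h)" "P \<one>\<^bsub>AL\<^esub>"
   "!!x y. [|x \<in> carrier AL; y \<in> carrier AL; P x; P y|] ==> P (x \<oplus>\<^bsub>AL\<^esub> y)"
   "!!x y. [|x \<in> carrier AL; y \<in> carrier AL; P x; P y|] ==> P (x \<otimes>\<^bsub>AL\<^esub> y)"
   "!!r x. [|r \<in> carrier R; x \<in> carrier AL; P x|] ==> P (r \<odot>\<^bsub>AL\<^esub> x)" for a P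
  using that by (intro P.subalg_generated_induct[OF par_eps_closed, of a P]) (auto simp: par_lbase_def)
qed

text \<open>In the opposite data the source is S' and the target is the inclusion. This fits the
  generators because S' sends tilde-epsilon_h to epsilon_{Z h}, which is the element
  \<open>e h\<close> formed in the opposite data.\<close>

lemma par_base_right: "par_base R (op_hopf Z H) S (op_alg PH) \<pi> AR anti' (%b. b) (par_eps' R H)"
proof (intro par_base.intro partial_rep_op(1)[OF par_gen_partial_rep] bases_algebra par_base_axioms.intro)
 show "anti' \<in> alg_hom R AR (op_alg PH)" "(%b. b) \<in> alg_hom R AR (op_alg (op_alg PH))"
  using alg_hom_id alg_hom_subset[OF antip'_ext(2)] bases_subset(2) by (simp_all add: par_rbase_def)
 show "par_eps' R H \<in> linear_maps R (op_hopf Z H) AR"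
  using par_eps_linear(2) by (simp add: linear_maps_def)
 show "anti' (par_eps' R H h) = partial_rep.e (op_hopf Z H) (op_alg PH) \<pi> h"
  "par_eps' R H h = partial_rep.e' (op_hopf Z H) (op_alg PH) \<pi> (S h)" if "h \<in> carrier (op_hopf Z H)" for h
  using that antip'_eps(2) partial_rep_op(2,3)[OF par_gen_partial_rep] by (simp_all add: par_eps_e')
 show "P a"
  if "a \<in> carrier AR" "!!h. h \<in> carrier (op_hopf Z H) ==> P (par_eps' R H h)" "P \<one>\<^bsub>AR\<^esub>"
   "!!x y. [|x \<in> carrier AR; y \<in> carrier AR; P x; P y|] ==> P (x \<oplus>\<^bsub>AR\<^esub> y)"
   "!!x y. [|x \<in> carrier AR; y \<in> carrier AR; P x; P y|] ==> P (x \<otimes>\<^bsub>AR\<^esub> y)"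
   "!!r x. [|r \<in> carrier R; x \<in> carrier AR; P x|] ==> P (r \<odot>\<^bsub>AR\<^esub> x)" for a P
  using that by (intro P.subalg_generated_induct[OF par_eps'_closed, of a P]) (auto simp: par_rbase_def)
qed

lemma generating_left: "generating_rep R H Z PH \<pi>"
proof (intro generating_rep.intro par_gen_partial_rep generating_rep_axioms.intro)
 show "P x"
  if "x \<in> carrier PH" "!!ws. ws \<in> LH ==> P (pr.wd ws)"
   "!!x y. [|x \<in> carrier PH; y \<in> carrier PH; P x; P y|] ==> P (x \<oplus>\<^bsub>PH\<^esub> y)"
   "!!r x. [|r \<in> carrier R; x \<in> carrier PH; P x|] ==> P (r \<odot>\<^bsub>PH\<^esub> x)" for x P
  using that(1) by (induction x rule: par_induct) (use that in "simp_all add: par_word_wd")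
qed

lemma generating_right: "generating_rep R (op_hopf Z H) S (op_alg PH) \<pi>"
proof (intro generating_rep.intro partial_rep_op(1)[OF par_gen_partial_rep] generating_rep_axioms.intro)
 interpret o: partial_rep R "op_hopf Z H" S "op_alg PH" \<pi> by (rule partial_rep_op(1)[OF par_gen_partial_rep])
 have wd: "o.wd (rev ws) = par_word R H ws" if "ws \<in> LH" for ws
  using that unfolding o.wd_def par_word_def
  by (subst list_prod_op_alg[OF P_alg]) (auto simp: rev_map)
 show "P x"
  if "x \<in> carrier (op_alg PH)" "!!ws. ws \<in> lists (carrier (op_hopf Z H)) ==> P (o.wd ws)"
   "!!x y. [|x \<in> carrier (op_alg PH); y \<in> carrier (op_alg PH); P x; P y|] ==> P (x \<oplus>\<^bsub>op_alg PH\<^esub> y)"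
   "!!r x. [|r \<in> carrier R; x \<in> carrier (op_alg PH); P x|] ==> P (r \<odot>\<^bsub>op_alg PH\<^esub> x)" for x P
  using that(1)[simplified]
 proof (induction x rule: par_induct)
  case (word ws)
  then have "rev ws \<in> LH" by auto
  then show ?case using that(2)[of "rev ws"] wd[OF word] by simp
 qed (use that in simp_all)
qed

lemma par_antip'_eq: "Z = inv_into (carrier H) S ==> par_antip' R H = anti'"
 by (simp add: par_antip'_def par_antip'_word_def[abs_def])

end

lemma (in hopf_algebra) hopf_inv_inv_into:
 assumes "bij_betw S (carrier H) (carrier H)"
 shows "hopf_inv R H (inv_into (carrier H) S)"
proof (intro hopf_inv.intro hopf_algebra_axioms hopf_inv_axioms.intro)
 have im: "S ` carrier H = carrier H" and inj: "inj_on S (carrier H)"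
  using assms by (simp_all add: bij_betw_def)
 fix h assume h: "h \<in> carrier H"
 show "inv_into (carrier H) S h \<in> carrier H" "S (inv_into (carrier H) S h) = h"
  using h im inv_into_into[of h S "carrier H"] f_inv_into_f[of h S "carrier H"] by simp_all
 show "inv_into (carrier H) S (S h) = h" using h inj by simp
qed

section \<open>Comultiplications and counits of the partial Hopf algebra\<close>

context hopf_inv begin

interpretation P: k_algebra R PH by (rule P_alg)

interpretation pr: partial_rep R H Z PH \<pi> by (rule par_gen_partial_rep)

text \<open>Makes S' injective on the right base, where it is the source of the mirrored
  structure.\<close>

lemma anti_anti':
 assumes "x \<in> carrier PH"
 shows "anti (anti' x) = x"
proof (rule par_linear_eq[OF _ _ assms, of _ PH])
 show "(%x. anti (anti' x)) \<in> linear_maps R PH PH"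
  using alg_hom_linear[OF antip_ext(2)] alg_hom_linear[OF antip'_ext(2)] by (auto intro: linear_maps_comp)
 show "(%x. x) \<in> linear_maps R PH PH" by (simp add: linear_maps_def)
 fix ws assume "ws \<in> LH"
 then show "anti (anti' (par_word R H ws)) = par_word R H ws"
  using alg_hom_one[OF antip_ext(2)] alg_hom_one[OF antip'_ext(2)] alg_hom_mult[OF antip_ext(2)] alg_hom_mult[OF antip'_ext(2)]
   alg_hom_closed[OF antip_ext(2)] alg_hom_closed[OF antip'_ext(2)] antip_ext(3) antip'_ext(3)
  by (induction ws rule: list.induct) simp_all
qed

abbreviation "TL \<equiv> left_tensor PH AL (%a. a) anti'"
abbreviation "TR \<equiv> right_tensor PH AR (%b. b) anti'"

lemma comult_word_wsw: "par_comult_word R H T ws = wsw T H ws (%u v. pr.wd u \<boxtimes>\<^bsub>T\<^esub> pr.wd v)"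
 unfolding par_comult_word_def par_word_wd
 by (rule multi_legs_wsw[of T H ws "%u v. pr.wd u \<boxtimes>\<^bsub>T\<^esub> pr.wd v"])

text \<open>The algebra map that \<open>par_universal\<close> attaches to \<open>dl\<close> has the
  prescribed values on words, so its restriction is the map described by \<open>par_extend\<close>;
  the locale is then established for that restriction.\<close>

lemma left_comult:
 shows "\<exists>!f. extends_words R H TL (par_comult_word R H TL) f"
  and "par_comult R H Z PH \<pi> AL (%a. a) anti' (par_eps R H) (par_extend R H TL (par_comult_word R H TL))"
proof -
 interpret pb: par_base R H Z PH \<pi> AL "%a. a" anti' "par_eps R H" by (rule par_base_left)
 obtain \<Delta> where \<Delta>: "\<Delta> \<in> alg_hom R PH pb.TK" "!!h. h \<in> carrier H ==> \<Delta> (\<pi> h) = pb.dl h"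
  using par_universal[OF pb.dl_partial_rep] by blast
 interpret pc: par_comult R H Z PH \<pi> AL "%a. a" anti' "par_eps R H" \<Delta>
  by (intro par_comult.intro par_base_left generating_left par_comult_axioms.intro \<Delta>)
 have w: "\<Delta> (par_word R H ws) = par_comult_word R H TL ws" if "ws \<in> LH" for ws
  using pc.\<Delta>_wd[OF that] by (simp add: comult_word_wsw par_word_wd)
 note e = par_extend_eq[of \<Delta> TL "par_comult_word R H TL", OF pc.\<Delta>_linear w]
 show "\<exists>!f. extends_words R H TL (par_comult_word R H TL) f" by (rule e(1))
 show "par_comult R H Z PH \<pi> AL (%a. a) anti' (par_eps R H) (par_extend R H TL (par_comult_word R H TL))"
 proof (rule ssubst[OF e(2), where P = "par_comult R H Z PH \<pi> AL (%a. a) anti' (par_eps R H)"])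
  show "par_comult R H Z PH \<pi> AL (%a. a) anti' (par_eps R H) (restrict \<Delta> (carrier PH))"
   by (intro par_comult.intro par_base_left generating_left par_comult_axioms.intro alg_hom_restrict[OF P_alg \<Delta>(1)])
    (simp add: \<Delta>(2))
 qed
qed

text \<open>Kept general in \<open>\<Delta>'\<close>, because \<open>right_comult\<close> works
  inside this locale before its own comultiplication is identified with the described map.\<close>

lemma par_oidI:
 assumes "par_comult R (op_hopf Z H) S (op_alg PH) \<pi> AR anti' (%b. b) (par_eps' R H) \<Delta>'"
 shows "par_oid R H Z PH \<pi> AL (%a. a) anti' (par_eps R H) (par_extend R H TL (par_comult_word R H TL))
  AR (%b. b) anti' (par_eps' R H) \<Delta>' anti anti'"
proof (intro par_oid.intro left_comult(2) assms par_oid_axioms.intro antip_ext antip'_ext)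
 show "inj_on anti' (carrier AR)"
 proof (rule inj_onI)
  fix x y assume "x \<in> carrier AR" "y \<in> carrier AR" and eq: "anti' x = anti' y"
  then have xy: "x \<in> carrier PH" "y \<in> carrier PH" using bases_subset(2) by blast+
  have "x = anti (anti' x)" by (rule anti_anti'[OF xy(1), symmetric])
  also have "... = anti (anti' y)" by (rule arg_cong[OF eq])
  also have "... = y" by (rule anti_anti'[OF xy(2)])
  finally show "x = y" .
 qed
qed simp_all

lemma right_comult:
 shows "\<exists>!f. extends_words R H TR (par_comult_word R H TR) f"
  and "par_comult R (op_hopf Z H) S (op_alg PH) \<pi> AR anti' (%b. b) (par_eps' R H) (par_extend R H TR (par_comult_word R H TR))"
proof -
 interpret pb: par_base R "op_hopf Z H" S "op_alg PH" \<pi> AR anti' "%b. b" "par_eps' R H" by (rule par_base_right)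
 \<comment> \<open>\<open>pb.dl\<close> is a partial representation of the opposite Hopf algebra. A
   second passage to opposites yields one of \<open>H\<close>, to which the universal property
   applies.\<close>
 have dl: "partial_rep R H Z (op_alg pb.TK) pb.dl"
  using partial_rep_op(1)[OF pb.dl_partial_rep] by simp
 obtain \<Delta> where \<Delta>: "\<Delta> \<in> alg_hom R PH (op_alg pb.TK)" "!!h. h \<in> carrier H ==> \<Delta> (\<pi> h) = pb.dl h"
  using par_universal[OF dl] by blast
 have c: "par_comult R (op_hopf Z H) S (op_alg PH) \<pi> AR anti' (%b. b) (par_eps' R H) \<Delta>"
  by (intro par_comult.intro par_base_right generating_right par_comult_axioms.intro) (simp_all add: \<Delta> alg_hom_op_alg')
 interpret po: par_oid R H Z PH \<pi> AL "%a. a" anti' "par_eps R H" "par_extend R H TL (par_comult_word R H TL)"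
  AR "%b. b" anti' "par_eps' R H" \<Delta> anti anti'
  by (rule par_oidI[OF c])
 have w: "\<Delta> (par_word R H ws) = par_comult_word R H TR ws" if "ws \<in> LH" for ws
  using po.\<Delta>'_word[OF that] by (simp add: comult_word_wsw par_word_wd)
 note e = par_extend_eq[of \<Delta> TR "par_comult_word R H TR", OF po.\<Delta>'_linear w]
 show "\<exists>!f. extends_words R H TR (par_comult_word R H TR) f" by (rule e(1))
 have r: "restrict \<Delta> (carrier PH) \<in> alg_hom R PH (op_alg pb.TK)"
  by (rule alg_hom_restrict[OF P_alg \<Delta>(1)])
 show "par_comult R (op_hopf Z H) S (op_alg PH) \<pi> AR anti' (%b. b) (par_eps' R H) (par_extend R H TR (par_comult_word R H TR))"
 proof (rule ssubst[OF e(2), where P = "par_comult R (op_hopf Z H) S (op_alg PH) \<pi> AR anti' (%b. b) (par_eps' R H)"])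
  show "par_comult R (op_hopf Z H) S (op_alg PH) \<pi> AR anti' (%b. b) (par_eps' R H) (restrict \<Delta> (carrier PH))"
   using r by (intro par_comult.intro par_base_right generating_right par_comult_axioms.intro) (simp_all add: \<Delta>(2) alg_hom_op_alg')
 qed
qed

lemmas par_par_oid = par_oidI[OF right_comult(2)]

interpretation po: par_oid R H Z PH \<pi> AL "%a. a" anti' "par_eps R H" "par_extend R H TL (par_comult_word R H TL)"
  AR "%b. b" anti' "par_eps' R H" "par_extend R H TR (par_comult_word R H TR)" anti anti'
 by (rule par_par_oid)

lemma list_prod_bases: "list_prod AL = list_prod PH" "list_prod AR = list_prod PH"
 by (simp_all add: fun_eq_iff list_prod_def base_ops)

lemma lcounit_word: "ws \<in> LH ==> po.\<epsilon> (par_word R H ws) = par_lcounit_word R H ws"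
 using po.left_counit_word[of ws] by (simp add: par_word_wd par_lcounit_word_def Let_def list_prod_bases del: upt_Suc)

lemma rcounit_word: "ws \<in> LH ==> po.\<epsilon>' (par_word R H ws) = par_rcounit_word R H ws"
 using po.right_counit_formula[of ws] by (simp add: par_word_wd par_rcounit_word_def Let_def list_prod_bases del: upt_Suc)

lemma rcounit_linear: "po.\<epsilon>' \<in> linear_maps R PH AR"
 using par_oid.\<epsilon>_linear[OF po.mirror] by (simp add: po.\<epsilon>'_def)

lemma lcounit_eq: "par_extend R H AL (par_lcounit_word R H) = po.\<epsilon>"
 by (simp add: par_extend_eq(2)[OF po.\<epsilon>_linear lcounit_word] fun_eq_iff po.\<epsilon>_def)

lemma rcounit_eq: "par_extend R H AR (par_rcounit_word R H) = po.\<epsilon>'"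
 by (simp add: par_extend_eq(2)[OF rcounit_linear rcounit_word] fun_eq_iff po.\<epsilon>'_def par_oid.\<epsilon>_def[OF po.mirror])

context
 assumes Z: "Z = inv_into (carrier H) S"
begin

lemma par_algebroid_eq: "par_algebroid R H = po.D"
 unfolding par_algebroid_def po.D_def par_ltensor_def par_rtensor_def par_antip'_eq[OF Z] lcounit_eq rcounit_eq ..

lemma par_algebroid_hopf: "hopf_algebroid R (par_algebroid R H)"
 unfolding par_algebroid_eq by (rule po.hopf_algebroid_D)

lemma par_well_defined: "par_maps_well_defined R H"
 unfolding par_maps_well_defined_def par_ltensor_def par_rtensor_def par_antip'_eq[OF Z]
proof (intro conjI left_comult(1) right_comult(1) antip_ext antip'_ext(2))
 have "par_antip'_word R H = (%ws. par_word R H (rev (map Z ws)))"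
  using Z by (simp add: par_antip'_word_def[abs_def])
 then show "\<exists>!f. extends_words R H PH (par_antip'_word R H) f"
  using antip'_ext(1) by simp
 show "\<exists>!f. extends_words R H AL (par_lcounit_word R H) f"
  by (rule par_extend_eq(1)[OF po.\<epsilon>_linear lcounit_word])
 show "\<exists>!f. extends_words R H AR (par_rcounit_word R H) f"
  by (rule par_extend_eq(1)[OF rcounit_linear rcounit_word])
qed

end

end

section \<open>Functoriality\<close>

lemma (in tensor_product) tmap_ident:
 assumes "V \<in> carrier T" "!!x. x \<in> carrier M ==> f x = x" "!!y. y \<in> carrier N ==> g y = y"
 shows "tmap T f g V = V"
proof -
 have "tmap T f g V = tlift T (%x y. x \<boxtimes>\<^bsub>T\<^esub> y) V"
  unfolding tmap_def by (rule tlift_cong[OF assms(1)]) (simp add: assms(2,3))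
 also have "... = V"
  by (rule tlift_comp'[OF _ tensor_abelian_group add_maps_id assms(1)]) simp
 finally show ?thesis .
qed

text \<open>The form in which naturality of a Sweedler sum or of a counit is used: a lift evaluated
  after F (x) F is a lift over the original tensor.\<close>

lemma tlift_tmap:
 assumes T: "tensor_product M N A ra la" "tensor_product M' N' A' ra' la'"
  and f: "f \<in> add_maps M M'" "g \<in> add_maps N N'"
  and c: "!!x a y. [|x \<in> carrier M; a \<in> A; y \<in> carrier N|] ==>
   f (ra x a) \<boxtimes>\<^bsub>tensor M' N' A' ra' la'\<^esub> g y = f x \<boxtimes>\<^bsub>tensor M' N' A' ra' la'\<^esub> g (la a y)"
  and be: "tensor_product.balanced M' N' A' ra' la' G be" "abelian_group G"
  and V: "V \<in> carrier (tensor M N A ra la)"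
 shows "tlift G be (tmap (tensor M' N' A' ra' la') f g V) = tlift G (%x y. be (f x) (g y)) V"
proof -
 interpret T: tensor_product M N A ra la by fact
 interpret T': tensor_product M' N' A' ra' la' by fact
 have bal: "T.balanced T'.T (%x y. f x \<boxtimes>\<^bsub>T'.T\<^esub> g y)"
  by (rule tmap_balanced[OF T refl f c])
 have "tlift G be (tmap T'.T f g V) = tlift G (%x y. tlift G be (f x \<boxtimes>\<^bsub>T'.T\<^esub> g y)) V"
  unfolding tmap_def by (rule T.tlift_comp[OF bal be(2) T'.tlift_add_maps[OF be(1)] V])
 also have "... = tlift G (%x y. be (f x) (g y)) V"
  by (rule T.tlift_cong[OF V]) (simp add: T'.tlift_pure[OF be(1)] add_maps_closed[OF f(1)] add_maps_closed[OF f(2)])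
 finally show ?thesis .
qed

lemma tmap_tmap:
 assumes T: "tensor_product M N A ra la" "tensor_product M' N' A' ra' la'" "tensor_product M'' N'' A'' ra'' la''"
  and f: "f \<in> add_maps M M'" "g \<in> add_maps N N'"
  and c: "!!x a y. [|x \<in> carrier M; a \<in> A; y \<in> carrier N|] ==>
   f (ra x a) \<boxtimes>\<^bsub>tensor M' N' A' ra' la'\<^esub> g y = f x \<boxtimes>\<^bsub>tensor M' N' A' ra' la'\<^esub> g (la a y)"
  and f': "f' \<in> add_maps M' M''" "g' \<in> add_maps N' N''"
  and c': "!!x a y. [|x \<in> carrier M'; a \<in> A'; y \<in> carrier N'|] ==>
   f' (ra' x a) \<boxtimes>\<^bsub>tensor M'' N'' A'' ra'' la''\<^esub> g' y = f' x \<boxtimes>\<^bsub>tensor M'' N'' A'' ra'' la''\<^esub> g' (la' a y)"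
  and V: "V \<in> carrier (tensor M N A ra la)"
 shows "tmap (tensor M'' N'' A'' ra'' la'') f' g' (tmap (tensor M' N' A' ra' la') f g V)
  = tmap (tensor M'' N'' A'' ra'' la'') (%x. f' (f x)) (%y. g' (g y)) V"
proof -
 interpret T'': tensor_product M'' N'' A'' ra'' la'' by fact
 show ?thesis
  unfolding tmap_def[of "tensor M'' N'' A'' ra'' la''"]
  by (rule tlift_tmap[OF T(1,2) f c tmap_balanced[OF T(2,3) refl f' c'] T''.tensor_abelian_group V])
qed

lemma tmap_cong:
 assumes "tensor_product M N A ra la" "V \<in> carrier (tensor M N A ra la)"
  and "!!x. x \<in> carrier M ==> f x = f' x" "!!y. y \<in> carrier N ==> g y = g' y"
 shows "tmap T' f g V = tmap T' f' g' V"
 unfolding tmap_def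
 by (rule tensor_product.tlift_cong[OF assms(1,2)]) (simp add: assms(3,4))

section \<open>Naturality in a Hopf algebra morphism\<close>

context hopf_algebra begin

lemma k_tensor_square_eq: "k_tensor_square R H = H2"
 by (simp add: k_tensor_square_def tensor_square_def)

end

locale hopf_morphism = H: hopf_algebra R H + L: hopf_algebra R L
 for R :: "'k ring" and H :: "('k, 'h) hopf_algebra" and L :: "('k, 'l) hopf_algebra" +
 fixes \<phi> :: "'h => 'l"
 assumes \<phi>: "\<phi> \<in> hopf_hom R H L"
begin

lemma \<phi>_hom: "\<phi> \<in> alg_hom R H L"
 and \<phi>_antipode: "h \<in> carrier H ==> \<phi> (antipode H h) = antipode L (\<phi> h)"
 and \<phi>_counit: "h \<in> carrier H ==> counit L (\<phi> h) = counit H h"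
 and \<phi>_comult: "h \<in> carrier H ==> comult L (\<phi> h) = tmap (k_tensor_square R L) \<phi> \<phi> (comult H h)"
 using \<phi> by (auto simp: hopf_hom_def)

lemmas \<phi>_closed [simp] = alg_hom_closed[OF \<phi>_hom]
lemmas \<phi>_rules = alg_hom_mult[OF \<phi>_hom] alg_hom_one[OF \<phi>_hom]

lemma \<phi>_add_maps: "\<phi> \<in> add_maps H L"
 by (rule linear_maps_add_maps[OF alg_hom_linear[OF \<phi>_hom]])

lemma \<phi>_compat:
 "[|x \<in> carrier H; r \<in> carrier R; y \<in> carrier H|] ==>
  \<phi> (r \<odot>\<^bsub>H\<^esub> x) \<boxtimes>\<^bsub>L.H2\<^esub> \<phi> y = \<phi> x \<boxtimes>\<^bsub>L.H2\<^esub> \<phi> (r \<odot>\<^bsub>H\<^esub> y)"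
 by (simp add: alg_hom_smult[OF \<phi>_hom] L.HH.pure_balanced)

text \<open>Compatibility of \<open>\<phi>\<close> with the comultiplications, recast for Sweedler
  sums: the legs of an image are the images of the legs.\<close>

lemma sw_\<phi>:
 assumes "L.bilinH G be" "h \<in> carrier H"
 shows "L.sw G be (\<phi> h) = H.sw G (%x y. be (\<phi> x) (\<phi> y)) h"
proof -
 have G: "abelian_group G" using assms(1) by (auto simp: bilin_def dest: module.axioms)
 have "L.sw G be (\<phi> h) = tlift G be (tmap L.H2 \<phi> \<phi> (comult H h))"
  unfolding \<phi>_comult[OF assms(2)] L.k_tensor_square_eq ..
 also have "... = H.sw G (%x y. be (\<phi> x) (\<phi> y)) h"
  by (rule tlift_tmap[OF H.HH.tensor_product_axioms L.HH.tensor_product_axioms \<phi>_add_maps \<phi>_add_maps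
     \<phi>_compat L.bilin_balanced[OF assms(1)] G H.comult_H2[OF assms(2)]])
 finally show ?thesis .
qed

lemma map_LH: "ws \<in> H.LH ==> map \<phi> ws \<in> L.LH"
 by auto

lemma wsw_\<phi>:
 assumes "ws \<in> H.LH" "L.wlin G ga"
 shows "wsw G L (map \<phi> ws) ga = wsw G H ws (%u v. ga (map \<phi> u) (map \<phi> v))"
 using assms
proof (induction ws arbitrary: ga rule: list.induct)
 case (Cons h ws)
 then have h: "h \<in> carrier H" and ws: "ws \<in> H.LH" by simp_all
 have "wsw G L (map \<phi> (h # ws)) ga = H.sw G (%x y. wsw G L (map \<phi> ws) (%u v. ga (\<phi> x # u) (\<phi> y # v))) h"
  using sw_\<phi>[OF L.bilin_wsw[OF map_LH[OF ws] Cons.prems(2)] h] by simp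
 also have "... = H.sw G (%x y. wsw G H ws (%u v. ga (map \<phi> (x # u)) (map \<phi> (y # v)))) h"
 proof (rule H.sw_cong[OF refl])
  fix x y assume "x \<in> carrier H" "y \<in> carrier H"
  then show "wsw G L (map \<phi> ws) (%u v. ga (\<phi> x # u) (\<phi> y # v)) = wsw G H ws (%u v. ga (map \<phi> (x # u)) (map \<phi> (y # v)))"
   using Cons.IH[OF ws L.wlin_shift[OF Cons.prems(2)], of "\<phi> x" "\<phi> y"] by simp
 qed (simp add: h)
 finally show ?case by simp
qed simp

end

locale hopf_inv_morphism = hopf_morphism R H L \<phi> + H: hopf_inv R H ZH + L: hopf_inv R L ZL
 for R :: "'k ring" and H :: "('k, 'h) hopf_algebra" and L :: "('k, 'l) hopf_algebra"
  and \<phi> :: "'h => 'l" and ZH :: "'h => 'h" and ZL :: "'l => 'l"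
begin

lemma \<phi>_Z: "h \<in> carrier H ==> \<phi> (ZH h) = ZL (\<phi> h)"
 using \<phi>_antipode[of "ZH h"] L.Z_antipode[of "\<phi> (ZH h)"] by simp

text \<open>Each relation at \<open>h\<close> and \<open>l\<close> is the relation of L_par at their
  images, because \<open>\<phi>\<close> respects products, coproducts and antipodes.\<close>

lemma partial_rep_\<phi>: "partial_rep R H ZH L.PH (%h. L.\<pi> (\<phi> h))"
proof -
 interpret r: partial_rep R L ZL L.PH L.\<pi> by (rule L.par_gen_partial_rep)
 show ?thesis
 proof (intro partial_rep.intro partial_rep_axioms.intro H.hopf_inv_axioms r.B_alg)
  show "(%h. L.\<pi> (\<phi> h)) \<in> linear_maps R H L.PH"
   by (rule linear_maps_comp[OF alg_hom_linear[OF \<phi>_hom] L.par_gen_linear])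
  show "L.\<pi> (\<phi> \<one>\<^bsub>H\<^esub>) = \<one>\<^bsub>L.PH\<^esub>" by (simp add: \<phi>_rules r.p_one)
  fix h l assume hl: "h \<in> carrier H" "l \<in> carrier H"
  have e: "H.sw L.PH (%x y. be x y) k = L.sw L.PH ga (\<phi> k)"
   if "L.bilinH L.PH ga" "k \<in> carrier H" "!!x y. x \<in> carrier H ==> y \<in> carrier H ==> be x y = ga (\<phi> x) (\<phi> y)"
   for k be ga
   unfolding sw_\<phi>[OF that(1,2)] by (rule H.sw_cong[OF refl]) (simp_all add: that)
  show "H.sw L.PH (%x y. L.\<pi> (\<phi> h) \<otimes>\<^bsub>L.PH\<^esub> L.\<pi> (\<phi> x) \<otimes>\<^bsub>L.PH\<^esub> L.\<pi> (\<phi> (antipode H y))) l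
    = H.sw L.PH (%x y. L.\<pi> (\<phi> (h \<otimes>\<^bsub>H\<^esub> x)) \<otimes>\<^bsub>L.PH\<^esub> L.\<pi> (\<phi> (antipode H y))) l"
   using r.PR2[of "\<phi> h" "\<phi> l"] hl
    e[of "%x y. L.\<pi> (\<phi> h) \<otimes>\<^bsub>L.PH\<^esub> L.\<pi> x \<otimes>\<^bsub>L.PH\<^esub> L.\<pi> (antipode L y)" l]
    e[of "%x y. L.\<pi> (\<phi> h \<otimes>\<^bsub>L\<^esub> x) \<otimes>\<^bsub>L.PH\<^esub> L.\<pi> (antipode L y)" l]
   by (simp add: r.p_rules \<phi>_rules \<phi>_antipode)
  show "H.sw L.PH (%x y. L.\<pi> (\<phi> x) \<otimes>\<^bsub>L.PH\<^esub> L.\<pi> (\<phi> (antipode H y)) \<otimes>\<^bsub>L.PH\<^esub> L.\<pi> (\<phi> l)) h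
    = H.sw L.PH (%x y. L.\<pi> (\<phi> x) \<otimes>\<^bsub>L.PH\<^esub> L.\<pi> (\<phi> (antipode H y \<otimes>\<^bsub>H\<^esub> l))) h"
   using r.PR3[of "\<phi> h" "\<phi> l"] hl
    e[of "%x y. L.\<pi> x \<otimes>\<^bsub>L.PH\<^esub> L.\<pi> (antipode L y) \<otimes>\<^bsub>L.PH\<^esub> L.\<pi> (\<phi> l)" h]
    e[of "%x y. L.\<pi> x \<otimes>\<^bsub>L.PH\<^esub> L.\<pi> (antipode L y \<otimes>\<^bsub>L\<^esub> \<phi> l)" h]
   by (simp add: r.p_rules \<phi>_rules \<phi>_antipode)
  show "H.sw L.PH (%x y. L.\<pi> (\<phi> h) \<otimes>\<^bsub>L.PH\<^esub> L.\<pi> (\<phi> (antipode H x)) \<otimes>\<^bsub>L.PH\<^esub> L.\<pi> (\<phi> y)) l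
    = H.sw L.PH (%x y. L.\<pi> (\<phi> (h \<otimes>\<^bsub>H\<^esub> antipode H x)) \<otimes>\<^bsub>L.PH\<^esub> L.\<pi> (\<phi> y)) l"
   using r.PR4[of "\<phi> h" "\<phi> l"] hl
    e[of "%x y. L.\<pi> (\<phi> h) \<otimes>\<^bsub>L.PH\<^esub> L.\<pi> (antipode L x) \<otimes>\<^bsub>L.PH\<^esub> L.\<pi> y" l]
    e[of "%x y. L.\<pi> (\<phi> h \<otimes>\<^bsub>L\<^esub> antipode L x) \<otimes>\<^bsub>L.PH\<^esub> L.\<pi> y" l]
   by (simp add: r.p_rules \<phi>_rules \<phi>_antipode)
  show "H.sw L.PH (%x y. L.\<pi> (\<phi> (antipode H x)) \<otimes>\<^bsub>L.PH\<^esub> L.\<pi> (\<phi> y) \<otimes>\<^bsub>L.PH\<^esub> L.\<pi> (\<phi> l)) h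
    = H.sw L.PH (%x y. L.\<pi> (\<phi> (antipode H x)) \<otimes>\<^bsub>L.PH\<^esub> L.\<pi> (\<phi> (y \<otimes>\<^bsub>H\<^esub> l))) h"
   using r.PR5[of "\<phi> h" "\<phi> l"] hl
    e[of "%x y. L.\<pi> (antipode L x) \<otimes>\<^bsub>L.PH\<^esub> L.\<pi> y \<otimes>\<^bsub>L.PH\<^esub> L.\<pi> (\<phi> l)" h]
    e[of "%x y. L.\<pi> (antipode L x) \<otimes>\<^bsub>L.PH\<^esub> L.\<pi> (y \<otimes>\<^bsub>L\<^esub> \<phi> l)" h]
   by (simp add: r.p_rules \<phi>_rules \<phi>_antipode)
 qed
qed

lemma is_par_map_unique:
 assumes "is_par_map R H L \<phi> F" "is_par_map R H L \<phi> F'"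
 shows "F = F'"
proof (rule extensionalityI[of _ "carrier H.PH"])
 have F: "F \<in> alg_hom R H.PH L.PH" "F' \<in> alg_hom R H.PH L.PH"
  "h \<in> carrier H ==> F (H.\<pi> h) = L.\<pi> (\<phi> h)" "h \<in> carrier H ==> F' (H.\<pi> h) = L.\<pi> (\<phi> h)" for h
  using assms by (simp_all add: is_par_map_def)
 fix x assume x: "x \<in> carrier H.PH"
 show "F x = F' x"
 proof (rule H.par_linear_eq[OF alg_hom_linear[OF F(1)] alg_hom_linear[OF F(2)] x])
  fix ws assume "ws \<in> H.LH"
  then show "F (par_word R H ws) = F' (par_word R H ws)"
   by (induction ws rule: list.induct)
    (simp_all add: alg_hom_one[OF F(1)] alg_hom_one[OF F(2)] alg_hom_mult[OF F(1)] alg_hom_mult[OF F(2)] F(3,4))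
 qed
qed (use assms in "simp_all add: is_par_map_def")

lemma is_par_map_exists: "\<exists>F. is_par_map R H L \<phi> F"
proof -
 obtain f where f: "f \<in> alg_hom R H.PH L.PH" "!!h. h \<in> carrier H ==> f (H.\<pi> h) = L.\<pi> (\<phi> h)"
  using H.par_universal[OF partial_rep_\<phi>] by blast
 have "is_par_map R H L \<phi> (restrict f (carrier H.PH))"
  using alg_hom_restrict[OF H.P_alg f(1)] f(2) by (simp add: is_par_map_def)
 then show ?thesis by (rule exI[of "is_par_map R H L \<phi>"])
qed

lemma is_par_map_ex1: "\<exists>!F. is_par_map R H L \<phi> F"
 using is_par_map_exists is_par_map_unique by blast

lemma par_map_is: "is_par_map R H L \<phi> (par_map R H L \<phi>)"
 unfolding par_map_def by (rule theI'[OF is_par_map_ex1])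

lemma par_map_eqI: "is_par_map R H L \<phi> F ==> par_map R H L \<phi> = F"
 by (rule is_par_map_unique[OF par_map_is])

abbreviation "F \<equiv> par_map R H L \<phi>"

lemma F_hom: "F \<in> alg_hom R H.PH L.PH" and F_extensional: "F \<in> extensional (carrier H.PH)"
 and F_gen: "h \<in> carrier H ==> F (H.\<pi> h) = L.\<pi> (\<phi> h)"
 using par_map_is by (simp_all add: is_par_map_def)

lemmas F_closed [simp] = alg_hom_closed[OF F_hom]
lemmas F_rules = alg_hom_add[OF F_hom] alg_hom_mult[OF F_hom] alg_hom_one[OF F_hom] alg_hom_smult[OF F_hom]

lemma F_word: "ws \<in> H.LH ==> F (par_word R H ws) = par_word R L (map \<phi> ws)"
 by (induction ws rule: list.induct) (simp_all add: F_rules F_gen)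

lemma F_anti:
 assumes "x \<in> carrier H.PH"
 shows "F (H.anti x) = L.anti (F x)" "F (H.anti' x) = L.anti' (F x)"
proof -
 have a: "(%x. F (G x)) \<in> linear_maps R H.PH L.PH" if "G \<in> alg_hom R H.PH (op_alg H.PH)" for G
  using alg_hom_linear[OF that] linear_maps_comp[OF _ alg_hom_linear[OF F_hom]] by simp
 have b: "(%x. G (F x)) \<in> linear_maps R H.PH L.PH" if "G \<in> alg_hom R L.PH (op_alg L.PH)" for G
  using alg_hom_linear[OF that] linear_maps_comp[OF alg_hom_linear[OF F_hom]] by simp
 have words: "F (G (par_word R H ws)) = G' (F (par_word R H ws))"
  if ws: "ws \<in> H.LH" and G: "G \<in> alg_hom R H.PH (op_alg H.PH)" "G' \<in> alg_hom R L.PH (op_alg L.PH)"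
   and "!!h. h \<in> carrier H ==> F (G (H.\<pi> h)) = G' (L.\<pi> (\<phi> h))" for ws G G'
  using ws
  by (induction ws rule: list.induct)
   (use alg_hom_closed[OF G(1)] alg_hom_closed[OF G(2)] alg_hom_mult[OF G(1)] alg_hom_mult[OF G(2)]
    alg_hom_one[OF G(1)] alg_hom_one[OF G(2)] that(4) in "simp_all add: F_rules F_gen")
 show "F (H.anti x) = L.anti (F x)"
  by (rule H.par_linear_eq[OF a[OF H.antip_ext(2)] b[OF L.antip_ext(2)] assms])
   (rule words; simp add: H.antip_ext L.antip_ext F_gen \<phi>_antipode)
 show "F (H.anti' x) = L.anti' (F x)"
  by (rule H.par_linear_eq[OF a[OF H.antip'_ext(2)] b[OF L.antip'_ext(2)] assms])
   (rule words; simp add: H.antip'_ext L.antip'_ext F_gen \<phi>_Z)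
qed

end

context par_oid begin

lemma antipode_balanced:
 "balanced B (%u v. \<sigma> u \<otimes> v)"
 "tensor_product.balanced B B (carrier A') (%h b. h \<otimes> s' b) (%b h. h \<otimes> t' b) B (%u v. u \<otimes> \<sigma> v)"
proof -
 show "balanced B (%u v. \<sigma> u \<otimes> v)"
  by (intro balancedI B.abelian_group_axioms biadditiveI add_mapsI)
   (simp_all add: \<sigma>_rules \<sigma>_t B.l_distr B.r_distr B.m_assoc)
 interpret T': tensor_module R B B "carrier A'" "%h b. h \<otimes> s' b" "%b h. h \<otimes> t' b"
  by (rule TB'_module)
 show "T'.balanced B (%u v. u \<otimes> \<sigma> v)"
  by (intro T'.balancedI B.abelian_group_axioms biadditiveI add_mapsI)
   (simp_all add: \<sigma>_rules \<sigma>_t' B.l_distr B.r_distr B.m_assoc)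
qed

lemma wlin_pure: "wlin TB (%u v. wd u \<bowtie> wd v)" "wlin TB' (%u v. wd u \<boxtimes>\<^bsub>TB'\<^esub> wd v)"
proof -
 show "wlin TB (%u v. wd u \<bowtie> wd v)" by (rule wlin_wd[OF bilin_pure])
 have "module R (op_alg G) \<longleftrightarrow> module R G" for G :: "('k, ('b \<times> 'b \<Rightarrow>\<^sub>0 int) set) module"
  by (simp add: module_def module_axioms_def)
 then have "wlin (op_alg G) = wlin G" for G :: "('k, ('b \<times> 'b \<Rightarrow>\<^sub>0 int) set) module"
  by (simp add: fun_eq_iff wlin_def lin_def)
 then show "wlin TB' (%u v. wd u \<boxtimes>\<^bsub>TB'\<^esub> wd v)"
  using wlin_o_pure by (simp add: o_TB)
qed

lemma \<Delta>'_closed: "x \<in> carrier B ==> \<Delta>' x \<in> carrier TB'"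
 by (rule linear_maps_closed[OF \<Delta>'_linear])

end

context hopf_inv_morphism begin

interpretation hp: par_oid R H ZH H.PH H.\<pi> H.AL "%a. a" H.anti' "par_eps R H" "par_extend R H H.TL (par_comult_word R H H.TL)"
  H.AR "%b. b" H.anti' "par_eps' R H" "par_extend R H H.TR (par_comult_word R H H.TR)" H.anti H.anti'
 by (rule H.par_par_oid)

interpretation lp: par_oid R L ZL L.PH L.\<pi> L.AL "%a. a" L.anti' "par_eps R L" "par_extend R L L.TL (par_comult_word R L L.TL)"
  L.AR "%b. b" L.anti' "par_eps' R L" "par_extend R L L.TR (par_comult_word R L L.TR)" L.anti L.anti'
 by (rule L.par_par_oid)

declare H.sw_cong [cong]

abbreviation "\<Delta>H \<equiv> par_extend R H H.TL (par_comult_word R H H.TL)"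
abbreviation "\<Delta>L \<equiv> par_extend R L L.TL (par_comult_word R L L.TL)"
abbreviation "\<Delta>H' \<equiv> par_extend R H H.TR (par_comult_word R H H.TR)"
abbreviation "\<Delta>L' \<equiv> par_extend R L L.TR (par_comult_word R L L.TR)"

lemma F_lin: "lin R H.PH L.PH F"
 using alg_hom_linear[OF F_hom] by (simp add: lin_def lp.B_mod)

lemma F_add_maps: "F \<in> add_maps H.PH L.PH"
 by (rule linear_maps_add_maps[OF alg_hom_linear[OF F_hom]])

lemma F_eps:
 assumes "h \<in> carrier H"
 shows "F (par_eps R H h) = par_eps R L (\<phi> h)" "F (par_eps' R H h) = par_eps' R L (\<phi> h)"
proof -
 have "F (par_eps R H h) = H.sw L.PH (%x y. L.\<pi> (\<phi> x) \<otimes>\<^bsub>L.PH\<^esub> L.\<pi> (antipode L (\<phi> y))) h"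
  unfolding par_eps_def using assms
  by (subst H.sw_map[OF F_lin _ assms]) (simp_all add: hp.p_rules F_rules F_gen \<phi>_antipode)
 also have "... = par_eps R L (\<phi> h)"
  unfolding par_eps_def using assms
  by (subst sw_\<phi>[of _ "%x y. L.\<pi> x \<otimes>\<^bsub>L.PH\<^esub> L.\<pi> (antipode L y)"]) (simp_all add: lp.p_rules)
 finally show "F (par_eps R H h) = par_eps R L (\<phi> h)" .
 have "F (par_eps' R H h) = H.sw L.PH (%x y. L.\<pi> (antipode L (\<phi> x)) \<otimes>\<^bsub>L.PH\<^esub> L.\<pi> (\<phi> y)) h"
  unfolding par_eps'_def using assms
  by (subst H.sw_map[OF F_lin _ assms]) (simp_all add: hp.p_rules F_rules F_gen \<phi>_antipode)
 also have "... = par_eps' R L (\<phi> h)"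
  unfolding par_eps'_def using assms
  by (subst sw_\<phi>[of _ "%x y. L.\<pi> (antipode L x) \<otimes>\<^bsub>L.PH\<^esub> L.\<pi> y"]) (simp_all add: lp.p_rules)
 finally show "F (par_eps' R H h) = par_eps' R L (\<phi> h)" .
qed

lemma base_PH: "a \<in> carrier H.AL ==> a \<in> carrier H.PH" "b \<in> carrier H.AR ==> b \<in> carrier H.PH"
 using H.bases_subset by auto

lemma F_AL: "a \<in> carrier H.AL ==> F a \<in> carrier L.AL"
proof (induction a rule: hp.A_induct[consumes 1])
 case (3 x y)
 then show ?case using lp.A.add.m_closed[of "F x" "F y"] by (simp add: H.base_ops L.base_ops F_rules base_PH)
next
 case (4 x y)
 then show ?case using lp.A.m_closed[of "F x" "F y"] by (simp add: H.base_ops L.base_ops F_rules base_PH)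
next
 case (5 r x)
 then show ?case using lp.A.smult_closed[of r "F x"] by (simp add: H.base_ops L.base_ops F_rules base_PH)
qed (use lp.A.one_closed in "simp_all add: F_eps L.par_eps_base H.base_ops L.base_ops F_rules")

lemma F_AR: "b \<in> carrier H.AR ==> F b \<in> carrier L.AR"
proof (induction b rule: hp.A'_induct[consumes 1])
 case (3 x y)
 then show ?case using lp.o.A.add.m_closed[of "F x" "F y"] by (simp add: H.base_ops L.base_ops F_rules base_PH)
next
 case (4 x y)
 then show ?case using lp.o.A.m_closed[of "F x" "F y"] by (simp add: H.base_ops L.base_ops F_rules base_PH)
next
 case (5 r x)
 then show ?case using lp.o.A.smult_closed[of r "F x"] by (simp add: H.base_ops L.base_ops F_rules base_PH)
qed (use lp.o.A.one_closed in "simp_all add: F_eps L.par_eps'_base H.base_ops L.base_ops F_rules")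

text \<open>Stated for arbitrary base sets and actions so that it serves both comultiplications. On
  a word, both sides are the sum over the letterwise splittings of the images of the two halves, by
  \<open>wsw_\<phi>\<close>.\<close>

lemma comult_compatible:
 assumes TH: "TH = tensor H.PH H.PH X1 raH laH" "tensor_module R H.PH H.PH X1 raH laH"
  and TL: "TL = tensor L.PH L.PH X2 raL laL" "tensor_module R L.PH L.PH X2 raL laL"
  and c: "!!x a y. [|x \<in> carrier H.PH; a \<in> X1; y \<in> carrier H.PH|] ==> F (raH x a) \<boxtimes>\<^bsub>TL\<^esub> F y = F x \<boxtimes>\<^bsub>TL\<^esub> F (laH a y)"
  and DH: "DH \<in> linear_maps R H.PH TH" "!!ws. ws \<in> H.LH ==> DH (hp.wd ws) = wsw TH H ws (%u v. hp.wd u \<boxtimes>\<^bsub>TH\<^esub> hp.wd v)"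
  and DL: "DL \<in> linear_maps R L.PH TL" "!!ws. ws \<in> L.LH ==> DL (lp.wd ws) = wsw TL L ws (%u v. lp.wd u \<boxtimes>\<^bsub>TL\<^esub> lp.wd v)"
  and wl: "H.wlin TH (%u v. hp.wd u \<boxtimes>\<^bsub>TH\<^esub> hp.wd v)" "L.wlin TL (%u v. lp.wd u \<boxtimes>\<^bsub>TL\<^esub> lp.wd v)"
  and x: "x \<in> carrier H.PH"
 shows "DL (F x) = tmap TL F F (DH x)"
proof -
 interpret TH: tensor_module R H.PH H.PH X1 raH laH by fact
 interpret TL: tensor_module R L.PH L.PH X2 raL laL by fact
 have bal: "TH.balanced TL (%x y. F x \<boxtimes>\<^bsub>TL\<^esub> F y)"
  by (rule tmap_balanced[OF TH.tensor_product_axioms TL.tensor_product_axioms TL(1) F_add_maps F_add_maps c])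
 have mTL: "module R TL" unfolding TL(1) by (rule TL.tensor_is_module)
 have F: "lin R TH TL (tmap TL F F)"
 proof -
  have "tlift TL (%x y. F x \<boxtimes>\<^bsub>TL\<^esub> F y) \<in> linear_maps R (tensor H.PH H.PH X1 raH laH) TL"
   using TL.smult_pure by (intro TH.tlift_linear bal mTL) (simp add: TL(1) F_rules)
  then show ?thesis by (simp add: lin_def tmap_def TH(1) mTL)
 qed
 show ?thesis
 proof (rule H.par_linear_eq[OF _ _ x])
  show "(%x. DL (F x)) \<in> linear_maps R H.PH TL"
   by (rule linear_maps_comp[OF alg_hom_linear[OF F_hom] DL(1)])
  show "(%x. tmap TL F F (DH x)) \<in> linear_maps R H.PH TL"
   using F by (intro linear_maps_comp[OF DH(1)]) (simp add: lin_def)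
  fix ws assume ws: "ws \<in> H.LH"
  have "DL (F (par_word R H ws)) = wsw TL H ws (%u v. lp.wd (map \<phi> u) \<boxtimes>\<^bsub>TL\<^esub> lp.wd (map \<phi> v))"
   using ws DL(2)[OF map_LH[OF ws]] by (simp add: F_word L.par_word_wd wsw_\<phi> wl)
  also have "... = wsw TL H ws (%u v. tmap TL F F (hp.wd u \<boxtimes>\<^bsub>TH\<^esub> hp.wd v))"
  proof (rule H.wsw_cong[OF ws])
   fix u v assume uv: "u \<in> H.LH" "v \<in> H.LH"
   have "tmap TL F F (hp.wd u \<boxtimes>\<^bsub>TH\<^esub> hp.wd v) = F (hp.wd u) \<boxtimes>\<^bsub>TL\<^esub> F (hp.wd v)"
    unfolding tmap_def TH(1) using uv by (intro TH.tlift_pure bal) simp_all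
   then show "lp.wd (map \<phi> u) \<boxtimes>\<^bsub>TL\<^esub> lp.wd (map \<phi> v) = tmap TL F F (hp.wd u \<boxtimes>\<^bsub>TH\<^esub> hp.wd v)"
    using F_word[OF uv(1)] F_word[OF uv(2)] by (simp add: H.par_word_wd L.par_word_wd)
  qed
  also have "... = tmap TL F F (DH (par_word R H ws))"
   using H.wsw_map[OF F ws wl(1)] DH(2)[OF ws] by (simp add: H.par_word_wd)
  finally show "DL (F (par_word R H ws)) = tmap TL F F (DH (par_word R H ws))" .
 qed
qed

lemma left_compat:
 assumes "x \<in> carrier H.PH" "a \<in> carrier H.AL" "y \<in> carrier H.PH"
 shows "F (H.anti' a \<otimes>\<^bsub>H.PH\<^esub> x) \<boxtimes>\<^bsub>L.TL\<^esub> F y = F x \<boxtimes>\<^bsub>L.TL\<^esub> F (a \<otimes>\<^bsub>H.PH\<^esub> y)"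
proof -
 have a: "a \<in> carrier H.PH" by (rule base_PH(1)[OF assms(2)])
 have "F (H.anti' a \<otimes>\<^bsub>H.PH\<^esub> x) = L.anti' (F a) \<otimes>\<^bsub>L.PH\<^esub> F x"
  using assms(1) a hp.t_closed[OF assms(2)] by (simp add: F_rules(2) F_anti(2))
 moreover have "F (a \<otimes>\<^bsub>H.PH\<^esub> y) = F a \<otimes>\<^bsub>L.PH\<^esub> F y" using assms(3) a by (simp add: F_rules(2))
 ultimately show ?thesis using lp.TB_balanced[of "F x" "F a" "F y"] assms F_AL by simp
qed

lemma right_compat:
 assumes "x \<in> carrier H.PH" "b \<in> carrier H.AR" "y \<in> carrier H.PH"
 shows "F (x \<otimes>\<^bsub>H.PH\<^esub> b) \<boxtimes>\<^bsub>L.TR\<^esub> F y = F x \<boxtimes>\<^bsub>L.TR\<^esub> F (y \<otimes>\<^bsub>H.PH\<^esub> H.anti' b)"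
proof -
 interpret T': tensor_module R L.PH L.PH "carrier L.AR" "%h b. h \<otimes>\<^bsub>L.PH\<^esub> b" "%b h. h \<otimes>\<^bsub>L.PH\<^esub> L.anti' b"
  by (rule lp.TB'_module)
 have b: "b \<in> carrier H.PH" by (rule base_PH(2)[OF assms(2)])
 have "F (y \<otimes>\<^bsub>H.PH\<^esub> H.anti' b) = F y \<otimes>\<^bsub>L.PH\<^esub> L.anti' (F b)"
  using assms(3) b hp.t'_closed[OF assms(2)] by (simp add: F_rules(2) F_anti(2))
 moreover have "F (x \<otimes>\<^bsub>H.PH\<^esub> b) = F x \<otimes>\<^bsub>L.PH\<^esub> F b" using assms(1) b by (simp add: F_rules(2))
 ultimately show ?thesis using T'.pure_balanced[of "F x" "F b" "F y"] assms F_AR by (simp add: lp.TB'_def)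
qed

lemma F_left_comult: "x \<in> carrier H.PH ==> \<Delta>L (F x) = tmap L.TL F F (\<Delta>H x)"
 by (rule comult_compatible[OF hp.TB_tensor hp.tensor_module_axioms lp.TB_tensor lp.tensor_module_axioms
   left_compat hp.\<Delta>_linear hp.\<Delta>_wd lp.\<Delta>_linear lp.\<Delta>_wd hp.wlin_pure(1) lp.wlin_pure(1)])

lemma F_right_comult: "x \<in> carrier H.PH ==> \<Delta>L' (F x) = tmap L.TR F F (\<Delta>H' x)"
 by (rule comult_compatible[OF hp.TB'_def hp.TB'_module lp.TB'_def lp.TB'_module
   right_compat hp.\<Delta>'_linear hp.\<Delta>'_word lp.\<Delta>'_linear lp.\<Delta>'_word hp.wlin_pure(2) lp.wlin_pure(2)])

text \<open>The counit is recovered from data that \<open>F\<close> is already known to respect: s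
  eps_l = mu(I (x) S) Delta_r. Naturality of the right comultiplication, of S and of products
  therefore suffices, in place of a comparison of the closed formulas.\<close>

lemma F_lcounit:
 assumes x: "x \<in> carrier H.PH"
 shows "F (hp.\<epsilon> x) = lp.\<epsilon> (F x)"
proof -
 interpret T': tensor_module R H.PH H.PH "carrier H.AR" "%h b. h \<otimes>\<^bsub>H.PH\<^esub> b" "%b h. h \<otimes>\<^bsub>H.PH\<^esub> H.anti' b"
  by (rule hp.TB'_module)
 interpret U': tensor_module R L.PH L.PH "carrier L.AR" "%h b. h \<otimes>\<^bsub>L.PH\<^esub> b" "%b h. h \<otimes>\<^bsub>L.PH\<^esub> L.anti' b"
  by (rule lp.TB'_module)
 have D: "\<Delta>H' x \<in> carrier (tensor H.PH H.PH (carrier H.AR) (%h b. h \<otimes>\<^bsub>H.PH\<^esub> b) (%b h. h \<otimes>\<^bsub>H.PH\<^esub> H.anti' b))"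
  using hp.\<Delta>'_closed[OF x] by (simp add: hp.TB'_def)
 have "F (hp.\<epsilon> x) = F (tlift H.PH (%u v. u \<otimes>\<^bsub>H.PH\<^esub> H.anti v) (\<Delta>H' x))"
  using hp.antipode_right_\<epsilon>[OF x] by simp
 also have "... = tlift L.PH (%u v. F (u \<otimes>\<^bsub>H.PH\<^esub> H.anti v)) (\<Delta>H' x)"
  by (rule T'.tlift_comp[OF hp.antipode_balanced(2) lp.B.abelian_group_axioms F_add_maps D])
 also have "... = tlift L.PH (%u v. F u \<otimes>\<^bsub>L.PH\<^esub> L.anti (F v)) (\<Delta>H' x)"
  by (rule T'.tlift_cong[OF D]) (simp add: F_rules F_anti)
 also have "... = tlift L.PH (%u v. u \<otimes>\<^bsub>L.PH\<^esub> L.anti v) (tmap L.TR F F (\<Delta>H' x))"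
  unfolding lp.TB'_def
  by (rule tlift_tmap[OF T'.tensor_product_axioms U'.tensor_product_axioms F_add_maps F_add_maps
     right_compat[unfolded lp.TB'_def] lp.antipode_balanced(2) lp.B.abelian_group_axioms D, symmetric])
 also have "... = lp.\<epsilon> (F x)"
  using lp.antipode_right_\<epsilon>[of "F x"] x by (simp add: F_right_comult)
 finally show ?thesis .
qed

text \<open>The same argument from the other antipode axiom, which expresses the right counit
  through S and the left comultiplication.\<close>

lemma F_rcounit:
 assumes x: "x \<in> carrier H.PH"
 shows "F (hp.\<epsilon>' x) = lp.\<epsilon>' (F x)"
proof -
 have D: "\<Delta>H x \<in> carrier (tensor H.PH H.PH (carrier H.AL) (%h a. H.anti' a \<otimes>\<^bsub>H.PH\<^esub> h) (%a h. a \<otimes>\<^bsub>H.PH\<^esub> h))"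
  using hp.\<Delta>_closed[OF x] unfolding hp.TB_def .
 have "F (hp.\<epsilon>' x) = F (tlift H.PH (%u v. H.anti u \<otimes>\<^bsub>H.PH\<^esub> v) (\<Delta>H x))"
  using hp.antipode_left_\<epsilon>'[OF x] by simp
 also have "... = tlift L.PH (%u v. F (H.anti u \<otimes>\<^bsub>H.PH\<^esub> v)) (\<Delta>H x)"
  by (rule hp.tlift_comp[OF hp.antipode_balanced(1) lp.B.abelian_group_axioms F_add_maps D])
 also have "... = tlift L.PH (%u v. L.anti (F u) \<otimes>\<^bsub>L.PH\<^esub> F v) (\<Delta>H x)"
  by (rule hp.tlift_cong[OF D]) (simp add: F_rules F_anti)
 also have "... = tlift L.PH (%u v. L.anti u \<otimes>\<^bsub>L.PH\<^esub> v) (tmap L.TL F F (\<Delta>H x))"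
  unfolding lp.TB_def
  by (rule tlift_tmap[OF hp.tensor_product_axioms lp.tensor_product_axioms F_add_maps F_add_maps
     left_compat[unfolded lp.TB_def] lp.antipode_balanced(1) lp.B.abelian_group_axioms D, symmetric])
 also have "... = lp.\<epsilon>' (F x)"
  using lp.antipode_left_\<epsilon>'[of "F x"] x by (simp add: F_left_comult)
 finally show ?thesis .
qed

lemma F_restrict_AL: "restrict F (carrier H.AL) \<in> alg_hom R H.AL L.AL"
 by (intro alg_homI linear_mapsI)
  (use hp.A.add.m_closed hp.A.m_closed hp.A.one_closed hp.A.smult_closed in
   \<open>simp_all add: F_AL F_rules base_PH H.base_ops L.base_ops\<close>)

lemma F_restrict_AR: "restrict F (carrier H.AR) \<in> alg_hom R H.AR L.AR"
 by (intro alg_homI linear_mapsI)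
  (use hp.o.A.add.m_closed hp.o.A.m_closed hp.o.A.one_closed hp.o.A.smult_closed in
   \<open>simp_all add: F_AR F_rules base_PH H.base_ops L.base_ops\<close>)

lemma par_algebroid_map_hom:
 assumes "ZH = inv_into (carrier H) (antipode H)" "ZL = inv_into (carrier L) (antipode L)"
 shows "par_algebroid_map R H L \<phi> \<in> hopf_algebroid_hom R (par_algebroid R H) (par_algebroid R L)"
 unfolding H.par_algebroid_eq[OF assms(1)] L.par_algebroid_eq[OF assms(2)] hp.D_def lp.D_def
  hopf_algebroid_hom_def par_algebroid_map_def
 by (simp add: F_hom F_restrict_AL F_restrict_AR F_anti base_PH F_left_comult F_right_comult F_lcounit F_rcounit hp.\<epsilon>'_closed)

end

section \<open>The categories and the functor\<close>

abbreviation "ident M \<equiv> \<lambda>x\<in>carrier M. x"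
abbreviation "antipode_inv H \<equiv> inv_into (carrier H) (antipode H)"
abbreviation "lact D \<equiv> %a h. lsource D a \<otimes>\<^bsub>total D\<^esub> h"
abbreviation "lact' D \<equiv> %h a. ltarget D a \<otimes>\<^bsub>total D\<^esub> h"
abbreviation "ract D \<equiv> %h b. h \<otimes>\<^bsub>total D\<^esub> rsource D b"
abbreviation "ract' D \<equiv> %b h. h \<otimes>\<^bsub>total D\<^esub> rtarget D b"

lemma hopf_hom_ident:
 assumes "hopf_algebra R H"
 shows "ident H \<in> hopf_hom R H H"
proof -
 interpret hopf_algebra R H by fact
 have "(%h. h) \<in> alg_hom R H H" by (auto simp: alg_hom_def ring_hom_def linear_maps_def)
 then have "ident H \<in> alg_hom R H H" by (rule alg_hom_restrict[OF H_alg])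
 moreover have "tmap H2 (ident H) (ident H) (comult H h) = comult H h"
  if "h \<in> carrier H" for h
  using that by (intro HH.tmap_ident comult_H2) simp_all
 ultimately show ?thesis by (simp add: hopf_hom_def k_tensor_square_eq)
qed

lemma hopf_hom_compose:
 assumes "hopf_algebra R H" "hopf_algebra R L" "hopf_algebra R M" "\<phi> \<in> hopf_hom R H L" "\<psi> \<in> hopf_hom R L M"
 shows "compose (carrier H) \<psi> \<phi> \<in> hopf_hom R H M"
proof -
 interpret f: hopf_morphism R H L \<phi> by (intro hopf_morphism.intro hopf_morphism_axioms.intro assms)
 interpret g: hopf_morphism R L M \<psi> by (intro hopf_morphism.intro hopf_morphism_axioms.intro assms)
 have "compose (carrier H) \<psi> \<phi> \<in> alg_hom R H M"
  unfolding compose_def by (rule alg_hom_restrict[OF f.H.H_alg alg_hom_comp[OF f.\<phi>_hom g.\<phi>_hom]])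
 moreover have "comult M (compose (carrier H) \<psi> \<phi> h)
   = tmap (k_tensor_square R M) (compose (carrier H) \<psi> \<phi>) (compose (carrier H) \<psi> \<phi>) (comult H h)"
  if h: "h \<in> carrier H" for h
 proof -
  have "comult M (compose (carrier H) \<psi> \<phi> h) = comult M (\<psi> (\<phi> h))" using h by (simp add: compose_eq)
  also have "... = tmap g.L.H2 \<psi> \<psi> (tmap f.L.H2 \<phi> \<phi> (comult H h))"
   unfolding g.\<phi>_comult[OF f.\<phi>_closed[OF h]] f.\<phi>_comult[OF h] g.L.k_tensor_square_eq f.L.k_tensor_square_eq ..
  also have "... = tmap g.L.H2 (%x. \<psi> (\<phi> x)) (%y. \<psi> (\<phi> y)) (comult H h)"
   by (rule tmap_tmap[OF f.H.HH.tensor_product_axioms f.L.HH.tensor_product_axioms g.L.HH.tensor_product_axioms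
      f.\<phi>_add_maps f.\<phi>_add_maps f.\<phi>_compat g.\<phi>_add_maps g.\<phi>_add_maps g.\<phi>_compat f.H.comult_H2[OF h]])
  also have "... = tmap g.L.H2 (compose (carrier H) \<psi> \<phi>) (compose (carrier H) \<psi> \<phi>) (comult H h)"
   by (rule tmap_cong[OF f.H.HH.tensor_product_axioms f.H.comult_H2[OF h]]) (simp_all add: compose_eq)
  finally show ?thesis by (simp only: g.L.k_tensor_square_eq)
 qed
 ultimately show ?thesis
  by (simp add: hopf_hom_def compose_eq f.\<phi>_counit g.\<phi>_counit f.\<phi>_antipode g.\<phi>_antipode)
qed

lemma alg_hom_funcset: "f \<in> alg_hom R M N ==> f \<in> carrier M \<rightarrow> carrier N"
 by (auto simp: alg_hom_closed)

lemma hopf_hom_funcset: "\<phi> \<in> hopf_hom R H L ==> \<phi> \<in> carrier H \<rightarrow> carrier L"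
 by (auto simp: hopf_hom_def alg_hom_closed)

lemma hopf_algebra_category: "category (hopf_algebra_category R)"
 unfolding hopf_algebra_category_def
 by (rule category.intro; simp)
  (auto simp: hopf_hom_ident compose_extensional intro: hopf_hom_compose
   Id_compose[OF hopf_hom_funcset] compose_Id[OF hopf_hom_funcset] compose_assoc[OF hopf_hom_funcset, symmetric])

section \<open>Identities and composition of Hopf algebroid morphisms\<close>

lemma bialgebroid_tensor_products:
 assumes "hopf_algebroid R D"
 shows "tensor_product (total D) (total D) (carrier (lbase D)) (lact' D) (lact D)"
  and "tensor_product (total D) (total D) (carrier (rbase D)) (ract D) (ract' D)"
proof -
 interpret hopf_algebroid R D by fact
 show "tensor_product (total D) (total D) (carrier (lbase D)) (lact' D) (lact D)"
  by unfold_locales (simp_all add: left.coring.la_closed left.coring.ra_closed)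
 show "tensor_product (total D) (total D) (carrier (rbase D)) (ract D) (ract' D)"
  by unfold_locales (simp_all add: right.coring.la_closed right.coring.ra_closed)
qed

lemma ltensor_eq: "ltensor D = tensor (total D) (total D) (carrier (lbase D)) (lact' D) (lact D)"
 and rtensor_eq: "rtensor D = tensor (total D) (total D) (carrier (rbase D)) (ract D) (ract' D)"
 by (simp_all add: left_tensor_def right_tensor_def tensor_square_def)

lemma algebroid_comult_closed:
 assumes "hopf_algebroid R D" "x \<in> carrier (total D)"
 shows "lcomult D x \<in> carrier (ltensor D)" "rcomult D x \<in> carrier (rtensor D)"
proof -
 interpret hopf_algebroid R D by fact
 show "lcomult D x \<in> carrier (ltensor D)" "rcomult D x \<in> carrier (rtensor D)"
  using left.coring.comult_closed[OF assms(2)] right.coring.comult_closed[OF assms(2)]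
  by (simp_all add: left_tensor_def right_tensor_def)
qed

lemma algebroid_maps_closed:
 assumes "hopf_algebroid R D"
 shows "x \<in> carrier (total D) ==> lcounit D x \<in> carrier (lbase D)" "x \<in> carrier (total D) ==> rcounit D x \<in> carrier (rbase D)"
  "x \<in> carrier (total D) ==> antip D x \<in> carrier (total D)"
  "a \<in> carrier (lbase D) ==> lsource D a \<in> carrier (total D)" "a \<in> carrier (lbase D) ==> ltarget D a \<in> carrier (total D)"
  "b \<in> carrier (rbase D) ==> rsource D b \<in> carrier (total D)" "b \<in> carrier (rbase D) ==> rtarget D b \<in> carrier (total D)"
  "k_algebra R (total D)" "k_algebra R (lbase D)" "k_algebra R (rbase D)"
proof -
 interpret hopf_algebroid R D by fact
 show "x \<in> carrier (total D) ==> lcounit D x \<in> carrier (lbase D)" "x \<in> carrier (total D) ==> rcounit D x \<in> carrier (rbase D)"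
  by (rule left.coring.counit_closed right.coring.counit_closed; assumption)+
 show "x \<in> carrier (total D) ==> antip D x \<in> carrier (total D)"
  "a \<in> carrier (lbase D) ==> lsource D a \<in> carrier (total D)" "a \<in> carrier (lbase D) ==> ltarget D a \<in> carrier (total D)"
  "b \<in> carrier (rbase D) ==> rsource D b \<in> carrier (total D)" "b \<in> carrier (rbase D) ==> rtarget D b \<in> carrier (total D)"
  using alg_hom_closed[OF antip_antihom] alg_hom_closed[OF left.source_hom] alg_hom_closed[OF left.target_antihom]
   alg_hom_closed[OF right.source_hom] alg_hom_closed[OF right.target_antihom] by simp_all
 show "k_algebra R (total D)" "k_algebra R (lbase D)" "k_algebra R (rbase D)"
  by (rule left.total.k_algebra_axioms left.base.k_algebra_axioms right.base.k_algebra_axioms)+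
qed

lemma alg_hom_ident: "k_algebra R M ==> ident M \<in> alg_hom R M M"
 by (rule alg_hom_restrict) (auto simp: alg_hom_def ring_hom_def linear_maps_def)

lemma hopf_algebroid_hom_ident:
 assumes D: "hopf_algebroid R D"
 shows "(ident (total D), ident (lbase D), ident (rbase D))
  \<in> hopf_algebroid_hom R D D"
proof -
 note cl = algebroid_maps_closed[OF D]
 have "tmap (ltensor D) (ident (total D)) (ident (total D)) (lcomult D x) = lcomult D x"
  "tmap (rtensor D) (ident (total D)) (ident (total D)) (rcomult D x) = rcomult D x"
  if x: "x \<in> carrier (total D)" for x
 proof -
  note c = algebroid_comult_closed[OF D x, unfolded ltensor_eq rtensor_eq]
  show "tmap (ltensor D) (ident (total D)) (ident (total D)) (lcomult D x) = lcomult D x"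
   unfolding ltensor_eq by (rule tensor_product.tmap_ident[OF bialgebroid_tensor_products(1)[OF D] c(1)]) simp_all
  show "tmap (rtensor D) (ident (total D)) (ident (total D)) (rcomult D x) = rcomult D x"
   unfolding rtensor_eq by (rule tensor_product.tmap_ident[OF bialgebroid_tensor_products(2)[OF D] c(2)]) simp_all
 qed
 then show ?thesis by (simp add: hopf_algebroid_hom_def cl alg_hom_ident)
qed

lemma hopf_algebroid_homD:
 assumes "(F, f, g) \<in> hopf_algebroid_hom R D E"
 shows "F \<in> alg_hom R (total D) (total E)" "f \<in> alg_hom R (lbase D) (lbase E)" "g \<in> alg_hom R (rbase D) (rbase E)"
  "a \<in> carrier (lbase D) ==> F (lsource D a) = lsource E (f a)" "a \<in> carrier (lbase D) ==> F (ltarget D a) = ltarget E (f a)"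
  "b \<in> carrier (rbase D) ==> F (rsource D b) = rsource E (g b)" "b \<in> carrier (rbase D) ==> F (rtarget D b) = rtarget E (g b)"
  "h \<in> carrier (total D) ==> lcomult E (F h) = tmap (ltensor E) F F (lcomult D h)"
  "h \<in> carrier (total D) ==> rcomult E (F h) = tmap (rtensor E) F F (rcomult D h)"
  "h \<in> carrier (total D) ==> f (lcounit D h) = lcounit E (F h)"
  "h \<in> carrier (total D) ==> g (rcounit D h) = rcounit E (F h)"
  "h \<in> carrier (total D) ==> F (antip D h) = antip E (F h)"
 using assms by (auto simp: hopf_algebroid_hom_def)

text \<open>This is what makes F (x) F well defined between tensor products over different bases:
  \<open>F\<close> carries source and target actions to those at the image base elements, where the
  balancing relation of the target tensor product applies.\<close>

lemma hopf_algebroid_hom_compatible: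
 assumes D: "hopf_algebroid R D" and E: "hopf_algebroid R E" and F: "(F, f, g) \<in> hopf_algebroid_hom R D E"
  and xy: "x \<in> carrier (total D)" "y \<in> carrier (total D)"
 shows "a \<in> carrier (lbase D) ==>
   F (ltarget D a \<otimes>\<^bsub>total D\<^esub> x) \<boxtimes>\<^bsub>ltensor E\<^esub> F y = F x \<boxtimes>\<^bsub>ltensor E\<^esub> F (lsource D a \<otimes>\<^bsub>total D\<^esub> y)"
  and "b \<in> carrier (rbase D) ==>
   F (x \<otimes>\<^bsub>total D\<^esub> rsource D b) \<boxtimes>\<^bsub>rtensor E\<^esub> F y = F x \<boxtimes>\<^bsub>rtensor E\<^esub> F (y \<otimes>\<^bsub>total D\<^esub> rtarget D b)"
proof -
 note h = hopf_algebroid_homD[OF F]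
 note cl = algebroid_maps_closed[OF D]
 interpret l: tensor_product "total E" "total E" "carrier (lbase E)" "lact' E" "lact E"
  by (rule bialgebroid_tensor_products[OF E])
 interpret r: tensor_product "total E" "total E" "carrier (rbase E)" "ract E" "ract' E"
  by (rule bialgebroid_tensor_products[OF E])
 show "F (ltarget D a \<otimes>\<^bsub>total D\<^esub> x) \<boxtimes>\<^bsub>ltensor E\<^esub> F y = F x \<boxtimes>\<^bsub>ltensor E\<^esub> F (lsource D a \<otimes>\<^bsub>total D\<^esub> y)"
  if "a \<in> carrier (lbase D)"
  unfolding ltensor_eq alg_hom_mult[OF h(1) cl(5)[OF that] xy(1)] alg_hom_mult[OF h(1) cl(4)[OF that] xy(2)] h(4,5)[OF that]
  by (rule l.pure_balanced[OF alg_hom_closed[OF h(1) xy(1)] alg_hom_closed[OF h(2) that] alg_hom_closed[OF h(1) xy(2)]])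
 show "F (x \<otimes>\<^bsub>total D\<^esub> rsource D b) \<boxtimes>\<^bsub>rtensor E\<^esub> F y = F x \<boxtimes>\<^bsub>rtensor E\<^esub> F (y \<otimes>\<^bsub>total D\<^esub> rtarget D b)"
  if "b \<in> carrier (rbase D)"
  unfolding rtensor_eq alg_hom_mult[OF h(1) xy(1) cl(6)[OF that]] alg_hom_mult[OF h(1) xy(2) cl(7)[OF that]] h(6,7)[OF that]
  by (rule r.pure_balanced[OF alg_hom_closed[OF h(1) xy(1)] alg_hom_closed[OF h(3) that] alg_hom_closed[OF h(1) xy(2)]])
qed

lemma alg_hom_compose:
 "k_algebra R M ==> f \<in> alg_hom R M N ==> g \<in> alg_hom R N P ==> compose (carrier M) g f \<in> alg_hom R M P"
 unfolding compose_def by (rule alg_hom_restrict[OF _ alg_hom_comp])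

lemma hopf_algebroid_hom_compose:
 assumes D: "hopf_algebroid R D" and E: "hopf_algebroid R E" and E': "hopf_algebroid R E'"
  and F: "(F, f, f') \<in> hopf_algebroid_hom R D E" and G: "(G, g, g') \<in> hopf_algebroid_hom R E E'"
 shows "(compose (carrier (total D)) G F, compose (carrier (lbase D)) g f, compose (carrier (rbase D)) g' f')
  \<in> hopf_algebroid_hom R D E'"
proof -
 note F' = hopf_algebroid_homD[OF F] and G' = hopf_algebroid_homD[OF G]
 note cl = algebroid_maps_closed[OF D]
 let ?C = "compose (carrier (total D)) G F"
 have a: "F \<in> add_maps (total D) (total E)" "G \<in> add_maps (total E) (total E')"
  by (rule linear_maps_add_maps[OF alg_hom_linear[OF F'(1)]] linear_maps_add_maps[OF alg_hom_linear[OF G'(1)]])+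
 have Fc: "F x \<in> carrier (total E)" if "x \<in> carrier (total D)" for x by (rule alg_hom_closed[OF F'(1) that])
 have "lcomult E' (?C x) = tmap (ltensor E') ?C ?C (lcomult D x)" if x: "x \<in> carrier (total D)" for x
 proof -
  note c = algebroid_comult_closed(1)[OF D x, unfolded ltensor_eq]
  have "lcomult E' (?C x) = tmap (ltensor E') G G (tmap (ltensor E) F F (lcomult D x))"
   using x by (simp add: compose_eq G'(8) F'(8) Fc)
  also have "... = tmap (ltensor E') (%x. G (F x)) (%x. G (F x)) (lcomult D x)"
   unfolding ltensor_eq
   by (rule tmap_tmap[where f = F and g = F and f' = G and g' = G, OF bialgebroid_tensor_products(1)[OF D] bialgebroid_tensor_products(1)[OF E]
      bialgebroid_tensor_products(1)[OF E'] a(1) a(1) hopf_algebroid_hom_compatible(1)[OF D E F, unfolded ltensor_eq]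
      a(2) a(2) hopf_algebroid_hom_compatible(1)[OF E E' G, unfolded ltensor_eq] c])
  also have "... = tmap (ltensor E') ?C ?C (lcomult D x)"
   by (rule tmap_cong[OF bialgebroid_tensor_products(1)[OF D] c]) (simp_all add: compose_eq)
  finally show ?thesis .
 qed
 moreover have "rcomult E' (?C x) = tmap (rtensor E') ?C ?C (rcomult D x)" if x: "x \<in> carrier (total D)" for x
 proof -
  note c = algebroid_comult_closed(2)[OF D x, unfolded rtensor_eq]
  have "rcomult E' (?C x) = tmap (rtensor E') G G (tmap (rtensor E) F F (rcomult D x))"
   using x by (simp add: compose_eq G'(9) F'(9) Fc)
  also have "... = tmap (rtensor E') (%x. G (F x)) (%x. G (F x)) (rcomult D x)"
   unfolding rtensor_eq
   by (rule tmap_tmap[where f = F and g = F and f' = G and g' = G, OF bialgebroid_tensor_products(2)[OF D] bialgebroid_tensor_products(2)[OF E]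
      bialgebroid_tensor_products(2)[OF E'] a(1) a(1) hopf_algebroid_hom_compatible(2)[OF D E F, unfolded rtensor_eq]
      a(2) a(2) hopf_algebroid_hom_compatible(2)[OF E E' G, unfolded rtensor_eq] c])
  also have "... = tmap (rtensor E') ?C ?C (rcomult D x)"
   by (rule tmap_cong[OF bialgebroid_tensor_products(2)[OF D] c]) (simp_all add: compose_eq)
  finally show ?thesis .
 qed
 ultimately show ?thesis
  using alg_hom_compose[OF cl(8) F'(1) G'(1)] alg_hom_compose[OF cl(9) F'(2) G'(2)] alg_hom_compose[OF cl(10) F'(3) G'(3)]
  by (simp add: hopf_algebroid_hom_def compose_eq cl F'(4-7,10-12) G'(4-7,10-12) Fc
    alg_hom_closed[OF F'(2)] alg_hom_closed[OF F'(3)])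
qed

lemma hopf_algebroid_category: "category (hopf_algebroid_category R)"
 unfolding hopf_algebroid_category_def
proof (rule category.intro; clarsimp)
 fix D :: "('a, 'b, 'c, 'd) hopf_algebroid" assume "hopf_algebroid R D"
 then show "(\<lambda>h\<in>carrier (total D). h, \<lambda>a\<in>carrier (lbase D). a, \<lambda>b\<in>carrier (rbase D). b) \<in> hopf_algebroid_hom R D D"
  by (rule hopf_algebroid_hom_ident)
qed (auto simp: compose_extensional intro: hopf_algebroid_hom_compose
  Id_compose[OF alg_hom_funcset[OF hopf_algebroid_homD(1)]] Id_compose[OF alg_hom_funcset[OF hopf_algebroid_homD(2)]]
  Id_compose[OF alg_hom_funcset[OF hopf_algebroid_homD(3)]]
  compose_Id[OF alg_hom_funcset[OF hopf_algebroid_homD(1)]] compose_Id[OF alg_hom_funcset[OF hopf_algebroid_homD(2)]]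
  compose_Id[OF alg_hom_funcset[OF hopf_algebroid_homD(3)]]
  compose_assoc[OF alg_hom_funcset[OF hopf_algebroid_homD(1)], symmetric]
  compose_assoc[OF alg_hom_funcset[OF hopf_algebroid_homD(2)], symmetric]
  compose_assoc[OF alg_hom_funcset[OF hopf_algebroid_homD(3)], symmetric])

lemma hopf_inv_morphismI:
 assumes "H \<in> Obj (hopf_algebra_category R)" "L \<in> Obj (hopf_algebra_category R)" "\<phi> \<in> Hom (hopf_algebra_category R) H L"
 shows "hopf_inv_morphism R H L \<phi> (antipode_inv H) (antipode_inv L)"
 using assms hopf_algebra.hopf_inv_inv_into
 by (intro hopf_inv_morphism.intro hopf_morphism.intro hopf_morphism_axioms.intro)
  (auto simp: hopf_algebra_category_def)

text \<open>Uniqueness of the algebra map with the given values on the classes [h] yields both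
  functor laws: here the identity, below the composite, has the defining property of
  \<open>par_map\<close>.\<close>

lemma par_map_ident:
 assumes "H \<in> Obj (hopf_algebra_category R)"
 shows "par_map R H H (ident H) = ident (par_alg R H)"
proof -
 have "ident H \<in> Hom (hopf_algebra_category R) H H"
  using assms category.Ident_Hom[OF hopf_algebra_category assms] by (simp add: hopf_algebra_category_def)
 then interpret hopf_inv_morphism R H H "ident H" "antipode_inv H" "antipode_inv H"
  by (rule hopf_inv_morphismI[OF assms assms])
 show ?thesis
  by (rule par_map_eqI) (simp add: is_par_map_def alg_hom_ident H.P_alg)
qed

lemma par_map_compose:
 assumes "H \<in> Obj (hopf_algebra_category R)" "L \<in> Obj (hopf_algebra_category R)" "M \<in> Obj (hopf_algebra_category R)"
  and "\<phi> \<in> Hom (hopf_algebra_category R) H L" "\<psi> \<in> Hom (hopf_algebra_category R) L M"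
 shows "par_map R H M (compose (carrier H) \<psi> \<phi>) = compose (carrier (par_alg R H)) (par_map R L M \<psi>) (par_map R H L \<phi>)"
proof -
 interpret f: hopf_inv_morphism R H L \<phi> "antipode_inv H" "antipode_inv L"
  by (rule hopf_inv_morphismI[OF assms(1,2,4)])
 interpret g: hopf_inv_morphism R L M \<psi> "antipode_inv L" "antipode_inv M"
  by (rule hopf_inv_morphismI[OF assms(2,3,5)])
 have "compose (carrier H) \<psi> \<phi> \<in> Hom (hopf_algebra_category R) H M"
  using category.Comp_Hom[OF hopf_algebra_category assms] by (simp add: hopf_algebra_category_def)
 then interpret gf: hopf_inv_morphism R H M "compose (carrier H) \<psi> \<phi>" "antipode_inv H" "antipode_inv M"
  by (rule hopf_inv_morphismI[OF assms(1,3)])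
 show ?thesis
  by (rule gf.par_map_eqI)
   (simp add: is_par_map_def compose_extensional alg_hom_compose[OF f.H.P_alg f.F_hom g.F_hom] compose_eq f.F_gen g.F_gen)
qed

theorem proposition4p11:
  fixes R :: "'k ring" and C :: "(('k, 'h) hopf_algebra, 'h \<Rightarrow> 'h) category"
  assumes "cring R"
    and "C = hopf_algebra_category R"
  shows "(\<forall>H\<in>Obj C. par_maps_well_defined R H) \<and>
    (\<forall>H\<in>Obj C. \<forall>L\<in>Obj C. \<forall>\<phi>\<in>Hom C H L. \<exists>!F. is_par_map R H L \<phi> F) \<and>
    is_functor C (hopf_algebroid_category R) (par_algebroid R) (par_algebroid_map R)"
proof (intro conjI ballI)
 fix H assume H: "H \<in> Obj C"
 then interpret hopf_inv R H "antipode_inv H"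
  using hopf_algebra.hopf_inv_inv_into by (auto simp: assms(2) hopf_algebra_category_def)
 show "par_maps_well_defined R H" by (rule par_well_defined[OF refl])
next
 fix H L \<phi> assume *: "H \<in> Obj C" "L \<in> Obj C" "\<phi> \<in> Hom C H L"
 show "\<exists>!F. is_par_map R H L \<phi> F"
  using hopf_inv_morphism.is_par_map_ex1[OF hopf_inv_morphismI[OF *[unfolded assms(2)]]] .
next
 have ob: "par_algebroid R H \<in> Obj (hopf_algebroid_category R)" if "H \<in> Obj C" for H
 proof -
  interpret hopf_inv R H "antipode_inv H"
   using that hopf_algebra.hopf_inv_inv_into by (auto simp: assms(2) hopf_algebra_category_def)
  show ?thesis using par_algebroid_hopf by (simp add: hopf_algebroid_category_def)
 qed
 show "is_functor C (hopf_algebroid_category R) (par_algebroid R) (par_algebroid_map R)"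
 proof (intro is_functor.intro is_functor_axioms.intro hopf_algebroid_category ob)
  show "category C" unfolding assms(2) by (rule hopf_algebra_category)
 next
  fix V Y f assume *: "V \<in> Obj C" "Y \<in> Obj C" "f \<in> Hom C V Y"
  interpret hopf_inv_morphism R V Y f "antipode_inv V" "antipode_inv Y"
   by (rule hopf_inv_morphismI[OF *[unfolded assms(2)]])
  show "par_algebroid_map R V Y f \<in> Hom (hopf_algebroid_category R) (par_algebroid R V) (par_algebroid R Y)"
   using par_algebroid_map_hom F_extensional
   by (simp add: hopf_algebroid_category_def par_algebroid_map_def par_algebroid_def)
 next
  fix V assume V: "V \<in> Obj C"
  interpret hopf_inv R V "antipode_inv V"
   using V hopf_algebra.hopf_inv_inv_into by (auto simp: assms(2) hopf_algebra_category_def)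
  have i: "Ident C V = ident V" by (simp add: assms(2) hopf_algebra_category_def)
  \<comment> \<open>The base components are restrictions of the identity of H_par; they are the
    identities of the bases because these are subsets of its carrier.\<close>
  show "par_algebroid_map R V V (Ident C V) = Ident (hopf_algebroid_category R) (par_algebroid R V)"
   using bases_subset unfolding i par_algebroid_map_def par_map_ident[OF V[unfolded assms(2)]]
   by (auto simp: hopf_algebroid_category_def par_algebroid_def restrict_def fun_eq_iff)
 next
  fix V Y W f g assume *: "V \<in> Obj C" "Y \<in> Obj C" "W \<in> Obj C" "f \<in> Hom C V Y" "g \<in> Hom C Y W"
  interpret hopf_inv_morphism R V Y f "antipode_inv V" "antipode_inv Y"
   by (rule hopf_inv_morphismI[OF *(1,2,4)[unfolded assms(2)]])
  have c: "Comp C V Y W g f = compose (carrier V) g f" by (simp add: assms(2) hopf_algebra_category_def)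
  \<comment> \<open>On the base components, restriction commutes with composition because the first
    map sends base elements to base elements (\<open>F_AL\<close>, \<open>F_AR\<close>).\<close>
  show "par_algebroid_map R V W (Comp C V Y W g f)
    = Comp (hopf_algebroid_category R) (par_algebroid R V) (par_algebroid R Y) (par_algebroid R W)
      (par_algebroid_map R Y W g) (par_algebroid_map R V Y f)"
   unfolding c par_algebroid_map_def par_map_compose[OF *[unfolded assms(2)]]
   by (auto simp: hopf_algebroid_category_def par_algebroid_def compose_def restrict_def fun_eq_iff F_AL F_AR base_PH)
 qed
qed

end
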